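(* There is a deterministic algorithm that, given $n$ integers in $\{1,\dots,s\}$, computes the prime factorization of all of them in total time $\widetilde{O}(n+\sqrt{s})$.
   Context: $\widetilde{O}(T)$ denotes $O(T\log^c T)$ for some constant $c$. *)

theory Defs
  imports Complex_Main "HOL-Library.Landau_Symbols" "HOL-Computational_Algebra.Primes"
begin

text \<open>
  The soft-O class of \<open>T\<close>, for functions of arbitrarily many parameters: the asymptotics are taken as
  the value of \<open>T\<close> itself tends to infinity.
\<close>

definition soft_bigo :: "('a \<Rightarrow> real) \<Rightarrow> ('a \<Rightarrow> real) set" where
  "soft_bigo T = {f. \<exists>c::nat. f \<in> O[filtercomap T at_top](\<lambda>x. T x * ln (T x) ^ c)}"

text \<open>
  Algorithms are programs for the word RAM. All values, including addresses, are \<open>w\<close>-bit words,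
  represented as natural numbers below \<open>2 ^ w\<close>. A program refers to finitely many registers and
  has random access to a memory of words. Programs do not depend on \<open>w\<close>. Control flow is
  structured, which differs from jumps by constant factors only.
\<close>

datatype operand = Const nat | Reg nat

datatype binop = Add | Sub | Mul | Div | Mod | BitAnd | BitOr | BitXor | ShiftL | ShiftR

datatype cmp = Eq operand operand | Lt operand operand

datatype com =
    Skip
  | Op nat binop operand operand
  | Load nat operand
  | Store operand operand
  | Seq com com
  | IfElse cmp com com
  | Loop cmp com

record state =
  regs :: "nat \<Rightarrow> nat"
  mem :: "nat \<Rightarrow> nat"

fun operand_val :: "nat \<Rightarrow> state \<Rightarrow> operand \<Rightarrow> nat" where
  "operand_val w \<sigma> (Const c) = c mod 2 ^ w"
| "operand_val w \<sigma> (Reg r) = regs \<sigma> r"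

text \<open>Arithmetic is modulo \<open>2 ^ w\<close>. Division by zero follows the conventions of type \<open>nat\<close>.\<close>

fun binop_val :: "nat \<Rightarrow> binop \<Rightarrow> nat \<Rightarrow> nat \<Rightarrow> nat" where
  "binop_val w Add a b = (a + b) mod 2 ^ w"
| "binop_val w Sub a b = nat ((int a - int b) mod 2 ^ w)"
| "binop_val w Mul a b = (a * b) mod 2 ^ w"
| "binop_val w Div a b = a div b"
| "binop_val w Mod a b = a mod b"
| "binop_val w BitAnd a b = and a b"
| "binop_val w BitOr a b = or a b"
| "binop_val w BitXor a b = xor a b"
| "binop_val w ShiftL a b = push_bit b a mod 2 ^ w"
| "binop_val w ShiftR a b = drop_bit b a"

fun cmp_val :: "nat \<Rightarrow> state \<Rightarrow> cmp \<Rightarrow> bool" where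
  "cmp_val w \<sigma> (Eq x y) \<longleftrightarrow> operand_val w \<sigma> x = operand_val w \<sigma> y"
| "cmp_val w \<sigma> (Lt x y) \<longleftrightarrow> operand_val w \<sigma> x < operand_val w \<sigma> y"

text \<open>
  \<open>exec w c \<sigma> \<tau> \<sigma>'\<close>: with word size \<open>w\<close>, started in \<open>\<sigma>\<close>, the program \<open>c\<close> halts in \<open>\<sigma>'\<close> after
  exactly \<open>\<tau>\<close> unit-cost steps; each word operation, memory access and test is one step.
\<close>

inductive exec :: "nat \<Rightarrow> com \<Rightarrow> state \<Rightarrow> nat \<Rightarrow> state \<Rightarrow> bool" for w where
  exec_Skip: "exec w Skip \<sigma> 1 \<sigma>"
| exec_Op: "exec w (Op r f x y) \<sigma> 1
    (\<sigma>\<lparr>regs := (regs \<sigma>)(r := binop_val w f (operand_val w \<sigma> x) (operand_val w \<sigma> y))\<rparr>)"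
| exec_Load: "exec w (Load r x) \<sigma> 1 (\<sigma>\<lparr>regs := (regs \<sigma>)(r := mem \<sigma> (operand_val w \<sigma> x))\<rparr>)"
| exec_Store: "exec w (Store x y) \<sigma> 1
    (\<sigma>\<lparr>mem := (mem \<sigma>)(operand_val w \<sigma> x := operand_val w \<sigma> y)\<rparr>)"
| exec_Seq: "exec w c \<sigma> \<tau> \<sigma>' \<Longrightarrow> exec w d \<sigma>' \<tau>' \<sigma>'' \<Longrightarrow> exec w (Seq c d) \<sigma> (\<tau> + \<tau>') \<sigma>''"
| exec_IfTrue: "cmp_val w \<sigma> b \<Longrightarrow> exec w c \<sigma> \<tau> \<sigma>' \<Longrightarrow> exec w (IfElse b c d) \<sigma> (Suc \<tau>) \<sigma>'"
| exec_IfFalse: "\<not> cmp_val w \<sigma> b \<Longrightarrow> exec w d \<sigma> \<tau> \<sigma>' \<Longrightarrow> exec w (IfElse b c d) \<sigma> (Suc \<tau>) \<sigma>'"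
| exec_LoopFalse: "\<not> cmp_val w \<sigma> b \<Longrightarrow> exec w (Loop b c) \<sigma> 1 \<sigma>"
| exec_LoopTrue: "cmp_val w \<sigma> b \<Longrightarrow> exec w c \<sigma> \<tau> \<sigma>' \<Longrightarrow> exec w (Loop b c) \<sigma>' \<tau>' \<sigma>'' \<Longrightarrow>
    exec w (Loop b c) \<sigma> (Suc (\<tau> + \<tau>')) \<sigma>''"

inductive_cases exec_SkipE: "exec w Skip \<sigma> \<tau> \<sigma>'"
inductive_cases exec_OpE: "exec w (Op r f x y) \<sigma> \<tau> \<sigma>'"
inductive_cases exec_LoadE: "exec w (Load r x) \<sigma> \<tau> \<sigma>'"
inductive_cases exec_StoreE: "exec w (Store x y) \<sigma> \<tau> \<sigma>'"
inductive_cases exec_SeqE: "exec w (Seq c d) \<sigma> \<tau> \<sigma>'"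
inductive_cases exec_IfElseE: "exec w (IfElse b c d) \<sigma> \<tau> \<sigma>'"
inductive_cases exec_LoopE: "exec w (Loop b c) \<sigma> \<tau> \<sigma>'"

text \<open>Execution is deterministic, so exhibiting one execution determines all of them.\<close>

lemma exec_deterministic:
  assumes "exec w c \<sigma> \<tau>\<^sub>1 \<sigma>\<^sub>1" and "exec w c \<sigma> \<tau>\<^sub>2 \<sigma>\<^sub>2"
  shows "\<tau>\<^sub>1 = \<tau>\<^sub>2 \<and> \<sigma>\<^sub>1 = \<sigma>\<^sub>2"
  using assms
proof (induction arbitrary: \<tau>\<^sub>2 \<sigma>\<^sub>2 rule: exec.induct)
  case exec_Skip then show ?case by (auto elim: exec_SkipE)
next
  case exec_Op then show ?case by (auto elim: exec_OpE)
next
  case exec_Load then show ?case by (auto elim: exec_LoadE)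
next
  case exec_Store then show ?case by (auto elim: exec_StoreE)
next
  case (exec_Seq c \<sigma> \<tau> \<sigma>' d \<tau>' \<sigma>'')
  from exec_Seq.prems show ?case by (rule exec_SeqE) (use exec_Seq.IH in blast)
next
  case (exec_IfTrue \<sigma> b c \<tau> \<sigma>' d)
  from exec_IfTrue.prems show ?case
    by (rule exec_IfElseE) (use exec_IfTrue.IH exec_IfTrue.hyps in blast)+
next
  case (exec_IfFalse \<sigma> b d \<tau> \<sigma>' c)
  from exec_IfFalse.prems show ?case
    by (rule exec_IfElseE) (use exec_IfFalse.IH exec_IfFalse.hyps in blast)+
next
  case (exec_LoopFalse \<sigma> b c)
  from exec_LoopFalse.prems show ?case
    by (rule exec_LoopE) (use exec_LoopFalse.hyps in simp_all)
next
  case (exec_LoopTrue \<sigma> b c \<tau> \<sigma>' \<tau>' \<sigma>'')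
  from exec_LoopTrue.prems show ?case
    by (rule exec_LoopE) (use exec_LoopTrue.IH exec_LoopTrue.hyps in blast)+
qed

text \<open>
  The input convention: \<open>n\<close> and \<open>s\<close> in registers 0 and 1, the numbers in memory cells
  \<open>0, \<dots>, n - 1\<close>, and zero everywhere else.
\<close>

definition input_state :: "nat \<Rightarrow> nat list \<Rightarrow> state" where
  "input_state s xs =
     \<lparr>regs = (\<lambda>_. 0)(0 := length xs, 1 := s),
      mem = (\<lambda>a. if a < length xs then xs ! a else 0)\<rparr>"

definition mem_holds :: "nat \<Rightarrow> state \<Rightarrow> nat \<Rightarrow> nat list \<Rightarrow> bool" where
  "mem_holds w \<sigma> a ys \<longleftrightarrow>
     a + length ys \<le> 2 ^ w \<and> (\<forall>j<length ys. mem \<sigma> (a + j) = ys ! j)"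

text \<open>
  The output convention: from the address in register 0 on, memory contains, for each input number
  in turn, the number of its prime factors followed by these factors, repeated according to
  multiplicity, in any order.
\<close>

definition outputs_factorizations :: "nat \<Rightarrow> state \<Rightarrow> nat list \<Rightarrow> bool" where
  "outputs_factorizations w \<sigma> xs \<longleftrightarrow>
     (\<exists>pss :: nat list list.
        map mset pss = map prime_factorization xs \<and>
        mem_holds w \<sigma> (regs \<sigma> 0) (concat (map (\<lambda>ps. length ps # ps) pss)))"

end

theory Submission
  imports Defs "HOL-Computational_Algebra.Polynomial" "HOL-Number_Theory.Cong"
begin

text \<open>
  Fix \<open>R\<close> with \<open>s < 2 ^ R\<close> and \<open>K = \<lceil>R / 2\<rceil>\<close>, so that every composite \<open>x \<le> s\<close> has a prime factor at most
  \<open>2 ^ K = O(\<surd>s)\<close>. The smallest \<open>d > 1\<close> that is not coprime to \<open>x\<close> is the smallest prime factor of \<open>x\<close>; it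
  is found by binary search in \<open>{1..2 ^ K}\<close>, where the test at a node is whether \<open>x\<close> is coprime to the
  product of all \<open>d\<close> below its left child. For each of the \<open>K\<close> levels the tests of all inputs are done
  together: inputs at the same node are collected in chunks as long as the node's product, and the product is
  reduced modulo all members of a chunk with a remainder tree. With quasilinear multiplication a level costs
  \<open>n + 2 ^ K\<close> up to logarithmic factors. Each round divides one prime out of every input, so \<open>R\<close> rounds suffice.

  The factors \<open>2\<close> are removed beforehand. All inputs are then odd, and remainders can be replaced by
  Montgomery reductions to the base \<open>2 ^ (R + 2)\<close>: they preserve the greatest common divisor with the modulus and
  need, besides multiplications, only inverses modulo powers of the base, which come from Newton's iteration.
  Long numbers are multiplied through Nussbaumer's negacyclic convolution, which uses ring operations only and
  therefore is exact in arithmetic modulo \<open>2 ^ w\<close>.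
\<close>

section \<open>Expressions, blocks and loops over the word RAM\<close>

datatype expr =
    Cst nat
  | Var nat
  | Arr nat expr
  | Exact binop expr expr
  | Modular binop expr expr
  | Pow2 expr
  | Ite expr expr expr expr

abbreviation add_expr (infixl \<open>[+]\<close> 65) where "a [+] b \<equiv> Exact Add a b"
abbreviation sub_expr (infixl \<open>[-]\<close> 65) where "a [-] b \<equiv> Exact Sub a b"
abbreviation mul_expr (infixl \<open>[*]\<close> 70) where "a [*] b \<equiv> Exact Mul a b"
abbreviation div_expr (infixl \<open>[div]\<close> 70) where "a [div] b \<equiv> Exact Div a b"
abbreviation mod_expr (infixl \<open>[mod]\<close> 70) where "a [mod] b \<equiv> Exact Mod a b"

abbreviation seq_com (infixr \<open>;;\<close> 60) where "c ;; d \<equiv> Seq c d"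

datatype stmt =
    Assign nat expr (infix \<open>::=\<close> 55)
  | Put nat expr expr (\<open>_\<lbrakk>_\<rbrakk> ::= _\<close> [60, 0, 56] 55)

text \<open>
  Register \<open>60\<close> holds the array stride \<open>S\<close>: entry \<open>i\<close> of array \<open>a\<close> is the memory cell \<open>a * S + i\<close>.
  Registers below \<open>60\<close> are program variables, those from \<open>61\<close> on are temporaries.
\<close>

fun compile :: "expr \<Rightarrow> nat \<Rightarrow> com" where
  "compile (Cst c) r = Op r BitOr (Const c) (Const 0)"
| "compile (Var v) r = Op r BitOr (Reg v) (Const 0)"
| "compile (Arr a e) r =
     compile e r ;; Op (Suc r) Mul (Const a) (Reg 60) ;; Op r Add (Reg r) (Reg (Suc r)) ;; Load r (Reg r)"
| "compile (Exact f e e') r = compile e r ;; compile e' (Suc r) ;; Op r f (Reg r) (Reg (Suc r))"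
| "compile (Modular f e e') r = compile e r ;; compile e' (Suc r) ;; Op r f (Reg r) (Reg (Suc r))"
| "compile (Pow2 e) r = compile e r ;; Op r ShiftL (Const 1) (Reg r)"
| "compile (Ite a b c d) r =
     compile a r ;; compile b (Suc r) ;; IfElse (Lt (Reg r) (Reg (Suc r))) (compile c r) (compile d r)"

fun cost :: "expr \<Rightarrow> nat" where
  "cost (Cst c) = 1"
| "cost (Var v) = 1"
| "cost (Arr a e) = cost e + 3"
| "cost (Exact f e e') = cost e + cost e' + 1"
| "cost (Modular f e e') = cost e + cost e' + 1"
| "cost (Pow2 e) = cost e + 1"
| "cost (Ite a b c d) = cost a + cost b + cost c + cost d + 1"

fun arrays :: "expr \<Rightarrow> nat set" where
  "arrays (Cst c) = {}"
| "arrays (Var v) = {}"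
| "arrays (Arr a e) = insert a (arrays e)"
| "arrays (Exact f e e') = arrays e \<union> arrays e'"
| "arrays (Modular f e e') = arrays e \<union> arrays e'"
| "arrays (Pow2 e) = arrays e"
| "arrays (Ite a b c d) = arrays a \<union> arrays b \<union> arrays c \<union> arrays d"

fun stmt_code :: "stmt \<Rightarrow> com" where
  "stmt_code (v ::= e) = compile e 61 ;; Op v BitOr (Reg 61) (Const 0)"
| "stmt_code (a\<lbrakk>e\<rbrakk> ::= e') = compile e 61 ;; compile e' 62 ;; Op 63 Mul (Const a) (Reg 60) ;;
     Op 61 Add (Reg 61) (Reg 63) ;; Store (Reg 61) (Reg 62)"

fun stmt_cost :: "stmt \<Rightarrow> nat" where
  "stmt_cost (v ::= e) = cost e + 1"
| "stmt_cost (a\<lbrakk>e\<rbrakk> ::= e') = cost e + cost e' + 3"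

fun block :: "stmt list \<Rightarrow> com" where
  "block [] = Skip"
| "block (s # ss) = stmt_code s ;; block ss"

declare block.simps [simp del]

definition block_cost :: "stmt list \<Rightarrow> nat" where
  "block_cost ss = sum_list (map stmt_cost ss) + 1"

definition for_loop :: "nat \<Rightarrow> nat \<Rightarrow> com \<Rightarrow> com" where
  "for_loop v l c = block [v ::= Cst 0] ;; Loop (Lt (Reg v) (Reg l)) (c ;; block [v ::= Var v [+] Cst 1])"

subsection \<open>Abstract states\<close>

datatype astate = AState (var: "nat \<Rightarrow> nat") (arr: "nat \<Rightarrow> nat \<Rightarrow> nat")

definition set_var :: "nat \<Rightarrow> nat \<Rightarrow> astate \<Rightarrow> astate" where
  "set_var v x sg = AState ((var sg)(v := x)) (arr sg)"

definition set_arr :: "nat \<Rightarrow> (nat \<Rightarrow> nat) \<Rightarrow> astate \<Rightarrow> astate" where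
  "set_arr a f sg = AState (var sg) ((arr sg)(a := f))"

lemma astate_simps [simp]:
  "var (set_var v x sg) = (var sg)(v := x)" "arr (set_var v x sg) = arr sg"
  "var (set_arr a f sg) = var sg" "arr (set_arr a f sg) = (arr sg)(a := f)"
  by (simp_all add: set_var_def set_arr_def)

definition frame :: "nat \<Rightarrow> nat set \<Rightarrow> astate \<Rightarrow> astate \<Rightarrow> bool" where
  "frame b Y sg sg' \<longleftrightarrow> (\<forall>v<b. var sg' v = var sg v) \<and> (\<forall>a. a \<notin> Y \<longrightarrow> arr sg' a = arr sg a)"

lemma frame_var: "frame b Y sg sg' \<Longrightarrow> v < b \<Longrightarrow> var sg' v = var sg v"
  and frame_arr: "frame b Y sg sg' \<Longrightarrow> a \<notin> Y \<Longrightarrow> arr sg' a = arr sg a"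
  by (simp_all add: frame_def)

lemma frame_refl [simp]: "frame b Y sg sg"
  by (simp add: frame_def)

lemma frame_set_var [simp]: "b \<le> v \<Longrightarrow> frame b Y sg (set_var v x sg') \<longleftrightarrow> frame b Y sg sg'"
  by (auto simp: frame_def)

lemma frame_set_arr [simp]: "a \<in> Y \<Longrightarrow> frame b Y sg (set_arr a f sg') \<longleftrightarrow> frame b Y sg sg'"
  by (auto simp: frame_def)

lemma frame_trans [trans]: "frame b Y sg sg' \<Longrightarrow> frame b Y sg' sg'' \<Longrightarrow> frame b Y sg sg''"
  by (simp add: frame_def)

lemma frame_mono: "frame b Y sg sg' \<Longrightarrow> b' \<le> b \<Longrightarrow> Y \<subseteq> Y' \<Longrightarrow> frame b' Y' sg sg'"
  unfolding frame_def by auto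

fun binop_nat :: "binop \<Rightarrow> nat \<Rightarrow> nat \<Rightarrow> nat" where
  "binop_nat Add a b = a + b"
| "binop_nat Sub a b = a - b"
| "binop_nat Mul a b = a * b"
| "binop_nat Div a b = a div b"
| "binop_nat Mod a b = a mod b"
| "binop_nat _ a b = 0"

text \<open>
  \<open>mag e\<close> bounds the value of \<open>e\<close> by a power of \<open>S\<close>; it makes the absence of overflow a syntactic
  condition. The value \<open>100\<close> stands for no bound.
\<close>

fun mag :: "expr \<Rightarrow> nat" where
  "mag (Cst c) = 1"
| "mag (Var v) = 1"
| "mag (Arr a e) = 1"
| "mag (Exact f e e') = (case f of Add \<Rightarrow> max (mag e) (mag e') + 1 | Mul \<Rightarrow> mag e + mag e'
     | Sub \<Rightarrow> mag e | Div \<Rightarrow> mag e | Mod \<Rightarrow> mag e | _ \<Rightarrow> 100)"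
| "mag (Modular f e e') = 100"
| "mag (Pow2 e) = 1"
| "mag (Ite a b c d) = max (mag c) (mag d)"

locale ram =
  fixes w S :: nat
  assumes S_ge: "256 \<le> S" and S_pow: "S ^ 8 \<le> 2 ^ w"
begin

fun ev :: "astate \<Rightarrow> expr \<Rightarrow> nat" where
  "ev sg (Cst c) = c"
| "ev sg (Var v) = var sg v"
| "ev sg (Arr a e) = arr sg a (ev sg e)"
| "ev sg (Exact f e e') = binop_nat f (ev sg e) (ev sg e')"
| "ev sg (Modular f e e') = binop_val w f (ev sg e) (ev sg e')"
| "ev sg (Pow2 e) = 2 ^ ev sg e"
| "ev sg (Ite a b c d) = (if ev sg a < ev sg b then ev sg c else ev sg d)"

fun small :: "astate \<Rightarrow> expr \<Rightarrow> bool" where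
  "small sg (Arr a e) \<longleftrightarrow> arr sg a (ev sg e) \<le> S"
| "small sg (Modular f e e') \<longleftrightarrow> False"
| "small sg (Ite a b c d) \<longleftrightarrow> (if ev sg a < ev sg b then small sg c else small sg d)"
| "small sg _ \<longleftrightarrow> True"

fun safe :: "astate \<Rightarrow> expr \<Rightarrow> bool" where
  "safe sg (Cst c) \<longleftrightarrow> c \<le> 256"
| "safe sg (Var v) \<longleftrightarrow> v < 60"
| "safe sg (Arr a e) \<longleftrightarrow> safe sg e \<and> a < 30 \<and> ev sg e < S"
| "safe sg (Exact f e e') \<longleftrightarrow> safe sg e \<and> safe sg e' \<and> small sg e \<and> small sg e' \<and> mag (Exact f e e') \<le> 7 \<and>
     (f = Sub \<longrightarrow> ev sg e' \<le> ev sg e)"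
| "safe sg (Modular f e e') \<longleftrightarrow> safe sg e \<and> safe sg e'"
| "safe sg (Pow2 e) \<longleftrightarrow> safe sg e \<and> 2 ^ ev sg e \<le> S"
| "safe sg (Ite a b c d) \<longleftrightarrow> safe sg a \<and> safe sg b \<and> (if ev sg a < ev sg b then safe sg c else safe sg d)"

lemma ev_cong:
  assumes "safe sg e" "\<And>v. v < 60 \<Longrightarrow> var sg' v = var sg v" "\<And>a. a \<in> arrays e \<Longrightarrow> arr sg' a = arr sg a"
  shows "ev sg' e = ev sg e" "small sg' e = small sg e" "safe sg' e"
proof -
  have "ev sg' e = ev sg e \<and> small sg' e = small sg e \<and> safe sg' e"
    using assms
  proof (induction e)
    case (Ite a b c d)
    then show ?case by (cases "ev sg a < ev sg b") simp_all
  qed simp_all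
  then show "ev sg' e = ev sg e" "small sg' e = small sg e" "safe sg' e" by auto
qed

definition bounded :: "astate \<Rightarrow> bool" where
  "bounded sg \<longleftrightarrow> (\<forall>v<60. var sg v \<le> S)"

lemma ev_le_mag: "bounded sg \<Longrightarrow> safe sg e \<Longrightarrow> small sg e \<Longrightarrow> ev sg e \<le> S ^ mag e"
proof (induction e)
  case (Exact f e e')
  have IH: "ev sg e \<le> S ^ mag e" "ev sg e' \<le> S ^ mag e'" using Exact by auto
  show ?case
  proof (cases f)
    case Add
    have "S ^ mag e \<le> S ^ max (mag e) (mag e')" "S ^ mag e' \<le> S ^ max (mag e) (mag e')"
      using S_ge by (auto intro!: power_increasing)
    then have "ev sg e + ev sg e' \<le> 2 * S ^ max (mag e) (mag e')" using IH by linarith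
    also have "\<dots> \<le> S * S ^ max (mag e) (mag e')" using S_ge by simp
    finally show ?thesis using Add by simp
  next
    case Mul then show ?thesis using IH by (simp add: power_add mult_mono)
  next
    case Sub then show ?thesis using IH by simp
  next
    case Div then show ?thesis using IH by simp (meson div_le_dividend le_trans)
  next
    case Mod then show ?thesis using IH by simp (meson mod_less_eq_dividend le_trans)
  qed (use Exact in auto)
next
  case (Ite a b c d)
  have "S ^ mag c \<le> S ^ max (mag c) (mag d)" "S ^ mag d \<le> S ^ max (mag c) (mag d)"
    using S_ge by (auto intro!: power_increasing)
  then show ?case using Ite by (auto split: if_splits intro: order_trans)
qed (use S_ge in \<open>auto simp: bounded_def\<close>)

lemma S_power_less: "k \<le> 7 \<Longrightarrow> S ^ k < 2 ^ w"
  using power_strict_increasing[of k 8 S] S_ge S_pow by linarith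

lemma S_less: "S < 2 ^ w" "S * S < 2 ^ w"
  using S_power_less[of 1] S_power_less[of 2] by (simp_all add: power2_eq_square)

lemma binop_val_exact:
  assumes "bounded sg" "safe sg (Exact f e e')"
  shows "binop_val w f (ev sg e) (ev sg e') = binop_nat f (ev sg e) (ev sg e')"
proof -
  have "ev sg (Exact f e e') \<le> S ^ mag (Exact f e e')" using assms by (rule ev_le_mag) simp
  also have "\<dots> < 2 ^ w" using assms by (intro S_power_less) simp
  finally have no_overflow: "binop_nat f (ev sg e) (ev sg e') < 2 ^ w" by (simp del: mag.simps)
  show ?thesis
  proof (cases f)
    case Sub
    have "int (ev sg e) - int (ev sg e') = int (ev sg e - ev sg e')" using assms(2) Sub by simp
    moreover have "int (ev sg e - ev sg e') mod 2 ^ w = int (ev sg e - ev sg e')"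
      using no_overflow Sub by (metis binop_nat.simps(2) mod_less of_nat_mod of_nat_numeral of_nat_power)
    ultimately show ?thesis unfolding Sub binop_val.simps binop_nat.simps by (metis nat_int)
  qed (use no_overflow assms in auto)
qed

subsection \<open>Simulation of abstract states\<close>

definition sim :: "astate \<Rightarrow> state \<Rightarrow> bool" where
  "sim sg \<rho> \<longleftrightarrow> bounded sg \<and> (\<forall>v<60. regs \<rho> v = var sg v) \<and> regs \<rho> 60 = S \<and>
     (\<forall>a<30. \<forall>i<S. mem \<rho> (a * S + i) = arr sg a i)"

lemma address:
  assumes "a < 30" "i < S"
  shows "a mod 2 ^ w * S mod 2 ^ w = a * S" "(i + a * S) mod 2 ^ w = a * S + i"
    "(a * S + i) mod 2 ^ w = a * S + i"
proof -
  have "a * S + i < Suc a * S" using assms by simp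
  also have "\<dots> \<le> S * S" using assms S_ge by (intro mult_right_mono) auto
  finally have no_overflow: "a * S + i < 2 ^ w" using S_less by simp
  have "a < 2 ^ w" using assms S_ge S_less by linarith
  with no_overflow show "a mod 2 ^ w * S mod 2 ^ w = a * S" by simp
  from no_overflow show "(i + a * S) mod 2 ^ w = a * S + i" "(a * S + i) mod 2 ^ w = a * S + i"
    by (simp_all add: add.commute)
qed

definition agree_below :: "nat \<Rightarrow> state \<Rightarrow> state \<Rightarrow> bool" where
  "agree_below r \<rho> \<rho>' \<longleftrightarrow> (\<forall>q<r. regs \<rho>' q = regs \<rho> q) \<and> mem \<rho>' = mem \<rho>"

definition yields :: "com \<Rightarrow> nat \<Rightarrow> state \<Rightarrow> nat \<Rightarrow> nat \<Rightarrow> bool" where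
  "yields c T \<rho> r x \<longleftrightarrow> (\<exists>\<tau> \<rho>'. exec w c \<rho> \<tau> \<rho>' \<and> \<tau> \<le> T \<and> regs \<rho>' r = x \<and> agree_below r \<rho> \<rho>')"

lemma yieldsI: "exec w c \<rho> \<tau> \<rho>' \<Longrightarrow> \<tau> \<le> T \<Longrightarrow> regs \<rho>' r = x \<Longrightarrow> agree_below r \<rho> \<rho>' \<Longrightarrow> yields c T \<rho> r x"
  by (auto simp: yields_def)

lemma yields_Op:
  assumes "z = binop_val w f (operand_val w \<rho> x) (operand_val w \<rho> y)" "1 \<le> T"
  shows "yields (Op r f x y) T \<rho> r z"
  by (rule yieldsI[OF exec_Op]) (use assms in \<open>auto simp: agree_below_def\<close>)

lemma yields_Seq:
  assumes "yields c T \<rho> r x"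
    and "\<And>\<rho>'. agree_below r \<rho> \<rho>' \<Longrightarrow> regs \<rho>' r = x \<Longrightarrow> yields d T' \<rho>' r y"
  shows "yields (c ;; d) (T + T') \<rho> r y"
proof -
  obtain \<tau> \<rho>' where first: "exec w c \<rho> \<tau> \<rho>'" "\<tau> \<le> T" "regs \<rho>' r = x" "agree_below r \<rho> \<rho>'"
    using assms(1) by (auto simp: yields_def)
  obtain \<tau>' \<rho>'' where second: "exec w d \<rho>' \<tau>' \<rho>''" "\<tau>' \<le> T'" "regs \<rho>'' r = y" "agree_below r \<rho>' \<rho>''"
    using assms(2)[OF first(4,3)] by (auto simp: yields_def)
  show ?thesis by (rule yieldsI[OF exec_Seq[OF first(1) second(1)]]) (use first second in \<open>auto simp: agree_below_def\<close>)
qed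

lemma yields_second:
  assumes "yields c T \<rho> (Suc r) y"
    and "\<And>\<rho>'. agree_below (Suc r) \<rho> \<rho>' \<Longrightarrow> regs \<rho>' (Suc r) = y \<Longrightarrow> yields d T' \<rho>' r z"
  shows "yields (c ;; d) (T + T') \<rho> r z"
proof -
  obtain \<tau> \<rho>' where first: "exec w c \<rho> \<tau> \<rho>'" "\<tau> \<le> T" "regs \<rho>' (Suc r) = y" "agree_below (Suc r) \<rho> \<rho>'"
    using assms(1) by (auto simp: yields_def)
  obtain \<tau>' \<rho>'' where second: "exec w d \<rho>' \<tau>' \<rho>''" "\<tau>' \<le> T'" "regs \<rho>'' r = z" "agree_below r \<rho>' \<rho>''"
    using assms(2)[OF first(4,3)] by (auto simp: yields_def)
  show ?thesis by (rule yieldsI[OF exec_Seq[OF first(1) second(1)]]) (use first second in \<open>auto simp: agree_below_def\<close>)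
qed

lemma yields_two:
  assumes "yields c T \<rho> r x"
    and "\<And>\<rho>'. agree_below r \<rho> \<rho>' \<Longrightarrow> yields c' T' \<rho>' (Suc r) y"
    and "\<And>\<rho>'. agree_below r \<rho> \<rho>' \<Longrightarrow> regs \<rho>' r = x \<Longrightarrow> regs \<rho>' (Suc r) = y \<Longrightarrow> yields d T'' \<rho>' r z"
  shows "yields (c ;; c' ;; d) (T + T' + T'') \<rho> r z"
  unfolding add.assoc
proof (rule yields_Seq[OF assms(1)])
  fix \<rho>1 assume \<rho>1: "agree_below r \<rho> \<rho>1" "regs \<rho>1 r = x"
  show "yields (c' ;; d) (T' + T'') \<rho>1 r z"
    by (rule yields_second[OF assms(2)[OF \<rho>1(1)] assms(3)]) (use \<rho>1 in \<open>auto simp: agree_below_def\<close>)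
qed

lemma yields_IfElse:
  assumes "yields (if regs \<rho> r < regs \<rho> q then c else d) T \<rho> r x"
  shows "yields (IfElse (Lt (Reg r) (Reg q)) c d) (Suc T) \<rho> r x"
proof -
  obtain \<tau> \<rho>' where branch: "exec w (if regs \<rho> r < regs \<rho> q then c else d) \<rho> \<tau> \<rho>'"
    "\<tau> \<le> T" "regs \<rho>' r = x" "agree_below r \<rho> \<rho>'"
    using assms by (auto simp: yields_def)
  have "exec w (IfElse (Lt (Reg r) (Reg q)) c d) \<rho> (Suc \<tau>) \<rho>'"
    by (cases "regs \<rho> r < regs \<rho> q") (use branch(1) in \<open>auto intro: exec_IfTrue exec_IfFalse\<close>)
  then show ?thesis by (rule yieldsI) (use branch in auto)
qed

lemma yields_mono: "yields c T \<rho> r x \<Longrightarrow> T \<le> T' \<Longrightarrow> yields c T' \<rho> r x"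
  unfolding yields_def by (metis le_trans)

lemma yields_array_access:
  assumes "sim sg \<rho>" "regs \<rho> r = i" "a < 30" "i < S" "61 \<le> r"
  shows "yields (Op (Suc r) Mul (Const a) (Reg 60) ;; Op r Add (Reg r) (Reg (Suc r)) ;; Load r (Reg r)) 3 \<rho> r (arr sg a i)"
  by (rule yieldsI[OF exec_Seq[OF exec_Op exec_Seq[OF exec_Op exec_Load]]])
     (use assms address[of a i] in \<open>auto simp: sim_def agree_below_def\<close>)

lemma sim_agree_below: "sim sg \<rho> \<Longrightarrow> agree_below r \<rho> \<rho>' \<Longrightarrow> 61 \<le> r \<Longrightarrow> sim sg \<rho>'"
  by (auto simp: sim_def agree_below_def)

lemma yields_conditional:
  assumes "regs \<rho> r = ev sg a" "regs \<rho> (Suc r) = ev sg b"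
    and "ev sg a < ev sg b \<Longrightarrow> yields (compile c r) (cost c) \<rho> r (ev sg c)"
    and "\<not> ev sg a < ev sg b \<Longrightarrow> yields (compile d r) (cost d) \<rho> r (ev sg d)"
  shows "yields (IfElse (Lt (Reg r) (Reg (Suc r))) (compile c r) (compile d r)) (Suc (cost c + cost d)) \<rho> r (ev sg (Ite a b c d))"
  by (intro yields_IfElse, cases "ev sg a < ev sg b") (use assms in \<open>auto elim: yields_mono\<close>)

lemma yields_compile:
  assumes "sim sg \<rho>" "safe sg e" "61 \<le> r"
  shows "yields (compile e r) (cost e) \<rho> r (ev sg e)"
  using assms
proof (induction e arbitrary: r \<rho>)
  case (Cst c)
  then show ?case using S_ge S_less unfolding compile.simps cost.simps by (intro yields_Op) simp_all
next
  case (Var v)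
  then show ?case unfolding compile.simps cost.simps by (intro yields_Op) (simp_all add: sim_def)
next
  case (Arr a e)
  show ?case unfolding compile.simps cost.simps ev.simps
    by (rule yields_Seq[OF Arr.IH[OF Arr.prems(1) _ Arr.prems(3)] yields_array_access])
       (use Arr.prems in \<open>auto elim: sim_agree_below\<close>)
next
  case (Exact f e e')
  have "bounded sg" using Exact.prems(1) by (simp add: sim_def)
  then have exact: "ev sg (Exact f e e') = binop_val w f (ev sg e) (ev sg e')"
    using binop_val_exact Exact.prems(2) by simp
  show ?case unfolding compile.simps cost.simps exact
    by (rule yields_two[OF Exact.IH(1) Exact.IH(2)])
       (use Exact.prems in \<open>auto intro!: yields_Op elim: sim_agree_below\<close>)
next
  case (Modular f e e')
  show ?case unfolding compile.simps cost.simps ev.simps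
    by (rule yields_two[OF Modular.IH(1) Modular.IH(2)])
       (use Modular.prems in \<open>auto intro!: yields_Op elim: sim_agree_below\<close>)
next
  case (Pow2 e)
  have "2 ^ ev sg e < (2::nat) ^ w" using Pow2.prems S_less(1) le_less_trans safe.simps(6) by blast
  moreover have "1 < (2::nat) ^ w" using S_ge S_less by linarith
  ultimately show ?case unfolding compile.simps cost.simps ev.simps
    by (intro yields_Seq[OF Pow2.IH])
       (use Pow2.prems in \<open>auto intro!: yields_Op simp: push_bit_eq_mult\<close>)
next
  case (Ite a b c d)
  have "cost (Ite a b c d) = cost a + cost b + Suc (cost c + cost d)" by simp
  then show ?case unfolding compile.simps
    by (simp only:) (rule yields_two[OF Ite.IH(1,2) yields_conditional[OF _ _ Ite.IH(3,4)]], use Ite.prems in \<open>auto elim: sim_agree_below\<close>)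
qed

definition run :: "com \<Rightarrow> nat \<Rightarrow> astate \<Rightarrow> astate \<Rightarrow> bool" where
  "run c T sg sg' \<longleftrightarrow> (\<forall>\<rho>. sim sg \<rho> \<longrightarrow> (\<exists>\<tau> \<rho>'. exec w c \<rho> \<tau> \<rho>' \<and> \<tau> \<le> T \<and> sim sg' \<rho>'))"

lemma run_Skip: "1 \<le> T \<Longrightarrow> run Skip T sg sg"
  unfolding run_def using exec_Skip by blast

lemma run_Seq:
  assumes "run c T sg sg'" "run d T' sg' sg''"
  shows "run (c ;; d) (T + T') sg sg''"
  unfolding run_def
proof (intro allI impI)
  fix \<rho> assume "sim sg \<rho>"
  then obtain \<tau> \<rho>' where first: "exec w c \<rho> \<tau> \<rho>'" "\<tau> \<le> T" "sim sg' \<rho>'" using assms(1) by (auto simp: run_def)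
  then obtain \<tau>' \<rho>'' where second: "exec w d \<rho>' \<tau>' \<rho>''" "\<tau>' \<le> T'" "sim sg'' \<rho>''" using assms(2) by (auto simp: run_def)
  show "\<exists>\<tau> \<rho>'. exec w (c ;; d) \<rho> \<tau> \<rho>' \<and> \<tau> \<le> T + T' \<and> sim sg'' \<rho>'"
    by (intro exI conjI, rule exec_Seq[OF first(1) second(1)]) (use first second in auto)
qed

lemma run_mono: "run c T sg sg' \<Longrightarrow> T \<le> T' \<Longrightarrow> run c T' sg sg'"
  unfolding run_def by (meson le_trans)

fun stmt_safe :: "astate \<Rightarrow> stmt \<Rightarrow> bool" where
  "stmt_safe sg (v ::= e) \<longleftrightarrow> safe sg e \<and> v < 60 \<and> ev sg e \<le> S"
| "stmt_safe sg (a\<lbrakk>e\<rbrakk> ::= e') \<longleftrightarrow> safe sg e \<and> safe sg e' \<and> a < 30 \<and> ev sg e < S"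

fun stmt_effect :: "stmt \<Rightarrow> astate \<Rightarrow> astate" where
  "stmt_effect (v ::= e) sg = set_var v (ev sg e) sg"
| "stmt_effect (a\<lbrakk>e\<rbrakk> ::= e') sg = set_arr a ((arr sg a)(ev sg e := ev sg e')) sg"

lemma array_cell_inj:
  assumes "a * S + i = b * S + j" "i < S" "j < S"
  shows "a = b \<and> i = j"
proof -
  have "(a * S + i) div S = a" "(b * S + j) div S = b" using assms(2,3) by simp_all
  then have "a = b" using assms(1) by metis
  then show ?thesis using assms(1) by simp
qed

lemma run_assign:
  assumes "stmt_safe sg (v ::= e)"
  shows "run (stmt_code (v ::= e)) (stmt_cost (v ::= e)) sg (stmt_effect (v ::= e) sg)"
  unfolding run_def
proof (intro allI impI)
  fix \<rho> assume \<rho>: "sim sg \<rho>"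
  have "yields (compile e 61) (cost e) \<rho> 61 (ev sg e)" using \<rho> assms by (intro yields_compile) auto
  then obtain \<tau> \<rho>' where compiled: "exec w (compile e 61) \<rho> \<tau> \<rho>'" "\<tau> \<le> cost e" "regs \<rho>' 61 = ev sg e" "agree_below 61 \<rho> \<rho>'"
    by (auto simp: yields_def)
  show "\<exists>\<tau> \<rho>'. exec w (stmt_code (v ::= e)) \<rho> \<tau> \<rho>' \<and> \<tau> \<le> stmt_cost (v ::= e) \<and> sim (stmt_effect (v ::= e) sg) \<rho>'"
    unfolding stmt_code.simps
    by (intro exI conjI, rule exec_Seq[OF compiled(1) exec_Op])
       (use compiled \<rho> assms in \<open>auto simp: sim_def bounded_def agree_below_def\<close>)
qed

lemma run_put:
  assumes "stmt_safe sg (a\<lbrakk>e\<rbrakk> ::= e')"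
  shows "run (stmt_code (a\<lbrakk>e\<rbrakk> ::= e')) (stmt_cost (a\<lbrakk>e\<rbrakk> ::= e')) sg (stmt_effect (a\<lbrakk>e\<rbrakk> ::= e') sg)"
  unfolding run_def
proof (intro allI impI)
  fix \<rho> assume \<rho>: "sim sg \<rho>"
  have "yields (compile e 61) (cost e) \<rho> 61 (ev sg e)" using \<rho> assms by (intro yields_compile) auto
  then obtain \<tau> \<rho>' where index: "exec w (compile e 61) \<rho> \<tau> \<rho>'" "\<tau> \<le> cost e" "regs \<rho>' 61 = ev sg e" "agree_below 61 \<rho> \<rho>'"
    by (auto simp: yields_def)
  have "yields (compile e' 62) (cost e') \<rho>' 62 (ev sg e')"
    using sim_agree_below[OF \<rho> index(4)] assms by (intro yields_compile) auto
  then obtain \<tau>' \<rho>'' where entry: "exec w (compile e' 62) \<rho>' \<tau>' \<rho>''" "\<tau>' \<le> cost e'" "regs \<rho>'' 62 = ev sg e'"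
    "agree_below 62 \<rho>' \<rho>''" by (auto simp: yields_def)
  have inj: "b * S + j = a * S + ev sg e \<longleftrightarrow> b = a \<and> j = ev sg e" if "j < S" for b j
    using array_cell_inj[of b j a "ev sg e"] that assms by auto
  show "\<exists>\<tau> \<rho>'. exec w (stmt_code (a\<lbrakk>e\<rbrakk> ::= e')) \<rho> \<tau> \<rho>' \<and> \<tau> \<le> stmt_cost (a\<lbrakk>e\<rbrakk> ::= e') \<and>
      sim (stmt_effect (a\<lbrakk>e\<rbrakk> ::= e') sg) \<rho>'"
    unfolding stmt_code.simps
    by (intro exI conjI, rule exec_Seq[OF index(1) exec_Seq[OF entry(1) exec_Seq[OF exec_Op exec_Seq[OF exec_Op exec_Store]]]])
       (use index entry \<rho> assms address[of a "ev sg e"] inj in \<open>auto simp: sim_def bounded_def agree_below_def\<close>)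
qed

fun block_safe :: "astate \<Rightarrow> stmt list \<Rightarrow> bool" where
  "block_safe sg [] \<longleftrightarrow> True"
| "block_safe sg (s # ss) \<longleftrightarrow> stmt_safe sg s \<and> block_safe (stmt_effect s sg) ss"

abbreviation block_effect :: "stmt list \<Rightarrow> astate \<Rightarrow> astate" where
  "block_effect \<equiv> fold stmt_effect"

lemma run_block:
  assumes "block_safe sg ss" "block_cost ss \<le> T"
  shows "run (block ss) T sg (block_effect ss sg)"
proof -
  have "run (block ss) (block_cost ss) sg (block_effect ss sg)"
    using assms(1)
  proof (induction ss arbitrary: sg)
    case Nil then show ?case by (simp add: block_cost_def run_Skip block.simps)
  next
    case (Cons s ss)
    have "run (stmt_code s) (stmt_cost s) sg (stmt_effect s sg)"
      using Cons.prems by (cases s) (simp_all only: run_assign run_put block_safe.simps)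
    from run_Seq[OF this Cons.IH] Cons.prems show ?case by (simp add: block_cost_def block.simps add.assoc)
  qed
  then show ?thesis using assms(2) by (rule run_mono)
qed

subsection \<open>Total correctness with time bounds\<close>

definition computes :: "com \<Rightarrow> nat \<Rightarrow> nat \<Rightarrow> nat set \<Rightarrow> astate \<Rightarrow> (astate \<Rightarrow> bool) \<Rightarrow> bool" where
  "computes c T b Y sg Q \<longleftrightarrow> (\<exists>sg'. run c T sg sg' \<and> frame b Y sg sg' \<and> Q sg')"

lemma computesI: "run c T' sg sg' \<Longrightarrow> T' \<le> T \<Longrightarrow> frame b Y sg sg' \<Longrightarrow> Q sg' \<Longrightarrow> computes c T b Y sg Q"
  unfolding computes_def using run_mono by blast

lemma computesE:
  assumes "computes c T b Y sg Q"
  obtains sg' where "run c T sg sg'" "frame b Y sg sg'" "Q sg'"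
  using assms by (auto simp: computes_def)

lemma computes_mono:
  assumes "computes c T b Y sg Q" "T \<le> T'" "b' \<le> b" "Y \<subseteq> Y'" "\<And>sg'. frame b Y sg sg' \<Longrightarrow> Q sg' \<Longrightarrow> Q' sg'"
  shows "computes c T' b' Y' sg Q'"
  using assms unfolding computes_def by (meson frame_mono run_mono)

lemma computes_block:
  assumes "block_safe sg ss" "block_cost ss \<le> T" "frame b Y sg (block_effect ss sg)" "Q (block_effect ss sg)"
  shows "computes (block ss) T b Y sg Q"
  by (rule computesI[OF run_block]) (use assms in auto)

lemma run_Loop_False: "x < 60 \<Longrightarrow> y < 60 \<Longrightarrow> \<not> var sg x < var sg y \<Longrightarrow> run (Loop (Lt (Reg x) (Reg y)) c) 1 sg sg"
  unfolding run_def by (intro allI impI exI conjI, rule exec_LoopFalse) (auto simp: sim_def)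

lemma run_Loop_True:
  assumes "x < 60" "y < 60" "var sg x < var sg y" "run c T sg sg'" "run (Loop (Lt (Reg x) (Reg y)) c) T' sg' sg''"
  shows "run (Loop (Lt (Reg x) (Reg y)) c) (T + 1 + T') sg sg''"
  unfolding run_def
proof (intro allI impI)
  fix \<rho> assume \<rho>: "sim sg \<rho>"
  then obtain \<tau> \<rho>' where body: "exec w c \<rho> \<tau> \<rho>'" "\<tau> \<le> T" "sim sg' \<rho>'" using assms(4) by (auto simp: run_def)
  then obtain \<tau>' \<rho>'' where rest: "exec w (Loop (Lt (Reg x) (Reg y)) c) \<rho>' \<tau>' \<rho>''" "\<tau>' \<le> T'" "sim sg'' \<rho>''"
    using assms(5) by (auto simp: run_def)
  have "cmp_val w \<rho> (Lt (Reg x) (Reg y))" using \<rho> assms(1-3) by (simp add: sim_def)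
  from exec_LoopTrue[OF this body(1) rest(1)] body(2) rest(2,3)
  show "\<exists>\<tau> \<rho>'. exec w (Loop (Lt (Reg x) (Reg y)) c) \<rho> \<tau> \<rho>' \<and> \<tau> \<le> T + 1 + T' \<and> sim sg'' \<rho>'"
    by (intro exI conjI) auto
qed

lemma computes_while:
  assumes xy: "x < 60" "y < 60" and init: "I 0 sg"
    and guard: "\<And>i sg'. i \<le> N \<Longrightarrow> frame b Y sg sg' \<Longrightarrow> I i sg' \<Longrightarrow> var sg' x < var sg' y \<longleftrightarrow> i < N"
    and step: "\<And>i sg'. i < N \<Longrightarrow> frame b Y sg sg' \<Longrightarrow> I i sg' \<Longrightarrow> computes c T b Y sg' (I (Suc i))"
  shows "computes (Loop (Lt (Reg x) (Reg y)) c) (N * (T + 1) + 1) b Y sg (I N)"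
proof -
  have "computes (Loop (Lt (Reg x) (Reg y)) c) ((N - i) * (T + 1) + 1) b Y sg' (I N)"
    if "i \<le> N" "frame b Y sg sg'" "I i sg'" for i sg'
    using that
  proof (induction "N - i" arbitrary: i sg')
    case 0
    then have i: "i = N" by simp
    then have "run (Loop (Lt (Reg x) (Reg y)) c) 1 sg' sg'" using 0 guard[of N sg'] xy by (intro run_Loop_False) auto
    then show ?case using 0 i by (intro computesI) auto
  next
    case (Suc d)
    then have i: "i < N" by simp
    obtain sg1 where body: "run c T sg' sg1" "frame b Y sg' sg1" "I (Suc i) sg1"
      using step[OF i Suc.prems(2,3)] by (rule computesE)
    have fr: "frame b Y sg sg1" using Suc.prems(2) body(2) by (rule frame_trans)
    obtain sg2 where rest: "run (Loop (Lt (Reg x) (Reg y)) c) ((N - Suc i) * (T + 1) + 1) sg1 sg2" "frame b Y sg1 sg2" "I N sg2"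
      by (rule computesE[OF Suc.hyps(1)[of "Suc i" sg1]]) (use Suc.hyps(2) i fr body(3) in auto)
    have "var sg' x < var sg' y" using guard[of i sg'] Suc.prems i by simp
    from run_Loop_True[OF xy this body(1) rest(1)] show ?case
      by (rule computesI) (use rest frame_trans[OF body(2)] Suc_diff_Suc[OF i, symmetric] in auto)
  qed
  from this[of 0 sg] init show ?thesis by simp
qed

lemma computes_for:
  assumes vl: "v < b'" "b \<le> v" "l < b'" "b' \<le> 60" "v \<noteq> l" "var sg l = N" "N \<le> S" and Y: "Y' \<subseteq> Y"
    and init: "I 0 (set_var v 0 sg)"
    and step: "\<And>i sg'. i < N \<Longrightarrow> frame b Y sg sg' \<Longrightarrow> I i sg' \<Longrightarrow> var sg' v = i \<Longrightarrow> var sg' l = N \<Longrightarrow>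
       computes c T b' Y' sg' (\<lambda>sg''. I (Suc i) (set_var v (Suc i) sg''))"
  shows "computes (for_loop v l c) (N * (T + 6) + 4) b Y sg (\<lambda>sg'. I N sg' \<and> var sg' v = N \<and> var sg' l = N)"
proof -
  let ?J = "\<lambda>i sg'. I i sg' \<and> var sg' v = i \<and> var sg' l = N"
  let ?body = "c ;; block [v ::= Var v [+] Cst 1]"
  have start: "run (block [v ::= Cst 0]) 3 sg (set_var v 0 sg)"
    using run_block[of sg "[v ::= Cst 0]" 3] vl by (simp add: block_cost_def)
  have "computes (Loop (Lt (Reg v) (Reg l)) ?body) (N * ((T + 5) + 1) + 1) b Y (set_var v 0 sg) (?J N)"
  proof (rule computes_while[where I = ?J])
    show "?J 0 (set_var v 0 sg)" using init vl by simp
  next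
    fix i sg1 assume i: "i < N" and fr: "frame b Y (set_var v 0 sg) sg1" and J: "?J i sg1"
    have "frame b Y sg sg1" using fr vl(2) by (auto simp: frame_def)
    from computesE[OF step[OF i this]] J obtain sg2 where
      body: "run c T sg1 sg2" "frame b' Y' sg1 sg2" "I (Suc i) (set_var v (Suc i) sg2)" by metis
    have "run (block [v ::= Var v [+] Cst 1]) 5 sg2 (set_var v (Suc i) sg2)"
      using run_block[of sg2 "[v ::= Var v [+] Cst 1]" 5] vl i J frame_var[OF body(2)] by (simp add: block_cost_def)
    from run_Seq[OF body(1) this] show "computes ?body (T + 5) b Y sg1 (?J (Suc i))"
      by (rule computesI) (use body vl Y J in \<open>auto simp: frame_def\<close>)
  qed (use vl in auto)
  then obtain sg' where "run (Loop (Lt (Reg v) (Reg l)) ?body) (N * (T + 6) + 1) (set_var v 0 sg) sg'"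
    "frame b Y (set_var v 0 sg) sg'" "?J N sg'" by (rule computesE) (simp add: eval_nat_numeral)
  then show ?thesis unfolding for_loop_def
    by (intro computesI[OF run_Seq[OF start]]) (use vl(2) in \<open>auto simp: frame_def\<close>)
qed

end

subsection \<open>Filling and updating arrays\<close>

abbreviation (input) "iV \<equiv> 59 :: nat"
abbreviation (input) "ix \<equiv> Var iV"
abbreviation (input) "scratchA \<equiv> 10 :: nat"

definition fill_loop :: "nat \<Rightarrow> expr \<Rightarrow> nat \<Rightarrow> expr \<Rightarrow> com" where
  "fill_loop a ea l e = for_loop iV l (block [a\<lbrakk>ea\<rbrakk> ::= e])"

abbreviation map_loop :: "nat \<Rightarrow> nat \<Rightarrow> expr \<Rightarrow> com" where
  "map_loop a l e \<equiv> fill_loop a ix l e"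

abbreviation map_loop_at :: "nat \<Rightarrow> nat \<Rightarrow> nat \<Rightarrow> expr \<Rightarrow> com" where
  "map_loop_at a v l e \<equiv> fill_loop a (Var v [+] ix) l e"

text \<open>The detour through the scratch array lets the new entries depend on all old ones.\<close>

definition update_loop :: "nat \<Rightarrow> nat \<Rightarrow> expr \<Rightarrow> com" where
  "update_loop a l e = map_loop scratchA l e ;; map_loop a l (Arr scratchA ix)"

definition overwrite :: "nat \<Rightarrow> nat \<Rightarrow> (nat \<Rightarrow> nat) \<Rightarrow> (nat \<Rightarrow> nat) \<Rightarrow> nat \<Rightarrow> nat" where
  "overwrite p N f g x = (if p \<le> x \<and> x < p + N then f (x - p) else g x)"

lemma overwrite_inside [simp]: "i < N \<Longrightarrow> overwrite p N f g (p + i) = f i"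
  and overwrite_start [simp]: "overwrite 0 N f g i = (if i < N then f i else g i)"
  and overwrite_empty [simp]: "overwrite p 0 f g = g"
  and overwrite_outside: "\<not> (p \<le> x \<and> x < p + N) \<Longrightarrow> overwrite p N f g x = g x"
  by (auto simp: overwrite_def fun_eq_iff)

context ram
begin

lemma computes_fill:
  assumes len: "l < 59" "var sg l = N" "N \<le> S" and target: "a < 30" "a \<notin> arrays ea" "a \<notin> arrays e" and cost: "cost ea + cost e \<le> 480"
    and exprs: "\<And>i. i < N \<Longrightarrow> safe (set_var iV i sg) ea \<and> ev (set_var iV i sg) ea = p + i \<and> safe (set_var iV i sg) e"
    and range: "p + N \<le> S"
  shows "computes (fill_loop a ea l e) (500 * (N + 1)) 59 {a} sg
    (\<lambda>sg'. arr sg' a = overwrite p N (\<lambda>i. ev (set_var iV i sg) e) (arr sg a))"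
proof -
  let ?F = "\<lambda>k. overwrite p k (\<lambda>i. ev (set_var iV i sg) e) (arr sg a)"
  let ?I = "\<lambda>k sg'. var sg' = (var sg)(iV := k) \<and> arr sg' = (arr sg)(a := ?F k)"
  have "computes (for_loop iV l (block [a\<lbrakk>ea\<rbrakk> ::= e])) (N * ((cost ea + cost e + 4) + 6) + 4) 59 {a} sg
    (\<lambda>sg'. ?I N sg' \<and> var sg' iV = N \<and> var sg' l = N)"
  proof (rule computes_for[where b' = 60 and Y' = "{a}" and I = ?I])
    show "?I 0 (set_var iV 0 sg)" by simp
    fix i sg1 assume i: "i < N" and I: "?I i sg1"
    have unchanged: "ev sg1 e' = ev (set_var iV i sg) e'" "safe sg1 e'" if "a \<notin> arrays e'" "safe (set_var iV i sg) e'" for e'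
    proof -
      have same: "arr sg1 b = arr (set_var iV i sg) b" if "b \<in> arrays e'" for b using I \<open>a \<notin> arrays e'\<close> that by auto
      show "ev sg1 e' = ev (set_var iV i sg) e'" "safe sg1 e'"
        by (rule ev_cong[OF that(2) _ same]; use I in simp)+
    qed
    have next_entry: "(?F i)(p + i := ev (set_var iV i sg) e) = ?F (Suc i)" by (auto simp: overwrite_def less_Suc_eq fun_eq_iff)
    have "run (block [a\<lbrakk>ea\<rbrakk> ::= e]) (cost ea + cost e + 4) sg1 (set_arr a (?F (Suc i)) sg1)"
      using run_block[of sg1 "[a\<lbrakk>ea\<rbrakk> ::= e]" "cost ea + cost e + 4"]
        i I unchanged[OF target(2)] unchanged[OF target(3)] exprs[OF i] target(1) range next_entry
      by (simp add: block_cost_def)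
    then show "computes (block [a\<lbrakk>ea\<rbrakk> ::= e]) (cost ea + cost e + 4) 60 {a} sg1 (\<lambda>sg2. ?I (Suc i) (set_var iV (Suc i) sg2))"
      by (rule computesI) (use I in auto)
  qed (use len in auto)
  moreover have "N * (cost ea + cost e + 4 + 6) + 4 \<le> 500 * (N + 1)"
  proof -
    have "N * (cost ea + cost e + 4 + 6) + 4 \<le> N * 490 + 4" using cost by (intro add_mono mult_le_mono2) simp_all
    also have "\<dots> \<le> 500 * (N + 1)" by simp
    finally show ?thesis .
  qed
  ultimately show ?thesis unfolding fill_loop_def by (rule computes_mono) auto
qed

lemma computes_map:
  assumes "l < 59" "var sg l = N" "N \<le> S" "a < 30" "a \<notin> arrays e" "cost e \<le> 400"
    and "\<And>i. i < N \<Longrightarrow> safe (set_var iV i sg) e"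
  shows "computes (map_loop a l e) (500 * (N + 1)) 59 {a} sg
    (\<lambda>sg'. \<forall>i. arr sg' a i = (if i < N then ev (set_var iV i sg) e else arr sg a i))"
  by (rule computes_mono[OF computes_fill[where p = 0 and N = N]]) (use assms in auto)

lemma computes_map_at:
  assumes "v < 59" "l < 59" "var sg l = N" "var sg v = p" "p + N \<le> S" "a < 30" "a \<notin> arrays e" "cost e \<le> 400"
    and "\<And>i. i < N \<Longrightarrow> safe (set_var iV i sg) e"
  shows "computes (map_loop_at a v l e) (500 * (N + 1)) 59 {a} sg
    (\<lambda>sg'. arr sg' a = overwrite p N (\<lambda>i. ev (set_var iV i sg) e) (arr sg a))"
  by (rule computes_mono[OF computes_fill[where p = p and N = N]]) (use assms in auto)

lemma computes_update:
  assumes "l < 59" "var sg l = N" "N \<le> S" "a < 30" "a \<noteq> scratchA" "scratchA \<notin> arrays e" "cost e \<le> 400"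
    and "\<And>i. i < N \<Longrightarrow> safe (set_var iV i sg) e"
  shows "computes (update_loop a l e) (1000 * (N + 1)) 59 {a, scratchA} sg
    (\<lambda>sg'. \<forall>i. arr sg' a i = (if i < N then ev (set_var iV i sg) e else arr sg a i))"
proof -
  obtain sg1 where copy: "run (map_loop scratchA l e) (500 * (N + 1)) sg sg1" "frame 59 {scratchA} sg sg1"
    "\<forall>i. arr sg1 scratchA i = (if i < N then ev (set_var iV i sg) e else arr sg scratchA i)"
    by (rule computesE[OF computes_map[of l sg N scratchA e]]) (use assms in auto)
  obtain sg2 where restore: "run (map_loop a l (Arr scratchA ix)) (500 * (N + 1)) sg1 sg2" "frame 59 {a} sg1 sg2"
    "\<forall>i. arr sg2 a i = (if i < N then arr sg1 scratchA i else arr sg1 a i)"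
    by (rule computesE[OF computes_map[of l sg1 N a "Arr scratchA ix"]]) (use assms copy(2) in \<open>auto simp: frame_var\<close>)
  show ?thesis unfolding update_loop_def
    by (rule computesI[OF run_Seq[OF copy(1) restore(1)]]) (use copy(2,3) restore(2,3) assms(5) in \<open>auto simp: frame_def\<close>)
qed

end

section \<open>Nussbaumer's negacyclic convolution\<close>

lemma (in comm_monoid_set) lessThan_add: "F g {..<a + b} = F g {..<a} \<^bold>* F (\<lambda>j. g (a + j)) {..<b::nat}"
  by (induction b) (simp_all add: assoc)

lemma (in comm_monoid_set) lessThan_mult: "F g {..<a * b} = F (\<lambda>j. F (\<lambda>l. g (j * b + l)) {..<b}) {..<a::nat}"
  by (induction a) (simp_all add: add.commute[of b] lessThan_add)

lemma block_div_mod: "l < n \<Longrightarrow> (b * n + l) div n = b" "l < n \<Longrightarrow> (b * n + l) mod n = l" for n :: nat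
  by simp_all

lemma block_index_less: "j < m \<Longrightarrow> l < r \<Longrightarrow> j * r + l < m * r" for j l m r :: nat
  using mult_le_mono1[of "Suc j" m r] by simp

definition poly_at :: "(nat \<Rightarrow> int) \<Rightarrow> nat \<Rightarrow> nat \<Rightarrow> complex \<Rightarrow> complex" where
  "poly_at f p n x = (\<Sum>l<n. of_int (f (p + l)) * x ^ l)"

text \<open>
  A segment of \<open>h * r\<close> cells read as a polynomial in \<open>X\<close> and \<open>y\<close>. An element of
  \<open>\<int>[X,y] / (y^r + 1, X^h - y^e)\<close> is studied through its values at the complex points with
  \<open>y^r = -1\<close> and \<open>X^h = y^e\<close>.
\<close>

definition poly2_at :: "(nat \<Rightarrow> int) \<Rightarrow> nat \<Rightarrow> nat \<Rightarrow> nat \<Rightarrow> complex \<Rightarrow> complex \<Rightarrow> complex" where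
  "poly2_at f p h r X y = (\<Sum>j<h. poly_at f (p + j * r) r y * X ^ j)"

lemma poly_at_add: "(\<And>l. l < n \<Longrightarrow> f (p + l) = g (q + l) + g' (q' + l)) \<Longrightarrow> poly_at f p n x = poly_at g q n x + poly_at g' q' n x"
  by (simp add: poly_at_def distrib_right sum.distrib)

lemma poly_at_diff: "poly_at (\<lambda>k. f k - f (k + H)) p n y = poly_at f p n y - poly_at f (p + H) n y"
  unfolding poly_at_def by (simp add: left_diff_distrib sum_subtractf add_ac)

lemma poly2_at_halves:
  "poly2_at f p (2 * h) r X y =
     (\<Sum>j<h. (poly_at f (p + j * r) r y + X ^ h * poly_at f (p + (h + j) * r) r y) * X ^ j)"
  unfolding poly2_at_def mult_2 sum.lessThan_add by (simp add: sum.distrib power_add algebra_simps)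

subsection \<open>Multiplication by powers of a root of \<open>-1\<close>\<close>

definition sign_ext :: "(nat \<Rightarrow> int) \<Rightarrow> nat \<Rightarrow> nat \<Rightarrow> nat \<Rightarrow> int" where
  "sign_ext f p r i = (if i mod (2*r) < r then f (p + i mod (2*r)) else - f (p + (i mod (2*r) - r)))"

lemma sign_ext_half_turn:
  assumes "0 < r" shows "sign_ext f p r (i + r) = - sign_ext f p r i"
proof -
  have less: "i mod (2*r) < 2 * r" using assms by simp
  have "(i + r) mod (2*r) = (i mod (2*r) + r) mod (2*r)" by (simp add: mod_add_left_eq)
  also have "\<dots> = (if i mod (2*r) < r then i mod (2*r) + r else i mod (2*r) - r)"
    using less by (auto simp: le_mod_geq)
  finally show ?thesis using less by (auto simp: sign_ext_def)
qed

lemma sign_ext_shift: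
  assumes "0 < r" "y ^ r = -1"
  shows "(\<Sum>l<r. of_int (sign_ext f p r (l + a)) * y ^ l) =
    y ^ e * (\<Sum>l<r. of_int (sign_ext f p r (l + (a + e))) * y ^ l :: complex)"
proof (induction e)
  case (Suc e)
  let ?G = "\<lambda>a. (\<Sum>l<r. of_int (sign_ext f p r (l + a)) * y ^ l :: complex)"
  have "?G a = y * ?G (a + 1)" for a
  proof -
    have "(\<Sum>l<Suc r. of_int (sign_ext f p r (l + a)) * y ^ l) = of_int (sign_ext f p r a) + y * ?G (a + 1)"
      by (subst sum.lessThan_Suc_shift) (simp add: sum_distrib_left mult_ac)
    moreover have "(\<Sum>l<Suc r. of_int (sign_ext f p r (l + a)) * y ^ l) = ?G a + of_int (sign_ext f p r a)"
      using sign_ext_half_turn[OF assms(1), of f p a] assms(2) by (simp add: add.commute)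
    ultimately show ?thesis by simp
  qed
  from this[of "a + e"] Suc show ?case by (simp add: mult_ac)
qed simp

lemma poly_at_rotate:
  assumes "0 < r" "y ^ r = -1" "e \<le> 2 * r" "\<And>l. l < r \<Longrightarrow> g (q + l) = sign_ext f p r (l + 2 * r - e)"
  shows "poly_at g q r y = y ^ e * poly_at f p r y"
proof -
  have "poly_at g q r y = (\<Sum>l<r. of_int (sign_ext f p r (l + (2 * r - e))) * y ^ l)"
    unfolding poly_at_def using assms(3,4) by (intro sum.cong) auto
  also have "\<dots> = y ^ e * (\<Sum>l<r. of_int (sign_ext f p r (l + (2 * r - e + e))) * y ^ l)"
    by (rule sign_ext_shift[OF assms(1,2)])
  also have "(\<Sum>l<r. of_int (sign_ext f p r (l + (2 * r - e + e))) * y ^ l) = poly_at f p r y"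
    unfolding poly_at_def using assms(3) by (intro sum.cong) (auto simp: sign_ext_def)
  finally show ?thesis .
qed

subsection \<open>One stage of the transform\<close>

text \<open>
  Reduction of each segment of length \<open>2 * H\<close> modulo the two factors \<open>X^h - y^e\<close>, \<open>X^h + y^e\<close>
  of \<open>X^(2h) - y^(2e)\<close>, where \<open>H = h * r\<close>; the exponents of the factors are tabulated in \<open>E\<close>,
  the \<open>G\<close> factors of one block being numbered \<open>G, \<dots>, 2 * G - 1\<close>.
\<close>

definition split_stage :: "nat \<Rightarrow> nat \<Rightarrow> nat \<Rightarrow> (nat \<Rightarrow> nat) \<Rightarrow> (nat \<Rightarrow> int) \<Rightarrow> nat \<Rightarrow> int" where
  "split_stage r H G E f i = f (i div (2*H) * (2*H) + i mod H) +
     sign_ext f (i div (2*H) * (2*H) + H + i mod H div r * r) r (i mod r + 2 * r - E (G + i div H mod G))"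

definition merge_stage :: "nat \<Rightarrow> nat \<Rightarrow> nat \<Rightarrow> (nat \<Rightarrow> nat) \<Rightarrow> (nat \<Rightarrow> int) \<Rightarrow> nat \<Rightarrow> int" where
  "merge_stage r H G E c i = (if i mod (2*H) < H then c i + c (i + H)
     else sign_ext (\<lambda>k. c k - c (k + H)) (i div (2*H) * (2*H) + i mod H div r * r) r
            (i mod r + E (G + (2 * (i div (2*H))) mod G)))"

lemma segment_index:
  fixes r h p c j l :: nat
  assumes "H = h * r" "j < h" "l < r" "c < 2"
  defines "i \<equiv> (2 * p + c) * H + j * r + l"
  shows "i div H = 2 * p + c" "i mod H = j * r + l" "i div (2*H) = p" "i mod r = l" "i mod (2*H) = c * H + (j * r + l)"
proof -
  have less: "j * r + l < H" using block_index_less assms(1-3) by simp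
  have i: "i = (2 * p + c) * H + (j * r + l)" by (simp add: i_def)
  show div_mod: "i div H = 2 * p + c" "i mod H = j * r + l" unfolding i using less by simp_all
  have "i div (2*H) = i div H div 2" by (simp add: div_mult2_eq mult.commute)
  then show "i div (2*H) = p" using div_mod assms(4) by simp
  have "i = ((2 * p + c) * h + j) * r + l" by (simp add: i_def assms(1) algebra_simps)
  then show "i mod r = l" using assms(3) by simp
  have "i = p * (2*H) + (c * H + (j * r + l))" by (simp add: i_def algebra_simps)
  moreover have "c * H + (j * r + l) < 2 * H" using less assms(4) by (cases c) auto
  ultimately show "i mod (2*H) = c * H + (j * r + l)" by (simp only: block_div_mod)
qed

context
  fixes r h H :: nat and y X :: complex
  assumes H: "H = h * r" and r: "0 < r" and y: "y ^ r = -1"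
begin

lemma poly2_at_split:
  fixes E :: "nat \<Rightarrow> nat" and G p c :: nat
  defines "e \<equiv> E (G + (2 * p + c) mod G)"
  assumes "c < 2" "X ^ h = y ^ e" "e \<le> 2 * r"
  shows "poly2_at (split_stage r H G E f) ((2 * p + c) * H) h r X y = poly2_at f (2 * p * H) (2 * h) r X y"
proof -
  have "poly_at (split_stage r H G E f) ((2 * p + c) * H + j * r) r y =
     poly_at f (2 * p * H + j * r) r y + y ^ e * poly_at f (2 * p * H + (h + j) * r) r y" if j: "j < h" for j
  proof -
    define g where "g l = sign_ext f (2 * p * H + (h + j) * r) r (l + 2 * r - e)" for l
    have "split_stage r H G E f ((2 * p + c) * H + j * r + l) = f (2 * p * H + j * r + l) + g (0 + l)" if "l < r" for l
      unfolding split_stage_def segment_index[OF H j that assms(2)] block_div_mod[OF that] e_def g_def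
      by (simp add: H algebra_simps)
    moreover have "poly_at g 0 r y = y ^ e * poly_at f (2 * p * H + (h + j) * r) r y"
      by (rule poly_at_rotate[OF r y assms(4)]) (simp add: g_def)
    ultimately show ?thesis using poly_at_add[where g' = g and q' = 0] by metis
  qed
  then show ?thesis unfolding poly2_at_halves assms(3) by (simp add: poly2_at_def)
qed

lemma poly_at_merge_low:
  assumes "j < h"
  shows "poly_at (merge_stage r H G E c) (2 * p * H + j * r) r y =
     poly_at c (2 * p * H + j * r) r y + poly_at c ((2 * p + 1) * H + j * r) r y"
proof (rule poly_at_add)
  fix l assume l: "l < r"
  have "j * r + l < H" using block_index_less[OF assms l] H by simp
  then show "merge_stage r H G E c (2 * p * H + j * r + l) =
      c (2 * p * H + j * r + l) + c ((2 * p + 1) * H + j * r + l)"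
    using segment_index[where p = p and c = 0, OF H assms l] by (simp add: merge_stage_def algebra_simps)
qed

lemma poly_at_merge_high:
  fixes E :: "nat \<Rightarrow> nat" and G p :: nat
  defines "e \<equiv> E (G + (2 * p) mod G)"
  assumes j: "j < h" and "e \<le> 2 * r"
  shows "y ^ e * poly_at (merge_stage r H G E c) (2 * p * H + (h + j) * r) r y =
     poly_at c (2 * p * H + j * r) r y - poly_at c ((2 * p + 1) * H + j * r) r y"
proof -
  let ?d = "\<lambda>k. c k - c (k + H)"
  have "merge_stage r H G E c (2 * p * H + (h + j) * r + l) =
      sign_ext ?d (2 * p * H + j * r) r (l + 2 * r - (2 * r - e))" if l: "l < r" for l
  proof -
    have "2 * p * H + (h + j) * r + l = (2 * p + 1) * H + j * r + l" by (simp add: H algebra_simps)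
    then show ?thesis
      using segment_index[where p = p and c = 1, OF H j l] block_div_mod[OF l] \<open>e \<le> 2 * r\<close>
      by (simp add: merge_stage_def e_def algebra_simps)
  qed
  then have "poly_at (merge_stage r H G E c) (2 * p * H + (h + j) * r) r y =
      y ^ (2 * r - e) * poly_at ?d (2 * p * H + j * r) r y"
    by (intro poly_at_rotate[OF r y]) auto
  moreover have "y ^ e * y ^ (2 * r - e) = 1"
    using y \<open>e \<le> 2 * r\<close> by (simp add: power_add[symmetric] mult.commute[of 2] power_mult)
  ultimately show ?thesis by (simp add: poly_at_diff add_ac distrib_right flip: mult.assoc)
qed

lemma poly2_at_merge:
  fixes E :: "nat \<Rightarrow> nat" and G p :: nat
  defines "e \<equiv> E (G + (2 * p) mod G)"
  assumes "c < 2" "X ^ h = (-1) ^ c * y ^ e" "e \<le> 2 * r"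
  shows "poly2_at (merge_stage r H G E f) (2 * p * H) (2 * h) r X y = 2 * poly2_at f ((2 * p + c) * H) h r X y"
proof -
  let ?lo = "\<lambda>j. poly_at f (2 * p * H + j * r) r y" and ?hi = "\<lambda>j. poly_at f ((2 * p + 1) * H + j * r) r y"
  have "poly_at (merge_stage r H G E f) (2 * p * H + j * r) r y + X ^ h * poly_at (merge_stage r H G E f) (2 * p * H + (h + j) * r) r y =
      (?lo j + ?hi j) + (-1) ^ c * (?lo j - ?hi j)" if "j < h" for j
    unfolding poly_at_merge_low[OF that] assms(3)
    using arg_cong[OF poly_at_merge_high[OF that, of E G p f], of "\<lambda>z. (-1) ^ c * z"] assms(4) by (simp add: e_def mult_ac)
  moreover have "(?lo j + ?hi j) + (-1) ^ c * (?lo j - ?hi j) = 2 * poly_at f ((2 * p + c) * H + j * r) r y" for j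
    using assms(2) by (cases c) auto
  ultimately show ?thesis
    unfolding poly2_at_halves unfolding poly2_at_def by (simp add: sum_distrib_left mult.assoc)
qed

end

subsection \<open>The table of exponents\<close>

text \<open>
  Factor \<open>v\<close> of a level is \<open>X^h - y^(twist r v)\<close>; it splits into the factors \<open>2 * v\<close> and \<open>2 * v + 1\<close>.
\<close>

function twist :: "nat \<Rightarrow> nat \<Rightarrow> nat" where
  "twist r v = (if v < 2 then 0 else twist r (v div 2) div 2 + v mod 2 * r)"
  by auto
termination by (relation "measure snd") auto

declare twist.simps [simp del]

lemma twist_child: "0 < v \<Longrightarrow> c < 2 \<Longrightarrow> twist r (2 * v + c) = twist r v div 2 + c * r"
  by (subst twist.simps) simp

lemma twist_1 [simp]: "twist r (Suc 0) = 0"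
  by (subst twist.simps) simp

lemma twist_le: "twist r v \<le> 2 * r"
proof (induction v rule: less_induct)
  case (less v)
  show ?case
  proof (cases "v < 2")
    case False
    then have "twist r (v div 2) div 2 \<le> r" using less[of "v div 2"] by simp
    moreover have "v mod 2 * r \<le> r" by (cases "even v") (auto simp: odd_iff_mod_2_eq_one)
    ultimately have "twist r (v div 2) div 2 + v mod 2 * r \<le> 2 * r" by linarith
    then show ?thesis by (subst twist.simps) simp
  qed (subst twist.simps, simp)
qed

lemma twist_dvd: "d \<le> u + 1 \<Longrightarrow> 2 ^ d \<le> v \<Longrightarrow> v < 2 ^ (d + 1) \<Longrightarrow> 2 ^ (u + 1 - d) dvd twist (2 ^ u) v"
proof (induction d arbitrary: v)
  case 0 then show ?case by (subst twist.simps) auto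
next
  case (Suc d)
  have "2 ^ (u + 1 - d) dvd twist (2 ^ u) (v div 2)" using Suc by (intro Suc.IH) auto
  then have "2 ^ (u - d) dvd twist (2 ^ u) (v div 2) div 2"
    using Suc.prems(1) by (intro dvd_mult_imp_div) (simp add: Suc_diff_le mult.commute)
  moreover have "2 ^ (u - d) dvd v mod 2 * (2::nat) ^ u" by (simp add: le_imp_power_dvd)
  ultimately show ?case by (subst twist.simps) auto
qed

subsection \<open>Products of segments\<close>

definition segment_product ::
    "nat \<Rightarrow> nat \<Rightarrow> nat \<Rightarrow> nat \<Rightarrow> nat \<Rightarrow> (nat \<Rightarrow> int) \<Rightarrow> (nat \<Rightarrow> int) \<Rightarrow> (nat \<Rightarrow> int) \<Rightarrow> bool" where
  "segment_product P h r d sc c a b \<longleftrightarrow>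
     (\<forall>p<P. \<forall>X y. y ^ r = -1 \<longrightarrow> X ^ h = y ^ twist r (2 ^ d + p mod 2 ^ d) \<longrightarrow>
        poly2_at c (p * (h * r)) h r X y =
          2 ^ sc * poly2_at a (p * (h * r)) h r X y * poly2_at b (p * (h * r)) h r X y)"

lemma child_number:
  fixes p d c :: nat
  assumes "c < 2"
  shows "2 ^ (d + 1) + (2 * p + c) mod 2 ^ (d + 1) = 2 * (2 ^ d + p mod 2 ^ d) + c"
proof -
  have "(2 * p + c) mod (2 * 2 ^ d) = 2 * (p mod 2 ^ d) + c"
    using mod_mult2_eq[of "2 * p + c" 2 "2 ^ d"] assms by simp
  then show ?thesis by simp
qed

lemma segment_product_merge:
  assumes r: "r = 2 ^ u" and depth: "d \<le> u" and H: "H = h * r"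
    and halves: "segment_product (2 * P) h r (d + 1) sc c
      (split_stage r H (2 ^ (d+1)) (twist r) a) (split_stage r H (2 ^ (d+1)) (twist r) b)"
  shows "segment_product P (2 * h) r d (sc + 1) (merge_stage r H (2 ^ (d+1)) (twist r) c) a b"
  unfolding segment_product_def
proof (intro allI impI)
  fix p :: nat and X y :: complex
  assume p: "p < P" and y: "y ^ r = -1" and X: "X ^ (2 * h) = y ^ twist r (2 ^ d + p mod 2 ^ d)"
  have r_pos: "0 < r" by (simp add: r)
  define v where "v = 2 ^ d + p mod 2 ^ d"
  have v: "2 ^ d \<le> v" "v < 2 ^ (d + 1)" "0 < v" by (auto simp: v_def)
  define e where "e = twist r v div 2"
  have "2 ^ (u + 1 - d) dvd twist r v" unfolding r using depth v by (intro twist_dvd) auto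
  moreover have "2 dvd (2::nat) ^ (u + 1 - d)" using depth by simp
  ultimately have "twist r v = 2 * e" using dvd_trans by (fastforce simp: e_def)
  then have "(X ^ h)\<^sup>2 = (y ^ e)\<^sup>2" using X unfolding v_def[symmetric] by (metis mult.commute power_mult)
  then have "X ^ h = y ^ e \<or> X ^ h = - (y ^ e)" by (simp add: power2_eq_iff)
  then obtain c' :: nat where c': "c' < 2" "X ^ h = (-1) ^ c' * y ^ e"
    using that[of 0] that[of 1] by auto
  have child: "2 ^ (d+1) + (2 * p + i) mod 2 ^ (d+1) = 2 * v + i" "twist r (2 * v + i) = e + i * r" if "i < 2" for i
    using child_number[OF that] twist_child[OF v(3) that] by (simp_all add: v_def e_def)
  have "y ^ (c' * r) = (-1) ^ c'" using y by (metis mult.commute power_mult)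
  then have Xh: "X ^ h = y ^ twist r (2 * v + c')" using c' by (simp add: child power_add)
  have "2 * p + c' < 2 * P" using p c'(1) by simp
  then have "poly2_at c ((2 * p + c') * (h * r)) h r X y =
      2 ^ sc * poly2_at (split_stage r H (2 ^ (d+1)) (twist r) a) ((2 * p + c') * (h * r)) h r X y *
        poly2_at (split_stage r H (2 ^ (d+1)) (twist r) b) ((2 * p + c') * (h * r)) h r X y"
    using halves y Xh child(1)[OF c'(1)] unfolding segment_product_def by metis
  moreover have "poly2_at (split_stage r H (2 ^ (d+1)) (twist r) g) ((2 * p + c') * H) h r X y = poly2_at g (2 * p * H) (2 * h) r X y" for g
    using Xh twist_le child(1)[OF c'(1)] by (intro poly2_at_split[OF H r_pos y c'(1)]) simp_all
  moreover have "poly2_at (merge_stage r H (2 ^ (d+1)) (twist r) c) (2 * p * H) (2 * h) r X y = 2 * poly2_at c ((2 * p + c') * H) h r X y"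
    using c'(2) twist_le[of r "2 * v"] child[of 0] by (intro poly2_at_merge[OF H r_pos y c'(1)]) simp_all
  ultimately show "poly2_at (merge_stage r H (2 ^ (d+1)) (twist r) c) (p * (2 * h * r)) (2 * h) r X y =
      2 ^ (sc + 1) * poly2_at a (p * (2 * h * r)) (2 * h) r X y * poly2_at b (p * (2 * h * r)) (2 * h) r X y"
    by (simp add: H mult_ac)
qed

subsection \<open>One level of the recursion\<close>

definition poly_of :: "nat \<Rightarrow> (nat \<Rightarrow> 'a::comm_ring_1) \<Rightarrow> 'a poly" where
  "poly_of n f = (\<Sum>j<n. monom (f j) j)"

lemma coeff_poly_of: "coeff (poly_of n f) i = (if i < n then f i else 0)"
  unfolding poly_of_def coeff_sum coeff_monom by (simp add: sum.delta)

lemma degree_poly_of: "0 < n \<Longrightarrow> degree (poly_of n f) < n"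
  by (intro degree_lessI) (simp_all add: coeff_poly_of)

lemma poly_poly_of: "poly (poly_of n f) x = (\<Sum>j<n. f j * x ^ j)"
  by (simp add: poly_of_def poly_sum poly_monom)

text \<open>
  The substitution \<open>y = x^m\<close> turns a block of \<open>m * r\<close> coefficients into a polynomial in \<open>x\<close> of
  degree below \<open>m\<close> over \<open>\<int>[y] / (y^r + 1)\<close>; products of two of these have degree below \<open>2 * m\<close>.
\<close>

definition transposed :: "nat \<Rightarrow> nat \<Rightarrow> (nat \<Rightarrow> int) \<Rightarrow> nat \<Rightarrow> int" where
  "transposed m r f i = f (i div (2*(m*r)) * (m*r) + i mod r * m + i mod (m*r) div r)"

definition zero_padded :: "nat \<Rightarrow> nat \<Rightarrow> (nat \<Rightarrow> int) \<Rightarrow> nat \<Rightarrow> int" where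
  "zero_padded m r f i = (if i mod (2*(m*r)) < m * r then transposed m r f i else 0)"

definition recombined :: "nat \<Rightarrow> nat \<Rightarrow> (nat \<Rightarrow> int) \<Rightarrow> nat \<Rightarrow> int" where
  "recombined m r c i = c (i div (m*r) * (2*(m*r)) + i mod m * r + i mod (m*r) div m) +
     sign_ext c (i div (m*r) * (2*(m*r)) + (m + i mod m) * r) r (i mod (m*r) div m + 2 * r - 1)"

lemma transposed_at:
  assumes "c < 2" "j < m" "l < r"
  shows "transposed m r f ((2 * p + c) * (m * r) + j * r + l) = f (p * (m * r) + l * m + j)"
  unfolding transposed_def segment_index[OF refl assms(2,3,1)] using assms(3) by simp

lemma zero_padded_at:
  assumes "c < 2" "j < m" "l < r"
  shows "zero_padded m r f ((2 * p + c) * (m * r) + j * r + l) = (if c = 0 then f (p * (m * r) + l * m + j) else 0)"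
  unfolding zero_padded_def segment_index[OF refl assms(2,3,1)] transposed_at[OF assms]
  using block_index_less[OF assms(2,3)] by (cases c) auto

lemma recombined_at:
  assumes "j < m" "l < r"
  shows "recombined m r c (p * (m * r) + l * m + j) =
    c (2 * p * (m * r) + j * r + l) + sign_ext c (2 * p * (m * r) + (m + j) * r) r (l + 2 * r - 1)"
proof -
  have i: "p * (m * r) + l * m + j = p * (m * r) + (l * m + j)" "p * (m * r) + l * m + j = (p * r + l) * m + j"
    by (simp_all add: algebra_simps)
  have "l * m + j < m * r" using block_index_less[OF assms(2,1)] by (simp add: mult.commute)
  from block_div_mod[OF this, of p]
  have "(p * (m * r) + l * m + j) div (m * r) = p" "(p * (m * r) + l * m + j) mod (m * r) = l * m + j"
    unfolding i(1) by blast+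
  moreover have "(p * (m * r) + l * m + j) mod m = j" unfolding i(2) by (rule block_div_mod[OF assms(1)])
  ultimately show ?thesis using assms(1) by (simp add: recombined_def mult_ac)
qed

lemma segment_decomposition:
  fixes i h r :: nat
  assumes "0 < h" "0 < r"
  obtains p c j l where "c < 2" "j < h" "l < r" "i = (2 * p + c) * (h * r) + j * r + l"
proof
  let ?q = "i div (h * r)"
  show "?q mod 2 < 2" "i mod (h * r) div r < h" "i mod (h * r) mod r < r"
    using assms by (simp_all add: less_mult_imp_div_less)
  have "2 * (?q div 2) + ?q mod 2 = ?q" by simp
  then show "i = (2 * (?q div 2) + ?q mod 2) * (h * r) + i mod (h * r) div r * r + i mod (h * r) mod r"
    by (metis add.assoc div_mult_mod_eq)
qed

lemma split_zero_padded:
  assumes "0 < m" "0 < r"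
  shows "split_stage r (m*r) 2 (twist r) (zero_padded m r f) = transposed m r f"
proof
  fix i
  obtain p c j l where c: "c < 2" and j: "j < m" and l: "l < r" and i: "i = (2 * p + c) * (m * r) + j * r + l"
    by (rule segment_decomposition[OF assms])
  have zero: "zero_padded m r f (p * (2 * (m * r)) + m * r + j * r + k) = 0" if "k < r" for k
    using zero_padded_at[where c = 1, OF _ j that, of f p] by (simp add: algebra_simps)
  have "sign_ext (zero_padded m r f) (p * (2 * (m * r)) + m * r + j * r) r k = 0" for k
  proof -
    have "k mod (2*r) < 2 * r" using assms by simp
    then have "k mod (2*r) - r < r" using assms by linarith
    then show ?thesis unfolding sign_ext_def using zero[of "k mod (2*r)"] zero[of "k mod (2*r) - r"] by presburger
  qed
  moreover have "zero_padded m r f (p * (2 * (m * r)) + (j * r + l)) = f (p * (m * r) + l * m + j)"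
    using zero_padded_at[where c = 0, OF _ j l, of f p] by (simp add: algebra_simps)
  ultimately show "split_stage r (m*r) 2 (twist r) (zero_padded m r f) i = transposed m r f i"
    unfolding i split_stage_def segment_index[OF refl j l c] transposed_at[OF c j l] block_div_mod[OF l] by simp
qed

lemma poly_at_transpose:
  "poly_at f p (m * r) x = (\<Sum>j<m. (\<Sum>l<r. of_int (f (p + l * m + j)) * (x ^ m) ^ l) * x ^ j)"
proof -
  have "poly_at f p (m * r) x = (\<Sum>l<r. \<Sum>j<m. of_int (f (p + (l * m + j))) * x ^ (l * m + j))"
    unfolding poly_at_def by (subst mult.commute) (rule sum.lessThan_mult)
  also have "\<dots> = (\<Sum>j<m. \<Sum>l<r. of_int (f (p + (l * m + j))) * x ^ (l * m + j))" by (rule sum.swap)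
  also have "\<dots> = (\<Sum>j<m. (\<Sum>l<r. of_int (f (p + l * m + j)) * (x ^ m) ^ l) * x ^ j)"
  proof -
    have "x ^ (l * m + j) = (x ^ m) ^ l * x ^ j" for l j by (simp add: power_add power_mult[symmetric] mult.commute)
    then show ?thesis by (simp add: sum_distrib_right add.assoc mult.assoc)
  qed
  finally show ?thesis .
qed

lemma poly2_at_zero_padded:
  "poly2_at (zero_padded m r f) (2 * p * (m * r)) (2 * m) r X y =
    (\<Sum>j<m. (\<Sum>l<r. of_int (f (p * (m * r) + l * m + j)) * y ^ l) * X ^ j)"
proof -
  have "poly_at (zero_padded m r f) (2 * p * (m * r) + j * r) r y = (\<Sum>l<r. of_int (f (p * (m * r) + l * m + j)) * y ^ l)"
    and "poly_at (zero_padded m r f) (2 * p * (m * r) + (m + j) * r) r y = 0" if "j < m" for j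
    using zero_padded_at[where c = 0, OF _ that, of _ r f p] zero_padded_at[where c = 1, OF _ that, of _ r f p]
    by (simp_all add: poly_at_def algebra_simps)
  then show ?thesis unfolding poly2_at_halves by simp
qed

lemma poly_at_recombined:
  assumes "0 < r" "x ^ (m * r) = -1"
  shows "poly_at (recombined m r c) (p * (m * r)) (m * r) x = poly2_at c (2 * p * (m * r)) (2 * m) r x (x ^ m)"
proof -
  have y: "(x ^ m) ^ r = -1" using assms(2) by (simp add: power_mult)
  have "(\<Sum>l<r. of_int (recombined m r c (p * (m * r) + l * m + j)) * (x ^ m) ^ l) =
     poly_at c (2 * p * (m * r) + j * r) r (x ^ m) + x ^ m * poly_at c (2 * p * (m * r) + (m + j) * r) r (x ^ m)"
    if j: "j < m" for j
  proof -
    define g where "g l = sign_ext c (2 * p * (m * r) + (m + j) * r) r (l + 2 * r - 1)" for l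
    have "poly_at g 0 r (x ^ m) = (x ^ m) ^ 1 * poly_at c (2 * p * (m * r) + (m + j) * r) r (x ^ m)"
      by (rule poly_at_rotate[OF assms(1) y]) (use assms(1) in \<open>simp_all add: g_def\<close>)
    then show ?thesis
      using recombined_at[OF j] by (simp add: poly_at_def g_def distrib_right sum.distrib)
  qed
  then show ?thesis unfolding poly_at_transpose poly2_at_halves by simp
qed

definition negacyclic_product :: "nat \<Rightarrow> nat \<Rightarrow> nat \<Rightarrow> (nat \<Rightarrow> int) \<Rightarrow> (nat \<Rightarrow> int) \<Rightarrow> (nat \<Rightarrow> int) \<Rightarrow> bool" where
  "negacyclic_product P n sc c a b \<longleftrightarrow> (\<forall>p<P. \<forall>x. x ^ n = -1 \<longrightarrow>
     poly_at c (p * n) n x = 2 ^ sc * poly_at a (p * n) n x * poly_at b (p * n) n x)"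

lemma negacyclic_product_recombined:
  assumes m: "0 < m" and r: "0 < r"
    and product: "segment_product P (2 * m) r 0 sc c (zero_padded m r a) (zero_padded m r b)"
  shows "negacyclic_product P (m * r) sc (recombined m r c) a b"
  unfolding negacyclic_product_def
proof (intro allI impI)
  fix p x assume p: "p < P" and x: "(x::complex) ^ (m * r) = -1"
  define y where "y = x ^ m"
  have y: "y ^ r = -1" using x by (simp add: y_def power_mult)
  define rows where "rows g = poly_of m (\<lambda>j. \<Sum>l<r. of_int (g (p * (m * r) + l * m + j)) * y ^ l)" for g :: "nat \<Rightarrow> int"
  define C where "C = poly_of (2 * m) (\<lambda>j. poly_at c (2 * p * (m * r) + j * r) r y)"
  have poly_rows: "poly (rows g) X = poly2_at (zero_padded m r g) (2 * p * (m * r)) (2 * m) r X y" for g X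
    by (simp add: rows_def poly_poly_of poly2_at_zero_padded)
  have poly_C: "poly C X = poly2_at c (2 * p * (m * r)) (2 * m) r X y" for X by (simp add: C_def poly_poly_of poly2_at_def)
  have "C = smult (2 ^ sc) (rows a * rows b)"
  proof (rule poly_eqI_degree[where A = "{X. X ^ (2 * m) = 1}"])
    fix X :: complex assume "X \<in> {X. X ^ (2 * m) = 1}"
    then have "X ^ (2 * m) = y ^ twist r (2 ^ 0 + p mod 2 ^ 0)" by simp
    moreover have "p * (2 * m * r) = 2 * p * (m * r)" by simp
    ultimately have "poly2_at c (2 * p * (m * r)) (2 * m) r X y =
        2 ^ sc * poly2_at (zero_padded m r a) (2 * p * (m * r)) (2 * m) r X y *
          poly2_at (zero_padded m r b) (2 * p * (m * r)) (2 * m) r X y"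
      using product[unfolded segment_product_def, rule_format, OF p y, of X] by (simp only:)
    then show "poly C X = poly (smult (2 ^ sc) (rows a * rows b)) X" by (simp add: poly_rows poly_C)
  next
    have card: "card {X::complex. X ^ (2 * m) = 1} = 2 * m" using m by (simp add: card_nth_roots)
    show "degree C < card {X::complex. X ^ (2 * m) = 1}" unfolding C_def card using m by (intro degree_poly_of) simp
    have "degree (rows a) < m" "degree (rows b) < m" unfolding rows_def using m by (simp_all add: degree_poly_of)
    then show "degree (smult (2 ^ sc) (rows a * rows b)) < card {X::complex. X ^ (2 * m) = 1}"
      unfolding card using degree_mult_le[of "rows a" "rows b"] by simp
  qed
  then have "poly C x = 2 ^ sc * poly (rows a) x * poly (rows b) x" by simp
  moreover have "poly (rows g) x = poly_at g (p * (m * r)) (m * r) x" for g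
    unfolding rows_def poly_poly_of poly_at_transpose y_def by simp
  moreover have "poly C x = poly_at (recombined m r c) (p * (m * r)) (m * r) x"
    unfolding poly_C poly_at_recombined[OF r x] y_def ..
  ultimately show "poly_at (recombined m r c) (p * (m * r)) (m * r) x =
      2 ^ sc * poly_at a (p * (m * r)) (m * r) x * poly_at b (p * (m * r)) (m * r) x" by simp
qed

text \<open>
  The intermediate arrays inside one level, for \<open>m = 2 ^ t\<close> and \<open>r = 2 ^ u\<close>. The first stage is
  applied to the zero-padded array and amounts to a transposition.
\<close>

fun split_stages :: "nat \<Rightarrow> nat \<Rightarrow> (nat \<Rightarrow> int) \<Rightarrow> nat \<Rightarrow> nat \<Rightarrow> int" where
  "split_stages t u f 0 = transposed (2 ^ t) (2 ^ u) f"
| "split_stages t u f (Suc q) =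
     split_stage (2 ^ u) (2 ^ (t - Suc q) * 2 ^ u) (2 ^ (q + 2)) (twist (2 ^ u)) (split_stages t u f q)"

fun merge_stages :: "nat \<Rightarrow> nat \<Rightarrow> (nat \<Rightarrow> int) \<Rightarrow> nat \<Rightarrow> nat \<Rightarrow> int" where
  "merge_stages t u c 0 = c"
| "merge_stages t u c (Suc q) =
     merge_stage (2 ^ u) (2 ^ q * 2 ^ u) (2 ^ (t + 1 - q)) (twist (2 ^ u)) (merge_stages t u c q)"

lemma segment_product_stages:
  assumes "t \<le> u" "q \<le> t"
    and product: "negacyclic_product (P * (2 * 2 ^ t)) (2 ^ u) sc c (split_stages t u a t) (split_stages t u b t)"
  shows "segment_product (P * 2 ^ (t + 1 - q)) (2 ^ q) (2 ^ u) (t + 1 - q) (sc + q) (merge_stages t u c q)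
    (split_stages t u a (t - q)) (split_stages t u b (t - q))"
  using assms(2)
proof (induction q)
  case 0
  then show ?case using product by (simp add: segment_product_def negacyclic_product_def poly2_at_def)
next
  case (Suc q)
  let ?split = "\<lambda>f. split_stage (2 ^ u) (2 ^ q * 2 ^ u) (2 ^ (t - q + 1)) (twist (2 ^ u)) (split_stages t u f (t - Suc q))"
  have "t - q = Suc (t - Suc q)" "t - Suc (t - Suc q) = q" using Suc.prems by auto
  then have split: "split_stages t u f (t - q) = ?split f" for f by simp
  have "segment_product (2 * (P * 2 ^ (t - q))) (2 ^ q) (2 ^ u) (t - q + 1) (sc + q) (merge_stages t u c q) (?split a) (?split b)"
    using Suc unfolding split by (simp add: Suc_diff_le mult.left_commute)
  from segment_product_merge[OF refl _ refl this] assms(1) Suc.prems show ?case by (simp add: Suc_diff_le)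
qed

lemma negacyclic_product_stages:
  assumes "t \<le> u" and product: "negacyclic_product (P * (2 * 2 ^ t)) (2 ^ u) sc c (split_stages t u a t) (split_stages t u b t)"
  shows "negacyclic_product P (2 ^ t * 2 ^ u) (sc + t + 1) (recombined (2 ^ t) (2 ^ u) (merge_stages t u c (Suc t))) a b"
proof (rule negacyclic_product_recombined)
  have "transposed (2 ^ t) (2 ^ u) f =
      split_stage (2 ^ u) (2 ^ t * 2 ^ u) (2 ^ (0 + 1)) (twist (2 ^ u)) (zero_padded (2 ^ t) (2 ^ u) f)" for f
    by (simp add: split_zero_padded)
  then have "segment_product P (2 * 2 ^ t) (2 ^ u) 0 (sc + t + 1)
      (merge_stage (2 ^ u) (2 ^ t * 2 ^ u) (2 ^ (0 + 1)) (twist (2 ^ u)) (merge_stages t u c t))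
      (zero_padded (2 ^ t) (2 ^ u) a) (zero_padded (2 ^ t) (2 ^ u) b)"
    using segment_product_stages[OF assms(1) le_refl product] by (intro segment_product_merge[OF refl _ refl]) (simp_all add: mult.commute)
  then show "segment_product P (2 * 2 ^ t) (2 ^ u) 0 (sc + t + 1) (merge_stages t u c (Suc t))
      (zero_padded (2 ^ t) (2 ^ u) a) (zero_padded (2 ^ t) (2 ^ u) b)" by simp
qed simp_all

subsection \<open>The recursion\<close>

text \<open>A block of \<open>2 ^ k\<close> coefficients is split into blocks of \<open>2 ^ ((k + 1) div 2)\<close>.\<close>

fun log_size :: "nat \<Rightarrow> nat \<Rightarrow> nat" where
  "log_size k 0 = k"
| "log_size k (Suc i) = (log_size k i + 1) div 2"

definition split_level :: "nat \<Rightarrow> (nat \<Rightarrow> int) \<Rightarrow> nat \<Rightarrow> int" where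
  "split_level k f = split_stages (k div 2) ((k + 1) div 2) f (k div 2)"

definition merge_level :: "nat \<Rightarrow> (nat \<Rightarrow> int) \<Rightarrow> nat \<Rightarrow> int" where
  "merge_level k c = recombined (2 ^ (k div 2)) (2 ^ ((k + 1) div 2)) (merge_stages (k div 2) ((k + 1) div 2) c (Suc (k div 2)))"

fun split_levels :: "nat \<Rightarrow> (nat \<Rightarrow> int) \<Rightarrow> nat \<Rightarrow> nat \<Rightarrow> int" where
  "split_levels k f 0 = f"
| "split_levels k f (Suc i) = split_level (log_size k i) (split_levels k f i)"

fun merge_levels :: "nat \<Rightarrow> nat \<Rightarrow> (nat \<Rightarrow> int) \<Rightarrow> nat \<Rightarrow> nat \<Rightarrow> int" where
  "merge_levels k D c 0 = c"
| "merge_levels k D c (Suc j) = merge_level (log_size k (D - Suc j)) (merge_levels k D c j)"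

fun scale_exponent :: "nat \<Rightarrow> nat \<Rightarrow> nat \<Rightarrow> nat" where
  "scale_exponent k D 0 = 0"
| "scale_exponent k D (Suc j) = scale_exponent k D j + log_size k (D - Suc j) div 2 + 1"

fun block_count :: "nat \<Rightarrow> nat \<Rightarrow> nat \<Rightarrow> nat" where
  "block_count k P 0 = P"
| "block_count k P (Suc i) = block_count k P i * (2 * 2 ^ (log_size k i div 2))"

definition mult_pairs :: "(nat \<Rightarrow> int) \<Rightarrow> (nat \<Rightarrow> int) \<Rightarrow> nat \<Rightarrow> int" where
  "mult_pairs a b i = (if even i then a i * b i - a (i + 1) * b (i + 1) else a (i - 1) * b i + a i * b (i - 1))"

lemma negacyclic_product_pairs: "negacyclic_product P 2 0 (mult_pairs a b) a b"
  unfolding negacyclic_product_def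
proof (intro allI impI)
  fix p and x :: complex assume "x ^ 2 = -1"
  then have x: "x * x = -1" by (simp add: power2_eq_square)
  have poly: "poly_at g (p * 2) 2 x = of_int (g (p * 2)) + of_int (g (p * 2 + 1)) * x" for g
    by (simp add: poly_at_def numeral_2_eq_2)
  have gauss: "(a0 + a1 * x) * (b0 + b1 * x) = a0 * b0 - a1 * b1 + (a0 * b1 + a1 * b0) * x" for a0 a1 b0 b1
  proof -
    have "(a0 + a1 * x) * (b0 + b1 * x) = a0 * b0 + (a0 * b1 + a1 * b0) * x + a1 * b1 * (x * x)" by (simp add: algebra_simps)
    then show ?thesis using x by simp
  qed
  show "poly_at (mult_pairs a b) (p * 2) 2 x = 2 ^ 0 * poly_at a (p * 2) 2 x * poly_at b (p * 2) 2 x"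
    unfolding poly power_0 mult_1 gauss by (simp add: mult_pairs_def)
qed

lemma negacyclic_product_level:
  assumes "negacyclic_product (P * (2 * 2 ^ (k div 2))) (2 ^ ((k + 1) div 2)) sc c (split_level k a) (split_level k b)"
  shows "negacyclic_product P (2 ^ k) (sc + k div 2 + 1) (merge_level k c) a b"
proof -
  have "(2::nat) ^ k = 2 ^ (k div 2) * 2 ^ ((k + 1) div 2)" by (simp add: power_add[symmetric])
  then show ?thesis
    using assms negacyclic_product_stages[of "k div 2" "(k + 1) div 2" P sc c a b] by (simp add: split_level_def merge_level_def)
qed

definition recursive_product :: "nat \<Rightarrow> nat \<Rightarrow> (nat \<Rightarrow> int) \<Rightarrow> (nat \<Rightarrow> int) \<Rightarrow> nat \<Rightarrow> nat \<Rightarrow> int" where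
  "recursive_product k D a b = merge_levels k D (mult_pairs (split_levels k a D) (split_levels k b D))"

lemma negacyclic_product_levels:
  assumes "log_size k D = 1" "j \<le> D"
  shows "negacyclic_product (block_count k P (D - j)) (2 ^ log_size k (D - j)) (scale_exponent k D j)
     (recursive_product k D a b j) (split_levels k a (D - j)) (split_levels k b (D - j))"
  using assms(2)
proof (induction j)
  case 0
  then show ?case using negacyclic_product_pairs assms(1) by (simp add: recursive_product_def)
next
  case (Suc j)
  then have "D - j = Suc (D - Suc j)" by simp
  then have "negacyclic_product (block_count k P (D - Suc j)) (2 ^ log_size k (D - Suc j))
      (scale_exponent k D j + log_size k (D - Suc j) div 2 + 1)
      (merge_level (log_size k (D - Suc j)) (recursive_product k D a b j)) (split_levels k a (D - Suc j)) (split_levels k b (D - Suc j))"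
    using Suc by (intro negacyclic_product_level) simp
  then show ?case by (simp add: recursive_product_def)
qed

theorem negacyclic_product_recursive:
  assumes "log_size k D = 1"
  shows "negacyclic_product P (2 ^ k) (scale_exponent k D D) (recursive_product k D a b D) a b"
  using negacyclic_product_levels[OF assms le_refl] by simp

lemma coeff_negacyclic_product:
  assumes product: "negacyclic_product P n sc c a b" and p: "p < P" and n: "n = 2 * h" "0 < h"
    and a: "\<And>i. h \<le> i \<Longrightarrow> i < n \<Longrightarrow> a (p * n + i) = 0" and b: "\<And>i. h \<le> i \<Longrightarrow> i < n \<Longrightarrow> b (p * n + i) = 0"
    and i: "i < n"
  shows "c (p * n + i) = 2 ^ sc * (\<Sum>j\<le>i. a (p * n + j) * b (p * n + (i - j)))"
proof -
  define pol where "pol g = poly_of n (\<lambda>l. of_int (g (p * n + l)) :: complex)" for g :: "nat \<Rightarrow> int"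
  have eval: "poly (pol g) x = poly_at g (p * n) n x" for g x by (simp add: pol_def poly_poly_of poly_at_def)
  have low_degree: "degree (pol a) < h" "degree (pol b) < h"
    using n(2) a b by (auto intro!: degree_lessI simp: pol_def coeff_poly_of)
  have "pol c = smult (2 ^ sc) (pol a * pol b)"
  proof (rule poly_eqI_degree[where A = "{x. x ^ n = -1}"])
    show "poly (pol c) x = poly (smult (2 ^ sc) (pol a * pol b)) x" if "x \<in> {x. x ^ n = -1}" for x
      using product p that by (simp add: negacyclic_product_def eval mult.assoc)
    have card: "card {x::complex. x ^ n = -1} = n" using n by (simp add: card_nth_roots)
    show "degree (pol c) < card {x::complex. x ^ n = -1}"
      unfolding card pol_def using n by (intro degree_poly_of) simp
    show "degree (smult (2 ^ sc) (pol a * pol b)) < card {x::complex. x ^ n = -1}"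
      unfolding card using low_degree degree_mult_le[of "pol a" "pol b"] n by simp
  qed
  then have "coeff (pol c) i = 2 ^ sc * (\<Sum>j\<le>i. coeff (pol a) j * coeff (pol b) (i - j))" by (simp add: coeff_mult)
  also have "(\<Sum>j\<le>i. coeff (pol a) j * coeff (pol b) (i - j)) = (\<Sum>j\<le>i. of_int (a (p * n + j) * b (p * n + (i - j))))"
    using i by (intro sum.cong) (auto simp: pol_def coeff_poly_of)
  finally have "(of_int (c (p * n + i)) :: complex) = of_int (2 ^ sc * (\<Sum>j\<le>i. a (p * n + j) * b (p * n + (i - j))))"
    using i by (simp add: pol_def coeff_poly_of)
  then show ?thesis by (simp only: of_int_eq_iff)
qed

lemma log_size_eq: "log_size k i = (k + 2 ^ i - 1) div 2 ^ i"
proof (induction i)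
  case (Suc i)
  have "log_size k (Suc i) = ((k + 2 ^ i - 1) div 2 ^ i + 1) div 2" using Suc by simp
  also have "(k + 2 ^ i - 1) div 2 ^ i + 1 = (k + 2 ^ i - 1 + 2 ^ i) div 2 ^ i" by simp
  also have "k + 2 ^ i - 1 + 2 ^ i = k + 2 ^ Suc i - (1::nat)"
    using one_le_power[of "2::nat" i] by (simp del: one_le_power)
  also have "(k + 2 ^ Suc i - 1) div 2 ^ i div 2 = (k + 2 ^ Suc i - 1) div 2 ^ Suc i"
    by (simp only: div_mult2_eq[symmetric] power_Suc2)
  finally show ?case .
qed simp

lemma log_size_le: "log_size k i \<le> k"
  and log_size_ge_1: "1 \<le> k \<Longrightarrow> 1 \<le> log_size k i"
  by (induction i) auto

lemma log_size_eq_1: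
  assumes "1 \<le> k" "k \<le> 2 ^ D"
  shows "log_size k D = 1"
proof -
  have "log_size k D = (k - 1 + 2 ^ D) div 2 ^ D" unfolding log_size_eq using assms by simp
  also have "\<dots> = (k - 1) div 2 ^ D + 1" by simp
  also have "(k - 1) div 2 ^ D = 0" using assms by (simp add: div_eq_0_iff)
  finally show ?thesis by simp
qed

lemma scale_exponent_eq: "j \<le> D \<Longrightarrow> scale_exponent k D j + log_size k D = log_size k (D - j) + j"
proof (induction j)
  case (Suc j)
  then have "D - j = Suc (D - Suc j)" by simp
  then have "log_size k (D - j) = (log_size k (D - Suc j) + 1) div 2" by simp
  then show ?case using Suc by simp
qed simp

lemma block_count_eq: "block_count k P i * 2 ^ log_size k i = P * 2 ^ k * 2 ^ i"
proof (induction i)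
  case (Suc i)
  have "(2::nat) ^ log_size k i = 2 ^ (log_size k i div 2) * 2 ^ log_size k (Suc i)" by (simp add: power_add[symmetric])
  then show ?case using Suc by (simp add: algebra_simps)
qed simp

section \<open>A program for negacyclic convolution\<close>

abbreviation (input) "kV \<equiv> 33 :: nat"
abbreviation (input) "NV \<equiv> 34 :: nat"
abbreviation (input) "levelV \<equiv> 37 :: nat"
abbreviation (input) "depthV \<equiv> 38 :: nat"
abbreviation (input) "depth_powV \<equiv> 39 :: nat"
abbreviation (input) "scaleV \<equiv> 40 :: nat"
abbreviation (input) "cur_kV \<equiv> 41 :: nat"
abbreviation (input) "cur_NV \<equiv> 42 :: nat"
abbreviation (input) "tV \<equiv> 43 :: nat"
abbreviation (input) "mV \<equiv> 44 :: nat"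
abbreviation (input) "rV \<equiv> 45 :: nat"
abbreviation (input) "stagesV \<equiv> 46 :: nat"
abbreviation (input) "stageV \<equiv> 47 :: nat"
abbreviation (input) "HV \<equiv> 48 :: nat"
abbreviation (input) "GV \<equiv> 49 :: nat"
abbreviation (input) "tableV \<equiv> 50 :: nat"
abbreviation (input) "entryV \<equiv> 51 :: nat"

abbreviation (input) "leftA \<equiv> 8 :: nat"
abbreviation (input) "rightA \<equiv> 9 :: nat"
abbreviation (input) "twistA \<equiv> 11 :: nat"
abbreviation (input) "levelsA \<equiv> 12 :: nat"

definition transposed_expr :: "nat \<Rightarrow> expr" where
  "transposed_expr a = Arr a (ix [div] (Cst 2 [*] (Var mV [*] Var rV)) [*] (Var mV [*] Var rV) [+]
     ix [mod] Var rV [*] Var mV [+] ix [mod] (Var mV [*] Var rV) [div] Var rV)"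

definition segment_expr :: expr where
  "segment_expr = ix [div] (Cst 2 [*] Var HV) [*] (Cst 2 [*] Var HV)"

definition row_expr :: expr where
  "row_expr = ix [mod] Var HV [div] Var rV [*] Var rV"

definition split_turn_expr :: expr where
  "split_turn_expr = (ix [mod] Var rV [+] Cst 2 [*] Var rV [-] Arr twistA (Var GV [+] ix [div] Var HV [mod] Var GV))
     [mod] (Cst 2 [*] Var rV)"

definition split_expr :: "nat \<Rightarrow> expr" where
  "split_expr a = (let low = Arr a (segment_expr [+] ix [mod] Var HV); row = segment_expr [+] Var HV [+] row_expr in
     Ite split_turn_expr (Var rV) (Modular Add low (Arr a (row [+] split_turn_expr)))
       (Modular Sub low (Arr a (row [+] (split_turn_expr [-] Var rV)))))"

definition merge_turn_expr :: expr where
  "merge_turn_expr = (ix [mod] Var rV [+] Arr twistA (Var GV [+] Cst 2 [*] (ix [div] (Cst 2 [*] Var HV)) [mod] Var GV))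
     [mod] (Cst 2 [*] Var rV)"

definition merge_expr :: "nat \<Rightarrow> expr" where
  "merge_expr a = (let row = segment_expr [+] row_expr; p = row [+] merge_turn_expr; q = row [+] (merge_turn_expr [-] Var rV) in
     Ite (ix [mod] (Cst 2 [*] Var HV)) (Var HV) (Modular Add (Arr a ix) (Arr a (ix [+] Var HV)))
       (Ite merge_turn_expr (Var rV) (Modular Sub (Arr a p) (Arr a (p [+] Var HV))) (Modular Sub (Arr a (q [+] Var HV)) (Arr a q))))"

definition recombined_expr :: "nat \<Rightarrow> expr" where
  "recombined_expr a = (let n = Var mV [*] Var rV; st = ix [div] n [*] (Cst 2 [*] n); l = ix [mod] n [div] Var mV; j = ix [mod] Var mV;
     turn = (l [+] Cst 2 [*] Var rV [-] Cst 1) [mod] (Cst 2 [*] Var rV); low = Arr a (st [+] j [*] Var rV [+] l);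
     row = st [+] (Var mV [+] j) [*] Var rV in
     Ite turn (Var rV) (Modular Add low (Arr a (row [+] turn))) (Modular Sub low (Arr a (row [+] (turn [-] Var rV)))))"

definition mult_pairs_expr :: expr where
  "mult_pairs_expr = Ite (ix [mod] Cst 2) (Cst 1)
     (Modular Sub (Modular Mul (Arr leftA ix) (Arr rightA ix)) (Modular Mul (Arr leftA (ix [+] Cst 1)) (Arr rightA (ix [+] Cst 1))))
     (Modular Add (Modular Mul (Arr leftA (ix [-] Cst 1)) (Arr rightA ix)) (Modular Mul (Arr leftA ix) (Arr rightA (ix [-] Cst 1))))"

lemmas convolution_expr_defs = transposed_expr_def split_expr_def merge_expr_def recombined_expr_def mult_pairs_expr_def
  segment_expr_def row_expr_def split_turn_expr_def merge_turn_expr_def Let_def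

lemma transposed_expr_static: "cost (transposed_expr a) \<le> 400 \<and> arrays (transposed_expr a) \<subseteq> {a, twistA}"
  and split_expr_static: "cost (split_expr a) \<le> 400 \<and> arrays (split_expr a) \<subseteq> {a, twistA}"
  and merge_expr_static: "cost (merge_expr a) \<le> 400 \<and> arrays (merge_expr a) \<subseteq> {a, twistA}"
  and recombined_expr_static: "cost (recombined_expr a) \<le> 400 \<and> arrays (recombined_expr a) \<subseteq> {a, twistA}"
  and mult_pairs_expr_static: "cost mult_pairs_expr \<le> 400 \<and> arrays mult_pairs_expr \<subseteq> {leftA, rightA}"
  by (auto simp: convolution_expr_defs)

subsection \<open>Entries of the transformed arrays\<close>

lemma segment_bounds:
  fixes i N H r h :: nat
  assumes "i < N" "2 * H dvd N" "H = h * r" "0 < H"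
  shows "i div (2*H) * (2*H) + 2 * H \<le> N" "i mod H < H" "i mod H div r * r + r \<le> H" "0 < r"
proof -
  obtain q where q: "N = 2 * H * q" using assms(2) by blast
  have "i div (2*H) < q" using assms(1,4) q by (simp add: less_mult_imp_div_less mult.commute)
  then have "(i div (2*H) + 1) * (2*H) \<le> q * (2*H)" by (intro mult_right_mono) auto
  then show "i div (2*H) * (2*H) + 2 * H \<le> N" using q by (simp add: mult_ac)
  show "i mod H < H" using assms(4) by simp
  show "0 < r" using assms(3,4) by (cases r) auto
  have "i mod H div r < h" using assms(3,4) \<open>i mod H < H\<close> by (simp add: less_mult_imp_div_less)
  then have "(i mod H div r + 1) * r \<le> h * r" by (intro mult_right_mono) auto
  then show "i mod H div r * r + r \<le> H" using assms(3) by simp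
qed

context ram
begin

definition word :: "int \<Rightarrow> nat" where
  "word x = nat (x mod 2 ^ w)"

definition represents :: "nat \<Rightarrow> (nat \<Rightarrow> nat) \<Rightarrow> (nat \<Rightarrow> int) \<Rightarrow> bool" where
  "represents N X f \<longleftrightarrow> (\<forall>i<N. X i = word (f i))"

lemma represents_at: "represents N X f \<Longrightarrow> i < N \<Longrightarrow> X i = word (f i)"
  by (simp add: represents_def)

lemma word_nat: "x < 2 ^ w \<Longrightarrow> word (int x) = x"
  unfolding word_def by (metis mod_less nat_int of_nat_mod of_nat_numeral of_nat_power)

lemma binop_val_word:
  "binop_val w Add (word a) (word b) = word (a + b)"
  "binop_val w Sub (word a) (word b) = word (a - b)"
  "binop_val w Mul (word a) (word b) = word (a * b)"
  by (auto simp: word_def nat_mod_as_int mod_simps nat_add_distrib[symmetric] nat_mult_distrib[symmetric])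

definition entry :: "astate \<Rightarrow> nat \<Rightarrow> expr \<Rightarrow> int \<Rightarrow> bool" where
  "entry sg i e x \<longleftrightarrow> safe (set_var iV i sg) e \<and> ev (set_var iV i sg) e = word x"

lemma entry_transposed:
  assumes "var sg mV = m" "var sg rV = r" "represents N (arr sg a) f" "m * r dvd N" "0 < m" "0 < r" "2 * N \<le> S" "a < 30" "i < 2 * N"
  shows "entry sg i (transposed_expr a) (transposed m r f i)"
proof -
  let ?j = "i div (2*(m*r)) * (m*r) + i mod r * m + i mod (m*r) div r"
  have pos: "0 < m * r" using assms by simp
  have "2 * (m * r) dvd 2 * N" using assms(4) by (metis dvd_refl mult_dvd_mono)
  then have "i div (2*(m*r)) * (2*(m*r)) + 2 * (m*r) \<le> 2 * N"
    using segment_bounds(1)[OF assms(9) _ refl pos] by blast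
  moreover have "i mod r * m + i mod (m*r) div r < r * m"
    using pos assms(6) by (intro block_index_less) (simp_all add: less_mult_imp_div_less)
  moreover have "i div (2*(m*r)) * (2*(m*r)) = 2 * (i div (2*(m*r)) * (m*r))" by simp
  ultimately have "?j < N" by (simp add: mult.commute[of r])
  moreover from this have "?j < S" using assms by linarith
  ultimately show ?thesis using assms by (simp add: entry_def transposed_expr_def represents_at transposed_def)
qed

definition stage_state :: "nat \<Rightarrow> nat \<Rightarrow> nat \<Rightarrow> astate \<Rightarrow> bool" where
  "stage_state r H G sg \<longleftrightarrow> var sg rV = r \<and> var sg HV = H \<and> var sg GV = G \<and> (\<forall>v<2 * G. arr sg twistA v = twist r v)"

context
  fixes r h H G N a i :: nat and sg :: astate and f :: "nat \<Rightarrow> int"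
  assumes state: "stage_state r H G sg" and f: "represents N (arr sg a) f"
    and dims: "2 * H dvd N" "H = h * r" "0 < H" "0 < G" and bounds: "N \<le> S" "2 * G \<le> S" "2 * r \<le> S" "a < 30" and i: "i < N"
begin

lemma segment_expr:
  "ev (set_var iV i sg) segment_expr = i div (2*H) * (2*H)" "safe (set_var iV i sg) segment_expr"
  "small (set_var iV i sg) segment_expr" "mag segment_expr = 3"
  using state by (simp_all add: segment_expr_def stage_state_def)

lemma row_expr:
  "ev (set_var iV i sg) row_expr = i mod H div r * r" "safe (set_var iV i sg) row_expr"
  "small (set_var iV i sg) row_expr" "mag row_expr = 2"
  using state by (simp_all add: row_expr_def stage_state_def)

lemma entry_split: "entry sg i (split_expr a) (split_stage r H G (twist r) f i)"
proof -
  note bds = segment_bounds[OF i dims(1-3)]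
  let ?low = "i div (2*H) * (2*H) + i mod H" and ?row = "i div (2*H) * (2*H) + H + i mod H div r * r"
  define turn where "turn = (i mod r + 2 * r - twist r (G + i div H mod G)) mod (2 * r)"
  have G: "G + i div H mod G < 2 * G" "G + i div H mod G < S"
    using mod_less_divisor[OF dims(4), of "i div H"] bounds(2) by linarith+
  have turn_expr: "ev (set_var iV i sg) split_turn_expr = turn" "safe (set_var iV i sg) split_turn_expr"
    "small (set_var iV i sg) split_turn_expr" "mag split_turn_expr = 3"
    using state G bounds(3) twist_le[of r "G + i div H mod G"] by (simp_all add: stage_state_def split_turn_expr_def turn_def)
  have turn: "turn < 2 * r" using bds(4) by (simp add: turn_def)
  have low: "?low < N" using bds by linarith
  have row: "?row + l < N" if "l < r" for l using bds(1,3) that by linarith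
  have val: "split_stage r H G (twist r) f i = f ?low + (if turn < r then f (?row + turn) else - f (?row + (turn - r)))"
    by (simp add: split_stage_def sign_ext_def turn_def)
  note exprs = segment_expr row_expr turn_expr
  show ?thesis
  proof (cases "turn < r")
    case True
    then show ?thesis
      using exprs state low row[OF True] bounds
      by (simp add: entry_def split_expr_def Let_def stage_state_def val binop_val_word represents_at[OF f] del: binop_val.simps)
  next
    case False
    then have wrapped: "turn - r < r" using turn by linarith
    show ?thesis
      using exprs state low row[OF wrapped] bounds False
      by (simp add: entry_def split_expr_def Let_def stage_state_def val binop_val_word represents_at[OF f] del: binop_val.simps)
  qed
qed

lemma entry_merge: "entry sg i (merge_expr a) (merge_stage r H G (twist r) f i)"
proof (cases "i mod (2*H) < H")
  case True
  have "i = i div (2*H) * (2*H) + i mod (2*H)" by (rule div_mult_mod_eq[symmetric])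
  then have "i + H < N" using True segment_bounds(1)[OF i dims(1-3)] by linarith
  then show ?thesis using True state i bounds
    by (simp add: entry_def merge_expr_def Let_def stage_state_def merge_stage_def binop_val_word represents_at[OF f] del: binop_val.simps)
next
  case high: False
  note bds = segment_bounds[OF i dims(1-3)]
  let ?row = "i div (2*H) * (2*H) + i mod H div r * r"
  define turn where "turn = (i mod r + twist r (G + 2 * (i div (2*H)) mod G)) mod (2 * r)"
  have G: "G + 2 * (i div (2*H)) mod G < 2 * G" "G + 2 * (i div (2*H)) mod G < S"
    using mod_less_divisor[OF dims(4), of "2 * (i div (2*H))"] bounds(2) by linarith+
  have turn_expr: "ev (set_var iV i sg) merge_turn_expr = turn" "safe (set_var iV i sg) merge_turn_expr"
    "small (set_var iV i sg) merge_turn_expr" "mag merge_turn_expr = 2"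
    using state G bounds(3) twist_le[of r "G + 2 * (i div (2*H)) mod G"] by (simp_all add: stage_state_def merge_turn_expr_def turn_def)
  have turn: "turn < 2 * r" using bds(4) by (simp add: turn_def)
  have row: "?row + l + H < N" if "l < r" for l using bds(1,3) that by linarith
  have val: "merge_stage r H G (twist r) f i = (if turn < r then f (?row + turn) - f (?row + turn + H)
      else f (?row + (turn - r) + H) - f (?row + (turn - r)))"
    using high by (simp add: merge_stage_def sign_ext_def turn_def)
  note exprs = segment_expr row_expr turn_expr
  show ?thesis
  proof (cases "turn < r")
    case True
    then show ?thesis using exprs state high row[OF True] bounds
      by (simp add: entry_def merge_expr_def Let_def stage_state_def val binop_val_word represents_at[OF f] del: binop_val.simps)
  next
    case False
    then have wrapped: "turn - r < r" using turn by linarith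
    show ?thesis using exprs state high row[OF wrapped] bounds False
      by (simp add: entry_def merge_expr_def Let_def stage_state_def val binop_val_word represents_at[OF f] del: binop_val.simps)
  qed
qed

end

lemma entry_recombined:
  assumes regs: "var sg mV = m" "var sg rV = r" and f: "represents (2 * N) (arr sg a) f" and N: "m * r dvd N" and pos: "0 < m" "0 < r"
    and bounds: "2 * N \<le> S" "2 * r \<le> S" "a < 30" and i: "i < N"
  shows "entry sg i (recombined_expr a) (recombined m r f i)"
proof -
  obtain q where q: "N = m * r * q" using N by blast
  have n: "0 < m * r" using pos by simp
  let ?st = "i div (m*r) * (2 * (m*r))"
  have "i div (m*r) < q" using i q by (simp add: less_mult_imp_div_less mult.commute)
  then have "(i div (m*r) + 1) * (2 * (m*r)) \<le> q * (2 * (m*r))" by (intro mult_right_mono) auto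
  then have st: "?st + 2 * (m*r) \<le> 2 * N" using q by (simp add: algebra_simps)
  define l j where "l = i mod (m*r) div m" and "j = i mod m"
  have l: "l < r" unfolding l_def using n by (intro less_mult_imp_div_less) (simp add: mult.commute)
  have j: "j < m" using pos by (simp add: j_def)
  have low: "?st + j * r + l < 2 * N" using block_index_less[OF j l] st by linarith
  have high: "?st + (m + j) * r + l' < 2 * N" if "l' < r" for l'
    using block_index_less[OF j that] st by (simp add: distrib_right)
  define turn where "turn = (l + 2 * r - 1) mod (2 * r)"
  have turn: "turn < 2 * r" "(l + 2 * r - Suc 0) mod (2 * r) = turn" using pos by (simp_all add: turn_def)
  have val: "recombined m r f i = f (?st + j * r + l) +
      (if turn < r then f (?st + (m + j) * r + turn) else - f (?st + (m + j) * r + (turn - r)))"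
    by (simp add: recombined_def sign_ext_def turn_def l_def j_def)
  have ge: "1 \<le> l + 2 * r" using pos by simp
  note defs = l_def[symmetric] j_def[symmetric] turn(2)
  show ?thesis
  proof (cases "turn < r")
    case True
    then show ?thesis using regs low high[OF True] bounds ge
      by (simp add: entry_def recombined_expr_def Let_def val binop_val_word represents_at[OF f] defs del: binop_val.simps)
  next
    case False
    then have wrapped: "turn - r < r" using turn by linarith
    show ?thesis using regs low high[OF wrapped] bounds ge False
      by (simp add: entry_def recombined_expr_def Let_def val binop_val_word represents_at[OF f] defs del: binop_val.simps)
  qed
qed

lemma entry_mult_pairs:
  assumes f: "represents N (arr sg leftA) f" and g: "represents N (arr sg rightA) g" and N: "even N" "N < S" "i < N"
  shows "entry sg i mult_pairs_expr (mult_pairs f g i)"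
proof (cases "even i")
  case True
  then have "i + 1 < N" using N by (metis Suc_eq_plus1 Suc_lessI even_Suc)
  then show ?thesis using True N
    by (simp add: entry_def mult_pairs_expr_def mult_pairs_def even_iff_mod_2_eq_zero binop_val_word represents_at[OF f] represents_at[OF g]
        del: binop_val.simps)
next
  case False
  then have "1 \<le> i" "i mod 2 = 1" by presburger+
  then show ?thesis using False N
    by (simp add: entry_def mult_pairs_expr_def mult_pairs_def binop_val_word represents_at[OF f] represents_at[OF g] del: binop_val.simps)
qed

end

subsection \<open>The program\<close>

definition twist_expr :: expr where
  "twist_expr = Ite (Var entryV) (Cst 2) (Cst 0)
     (Arr twistA (Var entryV [div] Cst 2) [div] Cst 2 [+] Var entryV [mod] Cst 2 [*] Var rV)"

definition level_params :: "stmt list" where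
  "level_params = [tV ::= Var cur_kV [div] Cst 2, mV ::= Pow2 (Var tV),
     rV ::= Pow2 ((Var cur_kV [+] Cst 1) [div] Cst 2), tableV ::= Cst 4 [*] Var mV]"

definition params_code :: com where
  "params_code = block level_params ;; for_loop entryV tableV (block [twistA\<lbrakk>Var entryV\<rbrakk> ::= twist_expr])"

definition both_code :: "(nat \<Rightarrow> expr) \<Rightarrow> com" where
  "both_code e = update_loop leftA cur_NV (e leftA) ;; update_loop rightA cur_NV (e rightA)"

definition transpose_code :: com where
  "transpose_code = block [cur_NV ::= Cst 2 [*] Var cur_NV] ;; both_code transposed_expr ;;
     block [HV ::= Var mV [*] Var rV, GV ::= Cst 2]"

definition split_stages_code :: com where
  "split_stages_code = for_loop stageV tV
     (block [HV ::= Var HV [div] Cst 2, GV ::= Cst 2 [*] Var GV] ;; both_code split_expr)"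

definition split_level_code :: com where
  "split_level_code = block [levelsA\<lbrakk>Var levelV\<rbrakk> ::= Var cur_kV] ;; params_code ;;
     transpose_code ;; split_stages_code ;; block [cur_kV ::= (Var cur_kV [+] Cst 1) [div] Cst 2]"

definition merge_stages_code :: com where
  "merge_stages_code = for_loop stageV stagesV
     (update_loop leftA cur_NV (merge_expr leftA) ;; block [HV ::= Cst 2 [*] Var HV, GV ::= Var GV [div] Cst 2])"

definition merge_level_code :: com where
  "merge_level_code = block [cur_kV ::= Arr levelsA (Var depthV [-] (Var levelV [+] Cst 1))] ;; params_code ;;
     block [HV ::= Var rV, GV ::= Cst 2 [*] Var mV, stagesV ::= Var tV [+] Cst 1] ;; merge_stages_code ;;
     block [scaleV ::= Var scaleV [+] Var stagesV, cur_NV ::= Var cur_NV [div] Cst 2] ;;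
     update_loop leftA cur_NV (recombined_expr leftA)"

definition depth_code :: com where
  "depth_code = block [depthV ::= Cst 0, depth_powV ::= Cst 1] ;;
     for_loop levelV kV (block [depthV ::= Ite (Var depth_powV) (Var kV) (Var depthV [+] Cst 1) (Var depthV),
       depth_powV ::= Ite (Var depth_powV) (Var kV) (Cst 2 [*] Var depth_powV) (Var depth_powV)])"

definition leaf_products_code :: com where
  "leaf_products_code = update_loop leftA cur_NV mult_pairs_expr ;; block [scaleV ::= Cst 0]"

definition convolution_code :: com where
  "convolution_code = depth_code ;; block [cur_kV ::= Var kV, cur_NV ::= Var NV] ;;
     for_loop levelV depthV split_level_code ;; leaf_products_code ;; for_loop levelV depthV merge_level_code"

definition mult_time :: "nat \<Rightarrow> nat \<Rightarrow> nat" where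
  "mult_time k N = (k + 2) ^ 3 * (N + 2 ^ k + 1)"

context ram
begin

definition params_set :: "nat \<Rightarrow> astate \<Rightarrow> bool" where
  "params_set k sg \<longleftrightarrow> var sg tV = k div 2 \<and> var sg mV = 2 ^ (k div 2) \<and> var sg rV = 2 ^ ((k + 1) div 2) \<and>
     (\<forall>v<4 * 2 ^ (k div 2). arr sg twistA v = twist (2 ^ ((k + 1) div 2)) v)"

lemma halved_powers:
  fixes k :: nat
  assumes "1 \<le> k"
  shows "2 ^ (k div 2) * 2 ^ ((k + 1) div 2) = (2::nat) ^ k" "2 ^ (k div 2) \<le> (2::nat) ^ k" "2 ^ ((k + 1) div 2) \<le> (2::nat) ^ k"
  using assms by (auto simp: power_add[symmetric] intro!: power_increasing)

lemma computes_twist_table: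
  assumes r: "var sg rV = r" "2 * r \<le> S" and n: "var sg tableV = n" "n \<le> S"
  shows "computes (for_loop entryV tableV (block [twistA\<lbrakk>Var entryV\<rbrakk> ::= twist_expr])) (29 * n + 4) 51 {twistA} sg
    (\<lambda>sg'. \<forall>v<n. arr sg' twistA v = twist r v)"
proof -
  have "computes (for_loop entryV tableV (block [twistA\<lbrakk>Var entryV\<rbrakk> ::= twist_expr])) (n * (23 + 6) + 4) 51 {twistA} sg
    (\<lambda>sg'. (\<forall>v<n. arr sg' twistA v = twist r v) \<and> var sg' entryV = n \<and> var sg' tableV = n)"
  proof (rule computes_for[where b' = 52 and Y' = "{twistA}" and I = "\<lambda>i sg'. \<forall>v<i. arr sg' twistA v = twist r v"])
    fix i sg1 assume i: "i < n" and fr: "frame 51 {twistA} sg sg1" and I: "\<forall>v<i. arr sg1 twistA v = twist r v"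
      and v: "var sg1 entryV = i"
    have "var sg1 rV = r" using fr r by (simp add: frame_var)
    then have "ev sg1 twist_expr = twist r i" using v I by (subst twist.simps) (auto simp: twist_expr_def)
    moreover have "safe sg1 twist_expr"
      using i n(2) v I r(2) twist_le[of r "i div 2"] by (auto simp: twist_expr_def)
    ultimately show "computes (block [twistA\<lbrakk>Var entryV\<rbrakk> ::= twist_expr]) 23 52 {twistA} sg1
        (\<lambda>sg2. \<forall>v<Suc i. arr (set_var entryV (Suc i) sg2) twistA v = twist r v)"
      using i n(2) v I by (intro computes_block) (auto simp: block_cost_def less_Suc_eq, simp add: twist_expr_def)
  qed (use n in auto)
  then show ?thesis by (rule computes_mono) (simp_all add: mult.commute)
qed

lemma computes_params:
  assumes k: "var sg cur_kV = k" "1 \<le> k" and S: "8 * 2 ^ k \<le> S"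
  shows "computes params_code (300 * 2 ^ k) 43 {twistA} sg (params_set k)"
proof -
  let ?m = "2 ^ (k div 2) :: nat" and ?r = "2 ^ ((k + 1) div 2) :: nat"
  note bds = halved_powers(2,3)[OF k(2)]
  have init_bounds: "k div 2 \<le> S" "?m \<le> S" "2 * ?r \<le> S" "4 * ?m \<le> S" using less_exp[of k] bds S by linarith+
  obtain sg1 where init: "run (block level_params) 25 sg sg1" "arr sg1 = arr sg"
    "var sg1 = (var sg)(tV := k div 2, mV := ?m, rV := ?r, tableV := 4 * ?m)"
    by (rule that[OF run_block[of sg level_params 25]]) (use k init_bounds in \<open>simp_all add: level_params_def block_cost_def\<close>)
  obtain sg2 where table: "run (for_loop entryV tableV (block [twistA\<lbrakk>Var entryV\<rbrakk> ::= twist_expr])) (29 * (4 * ?m) + 4) sg1 sg2"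
    "frame 51 {twistA} sg1 sg2" "\<forall>v<4 * ?m. arr sg2 twistA v = twist ?r v"
    by (rule computesE[OF computes_twist_table[of sg1 ?r "4 * ?m"]]) (use init_bounds init in auto)
  have "1 \<le> (2::nat) ^ k" by simp
  then have "25 + (29 * (4 * ?m) + 4) \<le> 300 * 2 ^ k" using bds(1) by linarith
  then show ?thesis unfolding params_code_def
    by (intro computesI[OF run_Seq[OF init(1) table(1)]]) (use init table in \<open>auto simp: frame_def params_set_def\<close>)
qed

definition operands :: "nat \<Rightarrow> (nat \<Rightarrow> int) \<Rightarrow> (nat \<Rightarrow> int) \<Rightarrow> astate \<Rightarrow> bool" where
  "operands N f g sg \<longleftrightarrow> represents N (arr sg leftA) f \<and> represents N (arr sg rightA) g"

lemma entry_frame: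
  assumes "frame 59 Y sg sg'" "Y \<inter> arrays e = {}" "entry sg i e x"
  shows "entry sg' i e x"
proof -
  have "var (set_var iV i sg') v = var (set_var iV i sg) v" if "v < 60" for v
    using that frame_var[OF assms(1), of v] by (cases "v = iV") auto
  moreover have "arr (set_var iV i sg') a = arr (set_var iV i sg) a" if "a \<in> arrays e" for a
    using that frame_arr[OF assms(1)] assms(2) by auto
  ultimately show ?thesis using assms(3) unfolding entry_def by (metis ev_cong(1,3))
qed

lemma computes_both:
  assumes N: "var sg cur_NV = N" "N \<le> S" and static: "\<And>a. cost (e a) \<le> 400 \<and> arrays (e a) \<subseteq> {a, twistA}"
    and left: "\<And>i. i < N \<Longrightarrow> entry sg i (e leftA) (f i)" and right: "\<And>i. i < N \<Longrightarrow> entry sg i (e rightA) (g i)"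
  shows "computes (both_code e) (2000 * (N + 1)) 59 {leftA, rightA, scratchA} sg (operands N f g)"
proof -
  obtain sg1 where step_left: "run (update_loop leftA cur_NV (e leftA)) (1000 * (N + 1)) sg sg1" "frame 59 {leftA, scratchA} sg sg1"
    "\<forall>i. arr sg1 leftA i = (if i < N then ev (set_var iV i sg) (e leftA) else arr sg leftA i)"
    by (rule computesE[OF computes_update[of cur_NV sg N leftA "e leftA"]]) (use N static[of leftA] left in \<open>auto simp: entry_def\<close>)
  have right': "entry sg1 i (e rightA) (g i)" if "i < N" for i
    by (rule entry_frame[OF step_left(2) _ right[OF that]]) (use static[of rightA] in auto)
  obtain sg2 where step_right: "run (update_loop rightA cur_NV (e rightA)) (1000 * (N + 1)) sg1 sg2" "frame 59 {rightA, scratchA} sg1 sg2"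
    "\<forall>i. arr sg2 rightA i = (if i < N then ev (set_var iV i sg1) (e rightA) else arr sg1 rightA i)"
    by (rule computesE[OF computes_update[of cur_NV sg1 N rightA "e rightA"]])
       (use N static[of rightA] right' frame_var[OF step_left(2)] in \<open>auto simp: entry_def\<close>)
  have "operands N f g sg2"
    using left right' step_left(3) step_right(3) frame_arr[OF step_right(2), of leftA] by (auto simp: operands_def represents_def entry_def)
  then show ?thesis unfolding both_code_def
    by (intro computesI[OF run_Seq[OF step_left(1) step_right(1)]]) (use step_left(2) step_right(2) in \<open>auto simp: frame_def\<close>)
qed

lemma params_set_frame: "params_set k sg \<Longrightarrow> frame 46 Y sg sg' \<Longrightarrow> twistA \<notin> Y \<Longrightarrow> params_set k sg'"
  by (simp add: params_set_def frame_def)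

definition split_inv :: "nat \<Rightarrow> nat \<Rightarrow> (nat \<Rightarrow> int) \<Rightarrow> (nat \<Rightarrow> int) \<Rightarrow> nat \<Rightarrow> astate \<Rightarrow> bool" where
  "split_inv k N f g q sg \<longleftrightarrow> params_set k sg \<and> var sg cur_NV = 2 * N \<and>
     var sg HV = 2 ^ (k div 2 - q) * 2 ^ ((k + 1) div 2) \<and> var sg GV = 2 ^ (q + 1) \<and>
     operands (2 * N) (split_stages (k div 2) ((k + 1) div 2) f q) (split_stages (k div 2) ((k + 1) div 2) g q) sg"

lemma computes_split_stage:
  fixes k :: nat
  defines "t \<equiv> k div 2" and "u \<equiv> (k + 1) div 2"
  assumes inv: "split_inv k N f g q sg" and q: "q < t" and k: "1 \<le> k" "8 * 2 ^ k \<le> S" and N: "2 ^ k dvd N" "2 * N \<le> S"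
  shows "computes (block [HV ::= Var HV [div] Cst 2, GV ::= Cst 2 [*] Var GV] ;; both_code split_expr) (2020 + 4000 * N)
    48 {leftA, rightA, scratchA} sg (split_inv k N f g (Suc q))"
proof -
  let ?H = "2 ^ (t - Suc q) * 2 ^ u :: nat"
  have tu: "2 ^ t * 2 ^ u = (2::nat) ^ k" unfolding t_def u_def by (rule halved_powers(1)[OF k(1)])
  note powers = halved_powers(2,3)[OF k(1), folded t_def u_def]
  have "t - q = Suc (t - Suc q)" using q by simp
  then have halve: "2 ^ (t - q) * 2 ^ u = 2 * ?H" by simp
  have "2 * ?H \<le> 2 ^ t * 2 ^ u" unfolding halve[symmetric] by (intro mult_right_mono power_increasing) auto
  moreover have G: "2 ^ (q + 2) \<le> 2 * (2::nat) ^ t"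
    using power_increasing[of "q + 2" "t + 1" "2::nat"] q by simp
  ultimately have bounds: "?H \<le> S" "2 ^ (q + 2) \<le> S" "2 * 2 ^ (q + 2) \<le> S" "2 * 2 ^ u \<le> S"
    using tu k(2) powers by linarith+
  obtain sg1 where halving: "run (block [HV ::= Var HV [div] Cst 2, GV ::= Cst 2 [*] Var GV]) 9 sg sg1"
    "var sg1 = (var sg)(HV := ?H, GV := 2 ^ (q + 2))" "arr sg1 = arr sg"
    by (rule that[OF run_block]) (use inv halve bounds in \<open>simp_all add: block_cost_def split_inv_def t_def u_def\<close>)
  have state: "stage_state (2 ^ u) ?H (2 ^ (q + 2)) sg1"
    using inv halving(2,3) G unfolding stage_state_def split_inv_def params_set_def t_def u_def by auto
  have "2 * ?H dvd 2 ^ t * 2 ^ u" unfolding halve[symmetric] by (intro mult_dvd_mono le_imp_power_dvd) auto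
  then have dvd: "2 * ?H dvd 2 * N" using N(1) tu dvd_trans dvd_mult by metis
  have "entry sg1 i (split_expr a) (split_stages t u h (Suc q) i)"
    if "represents (2 * N) (arr sg1 a) (split_stages t u h q)" "i < 2 * N" "a < 30" for i a h
    unfolding split_stages.simps
    by (rule entry_split[OF state that(1) dvd refl _ _ N(2) bounds(3,4) that(3,2)]) auto
  then have entries: "entry sg1 i (split_expr leftA) (split_stages t u f (Suc q) i)"
    "entry sg1 i (split_expr rightA) (split_stages t u g (Suc q) i)" if "i < 2 * N" for i
    using inv halving(3) that unfolding split_inv_def operands_def t_def u_def by simp_all
  have "var sg1 cur_NV = 2 * N" using inv halving(2) by (simp add: split_inv_def)
  then obtain sg2 where both: "run (both_code split_expr) (2000 * (2 * N + 1)) sg1 sg2" "frame 59 {leftA, rightA, scratchA} sg1 sg2"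
    "operands (2 * N) (split_stages t u f (Suc q)) (split_stages t u g (Suc q)) sg2"
    by (rule computesE[OF computes_both[where e = split_expr, OF _ N(2) split_expr_static entries]])
  have fr: "frame 48 {leftA, rightA, scratchA} sg sg2" using halving both(2) by (auto simp: frame_def)
  have "params_set k sg2" using inv by (intro params_set_frame[OF _ frame_mono[OF fr _ order_refl]]) (auto simp: split_inv_def)
  then have "split_inv k N f g (Suc q) sg2"
    using inv halving(2) both(2,3) frame_var[OF fr] unfolding split_inv_def t_def u_def by (simp add: frame_var)
  then show ?thesis by (intro computesI[OF run_Seq[OF halving(1) both(1)] _ fr]) auto
qed

lemma computes_split_stages:
  assumes inv: "split_inv k N f g 0 sg" and k: "1 \<le> k" "8 * 2 ^ k \<le> S" and N: "2 ^ k dvd N" "2 * N \<le> S"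
  shows "computes split_stages_code (k * (5000 * (N + 1))) 47 {leftA, rightA, scratchA} sg
    (operands (2 * N) (split_level k f) (split_level k g))"
proof -
  let ?t = "k div 2" and ?Y = "{leftA, rightA, scratchA}"
  have "?t \<le> S" using less_exp[of k] k(2) by linarith
  then have "computes split_stages_code (?t * ((2020 + 4000 * N) + 6) + 4) 47 ?Y sg
      (\<lambda>sg'. split_inv k N f g ?t sg' \<and> var sg' stageV = ?t \<and> var sg' tV = ?t)"
    unfolding split_stages_code_def
  proof (intro computes_for[where b' = 48 and Y' = ?Y])
    show "computes (block [HV ::= Var HV [div] Cst 2, GV ::= Cst 2 [*] Var GV] ;; both_code split_expr) (2020 + 4000 * N) 48 ?Y sg1
        (\<lambda>sg2. split_inv k N f g (Suc q) (set_var stageV (Suc q) sg2))" if "q < ?t" "split_inv k N f g q sg1" for q sg1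
      by (rule computes_mono[OF computes_split_stage[OF that(2,1) k N]]) (auto simp: split_inv_def params_set_def operands_def)
  qed (use inv in \<open>auto simp: split_inv_def params_set_def operands_def\<close>)
  moreover have "?t * ((2020 + 4000 * N) + 6) + 4 \<le> k * (5000 * (N + 1))"
  proof -
    have "?t * ((2020 + 4000 * N) + 6) + 4 \<le> k * ((2020 + 4000 * N) + 6) + k * 4" using k(1) by (intro add_mono mult_le_mono) auto
    also have "\<dots> \<le> k * (5000 * (N + 1))" unfolding distrib_left[symmetric] by (intro mult_le_mono2) simp
    finally show ?thesis .
  qed
  ultimately show ?thesis by (rule computes_mono) (auto simp: split_level_def split_inv_def)
qed

lemma computes_transpose:
  assumes params: "params_set k sg" and k: "1 \<le> k" "8 * 2 ^ k \<le> S" and N: "var sg cur_NV = N" "2 ^ k dvd N" "2 * N \<le> S"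
    and ops: "operands N f g sg"
  shows "computes transpose_code (4000 * N + 2020) 42 {leftA, rightA, scratchA} sg (split_inv k N f g 0)"
proof -
  let ?m = "2 ^ (k div 2) :: nat" and ?r = "2 ^ ((k + 1) div 2) :: nat" and ?Y = "{leftA, rightA, scratchA}"
  note powers = halved_powers[OF k(1)]
  obtain sg1 where double: "run (block [cur_NV ::= Cst 2 [*] Var cur_NV]) 5 sg sg1" "var sg1 = (var sg)(cur_NV := 2 * N)" "arr sg1 = arr sg"
    by (rule that[OF run_block]) (use N in \<open>simp_all add: block_cost_def\<close>)
  have "entry sg1 j (transposed_expr a) (transposed ?m ?r h j)"
    if "represents N (arr sg1 a) h" "a < 30" "j < 2 * N" for a h j
    by (rule entry_transposed[OF _ _ that(1)]) (use params double N powers(1) that in \<open>auto simp: params_set_def\<close>)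
  then have entries: "entry sg1 j (transposed_expr leftA) (transposed ?m ?r f j)"
    "entry sg1 j (transposed_expr rightA) (transposed ?m ?r g j)" if "j < 2 * N" for j
    using that ops double(3) by (simp_all add: operands_def)
  have "var sg1 cur_NV = 2 * N" using double(2) by simp
  then obtain sg2 where transpose: "run (both_code transposed_expr) (2000 * (2 * N + 1)) sg1 sg2" "frame 59 ?Y sg1 sg2"
    "operands (2 * N) (transposed ?m ?r f) (transposed ?m ?r g) sg2"
    by (rule computesE[OF computes_both[where e = transposed_expr, OF _ N(3) transposed_expr_static entries]])
  have fr: "frame 42 ?Y sg sg2" using double transpose(2) by (auto simp: frame_def)
  have params2: "params_set k sg2"
    using params double(2,3) by (intro params_set_frame[OF _ frame_mono[OF transpose(2) _ order_refl]]) (auto simp: params_set_def)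
  obtain sg3 where start: "run (block [HV ::= Var mV [*] Var rV, GV ::= Cst 2]) 7 sg2 sg3"
    "var sg3 = (var sg2)(HV := ?m * ?r, GV := 2)" "arr sg3 = arr sg2"
    by (rule that[OF run_block]) (use params2 powers(1) k(2) S_ge in \<open>simp_all add: block_cost_def params_set_def\<close>)
  have "split_inv k N f g 0 sg3"
    using params2 start transpose(3) frame_var[OF transpose(2)] double(2) powers(1)
    by (simp add: split_inv_def params_set_def operands_def)
  then show ?thesis unfolding transpose_code_def
    by (intro computesI[OF run_Seq[OF double(1) run_Seq[OF transpose(1) start(1)]]]) (use fr start in \<open>auto simp: frame_def\<close>)
qed

lemma computes_split_level:
  assumes k: "var sg cur_kV = k" "1 \<le> k" "8 * 2 ^ k \<le> S" and N: "var sg cur_NV = N" "2 ^ k dvd N" "2 * N \<le> S"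
    and level: "var sg levelV = i" "i < S" and ops: "operands N f g sg"
  shows "computes split_level_code (10000 * (k + 2) * (N + 2 ^ k + 1)) 41 {leftA, rightA, scratchA, twistA, levelsA} sg
    (\<lambda>sg'. var sg' cur_kV = (k + 1) div 2 \<and> var sg' cur_NV = 2 * N \<and> arr sg' levelsA = (arr sg levelsA)(i := k) \<and>
      operands (2 * N) (split_level k f) (split_level k g) sg')"
proof -
  let ?Y = "{leftA, rightA, scratchA}"
  have kS: "Suc k div 2 \<le> S" using less_exp[of k] k(2,3) by linarith
  obtain sg1 where save: "run (block [levelsA\<lbrakk>Var levelV\<rbrakk> ::= Var cur_kV]) 6 sg sg1" "var sg1 = var sg"
    "arr sg1 = (arr sg)(levelsA := (arr sg levelsA)(i := k))"
    by (rule that[OF run_block]) (use k(1) level in \<open>simp_all add: block_cost_def\<close>)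
  obtain sg2 where params: "run params_code (300 * 2 ^ k) sg1 sg2" "frame 43 {twistA} sg1 sg2" "params_set k sg2"
    by (rule computesE[OF computes_params[of sg1 k]]) (use k save in auto)
  have "var sg2 cur_NV = N" "operands N f g sg2"
    using ops N(1) frame_var[OF params(2)] frame_arr[OF params(2)] save by (simp_all add: operands_def)
  then obtain sg3 where transpose: "run transpose_code (4000 * N + 2020) sg2 sg3" "frame 42 ?Y sg2 sg3" "split_inv k N f g 0 sg3"
    by (rule computesE[OF computes_transpose[OF params(3) k(2,3) _ N(2,3)]])
  obtain sg4 where stages: "run split_stages_code (k * (5000 * (N + 1))) sg3 sg4" "frame 47 ?Y sg3 sg4"
    "operands (2 * N) (split_level k f) (split_level k g) sg4"
    by (rule computesE[OF computes_split_stages[OF transpose(3) k(2,3) N(2,3)]])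
  have vars: "var sg4 cur_kV = k" "var sg4 cur_NV = 2 * N"
    using k(1) frame_var[OF stages(2)] frame_var[OF transpose(2)] frame_var[OF params(2)] save(2) transpose(3)
    by (simp_all add: split_inv_def)
  obtain sg5 where next_k: "run (block [cur_kV ::= (Var cur_kV [+] Cst 1) [div] Cst 2]) 7 sg4 sg5"
    "var sg5 = (var sg4)(cur_kV := (k + 1) div 2)" "arr sg5 = arr sg4"
    by (rule that[OF run_block]) (use vars kS in \<open>simp_all add: block_cost_def\<close>)
  have time: "6 + (300 * 2 ^ k + (4000 * N + 2020 + (k * (5000 * (N + 1)) + 7))) \<le> 10000 * (k + 2) * (N + 2 ^ k + 1)"
    by (simp add: algebra_simps)
  have "frame 41 {leftA, rightA, scratchA, twistA, levelsA} sg sg5"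
    using save params(2) transpose(2) stages(2) next_k by (auto simp: frame_def)
  moreover have "arr sg5 levelsA = (arr sg levelsA)(i := k)"
    using save(3) frame_arr[OF params(2)] frame_arr[OF transpose(2)] frame_arr[OF stages(2)] next_k(3) by simp
  ultimately show ?thesis unfolding split_level_code_def
    by (intro computesI[OF run_Seq[OF save(1) run_Seq[OF params(1) run_Seq[OF transpose(1) run_Seq[OF stages(1) next_k(1)]]]] time])
       (use next_k vars stages(3) in \<open>auto simp: operands_def\<close>)
qed

definition merge_inv :: "nat \<Rightarrow> nat \<Rightarrow> (nat \<Rightarrow> int) \<Rightarrow> nat \<Rightarrow> astate \<Rightarrow> bool" where
  "merge_inv k N c q sg \<longleftrightarrow> params_set k sg \<and> var sg cur_NV = 2 * N \<and>
     var sg HV = 2 ^ q * 2 ^ ((k + 1) div 2) \<and> var sg GV = 2 ^ (k div 2 + 1 - q) \<and>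
     represents (2 * N) (arr sg leftA) (merge_stages (k div 2) ((k + 1) div 2) c q)"

lemma computes_merge_stage:
  fixes k :: nat
  defines "t \<equiv> k div 2" and "u \<equiv> (k + 1) div 2"
  assumes inv: "merge_inv k N c q sg" and q: "q \<le> t" and k: "1 \<le> k" "8 * 2 ^ k \<le> S" and N: "2 ^ k dvd N" "2 * N \<le> S"
  shows "computes (update_loop leftA cur_NV (merge_expr leftA) ;; block [HV ::= Cst 2 [*] Var HV, GV ::= Var GV [div] Cst 2])
    (1010 + 2000 * N) 48 {leftA, scratchA} sg (merge_inv k N c (Suc q))"
proof -
  let ?H = "2 ^ q * 2 ^ u :: nat" and ?G = "2 ^ (t + 1 - q) :: nat"
  have tu: "2 ^ t * 2 ^ u = (2::nat) ^ k" unfolding t_def u_def by (rule halved_powers(1)[OF k(1)])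
  note powers = halved_powers(2,3)[OF k(1), folded t_def u_def]
  have H: "?H \<le> 2 ^ t * 2 ^ u" using q by (intro mult_right_mono power_increasing) auto
  have G: "?G \<le> 2 * 2 ^ t" using power_increasing[of "t + 1 - q" "t + 1" "2::nat"] by simp
  have bounds: "2 * ?H \<le> S" "2 * ?G \<le> S" "2 * 2 ^ u \<le> S" using H G tu k(2) powers by linarith+
  have state: "stage_state (2 ^ u) ?H ?G sg"
    using inv G unfolding stage_state_def merge_inv_def params_set_def t_def u_def by auto
  have "?H dvd 2 ^ t * 2 ^ u" using q by (intro mult_dvd_mono le_imp_power_dvd) auto
  then have dvd: "2 * ?H dvd 2 * N" using N(1) tu dvd_trans mult_dvd_mono dvd_refl by metis
  have entries: "entry sg i (merge_expr leftA) (merge_stages t u c (Suc q) i)" if "i < 2 * N" for i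
    unfolding merge_stages.simps
    by (rule entry_merge[OF state _ dvd refl _ _ N(2) bounds(2,3) _ that]) (use inv in \<open>auto simp: merge_inv_def t_def u_def\<close>)
  obtain sg1 where merge: "run (update_loop leftA cur_NV (merge_expr leftA)) (1000 * (2 * N + 1)) sg sg1" "frame 59 {leftA, scratchA} sg sg1"
    "\<forall>i. arr sg1 leftA i = (if i < 2 * N then ev (set_var iV i sg) (merge_expr leftA) else arr sg leftA i)"
    by (rule computesE[OF computes_update[of cur_NV sg "2 * N" leftA "merge_expr leftA"]])
       (use inv N(2) entries merge_expr_static[of leftA] in \<open>auto simp: merge_inv_def entry_def\<close>)
  have rep: "represents (2 * N) (arr sg1 leftA) (merge_stages t u c (Suc q))"
    using merge(3) entries by (simp add: represents_def entry_def)
  have "?G = 2 * 2 ^ (t - q)" using q by (simp add: Suc_diff_le)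
  then have halve: "?G div 2 = 2 ^ (t - q)" "2 ^ (t - q) \<le> S" using bounds(2) by simp_all
  obtain sg2 where stage: "run (block [HV ::= Cst 2 [*] Var HV, GV ::= Var GV [div] Cst 2]) 9 sg1 sg2"
    "var sg2 = (var sg1)(HV := 2 * ?H, GV := 2 ^ (t - q))" "arr sg2 = arr sg1"
    by (rule that[OF run_block])
      (use inv bounds halve frame_var[OF merge(2)] in \<open>simp_all add: block_cost_def merge_inv_def t_def u_def\<close>)
  have fr: "frame 48 {leftA, scratchA} sg sg2" using merge(2) stage by (auto simp: frame_def)
  have "params_set k sg2" using inv by (intro params_set_frame[OF _ frame_mono[OF fr _ order_refl]]) (auto simp: merge_inv_def)
  then have "merge_inv k N c (Suc q) sg2"
    using inv rep stage(2,3) frame_var[OF fr] unfolding merge_inv_def t_def u_def by simp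
  then show ?thesis by (intro computesI[OF run_Seq[OF merge(1) stage(1)] _ fr]) auto
qed

lemma computes_merge_stages:
  assumes inv: "merge_inv k N c 0 sg" and stages: "var sg stagesV = k div 2 + 1"
    and k: "1 \<le> k" "8 * 2 ^ k \<le> S" and N: "2 ^ k dvd N" "2 * N \<le> S"
  shows "computes merge_stages_code ((k + 1) * (3000 * (N + 1))) 47 {leftA, scratchA} sg (merge_inv k N c (Suc (k div 2)))"
proof -
  let ?t = "k div 2" and ?Y = "{leftA, scratchA}"
  have "?t + 1 \<le> S" using less_exp[of k] k by linarith
  then have "computes merge_stages_code ((?t + 1) * ((1010 + 2000 * N) + 6) + 4) 47 ?Y sg
      (\<lambda>sg'. merge_inv k N c (?t + 1) sg' \<and> var sg' stageV = ?t + 1 \<and> var sg' stagesV = ?t + 1)"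
    unfolding merge_stages_code_def
  proof (intro computes_for[where b' = 48 and Y' = ?Y])
    show "computes (update_loop leftA cur_NV (merge_expr leftA) ;; block [HV ::= Cst 2 [*] Var HV, GV ::= Var GV [div] Cst 2])
        (1010 + 2000 * N) 48 ?Y sg1 (\<lambda>sg2. merge_inv k N c (Suc q) (set_var stageV (Suc q) sg2))"
      if "q < ?t + 1" "merge_inv k N c q sg1" for q sg1
      by (rule computes_mono[OF computes_merge_stage[OF that(2) _ k N]]) (use that(1) in \<open>auto simp: merge_inv_def params_set_def\<close>)
  qed (use inv stages in \<open>auto simp: merge_inv_def params_set_def\<close>)
  moreover have "(?t + 1) * ((1010 + 2000 * N) + 6) + 4 \<le> (k + 1) * (3000 * (N + 1))"
  proof -
    have "(?t + 1) * ((1010 + 2000 * N) + 6) + 4 \<le> (k + 1) * ((1010 + 2000 * N) + 6) + (k + 1) * 4"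
      by (intro add_mono mult_le_mono) auto
    also have "\<dots> \<le> (k + 1) * (3000 * (N + 1))" unfolding distrib_left[symmetric] by (intro mult_le_mono2) simp
    finally show ?thesis .
  qed
  ultimately show ?thesis by (rule computes_mono) auto
qed

lemma computes_merge_level:
  assumes level: "var sg levelV = j" "var sg depthV = D" "j < D" "D \<le> S" "arr sg levelsA (D - Suc j) = k" and k: "1 \<le> k" "8 * 2 ^ k \<le> S"
    and N: "var sg cur_NV = 2 * N" "2 ^ k dvd N" "2 * N \<le> S" and scale: "var sg scaleV = sc" "sc + k div 2 + 1 \<le> S"
    and rep: "represents (2 * N) (arr sg leftA) c"
  shows "computes merge_level_code (10000 * (k + 2) * (N + 2 ^ k + 1)) 40 {leftA, scratchA, twistA} sg
    (\<lambda>sg'. var sg' cur_NV = N \<and> var sg' scaleV = sc + k div 2 + 1 \<and> represents N (arr sg' leftA) (merge_level k c))"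
proof -
  let ?t = "k div 2" and ?u = "(k + 1) div 2" and ?Y = "{leftA, scratchA}"
  note powers = halved_powers[OF k(1)]
  have kS: "k \<le> S" "D - Suc j < S" using less_exp[of k] k level by linarith+
  obtain sg1 where load: "run (block [cur_kV ::= Arr levelsA (Var depthV [-] (Var levelV [+] Cst 1))]) 10 sg sg1"
    "var sg1 = (var sg)(cur_kV := k)" "arr sg1 = arr sg"
    by (rule that[OF run_block]) (use level kS in \<open>simp_all add: block_cost_def\<close>)
  obtain sg2 where params: "run params_code (300 * 2 ^ k) sg1 sg2" "frame 43 {twistA} sg1 sg2" "params_set k sg2"
    by (rule computesE[OF computes_params[of sg1 k]]) (use k load in auto)
  have bounds: "2 * 2 ^ ?t \<le> S" "2 * 2 ^ ?u \<le> S" "?t + 1 \<le> S" using powers k(2) scale(2) by linarith+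
  then obtain sg3 where start: "run (block [HV ::= Var rV, GV ::= Cst 2 [*] Var mV, stagesV ::= Var tV [+] Cst 1]) 11 sg2 sg3"
    "var sg3 = (var sg2)(HV := 2 ^ ?u, GV := 2 * 2 ^ ?t, stagesV := ?t + 1)" "arr sg3 = arr sg2"
    by (intro that[OF run_block]) (use params(3) in \<open>simp_all add: block_cost_def params_set_def\<close>)
  have "merge_inv k N c 0 sg3" "var sg3 stagesV = ?t + 1"
    using params(3) rep N(1) start(2,3) load(2,3) frame_var[OF params(2)] frame_arr[OF params(2)]
    by (simp_all add: merge_inv_def params_set_def)
  then obtain sg4 where stages: "run merge_stages_code ((k + 1) * (3000 * (N + 1))) sg3 sg4" "frame 47 ?Y sg3 sg4"
    "merge_inv k N c (Suc ?t) sg4"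
    by (rule computesE[OF computes_merge_stages[OF _ _ k N(2,3)]])
  have vars: "var sg4 scaleV = sc" "var sg4 stagesV = ?t + 1" "var sg4 cur_NV = 2 * N"
    using stages(3) frame_var[OF stages(2)] start(2) frame_var[OF params(2)] load(2) scale(1) by (simp_all add: merge_inv_def)
  obtain sg5 where finish: "run (block [scaleV ::= Var scaleV [+] Var stagesV, cur_NV ::= Var cur_NV [div] Cst 2]) 9 sg4 sg5"
    "var sg5 = (var sg4)(scaleV := sc + ?t + 1, cur_NV := N)" "arr sg5 = arr sg4"
    by (rule that[OF run_block]) (use vars scale(2) N(3) in \<open>simp_all add: block_cost_def\<close>)
  have entries: "entry sg5 i (recombined_expr leftA) (merge_level k c i)" if "i < N" for i
    unfolding merge_level_def
    by (rule entry_recombined[OF _ _ _ _ _ _ N(3) _ _ that])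
       (use stages(3) finish powers(1) bounds N(2) in \<open>auto simp: merge_inv_def params_set_def\<close>)
  obtain sg6 where recombine: "run (update_loop leftA cur_NV (recombined_expr leftA)) (1000 * (N + 1)) sg5 sg6" "frame 59 ?Y sg5 sg6"
    "\<forall>i. arr sg6 leftA i = (if i < N then ev (set_var iV i sg5) (recombined_expr leftA) else arr sg5 leftA i)"
    by (rule computesE[OF computes_update[of cur_NV sg5 N leftA "recombined_expr leftA"]])
       (use finish(2) N(3) entries recombined_expr_static[of leftA] in \<open>auto simp: entry_def\<close>)
  have time: "10 + (300 * 2 ^ k + (11 + ((k + 1) * (3000 * (N + 1)) + (9 + 1000 * (N + 1))))) \<le> 10000 * (k + 2) * (N + 2 ^ k + 1)"
    by (simp add: algebra_simps)
  have "represents N (arr sg6 leftA) (merge_level k c)" using recombine(3) entries by (simp add: represents_def entry_def)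
  moreover have "frame 40 {leftA, scratchA, twistA} sg sg6"
    using load params(2) start stages(2) finish recombine(2) by (auto simp: frame_def)
  ultimately show ?thesis unfolding merge_level_code_def
    by (intro computesI[OF run_Seq[OF load(1) run_Seq[OF params(1) run_Seq[OF start(1) run_Seq[OF stages(1)
          run_Seq[OF finish(1) recombine(1)]]]]] time]) (use finish(2) frame_var[OF recombine(2)] in auto)
qed

lemma computes_depth:
  assumes k: "var sg kV = k" "1 \<le> k" "4 * k \<le> S"
  shows "computes depth_code (50 * k + 20) 37 {} sg (\<lambda>sg'. k \<le> 2 ^ var sg' depthV \<and> 2 ^ var sg' depthV < 2 * k)"
proof -
  let ?I = "\<lambda>i sg'. var sg' depth_powV = 2 ^ var sg' depthV \<and> 2 ^ var sg' depthV < 2 * k \<and>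
     (k \<le> 2 ^ var sg' depthV \<or> i \<le> var sg' depthV)"
  let ?step = "[depthV ::= Ite (Var depth_powV) (Var kV) (Var depthV [+] Cst 1) (Var depthV),
     depth_powV ::= Ite (Var depth_powV) (Var kV) (Cst 2 [*] Var depth_powV) (Var depth_powV)]"
  obtain sg1 where init: "run (block [depthV ::= Cst 0, depth_powV ::= Cst 1]) 5 sg sg1"
    "var sg1 = (var sg)(depthV := 0, depth_powV := 1)" "arr sg1 = arr sg"
    by (rule that[OF run_block]) (use S_ge in \<open>simp_all add: block_cost_def\<close>)
  obtain sg2 where search: "run (for_loop levelV kV (block ?step)) (k * (20 + 6) + 4) sg1 sg2" "frame 37 {} sg1 sg2"
    "?I k sg2 \<and> var sg2 levelV = k \<and> var sg2 kV = k"
  proof (rule computesE[OF computes_for[where l = kV and v = levelV and b = 37 and b' = 38 and Y = "{}" and Y' = "{}" and N = k and T = 20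
        and c = "block ?step" and I = ?I and sg = sg1]])
    fix i sg' assume I: "?I i sg'" and kV: "var sg' kV = k"
    define d where "d = var sg' depthV"
    define d' where "d' = (if 2 ^ d < k then d + 1 else d)"
    have "2 ^ d' < 2 * k" using I by (simp add: d'_def d_def)
    moreover from this have "d' < 2 * k" using less_exp[of d'] by linarith
    ultimately show "computes (block ?step) 20 38 {} sg' (\<lambda>sg''. ?I (Suc i) (set_var levelV (Suc i) sg''))"
      using I kV k(3) S_ge by (intro computes_block) (auto simp: block_cost_def d'_def d_def split: if_splits)
  qed (use init k in auto)
  have "k \<le> 2 ^ var sg2 depthV" using search(3) less_exp[of "var sg2 depthV"] by (meson le_less_trans less_imp_le_nat)
  then show ?thesis unfolding depth_code_def
    by (intro computesI[OF run_Seq[OF init(1) search(1)]]) (use init search in \<open>auto simp: frame_def\<close>)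
qed

context
  fixes k N P D :: nat and f g :: "nat \<Rightarrow> int"
  assumes k: "1 \<le> k" "8 * 2 ^ k \<le> S" "4 * k \<le> S" and N: "N = P * 2 ^ k" "2 * k * N < S" and D: "k \<le> 2 ^ D" "2 ^ D < 2 * k"
begin

definition level_time :: nat where
  "level_time = 10000 * (k + 2) * (2 * k * N + 2 ^ k + 1)"

lemma depth_less: "D < 2 * k"
  using D(2) less_exp[of D] by linarith

lemma level_length:
  assumes "i \<le> D"
  shows "2 ^ i * N \<le> 2 * k * N" "2 ^ i * N < S"
proof -
  have "(2::nat) ^ i \<le> 2 ^ D" using assms by (intro power_increasing) auto
  then have "2 ^ i \<le> 2 * k" using D(2) by linarith
  then show "2 ^ i * N \<le> 2 * k * N" by (intro mult_right_mono) auto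
  then show "2 ^ i * N < S" using N(2) by linarith
qed

lemma power_log_size_le: "(2::nat) ^ log_size k i \<le> 2 ^ k" "8 * 2 ^ log_size k i \<le> S"
proof -
  show "(2::nat) ^ log_size k i \<le> 2 ^ k" using log_size_le[of k i] by (intro power_increasing) auto
  then show "8 * 2 ^ log_size k i \<le> S" using k(2) by linarith
qed

lemma power_log_size_dvd: "2 ^ log_size k i dvd 2 ^ i * N"
  using block_count_eq[of k P i] N(1) by (metis dvd_triv_right mult.commute)

lemma level_time_bound:
  assumes "i \<le> D"
  shows "10000 * (log_size k i + 2) * (2 ^ i * N + 2 ^ log_size k i + 1) \<le> level_time"
proof -
  have "2 ^ i * N + 2 ^ log_size k i + 1 \<le> 2 * k * N + 2 ^ k + 1"
    using power_log_size_le(1)[of i] level_length(1)[OF assms] by linarith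
  then show ?thesis unfolding level_time_def using log_size_le[of k i] by (intro mult_le_mono) auto
qed

definition split_levels_inv :: "nat \<Rightarrow> astate \<Rightarrow> bool" where
  "split_levels_inv i sg \<longleftrightarrow> var sg cur_kV = log_size k i \<and> var sg cur_NV = 2 ^ i * N \<and>
     (\<forall>j<i. arr sg levelsA j = log_size k j) \<and> operands (2 ^ i * N) (split_levels k f i) (split_levels k g i) sg"

lemma computes_split_levels:
  assumes depth: "var sg depthV = D" and inv: "split_levels_inv 0 sg"
  shows "computes (for_loop levelV depthV split_level_code) (2 * k * (level_time + 10)) 37
    {leftA, rightA, scratchA, twistA, levelsA} sg (\<lambda>sg'. split_levels_inv D sg' \<and> var sg' depthV = D)"
proof -
  let ?Y = "{leftA, rightA, scratchA, twistA, levelsA}"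
  have "computes (for_loop levelV depthV split_level_code) (D * (level_time + 6) + 4) 37 ?Y sg
      (\<lambda>sg'. split_levels_inv D sg' \<and> var sg' levelV = D \<and> var sg' depthV = D)"
  proof (rule computes_for[where b' = 41 and Y' = ?Y])
    fix i sg1 assume i: "i < D" and I: "split_levels_inv i sg1" and level: "var sg1 levelV = i"
    let ?k = "log_size k i"
    have bounds: "2 * (2 ^ i * N) \<le> S" "i < S"
      using k(1,3) level_length(2)[of "Suc i"] i depth_less by (simp_all add: mult.assoc)
    have "computes split_level_code (10000 * (?k + 2) * (2 ^ i * N + 2 ^ ?k + 1)) 41 ?Y sg1
      (\<lambda>sg'. var sg' cur_kV = (?k + 1) div 2 \<and> var sg' cur_NV = 2 * (2 ^ i * N) \<and> arr sg' levelsA = (arr sg1 levelsA)(i := ?k) \<and>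
        operands (2 * (2 ^ i * N)) (split_level ?k (split_levels k f i)) (split_level ?k (split_levels k g i)) sg')"
      by (rule computes_split_level[OF _ log_size_ge_1[OF k(1)] power_log_size_le(2) _ power_log_size_dvd bounds(1) level bounds(2)])
         (use I in \<open>auto simp: split_levels_inv_def\<close>)
    then show "computes split_level_code level_time 41 ?Y sg1 (\<lambda>sg2. split_levels_inv (Suc i) (set_var levelV (Suc i) sg2))"
      by (rule computes_mono) (use level_time_bound[of i] i I in \<open>auto simp: split_levels_inv_def operands_def less_Suc_eq mult.assoc\<close>)
  qed (use depth inv depth_less k in \<open>auto simp: split_levels_inv_def operands_def\<close>)
  moreover have "D * (level_time + 6) + 4 \<le> 2 * k * (level_time + 10)"
    using mult_le_mono1[OF less_imp_le[OF depth_less], of "level_time + 6"] k(1) by (simp add: algebra_simps)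
  ultimately show ?thesis by (rule computes_mono) auto
qed

definition merge_levels_inv :: "nat \<Rightarrow> astate \<Rightarrow> bool" where
  "merge_levels_inv j sg \<longleftrightarrow> var sg cur_NV = 2 ^ (D - j) * N \<and> var sg scaleV = scale_exponent k D j \<and>
     represents (2 ^ (D - j) * N) (arr sg leftA) (recursive_product k D f g j)"

lemma computes_leaf_products:
  assumes inv: "split_levels_inv D sg"
  shows "computes leaf_products_code (1000 * (2 ^ D * N + 1) + 3) 40 {leftA, scratchA} sg (merge_levels_inv 0)"
proof -
  let ?leaves = "2 ^ D * N" and ?c = "recursive_product k D f g 0"
  have leaves: "var sg cur_NV = ?leaves" "?leaves < S" "even ?leaves"
    using inv level_length(2)[OF order_refl] power_log_size_dvd[of D] log_size_eq_1[OF k(1) D(1)] by (simp_all add: split_levels_inv_def)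
  have entries: "entry sg i mult_pairs_expr (?c i)" if "i < ?leaves" for i
    unfolding recursive_product_def merge_levels.simps
    by (rule entry_mult_pairs[OF _ _ leaves(3,2) that]) (use inv in \<open>simp_all add: split_levels_inv_def operands_def\<close>)
  obtain sg1 where pairs: "run (update_loop leftA cur_NV mult_pairs_expr) (1000 * (?leaves + 1)) sg sg1" "frame 59 {leftA, scratchA} sg sg1"
    "\<forall>i. arr sg1 leftA i = (if i < ?leaves then ev (set_var iV i sg) mult_pairs_expr else arr sg leftA i)"
    by (rule computesE[OF computes_update[of cur_NV sg ?leaves leftA mult_pairs_expr]])
       (use leaves entries mult_pairs_expr_static in \<open>auto simp: entry_def\<close>)
  obtain sg2 where unscaled: "run (block [scaleV ::= Cst 0]) 3 sg1 sg2" "var sg2 = (var sg1)(scaleV := 0)" "arr sg2 = arr sg1"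
    by (rule that[OF run_block]) (simp_all add: block_cost_def)
  have "represents ?leaves (arr sg2 leftA) ?c" using pairs(3) entries unscaled(3) by (simp add: represents_def entry_def)
  then have "merge_levels_inv 0 sg2"
    using leaves(1) unscaled(2) frame_var[OF pairs(2)] by (simp add: merge_levels_inv_def)
  then show ?thesis unfolding leaf_products_code_def
    by (intro computesI[OF run_Seq[OF pairs(1) unscaled(1)]]) (use pairs(2) unscaled(2,3) in \<open>auto simp: frame_def\<close>)
qed

lemma scale_bound: "2 ^ scale_exponent k D D \<le> k * 2 ^ k"
proof -
  have "scale_exponent k D D + 1 = k + D" using scale_exponent_eq[of D D k] log_size_eq_1[OF k(1) D(1)] by simp
  then have "2 * 2 ^ scale_exponent k D D = 2 ^ k * (2::nat) ^ D" by (metis Suc_eq_plus1 power_Suc power_add)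
  also have "\<dots> \<le> 2 ^ k * (2 * k)" using D(2) by (intro mult_left_mono) auto
  finally show ?thesis by (simp add: mult.commute)
qed

lemma scale_exponent_le: "j \<le> D \<Longrightarrow> scale_exponent k D j \<le> 3 * k"
  using scale_exponent_eq[of j D k] log_size_le[of k "D - j"] depth_less by linarith

lemma computes_merge_levels:
  assumes depth: "var sg depthV = D" and inv: "merge_levels_inv 0 sg" and sizes: "\<And>i. i < D \<Longrightarrow> arr sg levelsA i = log_size k i"
  shows "computes (for_loop levelV depthV merge_level_code) (2 * k * (level_time + 10)) 37
    {leftA, scratchA, twistA} sg (merge_levels_inv D)"
proof -
  let ?Y = "{leftA, scratchA, twistA}"
  have "computes (for_loop levelV depthV merge_level_code) (D * (level_time + 6) + 4) 37 ?Y sg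
      (\<lambda>sg'. merge_levels_inv D sg' \<and> var sg' levelV = D \<and> var sg' depthV = D)"
  proof (rule computes_for[where b' = 40 and Y' = ?Y and I = merge_levels_inv])
    fix j sg1 assume j: "j < D" and fr: "frame 37 ?Y sg sg1" and I: "merge_levels_inv j sg1"
      and level: "var sg1 levelV = j" "var sg1 depthV = D"
    let ?i = "D - Suc j"
    let ?k = "log_size k ?i"
    have i: "?i < D" "2 ^ (D - j) * N = 2 * (2 ^ ?i * N)" using j by (auto simp flip: power_Suc Suc_diff_Suc)
    have bounds: "2 * (2 ^ ?i * N) \<le> S" "scale_exponent k D j + ?k div 2 + 1 \<le> S" "D \<le> S"
      using k(1,3) level_length(2)[of "D - j"] i(2) scale_exponent_le[of "Suc j"] j depth_less by simp_all
    have "computes merge_level_code (10000 * (?k + 2) * (2 ^ ?i * N + 2 ^ ?k + 1)) 40 ?Y sg1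
      (\<lambda>sg'. var sg' cur_NV = 2 ^ ?i * N \<and> var sg' scaleV = scale_exponent k D j + ?k div 2 + 1 \<and>
        represents (2 ^ ?i * N) (arr sg' leftA) (merge_level ?k (recursive_product k D f g j)))"
      by (rule computes_merge_level[OF level j bounds(3) _ log_size_ge_1[OF k(1)] power_log_size_le(2) _ power_log_size_dvd bounds(1) _ bounds(2)])
         (use I i(2) sizes[OF i(1)] frame_arr[OF fr] in \<open>auto simp: merge_levels_inv_def\<close>)
    then show "computes merge_level_code level_time 40 ?Y sg1 (\<lambda>sg2. merge_levels_inv (Suc j) (set_var levelV (Suc j) sg2))"
      by (rule computes_mono) (use level_time_bound[of ?i] i in \<open>auto simp: merge_levels_inv_def recursive_product_def\<close>)
  qed (use depth inv depth_less k in \<open>auto simp: merge_levels_inv_def\<close>)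
  moreover have "D * (level_time + 6) + 4 \<le> 2 * k * (level_time + 10)"
    using mult_le_mono1[OF less_imp_le[OF depth_less], of "level_time + 6"] k(1) by (simp add: algebra_simps)
  ultimately show ?thesis by (rule computes_mono) auto
qed

lemma convolution_time: "50 * k + 20 + (5 + (2 * k * (level_time + 10) + (1000 * (2 ^ D * N + 1) + 3 + 2 * k * (level_time + 10))))
    \<le> 100000 * mult_time k N"
proof -
  define X where "X = N + 2 ^ k + 1"
  have "2 * k * N + 2 ^ k + 1 \<le> 2 * (k + 2) * X" by (simp add: X_def algebra_simps)
  then have "level_time \<le> 10000 * (k + 2) * (2 * (k + 2) * X)" unfolding level_time_def by (rule mult_le_mono2)
  then have level: "level_time \<le> 20000 * ((k + 2) ^ 2 * X)" by (simp add: power2_eq_square algebra_simps)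
  have X: "1 \<le> X" and kX: "k \<le> k * X" by (simp_all add: X_def)
  have "2 ^ D * N \<le> 2 * k * N" by (rule level_length) simp
  also have "\<dots> \<le> 2 * k * X" by (rule mult_le_mono2) (simp add: X_def)
  finally have leaves: "2 ^ D * N \<le> 2 * (k * X)" by simp
  have "2 * k * (level_time + 10) \<le> 2 * k * (20000 * ((k + 2) ^ 2 * X) + 10)" using level by (intro mult_le_mono2) simp
  also have "\<dots> = 40000 * (k * (k + 2) ^ 2 * X) + 20 * k" by (simp add: algebra_simps)
  finally have levels: "2 * k * (level_time + 10) \<le> 40000 * (k * (k + 2) ^ 2 * X) + 20 * k" .
  have "80000 * (k * (k + 2) ^ 2) + 2200 * (k + 1) \<le> 100000 * (k + 2) ^ 3"
    by (simp add: power2_eq_square power3_eq_cube algebra_simps)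
  then have "(80000 * (k * (k + 2) ^ 2) + 2200 * (k + 1)) * X \<le> 100000 * (k + 2) ^ 3 * X" by (rule mult_le_mono1)
  then have total: "80000 * (k * (k + 2) ^ 2 * X) + 2200 * (k * X) + 2200 * X \<le> 100000 * (k + 2) ^ 3 * X" by (simp add: algebra_simps)
  have "50 * k + 20 + (5 + (a + (1000 * (b + 1) + 3 + a))) \<le> 2 * c + 2200 * y + 2200 * x"
    if "a \<le> c + 20 * k" "b \<le> 2 * y" "k \<le> y" "1 \<le> x" for a b c x y
    using that by simp
  from this[OF levels leaves kX X] total show ?thesis unfolding mult_time_def X_def[symmetric] by linarith
qed

end

lemma computes_convolution:
  assumes k: "var sg kV = k" "1 \<le> k" "8 * 2 ^ k \<le> S" "4 * k \<le> S" and N: "var sg NV = N" "N = P * 2 ^ k" "2 * k * N < S"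
    and ops: "operands N f g sg"
  shows "computes convolution_code (100000 * mult_time k N) 37 {8..12} sg
    (\<lambda>sg'. \<exists>c. 2 ^ var sg' scaleV \<le> k * 2 ^ k \<and> negacyclic_product P (2 ^ k) (var sg' scaleV) c f g \<and> represents N (arr sg' leftA) c)"
proof -
  have "1 * N \<le> 2 * k * N" using k(2) by (intro mult_right_mono) auto
  then have NS: "N \<le> S" using N(3) by linarith
  obtain sg1 D where depth: "run depth_code (50 * k + 20) sg sg1" "frame 37 {} sg sg1"
    and D: "var sg1 depthV = D" "k \<le> 2 ^ D" "2 ^ D < 2 * k"
    by (rule computesE[OF computes_depth[OF k(1,2,4)]]) auto
  note ctx = k(2-4) N(2,3) D(2,3)
  obtain sg2 where start: "run (block [cur_kV ::= Var kV, cur_NV ::= Var NV]) 5 sg1 sg2"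
    "var sg2 = (var sg1)(cur_kV := k, cur_NV := N)" "arr sg2 = arr sg1"
    by (rule that[OF run_block]) (use k N(1) NS frame_var[OF depth(2)] in \<open>simp_all add: block_cost_def\<close>)
  have "var sg2 depthV = D" "split_levels_inv k N f g 0 sg2"
    using start(2,3) D(1) ops frame_arr[OF depth(2)] by (simp_all add: split_levels_inv_def[OF ctx] operands_def)
  then obtain sg3 where split: "run (for_loop levelV depthV split_level_code) (2 * k * (level_time k N + 10)) sg2 sg3"
    "frame 37 {leftA, rightA, scratchA, twistA, levelsA} sg2 sg3" "split_levels_inv k N f g D sg3 \<and> var sg3 depthV = D"
    by (rule computesE[OF computes_split_levels[OF ctx]])
  obtain sg4 where pairs: "run leaf_products_code (1000 * (2 ^ D * N + 1) + 3) sg3 sg4" "frame 40 {leftA, scratchA} sg3 sg4"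
    "merge_levels_inv k N D f g 0 sg4"
    by (rule computesE[OF computes_leaf_products[OF ctx conjunct1[OF split(3)]]]) auto
  have "var sg4 depthV = D" using split(3) frame_var[OF pairs(2)] by simp
  moreover have "arr sg4 levelsA i = log_size k i" if "i < D" for i
    using that split(3) frame_arr[OF pairs(2)] by (simp add: split_levels_inv_def[OF ctx])
  ultimately obtain sg5 where merge: "run (for_loop levelV depthV merge_level_code) (2 * k * (level_time k N + 10)) sg4 sg5"
    "frame 37 {leftA, scratchA, twistA} sg4 sg5" "merge_levels_inv k N D f g D sg5"
    using pairs(3) by (rule_tac computesE[OF computes_merge_levels[OF ctx]])
  have "frame 37 {8..12} sg sg5"
    using depth(2) start split(2) pairs(2) merge(2) by (auto simp: frame_def)
  then show ?thesis
    unfolding convolution_code_def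
    using merge(3) scale_bound[OF ctx] negacyclic_product_recursive[OF log_size_eq_1[OF k(2) D(2)], of P f g]
    by (intro computesI[OF run_Seq[OF depth(1) run_Seq[OF start(1) run_Seq[OF split(1) run_Seq[OF pairs(1) merge(1)]]]]
          convolution_time[OF ctx]]) (auto simp: merge_levels_inv_def[OF ctx])
qed

end

section \<open>Multiplication of long numbers\<close>

definition digit_value :: "nat \<Rightarrow> (nat \<Rightarrow> nat) \<Rightarrow> nat \<Rightarrow> nat \<Rightarrow> nat" where
  "digit_value B f p n = (\<Sum>i<n. f (p + i) * B ^ i)"

lemma digit_value_cong: "(\<And>i. i < n \<Longrightarrow> f (p + i) = g (q + i)) \<Longrightarrow> digit_value B f p n = digit_value B g q n"
  by (simp add: digit_value_def)

lemma digit_value_Suc: "digit_value B f p (Suc n) = digit_value B f p n + f (p + n) * B ^ n"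
  by (simp add: digit_value_def)

lemma digit_value_add: "digit_value B f p (a + b) = digit_value B f p a + B ^ a * digit_value B f (p + a) b"
  by (simp add: digit_value_def sum.lessThan_add sum_distrib_left power_add mult_ac add_ac)

lemma digit_value_less: "(\<And>i. i < n \<Longrightarrow> f (p + i) < B) \<Longrightarrow> digit_value B f p n < B ^ n"
proof (induction n)
  case (Suc n)
  have "digit_value B f p (Suc n) < B ^ n + f (p + n) * B ^ n" using Suc by (simp add: digit_value_Suc)
  also have "\<dots> = (f (p + n) + 1) * B ^ n" by simp
  also have "\<dots> \<le> B * B ^ n" using Suc.prems[of n] by (intro mult_right_mono) auto
  finally show ?case by simp
qed (simp add: digit_value_def)

subsection \<open>Carries\<close>

fun carry :: "nat \<Rightarrow> nat \<Rightarrow> (nat \<Rightarrow> nat) \<Rightarrow> nat \<Rightarrow> nat" where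
  "carry B n c 0 = 0"
| "carry B n c (Suc i) = (if Suc i mod n = 0 then 0 else (c i + carry B n c i) div B)"

definition carried_digit :: "nat \<Rightarrow> nat \<Rightarrow> (nat \<Rightarrow> nat) \<Rightarrow> nat \<Rightarrow> nat" where
  "carried_digit B n c i = (c i + carry B n c i) mod B"

lemma carry_block_start: "i mod n = 0 \<Longrightarrow> carry B n c i = 0"
  by (cases i) auto

lemma carry_le:
  assumes "2 \<le> B" "\<And>l. l < i \<Longrightarrow> c l \<le> M"
  shows "carry B n c i \<le> M"
  using assms(2)
proof (induction i)
  case (Suc i)
  have "c i \<le> M" "carry B n c i \<le> M" using Suc by auto
  then have "(c i + carry B n c i) div B \<le> (2 * M) div 2"
    using assms(1) by (intro order_trans[OF div_le_mono2[of 2 B "c i + carry B n c i"]] div_le_mono) auto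
  then show ?case by simp
qed simp

lemma carried_digit_cong:
  assumes "\<And>l. l \<le> i \<Longrightarrow> c l = c' l"
  shows "carried_digit B n c i = carried_digit B n c' i"
proof -
  have "carry B n c l = carry B n c' l" if "l \<le> i" for l using that assms by (induction l) auto
  then show ?thesis using assms by (simp add: carried_digit_def)
qed

lemma digit_value_carried_prefix:
  assumes "j < n" "0 < B"
  shows "digit_value B (carried_digit B n c) (p * n) (Suc j) + (c (p * n + j) + carry B n c (p * n + j)) div B * B ^ Suc j =
    digit_value B c (p * n) (Suc j)"
  using assms(1)
proof (induction j)
  case 0
  have "carry B n c (p * n) = 0" by (rule carry_block_start) simp
  then show ?case by (simp add: digit_value_def carried_digit_def)
next
  case (Suc j)
  let ?x = "c (p * n + Suc j) + carry B n c (p * n + Suc j)" and ?V = "digit_value B (carried_digit B n c) (p * n) (Suc j)"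
  have "Suc (p * n + j) mod n = Suc j"
    using Suc.prems by (metis add_Suc_right mod_less mod_mult_self3)
  then have carry: "carry B n c (p * n + Suc j) = (c (p * n + j) + carry B n c (p * n + j)) div B" by simp
  have "digit_value B (carried_digit B n c) (p * n) (Suc (Suc j)) + ?x div B * B ^ Suc (Suc j) =
      ?V + (?x mod B + ?x div B * B) * B ^ Suc j"
    unfolding digit_value_Suc[of _ _ _ "Suc j"] carried_digit_def[of _ _ _ "p * n + Suc j"]
    by (simp only: distrib_left distrib_right power_Suc mult_ac add_ac)
  also have "\<dots> = (?V + carry B n c (p * n + Suc j) * B ^ Suc j) + c (p * n + Suc j) * B ^ Suc j"
    by (simp add: distrib_right)
  also have "\<dots> = digit_value B c (p * n) (Suc (Suc j))"
    unfolding digit_value_Suc[of _ c _ "Suc j"] carry using Suc by simp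
  finally show ?case .
qed

lemma digit_value_carried:
  assumes "0 < n" "0 < B"
  shows "[digit_value B (carried_digit B n c) (p * n) n = digit_value B c (p * n) n] (mod B ^ n)"
proof -
  obtain j where n: "n = Suc j" using assms(1) by (cases n) auto
  from digit_value_carried_prefix[of j n B c p] assms show ?thesis
    unfolding cong_def n by (metis lessI mod_mult_self1 mult.commute)
qed

subsection \<open>Products\<close>

definition convolution :: "(nat \<Rightarrow> nat) \<Rightarrow> (nat \<Rightarrow> nat) \<Rightarrow> nat \<Rightarrow> nat \<Rightarrow> nat" where
  "convolution a b p i = (\<Sum>j\<le>i. a (p + j) * b (p + (i - j)))"

lemma convolution_le:
  assumes "\<And>j. j \<le> i \<Longrightarrow> a (p + j) \<le> M \<and> b (p + j) \<le> M"
  shows "convolution a b p i \<le> (i + 1) * (M * M)"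
proof -
  have "convolution a b p i \<le> (\<Sum>j\<le>i. M * M)"
    unfolding convolution_def by (intro sum_mono mult_le_mono conjunct1[OF assms] conjunct2[OF assms]) auto
  then show ?thesis by simp
qed

lemma digit_value_mult:
  assumes "\<And>i. h \<le> i \<Longrightarrow> i < 2 * h \<Longrightarrow> a (p + i) = 0 \<and> b (p + i) = 0"
  shows "digit_value B a p h * digit_value B b p h = digit_value B (convolution a b p) 0 (2 * h)"
proof -
  let ?g = "\<lambda>i j. a (p + i) * b (p + j) * B ^ (i + j)"
  have "digit_value B a p h * digit_value B b p h = (\<Sum>(i,j)\<in>{..<h} \<times> {..<h}. ?g i j)"
    unfolding digit_value_def sum_product sum.cartesian_product by (intro sum.cong) (auto simp: power_add mult_ac)
  also have "\<dots> = (\<Sum>(i,j)\<in>{(i,j). i + j < 2 * h}. ?g i j)"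
  proof (rule sum.mono_neutral_left)
    show "finite {(i, j). i + j < 2 * h}"
      by (rule finite_subset[of _ "{..<2 * h} \<times> {..<2 * h}"]) auto
    have "?g (fst x) (snd x) = 0" if "x \<in> {(i, j). i + j < 2 * h} - {..<h} \<times> {..<h}" for x
      using that assms[of "fst x"] assms[of "snd x"] by (cases "fst x < h") auto
    then show "\<forall>x\<in>{(i, j). i + j < 2 * h} - {..<h} \<times> {..<h}. (case x of (i, j) \<Rightarrow> ?g i j) = 0"
      unfolding split_beta by blast
  qed auto
  also have "\<dots> = (\<Sum>k<2 * h. \<Sum>i\<le>k. ?g i (k - i))" by (rule sum.triangle_reindex)
  also have "\<dots> = digit_value B (convolution a b p) 0 (2 * h)"
    unfolding digit_value_def convolution_def by (intro sum.cong) (auto simp: sum_distrib_right intro!: sum.cong)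
  finally show ?thesis .
qed

definition block_products :: "nat \<Rightarrow> nat \<Rightarrow> nat \<Rightarrow> (nat \<Rightarrow> nat) \<Rightarrow> (nat \<Rightarrow> nat) \<Rightarrow> (nat \<Rightarrow> nat) \<Rightarrow> bool" where
  "block_products B k P a b X \<longleftrightarrow> (\<forall>i<P * 2 ^ k. X i < B) \<and>
     (\<forall>p<P. [digit_value B X (p * 2 ^ k) (2 ^ k) =
        digit_value B a (p * 2 ^ k) (2 ^ (k - 1)) * digit_value B b (p * 2 ^ k) (2 ^ (k - 1))] (mod B ^ 2 ^ k))"

lemma block_products_digit: "block_products B k P a b X \<Longrightarrow> i < P * 2 ^ k \<Longrightarrow> X i < B"
  by (simp add: block_products_def)

lemma block_products_cong_mod:
  "block_products B k P a b X \<Longrightarrow> p < P \<Longrightarrow> [digit_value B X (p * 2 ^ k) (2 ^ k) =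
     digit_value B a (p * 2 ^ k) (2 ^ (k - 1)) * digit_value B b (p * 2 ^ k) (2 ^ (k - 1))] (mod B ^ 2 ^ k)"
  by (simp add: block_products_def)

lemma block_position:
  fixes p P k i :: nat
  assumes "p < P" "i < 2 ^ k"
  shows "p * 2 ^ k + i < P * 2 ^ k" "(p * 2 ^ k + i) mod 2 ^ k = i"
  using block_index_less[OF assms] block_div_mod(2)[OF assms(2)] by auto

lemma block_products_operands:
  assumes X: "block_products B k P a b X"
    and ab: "\<And>i. i < P * 2 ^ k \<Longrightarrow> i mod 2 ^ k < 2 ^ (k - 1) \<Longrightarrow> a i = a' i \<and> b i = b' i"
  shows "block_products B k P a' b' X"
proof -
  have half: "(2::nat) ^ (k - 1) \<le> 2 ^ k" by (intro power_increasing) auto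
  have "a (p * 2 ^ k + i) = a' (p * 2 ^ k + i) \<and> b (p * 2 ^ k + i) = b' (p * 2 ^ k + i)" if "p < P" "i < 2 ^ (k - 1)" for p i
  proof -
    have "i < 2 ^ k" using that(2) half by linarith
    from ab[OF block_position(1)[OF that(1) this]] block_position(2)[OF that(1) this] that(2) show ?thesis by simp
  qed
  then have "digit_value B a' (p * 2 ^ k) (2 ^ (k - 1)) = digit_value B a (p * 2 ^ k) (2 ^ (k - 1))"
    "digit_value B b' (p * 2 ^ k) (2 ^ (k - 1)) = digit_value B b (p * 2 ^ k) (2 ^ (k - 1))" if "p < P" for p
    using that by (auto intro!: digit_value_cong)
  then show ?thesis using X by (simp add: block_products_def)
qed

subsection \<open>The program\<close>

abbreviation (input) "BV \<equiv> 5 :: nat"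
abbreviation (input) "halfV \<equiv> 35 :: nat"
abbreviation (input) "block_lenV \<equiv> 36 :: nat"
abbreviation (input) "carry_posV \<equiv> 37 :: nat"
abbreviation (input) "carryV \<equiv> 38 :: nat"
abbreviation (input) "digit_sumV \<equiv> 39 :: nat"

abbreviation (input) "resultA \<equiv> 13 :: nat"

definition carry_step :: "nat \<Rightarrow> stmt list" where
  "carry_step a = [carryV ::= Ite (Var carry_posV [mod] Var block_lenV) (Cst 1) (Cst 0) (Var carryV),
     digit_sumV ::= Arr a (Var carry_posV) [+] Var carryV,
     resultA\<lbrakk>Var carry_posV\<rbrakk> ::= Var digit_sumV [mod] Var BV, carryV ::= Var digit_sumV [div] Var BV]"

definition carry_code :: "nat \<Rightarrow> com" where
  "carry_code a = block [carryV ::= Cst 0] ;; for_loop carry_posV NV (block (carry_step a))"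

definition mult_code :: com where
  "mult_code = convolution_code ;; update_loop leftA NV (Modular ShiftR (Arr leftA ix) (Var scaleV)) ;;
     block [block_lenV ::= Pow2 (Var kV)] ;; carry_code leftA"

definition low_half :: "expr \<Rightarrow> expr" where
  "low_half e = Ite (ix [mod] (Cst 2 [*] Var halfV)) (Var halfV) e (Cst 0)"

definition mult_exprs_code :: "expr \<Rightarrow> expr \<Rightarrow> com" where
  "mult_exprs_code e e' = block [halfV ::= Pow2 (Var kV [-] Cst 1)] ;; map_loop leftA NV (low_half e) ;;
     map_loop rightA NV (low_half e') ;; mult_code"

context ram
begin

lemma computes_carry:
  assumes regs: "var sg NV = N" "var sg block_lenV = n" "var sg BV = B" and n: "0 < n" and B: "2 \<le> B"
    and a: "a < 30" "a \<noteq> resultA" and bounds: "N \<le> S" "2 * M \<le> S" and digits: "\<And>i. i < N \<Longrightarrow> arr sg a i \<le> M"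
  shows "computes (carry_code a) (50 * (N + 1)) 37 {resultA} sg (\<lambda>sg'. \<forall>i<N. arr sg' resultA i = carried_digit B n (arr sg a) i)"
proof -
  let ?c = "arr sg a"
  let ?I = "\<lambda>i sg'. (\<forall>l<i. arr sg' resultA l = carried_digit B n ?c l) \<and> (i mod n \<noteq> 0 \<longrightarrow> var sg' carryV = carry B n ?c i)"
  obtain sg1 where init: "run (block [carryV ::= Cst 0]) 3 sg sg1" "var sg1 = (var sg)(carryV := 0)" "arr sg1 = arr sg"
    by (rule that[OF run_block]) (simp_all add: block_cost_def)
  have "computes (for_loop carry_posV NV (block (carry_step a))) (N * (30 + 6) + 4) 37 {resultA} sg1
      (\<lambda>sg'. ?I N sg' \<and> var sg' carry_posV = N \<and> var sg' NV = N)"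
  proof (rule computes_for[where b' = 38 and Y' = "{resultA}"])
    fix i sg' assume i: "i < N" and fr: "frame 37 {resultA} sg1 sg'" and I: "?I i sg'" and pos: "var sg' carry_posV = i"
    have same: "var sg' block_lenV = n" "var sg' BV = B" "arr sg' a = ?c"
      using fr init(2,3) regs a by (simp_all add: frame_var frame_arr)
    let ?x = "?c i + carry B n ?c i"
    have "carry B n ?c i \<le> M" by (rule carry_le[OF B]) (use digits i in auto)
    then have small: "?c i \<le> S" "carry B n ?c i \<le> S" "?x \<le> S" "?x div B \<le> S" "i < S"
      using digits[OF i] bounds i div_le_dividend[of ?x B] by linarith+
    show "computes (block (carry_step a)) 30 38 {resultA} sg' (\<lambda>sg''. ?I (Suc i) (set_var carry_posV (Suc i) sg''))"
      by (rule computes_block)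
         (use pos same I small a carry_block_start[of i n B ?c] in
           \<open>auto simp: carry_step_def block_cost_def carried_digit_def less_Suc_eq\<close>)
  qed (use regs bounds in \<open>auto simp: init(2)\<close>)
  then obtain sg2 where loop: "run (for_loop carry_posV NV (block (carry_step a))) (N * 36 + 4) sg1 sg2" "frame 37 {resultA} sg1 sg2"
    "?I N sg2" by (rule computesE) simp
  show ?thesis unfolding carry_code_def
    by (rule computesI[OF run_Seq[OF init(1) loop(1)]]) (use init loop in \<open>auto simp: frame_def\<close>)
qed

definition fits :: "nat \<Rightarrow> nat \<Rightarrow> nat \<Rightarrow> bool" where
  "fits k N B \<longleftrightarrow> 8 * 2 ^ k * (B * B) \<le> S \<and> 4 * k \<le> S \<and> 2 * k * N < S"

lemma fits_mono: "fits k N B \<Longrightarrow> k' \<le> k \<Longrightarrow> N' \<le> N \<Longrightarrow> fits k' N' B"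
proof -
  assume fits: "fits k N B" and smaller: "k' \<le> k" "N' \<le> N"
  have "8 * 2 ^ k' * (B * B) \<le> 8 * 2 ^ k * (B * B)"
    using smaller(1) by (intro mult_right_mono mult_left_mono power_increasing) auto
  moreover have "2 * k' * N' \<le> 2 * k * N" using smaller by (intro mult_le_mono) auto
  ultimately show ?thesis using fits smaller(1) unfolding fits_def by linarith
qed

lemma fitsD:
  assumes "fits k N B" "1 \<le> k" "2 \<le> B"
  shows "8 * 2 ^ k * (B * B) \<le> S" "4 * k \<le> S" "2 * k * N < S" "8 * 2 ^ k \<le> S" "N \<le> S" "8 * B \<le> S" "8 * (B * B) \<le> S"
proof -
  show big: "8 * 2 ^ k * (B * B) \<le> S" and "4 * k \<le> S" and N: "2 * k * N < S" using assms(1) by (auto simp: fits_def)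
  have "8 * 2 ^ k * 1 \<le> 8 * 2 ^ k * (B * B)" "8 * 1 * (B * B) \<le> 8 * 2 ^ k * (B * B)"
    using assms(3) by (auto intro!: mult_le_mono)
  then show "8 * 2 ^ k \<le> S" "8 * (B * B) \<le> S" using big by linarith+
  then show "8 * B \<le> S" using le_square[of B] by linarith
  have "1 * N \<le> 2 * k * N" using assms(2) by (intro mult_right_mono) auto
  then show "N \<le> S" using N by linarith
qed

context
  fixes k N P B :: nat and a b :: "nat \<Rightarrow> nat"
  assumes k: "1 \<le> k" and N: "N = P * 2 ^ k" and B: "2 \<le> B" and fits: "fits k N B"
    and digits: "\<And>i. i < N \<Longrightarrow> a i \<le> 2 * B \<and> b i \<le> 2 * B"
    and padding: "\<And>i. i < N \<Longrightarrow> 2 ^ (k - 1) \<le> i mod 2 ^ k \<Longrightarrow> a i = 0 \<and> b i = 0"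
begin

lemma coefficient_le:
  assumes "p < P" "i < 2 ^ k"
  shows "convolution a b (p * 2 ^ k) i \<le> 4 * 2 ^ k * (B * B)"
proof -
  have "convolution a b (p * 2 ^ k) i \<le> (i + 1) * ((2 * B) * (2 * B))"
    using digits block_position(1)[OF assms(1)] assms(2) N by (intro convolution_le) auto
  also have "\<dots> \<le> 2 ^ k * ((2 * B) * (2 * B))" using assms(2) by (intro mult_right_mono) auto
  finally show ?thesis by (simp add: mult_ac)
qed

lemma padded_operands:
  assumes "p < P" "2 ^ (k - 1) \<le> i" "i < 2 ^ k"
  shows "a (p * 2 ^ k + i) = 0 \<and> b (p * 2 ^ k + i) = 0"
  using padding block_position[OF assms(1,3)] assms(2) N by simp

lemma unscaled_coefficient:
  assumes product: "negacyclic_product P (2 ^ k) sc c (\<lambda>i. int (a i)) (\<lambda>i. int (b i))" and sc: "2 ^ sc \<le> k * 2 ^ k" and i: "p < P" "i < 2 ^ k"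
  shows "word (c (p * 2 ^ k + i)) = 2 ^ sc * convolution a b (p * 2 ^ k) i"
proof -
  have half: "(2::nat) ^ k = 2 * 2 ^ (k - 1)" using k by (simp add: power_eq_if)
  have "c (p * 2 ^ k + i) = 2 ^ sc * (\<Sum>j\<le>i. int (a (p * 2 ^ k + j)) * int (b (p * 2 ^ k + (i - j))))"
    by (rule coeff_negacyclic_product[OF product i(1) half]) (use padded_operands[OF i(1)] i(2) in auto)
  then have scaled: "c (p * 2 ^ k + i) = int (2 ^ sc * convolution a b (p * 2 ^ k) i)" by (simp add: convolution_def)
  note fD = fitsD[OF fits k B]
  have "k * 2 ^ k \<le> S * S" using fD(2,4) by (intro mult_le_mono) auto
  then have "2 ^ sc * convolution a b (p * 2 ^ k) i \<le> (S * S) * S"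
    using sc coefficient_le[OF i] fD(1) by (intro mult_le_mono) auto
  also have "\<dots> < 2 ^ w" using S_power_less[of 3] by (simp add: power3_eq_cube)
  finally show ?thesis unfolding scaled by (rule word_nat)
qed

lemma block_products_carried:
  assumes coefficients: "\<And>p i. p < P \<Longrightarrow> i < 2 ^ k \<Longrightarrow> c (p * 2 ^ k + i) = convolution a b (p * 2 ^ k) i"
    and X: "\<And>i. i < N \<Longrightarrow> X i = carried_digit B (2 ^ k) c i"
  shows "block_products B k P a b X"
  unfolding block_products_def
proof (intro conjI allI impI)
  show "X i < B" if "i < P * 2 ^ k" for i using X that B N by (simp add: carried_digit_def)
  fix p assume p: "p < P"
  have half: "(2::nat) ^ k = 2 * 2 ^ (k - 1)" using k by (simp add: power_eq_if)
  have "digit_value B X (p * 2 ^ k) (2 ^ k) = digit_value B (carried_digit B (2 ^ k) c) (p * 2 ^ k) (2 ^ k)"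
    using X block_position(1)[OF p] N by (intro digit_value_cong) auto
  also have "[\<dots> = digit_value B c (p * 2 ^ k) (2 ^ k)] (mod B ^ 2 ^ k)" using B by (intro digit_value_carried) auto
  also have "digit_value B c (p * 2 ^ k) (2 ^ k) = digit_value B (convolution a b (p * 2 ^ k)) 0 (2 * 2 ^ (k - 1))"
    unfolding half[symmetric] using coefficients[OF p] by (intro digit_value_cong) auto
  also have "\<dots> = digit_value B a (p * 2 ^ k) (2 ^ (k - 1)) * digit_value B b (p * 2 ^ k) (2 ^ (k - 1))"
    using padded_operands[OF p] half by (intro digit_value_mult[symmetric]) auto
  finally show "[digit_value B X (p * 2 ^ k) (2 ^ k) =
      digit_value B a (p * 2 ^ k) (2 ^ (k - 1)) * digit_value B b (p * 2 ^ k) (2 ^ (k - 1))] (mod B ^ 2 ^ k)" .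
qed

lemma computes_mult:
  assumes regs: "var sg kV = k" "var sg NV = N" "var sg BV = B" and ab: "\<And>i. i < N \<Longrightarrow> arr sg leftA i = a i \<and> arr sg rightA i = b i"
  shows "computes mult_code (200000 * mult_time k N) 36 {8..13} sg (\<lambda>sg'. block_products B k P a b (arr sg' resultA))"
proof -
  note fD = fitsD[OF fits k B]
  have "word (int x) = x" if "x \<le> 2 * B" for x using that fD(6) S_less(1) by (intro word_nat) linarith
  then have "operands N (\<lambda>i. int (a i)) (\<lambda>i. int (b i)) sg"
    using ab digits by (auto simp: operands_def represents_def)
  then obtain sg1 c where conv: "run convolution_code (100000 * mult_time k N) sg sg1" "frame 37 {8..12} sg sg1"
    and product: "2 ^ var sg1 scaleV \<le> k * 2 ^ k" "negacyclic_product P (2 ^ k) (var sg1 scaleV) c (\<lambda>i. int (a i)) (\<lambda>i. int (b i))"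
      "represents N (arr sg1 leftA) c"
    by (rule computesE[OF computes_convolution[OF regs(1) k fD(4,2) regs(2) N fD(3)]]) blast
  obtain sg2 where shift: "run (update_loop leftA NV (Modular ShiftR (Arr leftA ix) (Var scaleV))) (1000 * (N + 1)) sg1 sg2"
    "frame 59 {leftA, scratchA} sg1 sg2"
    "\<forall>i. arr sg2 leftA i = (if i < N then ev (set_var iV i sg1) (Modular ShiftR (Arr leftA ix) (Var scaleV)) else arr sg1 leftA i)"
    by (rule computesE[OF computes_update[of NV sg1 N leftA "Modular ShiftR (Arr leftA ix) (Var scaleV)"]])
       (use frame_var[OF conv(2)] regs fD(5) in auto)
  have coeff: "arr sg2 leftA (p * 2 ^ k + i) = convolution a b (p * 2 ^ k) i" if "p < P" "i < 2 ^ k" for p i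
    using shift(3) block_position(1)[OF that] N unscaled_coefficient[OF product(2,1) that] represents_at[OF product(3)]
    by (simp add: drop_bit_eq_div)
  have small: "arr sg2 leftA i \<le> 4 * 2 ^ k * (B * B)" if "i < N" for i
  proof -
    have "i div 2 ^ k < P" "i mod 2 ^ k < 2 ^ k" using that N by (simp_all add: less_mult_imp_div_less)
    from coeff[OF this] coefficient_le[OF this] show ?thesis by (metis div_mult_mod_eq)
  qed
  obtain sg3 where length: "run (block [block_lenV ::= Pow2 (Var kV)]) 4 sg2 sg3" "var sg3 = (var sg2)(block_lenV := 2 ^ k)" "arr sg3 = arr sg2"
    by (rule that[OF run_block]) (use frame_var[OF conv(2)] frame_var[OF shift(2)] regs fD(4) in \<open>simp_all add: block_cost_def\<close>)
  obtain sg4 where carry: "run (carry_code leftA) (50 * (N + 1)) sg3 sg4" "frame 37 {resultA} sg3 sg4"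
    "\<forall>i<N. arr sg4 resultA i = carried_digit B (2 ^ k) (arr sg3 leftA) i"
    by (rule computesE[OF computes_carry[of sg3 N "2 ^ k" B leftA "4 * 2 ^ k * (B * B)"]])
       (use length small B fD(1,5) regs frame_var[OF conv(2)] frame_var[OF shift(2)] in auto)
  have "1 * (N + 2 ^ k + 1) \<le> mult_time k N" unfolding mult_time_def by (intro mult_right_mono one_le_power) auto
  then have time: "100000 * mult_time k N + (1000 * (N + 1) + (4 + 50 * (N + 1))) \<le> 200000 * mult_time k N" by simp
  have "frame 36 {8..13} sg sg4" using conv(2) shift(2) length carry(2) by (auto simp: frame_def)
  moreover have "block_products B k P a b (arr sg4 resultA)"
    by (rule block_products_carried[of "arr sg3 leftA"]) (use carry(3) coeff length(3) in auto)
  ultimately show ?thesis unfolding mult_code_def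
    by (rule computesI[OF run_Seq[OF conv(1) run_Seq[OF shift(1) run_Seq[OF length(1) carry(1)]]] time])
qed

end

lemma computes_low_half:
  assumes "var sg NV = N" "var sg halfV = h" "N \<le> S" "a < 30" "a \<notin> arrays e" "cost e \<le> 300"
    and "\<And>i. i < N \<Longrightarrow> i mod (2 * h) < h \<Longrightarrow> safe (set_var iV i sg) e \<and> ev (set_var iV i sg) e = f i"
  shows "computes (map_loop a NV (low_half e)) (500 * (N + 1)) 59 {a} sg
    (\<lambda>sg'. \<forall>i<N. arr sg' a i = (if i mod (2 * h) < h then f i else 0))"
  by (rule computes_mono[OF computes_map[where N = N]]) (use assms in \<open>auto simp: low_half_def\<close>)

lemma computes_mult_exprs:
  assumes regs: "var sg kV = k" "var sg NV = N" "var sg BV = B" and k: "1 \<le> k" and N: "N = P * 2 ^ k" and B: "2 \<le> B" and fits: "fits k N B"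
    and static: "cost e \<le> 300" "cost e' \<le> 300" "leftA \<notin> arrays e" "leftA \<notin> arrays e'" "rightA \<notin> arrays e'"
    and left_expr: "\<And>i sg'. i < N \<Longrightarrow> i mod 2 ^ k < 2 ^ (k - 1) \<Longrightarrow> frame 35 {leftA} sg sg' \<Longrightarrow>
       safe (set_var iV i sg') e \<and> ev (set_var iV i sg') e = f i \<and> f i \<le> 2 * B"
    and right_expr: "\<And>i sg'. i < N \<Longrightarrow> i mod 2 ^ k < 2 ^ (k - 1) \<Longrightarrow> frame 35 {leftA} sg sg' \<Longrightarrow>
       safe (set_var iV i sg') e' \<and> ev (set_var iV i sg') e' = f' i \<and> f' i \<le> 2 * B"
  shows "computes (mult_exprs_code e e') (250000 * mult_time k N) 35 {8..13} sg (\<lambda>sg'. block_products B k P f f' (arr sg' resultA))"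
proof -
  define h where "h = (2::nat) ^ (k - 1)"
  have half: "2 ^ k = 2 * h" using k by (simp add: h_def power_eq_if)
  note fD = fitsD[OF fits k B] and left_low = left_expr[folded h_def, unfolded half] and right_low = right_expr[folded h_def, unfolded half]
  define a b where "a i = (if i mod (2 * h) < h then f i else 0)" and "b i = (if i mod (2 * h) < h then f' i else 0)" for i
  obtain sg1 where init: "run (block [halfV ::= Pow2 (Var kV [-] Cst 1)]) 6 sg sg1" "var sg1 = (var sg)(halfV := h)" "arr sg1 = arr sg"
    by (rule that[OF run_block]) (use regs k fD(4) half in \<open>auto simp: h_def block_cost_def\<close>)
  have fr1: "frame 35 {leftA} sg sg1" using init by (simp add: frame_def)
  obtain sg2 where left: "run (map_loop leftA NV (low_half e)) (500 * (N + 1)) sg1 sg2" "frame 59 {leftA} sg1 sg2"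
    "\<forall>i<N. arr sg2 leftA i = a i"
    by (rule computesE[OF computes_low_half[of sg1 N h leftA e f]])
       (use init(2) regs fD(5) static left_low[OF _ _ fr1] in \<open>auto simp: a_def\<close>)
  have fr2: "frame 35 {leftA} sg sg2" using fr1 left(2) by (auto simp: frame_def)
  obtain sg3 where right: "run (map_loop rightA NV (low_half e')) (500 * (N + 1)) sg2 sg3" "frame 59 {rightA} sg2 sg3"
    "\<forall>i<N. arr sg3 rightA i = b i"
    by (rule computesE[OF computes_low_half[of sg2 N h rightA e' f']])
       (use init(2) frame_var[OF left(2)] regs fD(5) static right_low[OF _ _ fr2] in \<open>auto simp: b_def\<close>)
  have digits: "a i \<le> 2 * B \<and> b i \<le> 2 * B" if "i < N" for i
    using left_low[OF that _ fr1] right_low[OF that _ fr2] by (auto simp: a_def b_def)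
  have padding: "a i = 0 \<and> b i = 0" if "i < N" "2 ^ (k - 1) \<le> i mod 2 ^ k" for i
    using that[folded h_def] half by (auto simp: a_def b_def)
  obtain sg4 where mult: "run mult_code (200000 * mult_time k N) sg3 sg4" "frame 36 {8..13} sg3 sg4" "block_products B k P a b (arr sg4 resultA)"
    by (rule computesE[OF computes_mult[where sg = sg3, OF k N B fits digits padding]])
       (use init(2) frame_var[OF left(2)] frame_var[OF right(2)] regs left(3) right(3) frame_arr[OF right(2)] in auto)
  have "block_products B k P f f' (arr sg4 resultA)"
    by (rule block_products_operands[OF mult(3), folded h_def]) (use half in \<open>simp add: a_def b_def\<close>)
  moreover have "1 * (N + 2 ^ k + 1) \<le> mult_time k N" unfolding mult_time_def by (intro mult_right_mono one_le_power) auto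
  ultimately show ?thesis unfolding mult_exprs_code_def
    by (intro computesI[OF run_Seq[OF init(1) run_Seq[OF left(1) run_Seq[OF right(1) mult(1)]]]])
       (use fr2 right(2) mult(2) in \<open>auto simp: frame_def\<close>)
qed

end

section \<open>Levels of the product, inverse and residue trees\<close>

definition subproduct :: "(nat \<Rightarrow> nat) \<Rightarrow> nat \<Rightarrow> nat \<Rightarrow> nat" where
  "subproduct x l c = (\<Prod>j<2 ^ l. x (c * 2 ^ l + j))"

lemma subproduct_0: "subproduct x 0 c = x c"
  by (simp add: subproduct_def)

lemma subproduct_Suc: "subproduct x (Suc l) c = subproduct x l (2 * c) * subproduct x l (2 * c + 1)"
proof -
  have "(2::nat) ^ Suc l = 2 ^ l + 2 ^ l" by simp
  then have "subproduct x (Suc l) c = (\<Prod>j<2 ^ l. x (c * 2 ^ Suc l + j)) * (\<Prod>j<2 ^ l. x (c * 2 ^ Suc l + (2 ^ l + j)))"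
    unfolding subproduct_def by (simp only: prod.lessThan_add)
  then show ?thesis by (simp add: subproduct_def algebra_simps)
qed

lemma subproduct_le: "(\<And>j. j < 2 ^ l \<Longrightarrow> x (c * 2 ^ l + j) \<le> b) \<Longrightarrow> subproduct x l c \<le> b ^ 2 ^ l"
  unfolding subproduct_def by (rule order_trans[OF prod_mono[where g = "\<lambda>_. b"]]) auto

lemma dvd_subproduct: "j < 2 ^ l \<Longrightarrow> x (c * 2 ^ l + j) dvd subproduct x l c"
  unfolding subproduct_def by (intro dvd_prodI) auto

text \<open>A level consists of \<open>Z div 2 ^ l\<close> numbers of \<open>2 ^ l\<close> digits each, stored from position \<open>p\<close> on.\<close>

definition nodes :: "nat \<Rightarrow> nat \<Rightarrow> nat \<Rightarrow> nat \<Rightarrow> (nat \<Rightarrow> nat \<Rightarrow> bool) \<Rightarrow> (nat \<Rightarrow> nat) \<Rightarrow> bool" where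
  "nodes B Z l p P X \<longleftrightarrow> (\<forall>i<Z. X (p + i) < B) \<and>
     (\<forall>c<Z div 2 ^ l. P c (digit_value B X (p + c * 2 ^ l) (2 ^ l)))"

definition product_level :: "nat \<Rightarrow> nat \<Rightarrow> (nat \<Rightarrow> nat) \<Rightarrow> nat \<Rightarrow> (nat \<Rightarrow> nat) \<Rightarrow> bool" where
  "product_level B Z x l = nodes B Z l (l * Z) (\<lambda>c v. v = subproduct x l c)"

definition inverse_level :: "nat \<Rightarrow> nat \<Rightarrow> (nat \<Rightarrow> nat) \<Rightarrow> nat \<Rightarrow> (nat \<Rightarrow> nat) \<Rightarrow> bool" where
  "inverse_level B Z x l = nodes B Z l (l * Z) (\<lambda>c v. B ^ 2 ^ l dvd subproduct x l c * v + 1)"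

definition residue_level :: "nat \<Rightarrow> nat \<Rightarrow> nat \<Rightarrow> (nat \<Rightarrow> nat) \<Rightarrow> (nat \<Rightarrow> nat) \<Rightarrow> nat \<Rightarrow> (nat \<Rightarrow> nat) \<Rightarrow> bool" where
  "residue_level B b Z x G l = nodes B Z l 0
     (\<lambda>c v. v \<le> 2 * b ^ 2 ^ l \<and> (\<forall>j<2 ^ l. gcd v (x (c * 2 ^ l + j)) = G (c * 2 ^ l + j)))"

lemma node_end: "c < Z div n \<Longrightarrow> c * n + n \<le> Z" for c n Z :: nat
  using order_trans[OF mult_le_mono1[of "Suc c" "Z div n" n] div_times_less_eq_dividend] by (simp add: add.commute)

lemma nodes_digit: "nodes B Z l p P X \<Longrightarrow> i < Z \<Longrightarrow> X (p + i) < B"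
  by (simp add: nodes_def)

lemma nodes_value: "nodes B Z l p P X \<Longrightarrow> c < Z div 2 ^ l \<Longrightarrow> P c (digit_value B X (p + c * 2 ^ l) (2 ^ l))"
  by (simp add: nodes_def)

lemma nodes_cong:
  assumes "\<And>i. i < Z \<Longrightarrow> X' (p + i) = X (p + i)" "nodes B Z l p P X"
  shows "nodes B Z l p P X'"
proof -
  have "digit_value B X' (p + c * 2 ^ l) (2 ^ l) = digit_value B X (p + c * 2 ^ l) (2 ^ l)" if "c < Z div 2 ^ l" for c
    by (rule digit_value_cong) (use assms(1) node_end[OF that] in \<open>simp add: add.assoc\<close>)
  then show ?thesis using assms by (simp add: nodes_def)
qed

lemma digit_value_low: "[digit_value B f p (a + b) = digit_value B f p a] (mod B ^ a)"
  by (simp add: digit_value_add cong_def)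

lemma digit_value_distrib: "digit_value B (\<lambda>i. f i + g i) p n = digit_value B f p n + digit_value B g p n"
  by (simp add: digit_value_def distrib_right sum.distrib)

text \<open>Operands and results of the blockwise products are stored with different block lengths.\<close>

definition gather :: "(nat \<Rightarrow> nat) \<Rightarrow> nat \<Rightarrow> nat \<Rightarrow> nat \<Rightarrow> nat \<Rightarrow> nat \<Rightarrow> nat" where
  "gather f p d m n i = f (p + i div d * m + i mod n)"

lemma digit_value_gather:
  assumes "h \<le> n"
  shows "digit_value B (gather f p (q * n) m n) (c * n) h = digit_value B f (p + c div q * m) h"
proof (rule digit_value_cong)
  fix j assume "j < h"
  then have "(c * n + j) div n = c" "(c * n + j) mod n = j" using assms by (auto intro!: block_div_mod)
  then show "gather f p (q * n) m n (c * n + j) = f (p + c div q * m + j)"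
    by (simp add: gather_def mult.commute[of q n] div_mult2_eq)
qed

lemma gather_position:
  fixes i Q q n h m :: nat
  assumes "i < Q * q * n" "i mod n < h" "h \<le> m"
  shows "i div (q * n) * m + i mod n < Q * m"
proof -
  have "i div (q * n) < Q" using assms(1)[unfolded mult.assoc] by (rule less_mult_imp_div_less)
  then have "(i div (q * n) + 1) * m \<le> Q * m" by (intro mult_right_mono) auto
  then show ?thesis using assms(2,3) by simp
qed

lemma block_products_cong:
  assumes "block_products B k P a b X" "\<And>i. i < P * 2 ^ k \<Longrightarrow> X' i = X i"
  shows "block_products B k P a b X'"
proof -
  have "digit_value B X' (p * 2 ^ k) (2 ^ k) = digit_value B X (p * 2 ^ k) (2 ^ k)" if "p < P" for p
    by (rule digit_value_cong) (rule assms(2)[OF block_position(1)[OF that]])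
  then show ?thesis using assms by (simp add: block_products_def)
qed

lemma block_products_low:
  assumes "block_products B (Suc k) P a b X" "p < P"
  shows "[digit_value B X (p * 2 ^ Suc k) (2 ^ k) =
     digit_value B a (p * 2 ^ Suc k) (2 ^ k) * digit_value B b (p * 2 ^ Suc k) (2 ^ k)] (mod B ^ 2 ^ k)"
proof -
  have twice: "(2::nat) ^ Suc k = 2 ^ k + 2 ^ k" by simp
  have "[digit_value B X (p * 2 ^ Suc k) (2 ^ Suc k) =
      digit_value B a (p * 2 ^ Suc k) (2 ^ k) * digit_value B b (p * 2 ^ Suc k) (2 ^ k)] (mod B ^ 2 ^ k)"
    by (rule cong_dvd_modulus_nat[OF block_products_cong_mod[OF assms, unfolded diff_Suc_1]]) (simp add: le_imp_power_dvd)
  then show ?thesis by (rule cong_trans[OF cong_sym[OF digit_value_low[of B X "p * 2 ^ Suc k" "2 ^ k" "2 ^ k", folded twice]]])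
qed

subsection \<open>Products of two children\<close>

abbreviation child_products :: "nat \<Rightarrow> nat \<Rightarrow> nat \<Rightarrow> nat \<Rightarrow> (nat \<Rightarrow> nat) \<Rightarrow> (nat \<Rightarrow> nat) \<Rightarrow> bool" where
  "child_products B l Q p X \<equiv> block_products B (Suc l) Q (\<lambda>i. X (p + i)) (\<lambda>i. X (p + i + 2 ^ l))"

lemma child_products_value:
  assumes "child_products B l Q p X Y" "c < Q"
  shows "[digit_value B Y (c * 2 ^ Suc l) (2 ^ Suc l) =
     digit_value B X (p + 2 * c * 2 ^ l) (2 ^ l) * digit_value B X (p + (2 * c + 1) * 2 ^ l) (2 ^ l)] (mod B ^ 2 ^ Suc l)"
proof -
  have "digit_value B (\<lambda>i. X (p + i)) (c * 2 ^ Suc l) (2 ^ l) = digit_value B X (p + 2 * c * 2 ^ l) (2 ^ l)"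
    "digit_value B (\<lambda>i. X (p + i + 2 ^ l)) (c * 2 ^ Suc l) (2 ^ l) = digit_value B X (p + (2 * c + 1) * 2 ^ l) (2 ^ l)"
    by (simp_all add: digit_value_def algebra_simps)
  then show ?thesis using block_products_cong_mod[OF assms] by simp
qed

lemma product_level_Suc:
  assumes X: "product_level B Z x l X" and Z: "Z = Q * 2 ^ Suc l" and B: "B = 4 * b" "1 \<le> b" and x: "\<And>i. i < Z \<Longrightarrow> x i \<le> b"
    and Y: "child_products B l Q (l * Z) X Y" and X': "\<And>i. i < Z \<Longrightarrow> X' (Suc l * Z + i) = Y i"
  shows "product_level B Z x (Suc l) X'"
  unfolding product_level_def nodes_def
proof (intro conjI allI impI)
  show "X' (Suc l * Z + i) < B" if "i < Z" for i
    using X'[OF that] block_products_digit[OF Y] that Z by simp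
  fix c assume c: "c < Z div 2 ^ Suc l"
  then have cQ: "c < Q" using Z by simp
  note end_le = node_end[OF c]
  have child: "digit_value B X (l * Z + c' * 2 ^ l) (2 ^ l) = subproduct x l c'" if "c' < 2 * Q" for c'
    using nodes_value[OF X[unfolded product_level_def]] that Z by simp
  have "digit_value B X' (Suc l * Z + c * 2 ^ Suc l) (2 ^ Suc l) = digit_value B Y (c * 2 ^ Suc l) (2 ^ Suc l)"
    by (rule digit_value_cong) (use X' end_le in \<open>simp add: add.assoc\<close>)
  moreover have "[digit_value B Y (c * 2 ^ Suc l) (2 ^ Suc l) = subproduct x (Suc l) c] (mod B ^ 2 ^ Suc l)"
    using child_products_value[OF Y cQ] child[of "2 * c"] child[of "2 * c + 1"] cQ by (simp only: subproduct_Suc)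
  moreover have "digit_value B Y (c * 2 ^ Suc l) (2 ^ Suc l) < B ^ 2 ^ Suc l"
    using block_products_digit[OF Y] end_le Z by (intro digit_value_less) simp
  moreover have "subproduct x (Suc l) c < B ^ 2 ^ Suc l"
  proof -
    have "subproduct x (Suc l) c \<le> b ^ 2 ^ Suc l" using x end_le by (intro subproduct_le) simp
    also have "\<dots> < B ^ 2 ^ Suc l" using B by (intro power_strict_mono) auto
    finally show ?thesis .
  qed
  ultimately show "digit_value B X' (Suc l * Z + c * 2 ^ Suc l) (2 ^ Suc l) = subproduct x (Suc l) c"
    by (simp add: cong_def)
qed

subsection \<open>Newton iteration for the inverses\<close>

text \<open>If \<open>X J \<equiv> 1\<close> modulo \<open>D\<close>, then \<open>X J (X J - 2) + 1 = (X J - 1)\<^sup>2 \<equiv> 0\<close> modulo \<open>D\<^sup>2\<close>.\<close>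

lemma newton_step:
  fixes D xl xr Nl Nr J Y N :: nat
  assumes left: "D dvd xl * Nl + 1" and right: "D dvd xr * Nr + 1" and J: "[J = Nl * Nr] (mod D)"
    and Y: "[Y = xl * xr * J] (mod D * D)" and N: "[N = (Y + (D * D - 2)) * J] (mod D * D)" and D: "2 \<le> D"
  shows "D * D dvd xl * xr * N + 1"
proof -
  define X where "X = int (xl * xr)"
  have "[int xl * int Nl = -1] (mod int D)" "[int xr * int Nr = -1] (mod int D)"
    using left right by (simp_all add: cong_iff_dvd_diff) (metis int_dvd_int_iff of_nat_Suc of_nat_mult add.commute)+
  then have "[(int xl * int Nl) * (int xr * int Nr) = (-1) * (-1)] (mod int D)" by (rule cong_mult)
  moreover have "[X * int J = X * (int Nl * int Nr)] (mod int D)"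
    using J by (intro cong_scalar_left) (simp add: cong_int_iff flip: of_nat_mult)
  ultimately have "[X * int J = 1] (mod int D)" by (simp add: X_def mult_ac cong_def)
  then have square: "int D * int D dvd (X * int J - 1) * (X * int J - 1)"
    by (metis cong_iff_dvd_diff mult_dvd_mono)
  have Y_int: "[int Y = X * int J] (mod int D * int D)"
    using Y unfolding X_def by (simp add: cong_int_iff flip: of_nat_mult)
  have "int (D * D - 2) = int D * int D - 2" using mult_le_mono[OF D, of 1 D] D by (simp add: of_nat_diff)
  moreover have "[int N = int ((Y + (D * D - 2)) * J)] (mod int (D * D))" using N by (simp only: cong_int_iff)
  ultimately have "[int N = (int Y + (int D * int D - 2)) * int J] (mod int D * int D)" by simp
  also have "[(int Y + (int D * int D - 2)) * int J = (X * int J + (0 - 2)) * int J] (mod int D * int D)"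
    by (intro cong_mult cong_add cong_diff Y_int cong_refl) (simp add: cong_def)
  finally have "[X * int N + 1 = X * ((X * int J + (0 - 2)) * int J) + 1] (mod int D * int D)"
    by (intro cong_add cong_scalar_left cong_refl)
  also have "X * ((X * int J + (0 - 2)) * int J) + 1 = (X * int J - 1) * (X * int J - 1)" by (simp add: algebra_simps)
  also have "[(X * int J - 1) * (X * int J - 1) = 0] (mod int D * int D)" using square by (simp add: cong_iff_dvd_diff)
  finally have "int (D * D) dvd int (xl * xr * N + 1)" by (simp add: cong_iff_dvd_diff X_def add.commute)
  then show ?thesis by (simp only: int_dvd_int_iff)
qed

definition minus_two_digit :: "nat \<Rightarrow> nat \<Rightarrow> nat \<Rightarrow> nat" where
  "minus_two_digit B n i = (if i mod n = 0 then B - 2 else B - 1)"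

lemma digit_value_minus_two:
  assumes B: "2 \<le> B" and h: "0 < h" "h \<le> n"
  shows "digit_value B (minus_two_digit B n) (c * n) h = B ^ h - 2"
proof -
  have "digit_value B (minus_two_digit B n) (c * n) (Suc m) + 2 = B ^ Suc m" if "m < n" for m
    using that
  proof (induction m)
    case 0
    show ?case using B by (simp add: digit_value_def minus_two_digit_def)
  next
    case (Suc m)
    have "minus_two_digit B n (c * n + Suc m) = B - 1"
      using block_div_mod(2)[of "Suc m" n c] Suc.prems by (simp add: minus_two_digit_def)
    then have "digit_value B (minus_two_digit B n) (c * n) (Suc (Suc m)) + 2 = B ^ Suc m + (B - 1) * B ^ Suc m"
      unfolding digit_value_Suc[of _ _ _ "Suc m"] using Suc by simp
    also have "\<dots> = (1 + (B - 1)) * B ^ Suc m" by (simp only: distrib_right mult_1)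
    finally show ?case using B by simp
  qed
  then have "digit_value B (minus_two_digit B n) (c * n) h + 2 = B ^ h"
    using h by (metis Suc_le_lessD Suc_pred)
  then show ?thesis by linarith
qed

lemma inverse_level_Suc:
  assumes X: "product_level B Z x (Suc l) X" and V: "inverse_level B Z x l V" and Z: "Z = Q * 2 ^ Suc l" and B: "2 \<le> B"
    and J: "child_products B l Q (l * Z) V J"
    and Y: "block_products B (Suc (Suc l)) Q (gather X (Suc l * Z) (2 ^ Suc (Suc l)) (2 ^ Suc l) (2 ^ Suc (Suc l)))
       (gather J 0 (2 ^ Suc (Suc l)) (2 ^ Suc l) (2 ^ Suc (Suc l))) Y"
    and N: "block_products B (Suc (Suc l)) Q (\<lambda>i. Y i + minus_two_digit B (2 ^ Suc (Suc l)) i)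
       (gather J 0 (2 ^ Suc (Suc l)) (2 ^ Suc l) (2 ^ Suc (Suc l))) N"
    and V': "\<And>i. i < Z \<Longrightarrow> V' (Suc l * Z + i) = gather N 0 (2 ^ Suc l) (2 ^ Suc (Suc l)) (2 ^ Suc l) i"
  shows "inverse_level B Z x (Suc l) V'"
  unfolding inverse_level_def nodes_def
proof (intro conjI allI impI)
  fix i assume i: "i < Z"
  have "i div 2 ^ Suc l * 2 ^ Suc (Suc l) + i mod 2 ^ Suc l < Q * 2 ^ Suc (Suc l)"
    using gather_position[of i Q 1 "2 ^ Suc l" "2 ^ Suc l" "2 ^ Suc (Suc l)"] i Z by simp
  then show "V' (Suc l * Z + i) < B"
    unfolding V'[OF i] gather_def using block_products_digit[OF N] by simp
next
  fix c assume c: "c < Z div 2 ^ Suc l"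
  then have cQ: "c < Q" using Z by simp
  define D where "D = B ^ 2 ^ l"
  have D: "B ^ 2 ^ Suc l = D * D" "2 \<le> D"
    using B self_le_power[of B "2 ^ l"] by (simp_all add: D_def power_add[symmetric] mult_2)
  let ?J = "digit_value B J (c * 2 ^ Suc l) (2 ^ Suc l)" and ?Y = "digit_value B Y (c * 2 ^ Suc (Suc l)) (2 ^ Suc l)"
    and ?N = "digit_value B N (c * 2 ^ Suc (Suc l)) (2 ^ Suc l)"
  let ?V = "\<lambda>c. digit_value B V (l * Z + c * 2 ^ l) (2 ^ l)"
  have block: "digit_value B (gather f p (2 ^ Suc (Suc l)) (2 ^ Suc l) (2 ^ Suc (Suc l))) (c * 2 ^ Suc (Suc l)) (2 ^ Suc l) =
      digit_value B f (p + c * 2 ^ Suc l) (2 ^ Suc l)" for f p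
    using digit_value_gather[of "2 ^ Suc l" "2 ^ Suc (Suc l)" B f p 1] by simp
  have "D dvd subproduct x l c' * ?V c' + 1" if "c' < 2 * Q" for c'
    using nodes_value[OF V[unfolded inverse_level_def]] that Z by (simp add: D_def)
  from this[of "2 * c"] this[of "2 * c + 1"]
  have inverse: "D dvd subproduct x l (2 * c) * ?V (2 * c) + 1" "D dvd subproduct x l (2 * c + 1) * ?V (2 * c + 1) + 1"
    using cQ by simp_all
  have J_cong: "[?J = ?V (2 * c) * ?V (2 * c + 1)] (mod D)"
    by (rule cong_dvd_modulus_nat[OF child_products_value[OF J cQ]]) (simp only: D(1) dvd_triv_left)
  have "digit_value B X (Suc l * Z + c * 2 ^ Suc l) (2 ^ Suc l) = subproduct x (Suc l) c"
    using nodes_value[OF X[unfolded product_level_def] c] .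
  then have Y_cong: "[?Y = subproduct x l (2 * c) * subproduct x l (2 * c + 1) * ?J] (mod D * D)"
    using block_products_low[OF Y cQ] unfolding block D(1) subproduct_Suc by simp
  have N_cong: "[?N = (?Y + (D * D - 2)) * ?J] (mod D * D)"
    using block_products_low[OF N cQ] B
    unfolding block D(1) digit_value_distrib by (simp add: digit_value_minus_two D(1)[symmetric])
  have "digit_value B V' (Suc l * Z + c * 2 ^ Suc l) (2 ^ Suc l) =
      digit_value B (gather N 0 (2 ^ Suc l) (2 ^ Suc (Suc l)) (2 ^ Suc l)) (c * 2 ^ Suc l) (2 ^ Suc l)"
    by (rule digit_value_cong) (use V' node_end[OF c] in \<open>simp add: add.assoc\<close>)
  also have "\<dots> = ?N" using digit_value_gather[of "2 ^ Suc l" "2 ^ Suc l" B N 0 1] by simp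
  finally show "B ^ 2 ^ Suc l dvd subproduct x (Suc l) c * digit_value B V' (Suc l * Z + c * 2 ^ Suc l) (2 ^ Suc l) + 1"
    using newton_step[OF inverse J_cong Y_cong N_cong D(2)] unfolding D(1) subproduct_Suc by simp
qed

subsection \<open>Montgomery reduction\<close>

text \<open>Adding a multiple of the modulus makes \<open>V\<close> divisible by \<open>D\<close>, a unit modulo \<open>X\<close>.\<close>

lemma montgomery_step:
  fixes V q X N b L :: nat
  assumes B: "B = 4 * b" "1 \<le> b" and D: "D = B ^ L" and L: "1 \<le> L"
    and V: "V \<le> 2 * (b ^ L * b ^ L)" and X: "X \<le> b ^ L" and q: "q < D" "[q = V * N] (mod D)" and N: "D dvd X * N + 1"
  shows "D dvd V + q * X" "V + q * X \<le> D * (2 * b ^ L)" "V + q * X < D * D"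
proof -
  have D_split: "D = 4 ^ L * b ^ L" unfolding D B by (simp add: power_mult_distrib)
  have "[V + q * X = V + V * N * X] (mod D)" using q(2) by (intro cong_add cong_mult cong_refl)
  also have "V + V * N * X = V * (X * N + 1)" by (simp add: algebra_simps)
  also have "[\<dots> = 0] (mod D)" unfolding cong_0_iff using N by (rule dvd_mult)
  finally show "D dvd V + q * X" by (simp add: cong_0_iff)
  have four: "(4::nat) \<le> 4 ^ L" using L by (intro self_le_power) auto
  have "2 * b ^ L \<le> D" unfolding D_split using four by (intro mult_right_mono) auto
  then have "2 * b ^ L * b ^ L \<le> D * b ^ L" by (rule mult_le_mono1)
  then show small: "V + q * X \<le> D * (2 * b ^ L)"
    using V mult_le_mono[OF less_imp_le[OF q(1)] X] unfolding mult.assoc mult.left_commute[of D 2] by linarith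
  have "2 * b ^ L < D" unfolding D_split using four B(2) by (simp add: less_le_trans[of 2 4])
  then have "D * (2 * b ^ L) < D * D" by simp
  with small show "V + q * X < D * D" by linarith
qed

lemma reduced_half:
  assumes T: "\<And>i. i < 2 * L \<Longrightarrow> T (p + i) < B" and U: "[digit_value B T p (2 * L) = U] (mod B ^ (2 * L))"
    and dvd: "B ^ L dvd U" and less: "U < B ^ L * B ^ L"
  shows "B ^ L * digit_value B T (p + L) L = U"
proof -
  let ?D = "B ^ L" and ?low = "digit_value B T p L"
  have "digit_value B T p (2 * L) < B ^ (2 * L)" using T by (rule digit_value_less)
  then have split: "?low + ?D * digit_value B T (p + L) L = U"
    using U less digit_value_add[of B T p L L] by (simp add: cong_def mult_2 power_add)
  then have "?D dvd ?low" using dvd by (metis dvd_add_left_iff dvd_triv_left)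
  moreover have "?low < ?D" using T by (intro digit_value_less) simp
  ultimately show ?thesis using split by (metis add_0 nat_dvd_not_less neq0_conv)
qed

lemma gcd_reduced:
  fixes D W V q X x :: nat
  assumes "D * W = V + q * X" "coprime D x" "x dvd X"
  shows "gcd W x = gcd V x"
proof -
  obtain m where X: "X = x * m" using assms(3) by (rule dvdE)
  have "gcd W x = gcd (D * W) x" using assms(2) by (simp add: gcd_mult_left_left_cancel coprime_commute)
  also have "\<dots> = gcd V x"
    unfolding assms(1) using gcd_add_mult[of x "q * m" V] by (simp add: X gcd.commute add.commute mult_ac)
  finally show ?thesis .
qed

lemma upper_half_position:
  fixes i Q n :: nat
  assumes "i < Q * n"
  shows "n + i div n * (2 * n) + i mod n < Q * (2 * n)"
proof -
  have "i div n < Q" "0 < n" using assms by (auto simp: less_mult_imp_div_less intro: gr0I)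
  then have "(i div n + 1) * (2 * n) \<le> Q * (2 * n)" "i mod n < n" by (auto intro!: mult_right_mono simp del: mult_Suc)
  then show ?thesis by simp
qed

context
  fixes B b Z Q l :: nat and x G P N V M U T W :: "nat \<Rightarrow> nat"
  assumes P: "product_level B Z x l P" and N: "inverse_level B Z x l N" and V: "residue_level B b Z x G (Suc l) V"
    and Z: "Z = Q * 2 ^ Suc l" and B: "B = 4 * b" "1 \<le> b" and x: "\<And>i. i < Z \<Longrightarrow> x i \<le> b \<and> coprime B (x i)"
    and M: "block_products B (Suc l) (2 * Q) (gather V 0 (2 ^ Suc (Suc l)) (2 ^ Suc l) (2 ^ Suc l))
       (gather N (l * Z) (2 ^ Suc l) (2 ^ l) (2 ^ Suc l)) M"
    and U: "block_products B (Suc l) (2 * Q) M (gather P (l * Z) (2 ^ Suc l) (2 ^ l) (2 ^ Suc l)) U"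
    and T: "\<And>i. i < 2 * Z \<Longrightarrow> T i =
       carried_digit B (2 ^ Suc l) (\<lambda>i. U i + gather V 0 (2 ^ Suc (Suc l)) (2 ^ Suc l) (2 ^ Suc l) i) i"
    and W: "\<And>i. i < Z \<Longrightarrow> W i = gather T (2 ^ l) (2 ^ l) (2 ^ Suc l) (2 ^ l) i"
begin

private lemma parent_value:
  "h \<le> 2 ^ Suc l \<Longrightarrow> digit_value B (gather V 0 (2 ^ Suc (Suc l)) (2 ^ Suc l) (2 ^ Suc l)) (c * 2 ^ Suc l) h =
     digit_value B V (c div 2 * 2 ^ Suc l) h"
  using digit_value_gather[of h "2 ^ Suc l" B V 0 2 "2 ^ Suc l" c] by simp

private lemma child_value:
  "digit_value B (gather f (l * Z) (2 ^ Suc l) (2 ^ l) (2 ^ Suc l)) (c * 2 ^ Suc l) (2 ^ l) =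
     digit_value B f (l * Z + c * 2 ^ l) (2 ^ l)"
  using digit_value_gather[of "2 ^ l" "2 ^ Suc l" B f "l * Z" 1 "2 ^ l" c] by simp

lemma residue_quotient:
  assumes c: "c < 2 * Q"
  defines "v \<equiv> digit_value B V (c div 2 * 2 ^ Suc l) (2 ^ Suc l)"
    and "q \<equiv> digit_value B M (c * 2 ^ Suc l) (2 ^ l)"
  shows "q < B ^ 2 ^ l" "[q = v * digit_value B N (l * Z + c * 2 ^ l) (2 ^ l)] (mod B ^ 2 ^ l)"
    "[digit_value B T (c * 2 ^ Suc l) (2 ^ Suc l) = v + q * subproduct x l c] (mod B ^ 2 ^ Suc l)"
proof -
  have pos: "c * 2 ^ Suc l + i < 2 * Q * 2 ^ Suc l" if "i < 2 ^ Suc l" for i by (rule block_position(1)[OF c that])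
  show "q < B ^ 2 ^ l" unfolding q_def using block_products_digit[OF M] pos by (intro digit_value_less) simp
  have "[digit_value B V (c div 2 * 2 ^ Suc l) (2 ^ l) = v] (mod B ^ 2 ^ l)"
    unfolding v_def using digit_value_low[of B V "c div 2 * 2 ^ Suc l" "2 ^ l" "2 ^ l"] by (simp add: mult_2 cong_sym_eq)
  then show "[q = v * digit_value B N (l * Z + c * 2 ^ l) (2 ^ l)] (mod B ^ 2 ^ l)"
    by (intro cong_trans[OF block_products_low[OF M c, folded q_def]], subst child_value, subst parent_value)
       (simp_all only: cong_scalar_right power_increasing lessI less_imp_le one_le_numeral)
  have "subproduct x l c = digit_value B P (l * Z + c * 2 ^ l) (2 ^ l)"
    using nodes_value[OF P[unfolded product_level_def]] c Z by simp
  then have U_value: "[digit_value B U (c * 2 ^ Suc l) (2 ^ Suc l) = q * subproduct x l c] (mod B ^ 2 ^ Suc l)"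
    using block_products_cong_mod[OF U c, unfolded diff_Suc_1 child_value, folded q_def] by simp
  define F where "F i = U i + gather V 0 (2 ^ Suc (Suc l)) (2 ^ Suc l) (2 ^ Suc l) i" for i
  have "digit_value B T (c * 2 ^ Suc l) (2 ^ Suc l) = digit_value B (carried_digit B (2 ^ Suc l) F) (c * 2 ^ Suc l) (2 ^ Suc l)"
    using T pos Z by (intro digit_value_cong) (simp add: F_def[abs_def])
  then have T_value: "[digit_value B T (c * 2 ^ Suc l) (2 ^ Suc l) = digit_value B F (c * 2 ^ Suc l) (2 ^ Suc l)] (mod B ^ 2 ^ Suc l)"
    using digit_value_carried[of "2 ^ Suc l" B F c] B by simp
  have "digit_value B F (c * 2 ^ Suc l) (2 ^ Suc l) = digit_value B U (c * 2 ^ Suc l) (2 ^ Suc l) + v"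
    unfolding F_def[abs_def] digit_value_distrib v_def by (simp only: parent_value order_refl)
  with cong_trans[OF T_value] cong_add[OF U_value cong_refl[of v]]
  show "[digit_value B T (c * 2 ^ Suc l) (2 ^ Suc l) = v + q * subproduct x l c] (mod B ^ 2 ^ Suc l)"
    by (simp only: add.commute)
qed

lemma residue_reduced:
  assumes c: "c < 2 * Q"
  obtains q where "B ^ 2 ^ l * digit_value B W (c * 2 ^ l) (2 ^ l) =
      digit_value B V (c div 2 * 2 ^ Suc l) (2 ^ Suc l) + q * subproduct x l c"
    "digit_value B W (c * 2 ^ l) (2 ^ l) \<le> 2 * b ^ 2 ^ l"
proof -
  let ?v = "digit_value B V (c div 2 * 2 ^ Suc l) (2 ^ Suc l)" and ?q = "digit_value B M (c * 2 ^ Suc l) (2 ^ l)"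
  have c_end: "c * 2 ^ l + 2 ^ l \<le> Z" using node_end[of c Z "2 ^ l"] c Z by simp
  have twice: "(2::nat) ^ Suc l = 2 * 2 ^ l" by simp
  have "?v \<le> 2 * b ^ 2 ^ Suc l"
    using nodes_value[OF V[unfolded residue_level_def], of "c div 2"] c Z by simp
  then have v: "?v \<le> 2 * (b ^ 2 ^ l * b ^ 2 ^ l)" by (simp add: mult_2 power_add)
  have X: "subproduct x l c \<le> b ^ 2 ^ l" using x c_end by (intro subproduct_le) simp
  have inverse: "B ^ 2 ^ l dvd subproduct x l c * digit_value B N (l * Z + c * 2 ^ l) (2 ^ l) + 1"
    using nodes_value[OF N[unfolded inverse_level_def]] c Z by simp
  note reduction = montgomery_step[OF B refl _ v X residue_quotient(1,2)[OF c] inverse]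
  have "T (c * 2 ^ Suc l + i) < B" if "i < 2 * 2 ^ l" for i
    using T block_position(1)[OF c, of i "Suc l"] that Z B by (simp add: carried_digit_def)
  then have half: "B ^ 2 ^ l * digit_value B T (c * 2 ^ Suc l + 2 ^ l) (2 ^ l) = ?v + ?q * subproduct x l c"
    using residue_quotient(3)[OF c] reduction(1,3) by (intro reduced_half) (simp_all only: twice[symmetric], simp_all)
  have "digit_value B W (c * 2 ^ l) (2 ^ l) = digit_value B (gather T (2 ^ l) (2 ^ l) (2 ^ Suc l) (2 ^ l)) (c * 2 ^ l) (2 ^ l)"
    by (rule digit_value_cong) (use W c_end in simp)
  also have "\<dots> = digit_value B T (c * 2 ^ Suc l + 2 ^ l) (2 ^ l)"
    using digit_value_gather[of "2 ^ l" "2 ^ l" B T "2 ^ l" 1 "2 ^ Suc l" c] by (simp add: add.commute)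
  finally have W_value: "B ^ 2 ^ l * digit_value B W (c * 2 ^ l) (2 ^ l) = ?v + ?q * subproduct x l c" using half by simp
  moreover have "digit_value B W (c * 2 ^ l) (2 ^ l) \<le> 2 * b ^ 2 ^ l"
    using reduction(2)[folded W_value] B by simp
  ultimately show thesis by (rule that)
qed

lemma residue_level_pred: "residue_level B b Z x G l W"
  unfolding residue_level_def nodes_def
proof (intro conjI allI impI)
  fix i assume i: "i < Z"
  have "2 ^ l + i div 2 ^ l * (2 * 2 ^ l) + i mod 2 ^ l < 2 * Z" using upper_half_position[of i "2 * Q" "2 ^ l"] i Z by simp
  then show "W (0 + i) < B" using T W[OF i] B by (simp add: gather_def carried_digit_def)
next
  fix c assume "c < Z div 2 ^ l"
  then have c: "c < 2 * Q" and c_end: "c * 2 ^ l + 2 ^ l \<le> Z" using Z node_end[of c Z "2 ^ l"] by simp_all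
  from residue_reduced[OF c] obtain q where q: "B ^ 2 ^ l * digit_value B W (c * 2 ^ l) (2 ^ l) =
      digit_value B V (c div 2 * 2 ^ Suc l) (2 ^ Suc l) + q * subproduct x l c"
    and "digit_value B W (c * 2 ^ l) (2 ^ l) \<le> 2 * b ^ 2 ^ l" .
  then show "digit_value B W (0 + c * 2 ^ l) (2 ^ l) \<le> 2 * b ^ 2 ^ l" by simp
  fix j assume j: "j < (2::nat) ^ l"
  let ?j = "c mod 2 * 2 ^ l + j"
  have "c mod 2 * 2 ^ l \<le> 1 * (2::nat) ^ l" by (intro mult_right_mono) auto
  then have "?j < 2 ^ Suc l" using j unfolding power_Suc by linarith
  moreover have "c div 2 * 2 ^ Suc l + ?j = (c div 2 * 2 + c mod 2) * 2 ^ l + j"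
    by (simp only: power_Suc distrib_right mult.assoc add.assoc)
  then have "c div 2 * 2 ^ Suc l + ?j = c * 2 ^ l + j" by (simp only: div_mult_mod_eq)
  ultimately have "gcd (digit_value B V (c div 2 * 2 ^ Suc l) (2 ^ Suc l)) (x (c * 2 ^ l + j)) = G (c * 2 ^ l + j)"
    using nodes_value[OF V[unfolded residue_level_def], of "c div 2"] c Z
    by (metis add_0 less_mult_imp_div_less mult.commute nonzero_mult_div_cancel_right power_not_zero zero_neq_numeral)
  moreover have "gcd (digit_value B W (c * 2 ^ l) (2 ^ l)) (x (c * 2 ^ l + j)) =
      gcd (digit_value B V (c div 2 * 2 ^ Suc l) (2 ^ Suc l)) (x (c * 2 ^ l + j))"
    by (rule gcd_reduced[OF q]) (use x j c_end in \<open>simp_all add: dvd_subproduct\<close>)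
  ultimately show "gcd (digit_value B W (0 + c * 2 ^ l) (2 ^ l)) (x (c * 2 ^ l + j)) = G (c * 2 ^ l + j)" by simp
qed

end

subsection \<open>The programs\<close>

abbreviation (input) "ZV \<equiv> 25 :: nat"
abbreviation (input) "lV \<equiv> 29 :: nat"
abbreviation (input) "lenV \<equiv> 30 :: nat"
abbreviation (input) "offV \<equiv> 31 :: nat"
abbreviation (input) "next_offV \<equiv> 32 :: nat"

abbreviation (input) "productA \<equiv> 4 :: nat"
abbreviation (input) "inverseA \<equiv> 5 :: nat"
abbreviation (input) "residueA \<equiv> 6 :: nat"
abbreviation (input) "newtonA \<equiv> 7 :: nat"

abbreviation "len2 \<equiv> Cst 2 [*] Var lenV"
abbreviation "len4 \<equiv> Cst 4 [*] Var lenV"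

definition gather_expr :: "nat \<Rightarrow> expr \<Rightarrow> expr \<Rightarrow> expr \<Rightarrow> expr \<Rightarrow> expr" where
  "gather_expr a p d m n = Arr a (p [+] ix [div] d [*] m [+] ix [mod] n)"

definition children_code :: "nat \<Rightarrow> com" where
  "children_code a = block [offV ::= Var lV [*] Var ZV, next_offV ::= Var offV [+] Var ZV, kV ::= Var lV [+] Cst 1, NV ::= Var ZV] ;;
     mult_exprs_code (Arr a (Var offV [+] ix)) (Arr a (Var offV [+] ix [+] Var lenV))"

definition product_level_code :: "nat \<Rightarrow> com" where
  "product_level_code a = children_code a ;; map_loop_at a next_offV ZV (Arr resultA ix)"

definition newton_init_code :: com where
  "newton_init_code = children_code inverseA ;; map_loop newtonA ZV (Arr resultA ix) ;;
     block [kV ::= Var lV [+] Cst 2, NV ::= Cst 2 [*] Var ZV]"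

abbreviation "minus_two_expr \<equiv>
  Ite (ix [mod] len4) (Cst 1) (Arr resultA ix [+] Var BV [-] Cst 2) (Arr resultA ix [+] Var BV [-] Cst 1)"

definition newton_code :: com where
  "newton_code = mult_exprs_code (gather_expr productA (Var next_offV) len4 len2 len4) (gather_expr newtonA (Cst 0) len4 len2 len4) ;;
     mult_exprs_code minus_two_expr (gather_expr newtonA (Cst 0) len4 len2 len4)"

definition inverse_level_code :: com where
  "inverse_level_code = newton_init_code ;; newton_code ;;
     map_loop_at inverseA next_offV ZV (gather_expr resultA (Cst 0) len2 len4 len2)"

abbreviation "parent_expr \<equiv> gather_expr residueA (Cst 0) len4 len2 len2"

abbreviation child_expr :: "nat \<Rightarrow> expr" where
  "child_expr a \<equiv> gather_expr a (Var offV) len2 (Var lenV) len2"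

definition residue_products_code :: com where
  "residue_products_code = block [offV ::= Var lV [*] Var ZV, kV ::= Var lV [+] Cst 1, NV ::= Cst 2 [*] Var ZV] ;;
     mult_exprs_code parent_expr (child_expr inverseA) ;; mult_exprs_code (Arr resultA ix) (child_expr productA)"

definition residue_sum_code :: com where
  "residue_sum_code = map_loop leftA NV (Arr resultA ix [+] parent_expr) ;; block [block_lenV ::= len2] ;; carry_code leftA"

definition residue_level_code :: com where
  "residue_level_code = residue_products_code ;; residue_sum_code ;;
     map_loop residueA ZV (gather_expr resultA (Var lenV) (Var lenV) len2 (Var lenV))"

definition tree_time :: "nat \<Rightarrow> nat \<Rightarrow> nat" where
  "tree_time l Z = mult_time (l + 2) (2 * Z)"

lemma mult_time_mono: "k \<le> k' \<Longrightarrow> N \<le> N' \<Longrightarrow> mult_time k N \<le> mult_time k' N'"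
  unfolding mult_time_def by (intro mult_le_mono power_mono add_mono) auto

lemma sibling_position:
  fixes i Q l :: nat
  assumes "i < Q * 2 ^ Suc l" "i mod 2 ^ Suc l < 2 ^ l"
  shows "i + 2 ^ l < Q * 2 ^ Suc l"
proof -
  have "i div 2 ^ Suc l < Q" using assms(1) by (rule less_mult_imp_div_less)
  then have "i div 2 ^ Suc l * 2 ^ Suc l + (i mod 2 ^ Suc l + 2 ^ l) < Q * 2 ^ Suc l"
    using assms(2) by (intro block_index_less) auto
  then show ?thesis by (simp only: add.assoc[symmetric] div_mult_mod_eq)
qed

lemma tree_time_ge: "2 * Z + 1 \<le> tree_time l Z"
proof -
  have "1 * (2 * Z + 2 ^ (l + 2) + 1) \<le> tree_time l Z"
    unfolding tree_time_def mult_time_def by (intro mult_right_mono one_le_power) auto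
  then show ?thesis by (rule order_trans[rotated]) simp
qed

context ram
begin

definition at_level :: "nat \<Rightarrow> nat \<Rightarrow> nat \<Rightarrow> nat \<Rightarrow> astate \<Rightarrow> bool" where
  "at_level l Z Q B sg \<longleftrightarrow> var sg lV = l \<and> var sg ZV = Z \<and> var sg lenV = 2 ^ l \<and> var sg BV = B \<and>
     Q * 2 ^ Suc l = Z \<and> 2 \<le> B \<and> fits (l + 2) (2 * Z) B"

lemma at_level_frame: "at_level l Z Q B sg \<Longrightarrow> frame b Y sg sg' \<Longrightarrow> 31 \<le> b \<Longrightarrow> at_level l Z Q B sg'"
  by (simp add: at_level_def frame_var)

lemma at_level_regs:
  assumes "at_level l Z Q B sg"
  shows "var sg lV = l" "var sg ZV = Z" "var sg lenV = 2 ^ l" "var sg BV = B"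
  using assms by (auto simp: at_level_def)

lemma at_levelD:
  assumes "at_level l Z Q B sg"
  shows "Z = Q * 2 ^ Suc l" "2 \<le> B" "(l + 2) * Z < S" "2 * Z < S" "8 * 2 ^ (l + 2) \<le> S" "8 * (l + 2) \<le> 2 * S" "8 * B \<le> S"
    "fits (Suc l) Z B" "fits (Suc l) (2 * Z) B"
proof -
  have fits: "fits (l + 2) (2 * Z) B" and B: "2 \<le> B" using assms by (auto simp: at_level_def)
  note fD = fitsD[OF fits _ B]
  show "Z = Q * 2 ^ Suc l" "2 \<le> B" using assms by (auto simp: at_level_def)
  show "(l + 2) * Z < S" "2 * Z < S" using fD(3) by (auto simp: algebra_simps)
  show "8 * 2 ^ (l + 2) \<le> S" "8 * (l + 2) \<le> 2 * S" "8 * B \<le> S" using fD by simp_all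
  show "fits (Suc l) Z B" "fits (Suc l) (2 * Z) B" using fits_mono[OF fits] by auto
qed

lemma at_level_position:
  assumes "at_level l Z Q B sg" "i < Z"
  shows "i < S" "l * Z + i < S" "Suc l * Z + i < S"
  using at_levelD(3)[OF assms(1)] assms(2) by (auto simp: algebra_simps)

lemma computes_children:
  assumes at: "at_level l Z Q B sg" and a: "a < 8" and digits: "\<And>i. i < Z \<Longrightarrow> arr sg a (l * Z + i) \<le> 2 * B"
  shows "computes (children_code a) (260000 * tree_time l Z) 31 {8..13} sg
    (\<lambda>sg'. child_products B l Q (l * Z) (arr sg a) (arr sg' resultA) \<and> var sg' next_offV = Suc l * Z)"
proof -
  note atD = at_levelD[OF at] and regs = at_level_regs[OF at]
  let ?init = "[offV ::= Var lV [*] Var ZV, next_offV ::= Var offV [+] Var ZV, kV ::= Var lV [+] Cst 1, NV ::= Var ZV]"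
  obtain sg1 where init: "run (block ?init) 20 sg sg1"
    "var sg1 = (var sg)(offV := l * Z, next_offV := Suc l * Z, kV := Suc l, NV := Z)" "arr sg1 = arr sg"
    by (rule that[OF run_block]) (use regs atD(3,6) in \<open>auto simp: block_cost_def algebra_simps\<close>)
  have fr1: "frame 31 {8..13} sg sg1" using init by (simp add: frame_def)
  obtain sg2 where mult: "run (mult_exprs_code (Arr a (Var offV [+] ix)) (Arr a (Var offV [+] ix [+] Var lenV)))
      (250000 * mult_time (Suc l) Z) sg1 sg2"
    "frame 35 {8..13} sg1 sg2" "child_products B l Q (l * Z) (arr sg a) (arr sg2 resultA)"
  proof (rule computesE[OF computes_mult_exprs[where sg = sg1 and k = "Suc l" and N = Z and P = Q and B = B]])
    fix i sg' assume i: "i < Z" "i mod 2 ^ Suc l < 2 ^ (Suc l - 1)" and fr: "frame 35 {leftA} sg1 sg'"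
    have "i + 2 ^ l < Z" using sibling_position[of i Q l] i atD(1) by simp
    then show "safe (set_var iV i sg') (Arr a (Var offV [+] ix)) \<and>
        ev (set_var iV i sg') (Arr a (Var offV [+] ix)) = arr sg a (l * Z + i) \<and> arr sg a (l * Z + i) \<le> 2 * B"
      and "safe (set_var iV i sg') (Arr a (Var offV [+] ix [+] Var lenV)) \<and>
        ev (set_var iV i sg') (Arr a (Var offV [+] ix [+] Var lenV)) = arr sg a (l * Z + i + 2 ^ l) \<and> arr sg a (l * Z + i + 2 ^ l) \<le> 2 * B"
      using init fr i a regs at_level_position[OF at] digits[of i] digits[of "i + 2 ^ l"] by (auto simp: frame_var frame_arr add.assoc)
  qed (use init regs atD a in auto)
  have "mult_time (Suc l) Z \<le> tree_time l Z" unfolding tree_time_def by (rule mult_time_mono) auto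
  then have "20 + 250000 * mult_time (Suc l) Z \<le> 260000 * tree_time l Z" using tree_time_ge[of Z l] by linarith
  then show ?thesis unfolding children_code_def
    by (rule computesI[OF run_Seq[OF init(1) mult(1)]]) (use init fr1 mult in \<open>auto simp: frame_def\<close>)
qed

lemma computes_product_level:
  assumes at: "at_level l Z Q B sg" and B: "B = 4 * b" "1 \<le> b" and x: "\<And>i. i < Z \<Longrightarrow> x i \<le> b" and a: "a < 8"
    and X: "product_level B Z x l (arr sg a)"
  shows "computes (product_level_code a) (300000 * tree_time l Z) 31 ({8..13} \<union> {a}) sg
    (\<lambda>sg'. product_level B Z x (Suc l) (arr sg' a) \<and> (\<forall>i<Suc l * Z. arr sg' a i = arr sg a i))"
proof -
  note atD = at_levelD[OF at] and regs = at_level_regs[OF at]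
  have digits: "arr sg a (l * Z + i) \<le> 2 * B" if "i < Z" for i
    using nodes_digit[OF X[unfolded product_level_def] that] by simp
  obtain sg1 where children: "run (children_code a) (260000 * tree_time l Z) sg sg1" "frame 31 {8..13} sg sg1"
    "child_products B l Q (l * Z) (arr sg a) (arr sg1 resultA)" "var sg1 next_offV = Suc l * Z"
    by (rule computesE[OF computes_children[OF at a digits]]) auto
  obtain sg2 where copy: "run (map_loop_at a next_offV ZV (Arr resultA ix)) (500 * (Z + 1)) sg1 sg2" "frame 59 {a} sg1 sg2"
    "arr sg2 a = overwrite (Suc l * Z) Z (arr sg1 resultA) (arr sg a)"
    by (rule computesE[OF computes_map_at[of next_offV ZV sg1 Z "Suc l * Z" a "Arr resultA ix"]])
       (use frame_var[OF children(2)] frame_arr[OF children(2)] children(4) regs atD(3) a in \<open>auto simp: algebra_simps\<close>)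
  have "product_level B Z x (Suc l) (arr sg2 a)"
    by (rule product_level_Suc[OF X atD(1) B x children(3)]) (simp_all add: copy(3))
  moreover have "260000 * tree_time l Z + 500 * (Z + 1) \<le> 300000 * tree_time l Z" using tree_time_ge[of Z l] by simp
  ultimately show ?thesis unfolding product_level_code_def
    by (intro computesI[OF run_Seq[OF children(1) copy(1)]])
       (use children(2) copy in \<open>auto simp: frame_def overwrite_outside\<close>)
qed

lemma computes_newton_init:
  assumes at: "at_level l Z Q B sg" and V: "inverse_level B Z x l (arr sg inverseA)"
  shows "computes newton_init_code (270000 * tree_time l Z) 31 ({8..13} \<union> {newtonA}) sg
    (\<lambda>sg'. child_products B l Q (l * Z) (arr sg inverseA) (arr sg' newtonA) \<and>
       var sg' next_offV = Suc l * Z \<and> var sg' kV = l + 2 \<and> var sg' NV = 2 * Z)"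
proof -
  note atD = at_levelD[OF at]
  have digits: "arr sg inverseA (l * Z + i) \<le> 2 * B" if "i < Z" for i
    using nodes_digit[OF V[unfolded inverse_level_def] that] by simp
  obtain sg1 where children: "run (children_code inverseA) (260000 * tree_time l Z) sg sg1" "frame 31 {8..13} sg sg1"
    "child_products B l Q (l * Z) (arr sg inverseA) (arr sg1 resultA)" "var sg1 next_offV = Suc l * Z"
    by (rule computesE[OF computes_children[OF at _ digits]]) auto
  note regs = at_level_regs[OF at_level_frame[OF at children(2) order_refl]]
  obtain sg2 where copy: "run (map_loop newtonA ZV (Arr resultA ix)) (500 * (Z + 1)) sg1 sg2" "frame 59 {newtonA} sg1 sg2"
    "\<forall>i. arr sg2 newtonA i = (if i < Z then arr sg1 resultA i else arr sg1 newtonA i)"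
    by (rule computesE[OF computes_map[of ZV sg1 Z newtonA "Arr resultA ix"]]) (use regs atD(4) in auto)
  let ?init = "[kV ::= Var lV [+] Cst 2, NV ::= Cst 2 [*] Var ZV]"
  obtain sg3 where init: "run (block ?init) 10 sg2 sg3" "var sg3 = (var sg2)(kV := l + 2, NV := 2 * Z)" "arr sg3 = arr sg2"
    by (rule that[OF run_block]) (use regs frame_var[OF copy(2)] atD(4,6) in \<open>auto simp: block_cost_def\<close>)
  have "child_products B l Q (l * Z) (arr sg inverseA) (arr sg3 newtonA)"
    by (rule block_products_cong[OF children(3)]) (use copy(3) init(3) atD(1) in simp)
  moreover have "260000 * tree_time l Z + (500 * (Z + 1) + 10) \<le> 270000 * tree_time l Z" using tree_time_ge[of Z l] by simp
  ultimately show ?thesis unfolding newton_init_code_def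
    by (intro computesI[OF run_Seq[OF children(1) run_Seq[OF copy(1) init(1)]]])
       (use children(2,4) copy(2) init in \<open>auto simp: frame_def\<close>)
qed

lemma padded_operand:
  assumes at: "at_level l Z Q B sg" and i: "i < 2 * Z" "i mod 2 ^ Suc (Suc l) < 2 ^ (Suc (Suc l) - 1)"
    and offset: "safe (set_var iV i sg) e" "ev (set_var iV i sg) e = p" "small (set_var iV i sg) e" "mag e \<le> 2" "p + Z \<le> S"
    and a: "a < 30" and digits: "\<And>i. i < Z \<Longrightarrow> arr sg a (p + i) < B"
  defines "f \<equiv> gather (arr sg a) p (2 ^ Suc (Suc l)) (2 ^ Suc l) (2 ^ Suc (Suc l))"
  shows "safe (set_var iV i sg) (gather_expr a e len4 len2 len4)" "ev (set_var iV i sg) (gather_expr a e len4 len2 len4) = f i" "f i \<le> 2 * B"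
proof -
  have position: "i div 2 ^ Suc (Suc l) * 2 ^ Suc l + i mod 2 ^ Suc (Suc l) < Z"
    using gather_position[of i Q 1 "2 ^ Suc (Suc l)" "2 ^ Suc l" "2 ^ Suc l"] i at_levelD(1)[OF at] by simp
  show "safe (set_var iV i sg) (gather_expr a e len4 len2 len4)" "ev (set_var iV i sg) (gather_expr a e len4 len2 len4) = f i" "f i \<le> 2 * B"
    using position digits[OF position] offset a at_level_regs[OF at] by (simp_all add: f_def gather_expr_def gather_def add.assoc)
qed

lemma minus_two_operand:
  assumes at: "at_level l Z Q B sg" and i: "i < 2 * Z" "arr sg resultA i < B"
  shows "safe (set_var iV i sg) minus_two_expr"
    "ev (set_var iV i sg) minus_two_expr = arr sg resultA i + minus_two_digit B (2 ^ Suc (Suc l)) i"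
    "arr sg resultA i + minus_two_digit B (2 ^ Suc (Suc l)) i \<le> 2 * B"
  using i at_level_regs[OF at] at_levelD(2,4,7)[OF at] by (auto simp: minus_two_digit_def)

lemma computes_newton:
  assumes at: "at_level l Z Q B sg" and regs: "var sg next_offV = Suc l * Z" "var sg kV = l + 2" "var sg NV = 2 * Z"
    and digits: "\<And>i. i < Z \<Longrightarrow> arr sg productA (Suc l * Z + i) < B" "\<And>i. i < Z \<Longrightarrow> arr sg newtonA i < B"
  defines "X \<equiv> gather (arr sg productA) (Suc l * Z) (2 ^ Suc (Suc l)) (2 ^ Suc l) (2 ^ Suc (Suc l))"
    and "J \<equiv> gather (arr sg newtonA) 0 (2 ^ Suc (Suc l)) (2 ^ Suc l) (2 ^ Suc (Suc l))"
  shows "computes newton_code (500000 * tree_time l Z) 35 {8..13} sg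
    (\<lambda>sg'. \<exists>Y. block_products B (Suc (Suc l)) Q X J Y \<and>
       block_products B (Suc (Suc l)) Q (\<lambda>i. Y i + minus_two_digit B (2 ^ Suc (Suc l)) i) J (arr sg' resultA))"
proof -
  let ?eX = "gather_expr productA (Var next_offV) len4 len2 len4" and ?eJ = "gather_expr newtonA (Cst 0) len4 len2 len4"
  note atD = at_levelD[OF at] and vars = at_level_regs[OF at] regs
  have at': "at_level l Z Q B sg'" "var sg' next_offV = Suc l * Z" "arr sg' productA = arr sg productA" "arr sg' newtonA = arr sg newtonA"
    if "frame 35 {8..13} sg sg'" for sg'
    using at_level_frame[OF at that] regs(1) frame_var[OF that] frame_arr[OF that] by simp_all
  have ends: "Suc l * Z + Z \<le> S" "0 + Z \<le> S" using atD(3) by simp_all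
  have eJ: "safe (set_var iV i sg') ?eJ \<and> ev (set_var iV i sg') ?eJ = J i \<and> J i \<le> 2 * B"
    if "frame 35 {8..13} sg sg'" "i < 2 * Z" "i mod 2 ^ Suc (Suc l) < 2 ^ (Suc (Suc l) - 1)" for i sg'
    using padded_operand[OF at'(1)[OF that(1)] that(2,3), of "Cst 0" 0 newtonA] digits(2) ends(2) at'[OF that(1)] unfolding J_def by simp
  have eX: "safe (set_var iV i sg') ?eX \<and> ev (set_var iV i sg') ?eX = X i \<and> X i \<le> 2 * B"
    if "frame 35 {8..13} sg sg'" "i < 2 * Z" "i mod 2 ^ Suc (Suc l) < 2 ^ (Suc (Suc l) - 1)" for i sg'
    using padded_operand[OF at'(1)[OF that(1)] that(2,3), of "Var next_offV" "Suc l * Z" productA] digits(1) ends(1) at'[OF that(1)]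
    unfolding X_def by simp
  have static: "cost ?eX \<le> 300" "cost ?eJ \<le> 300" "cost minus_two_expr \<le> 300" "arrays ?eX = {productA}" "arrays ?eJ = {newtonA}"
    "arrays minus_two_expr = {resultA}"
    by (simp_all add: gather_expr_def)
  have fr: "frame 35 {8..13} sg sg'" if "frame 35 {leftA} sg sg'" for sg' using that by (rule frame_mono) auto
  have fits: "fits (Suc (Suc l)) (2 * Z) B" "2 * Z = Q * 2 ^ Suc (Suc l)" using at by (auto simp: at_level_def)
  note mult = computes_mult_exprs[OF _ _ _ _ fits(2) atD(2) fits(1)]
  obtain sg1 where first: "run (mult_exprs_code ?eX ?eJ) (250000 * mult_time (Suc (Suc l)) (2 * Z)) sg sg1" "frame 35 {8..13} sg sg1"
    "block_products B (Suc (Suc l)) Q X J (arr sg1 resultA)"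
    by (rule computesE[OF mult[where sg = sg and e = ?eX and e' = ?eJ and f = X and f' = J]])
       (rule eX eJ | erule fr | assumption | simp add: vars static)+
  let ?Y = "\<lambda>i. arr sg1 resultA i + minus_two_digit B (2 ^ Suc (Suc l)) i"
  have fr1: "frame 35 {8..13} sg sg'" if "frame 35 {leftA} sg1 sg'" for sg' by (rule frame_trans[OF first(2) frame_mono[OF that]]) auto
  have eY: "safe (set_var iV i sg') minus_two_expr \<and> ev (set_var iV i sg') minus_two_expr = ?Y i \<and> ?Y i \<le> 2 * B"
    if "i < 2 * Z" "frame 35 {leftA} sg1 sg'" for i sg'
    using minus_two_operand[OF at'(1)[OF fr1[OF that(2)]] that(1)] block_products_digit[OF first(3)] that fits(2) by (simp add: frame_arr)
  obtain sg2 where second: "run (mult_exprs_code minus_two_expr ?eJ) (250000 * mult_time (Suc (Suc l)) (2 * Z)) sg1 sg2" "frame 35 {8..13} sg1 sg2"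
    "block_products B (Suc (Suc l)) Q ?Y J (arr sg2 resultA)"
    by (rule computesE[OF mult[where sg = sg1 and e = minus_two_expr and e' = ?eJ and f = ?Y and f' = J]])
       (rule eY eJ | erule fr1 | assumption | simp add: vars frame_var[OF first(2)] static)+
  show ?thesis unfolding newton_code_def
    by (rule computesI[OF run_Seq[OF first(1) second(1)]])
       (use first second frame_trans[OF first(2)] in \<open>auto simp: tree_time_def\<close>)
qed

lemma computes_inverse_level:
  assumes at: "at_level l Z Q B sg" and X: "product_level B Z x (Suc l) (arr sg productA)" and V: "inverse_level B Z x l (arr sg inverseA)"
  shows "computes inverse_level_code (800000 * tree_time l Z) 31 ({8..13} \<union> {inverseA, newtonA}) sg
    (\<lambda>sg'. inverse_level B Z x (Suc l) (arr sg' inverseA) \<and> (\<forall>i<Suc l * Z. arr sg' inverseA i = arr sg inverseA i))"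
proof -
  note atD = at_levelD[OF at]
  obtain sg1 where init: "run newton_init_code (270000 * tree_time l Z) sg sg1" "frame 31 ({8..13} \<union> {newtonA}) sg sg1"
    and J: "child_products B l Q (l * Z) (arr sg inverseA) (arr sg1 newtonA)"
    and offs: "var sg1 next_offV = Suc l * Z" "var sg1 kV = l + 2" "var sg1 NV = 2 * Z"
    by (rule computesE[OF computes_newton_init[OF at V]]) auto
  have at1: "at_level l Z Q B sg1" by (rule at_level_frame[OF at init(2) order_refl])
  have same: "arr sg1 productA = arr sg productA" "arr sg1 inverseA = arr sg inverseA" using frame_arr[OF init(2)] by simp_all
  obtain sg2 Y where newton: "run newton_code (500000 * tree_time l Z) sg1 sg2" "frame 35 {8..13} sg1 sg2"
    and Y: "block_products B (Suc (Suc l)) Q (gather (arr sg productA) (Suc l * Z) (2 ^ Suc (Suc l)) (2 ^ Suc l) (2 ^ Suc (Suc l)))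
       (gather (arr sg1 newtonA) 0 (2 ^ Suc (Suc l)) (2 ^ Suc l) (2 ^ Suc (Suc l))) Y"
     "block_products B (Suc (Suc l)) Q (\<lambda>i. Y i + minus_two_digit B (2 ^ Suc (Suc l)) i)
       (gather (arr sg1 newtonA) 0 (2 ^ Suc (Suc l)) (2 ^ Suc l) (2 ^ Suc (Suc l))) (arr sg2 resultA)"
    by (rule computesE[OF computes_newton[OF at1 offs]])
       (use nodes_digit[OF X[unfolded product_level_def]] block_products_digit[OF J] atD(1) in \<open>auto simp only: same\<close>)
  let ?e = "gather_expr resultA (Cst 0) len2 len4 len2"
  have at2: "at_level l Z Q B sg2" by (rule at_level_frame[OF at1 newton(2)]) simp
  have pos: "i div 2 ^ Suc l * 2 ^ Suc (Suc l) + i mod 2 ^ Suc l < S" if "i < Z" for i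
    using gather_position[of i Q 1 "2 ^ Suc l" "2 ^ Suc l" "2 ^ Suc (Suc l)"] that atD(1,4) by simp
  obtain sg3 where result: "run (map_loop_at inverseA next_offV ZV ?e) (500 * (Z + 1)) sg2 sg3" "frame 59 {inverseA} sg2 sg3"
    "arr sg3 inverseA = overwrite (Suc l * Z) Z (\<lambda>i. ev (set_var iV i sg2) ?e) (arr sg2 inverseA)"
    by (rule computesE[OF computes_map_at[of next_offV ZV sg2 Z "Suc l * Z" inverseA ?e]])
       (use frame_var[OF newton(2)] offs at_level_regs[OF at2] pos atD(3,4) in \<open>auto simp: gather_expr_def algebra_simps\<close>)
  have "inverse_level B Z x (Suc l) (arr sg3 inverseA)"
    by (rule inverse_level_Suc[OF X V atD(1,2) J Y])
       (use result(3) at_level_regs[OF at2] in \<open>simp add: gather_expr_def gather_def\<close>)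
  moreover have "270000 * tree_time l Z + (500000 * tree_time l Z + 500 * (Z + 1)) \<le> 800000 * tree_time l Z"
    using tree_time_ge[of Z l] by simp
  ultimately show ?thesis unfolding inverse_level_code_def
    by (intro computesI[OF run_Seq[OF init(1) run_Seq[OF newton(1) result(1)]]])
       (use init(2) newton(2) result(2,3) in \<open>auto simp: frame_def overwrite_outside\<close>)
qed

context
  fixes sg :: astate and l Z Q B b :: nat and x G :: "nat \<Rightarrow> nat"
  assumes at: "at_level l Z Q B sg" and P: "product_level B Z x l (arr sg productA)" and N: "inverse_level B Z x l (arr sg inverseA)"
    and V: "residue_level B b Z x G (Suc l) (arr sg residueA)"
begin

abbreviation (input) "parents \<equiv> gather (arr sg residueA) 0 (2 ^ Suc (Suc l)) (2 ^ Suc l) (2 ^ Suc l)"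

abbreviation (input) children :: "nat \<Rightarrow> nat \<Rightarrow> nat" where
  "children a \<equiv> gather (arr sg a) (l * Z) (2 ^ Suc l) (2 ^ l) (2 ^ Suc l)"

lemma parent_expr_value:
  assumes "frame 31 {8..13} sg sg'" "i < 2 * Z"
  shows "safe (set_var iV i sg') parent_expr" "ev (set_var iV i sg') parent_expr = parents i" "parents i < B"
proof -
  note atD = at_levelD[OF at]
  have "i mod 2 ^ Suc l < 2 ^ Suc l" by simp
  then have pos: "i div 2 ^ Suc (Suc l) * 2 ^ Suc l + i mod 2 ^ Suc l < Z"
    using gather_position[of i Q 2 "2 ^ Suc l" "2 ^ Suc l" "2 ^ Suc l"] assms(2) atD(1) by simp
  show "safe (set_var iV i sg') parent_expr" "ev (set_var iV i sg') parent_expr = parents i"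
    using pos atD(4) assms(1) at_level_regs[OF at] by (simp_all add: gather_expr_def gather_def frame_var frame_arr)
  show "parents i < B" using nodes_digit[OF V[unfolded residue_level_def] pos] by (simp add: gather_def)
qed

lemma child_expr_value:
  assumes fr: "frame 31 {8..13} sg sg'" and off: "var sg' offV = l * Z" and i: "i < 2 * Z" "i mod 2 ^ Suc l < 2 ^ (Suc l - 1)"
    and a: "a = productA \<or> a = inverseA"
  shows "safe (set_var iV i sg') (child_expr a) \<and> ev (set_var iV i sg') (child_expr a) = children a i \<and> children a i \<le> 2 * B"
proof -
  have pos: "i div 2 ^ Suc l * 2 ^ l + i mod 2 ^ Suc l < Z"
    using gather_position[of i "2 * Q" 1 "2 ^ Suc l" "2 ^ l" "2 ^ l"] i at_levelD(1)[OF at] by simp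
  have "children a i < B"
    using a nodes_digit[OF P[unfolded product_level_def] pos] nodes_digit[OF N[unfolded inverse_level_def] pos]
    by (auto simp: gather_def add.assoc)
  then show ?thesis using at_level_position(2)[OF at pos] fr off a at_level_regs[OF at]
    by (auto simp: gather_expr_def gather_def frame_var frame_arr add.assoc)
qed

lemma computes_residue_products:
  "computes residue_products_code (510000 * tree_time l Z) 31 {8..13} sg
    (\<lambda>sg'. var sg' NV = 2 * Z \<and> (\<exists>M. block_products B (Suc l) (2 * Q) parents (children inverseA) M \<and>
       block_products B (Suc l) (2 * Q) M (children productA) (arr sg' resultA)))"
proof -
  note atD = at_levelD[OF at] and regs = at_level_regs[OF at]
  let ?init = "[offV ::= Var lV [*] Var ZV, kV ::= Var lV [+] Cst 1, NV ::= Cst 2 [*] Var ZV]"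
  obtain sg1 where init: "run (block ?init) 20 sg sg1" "var sg1 = (var sg)(offV := l * Z, kV := Suc l, NV := 2 * Z)" "arr sg1 = arr sg"
    by (rule that[OF run_block]) (use regs atD(3,4,6) in \<open>auto simp: block_cost_def algebra_simps\<close>)
  have digits: "2 * Z = 2 * Q * 2 ^ Suc l" using atD(1) by simp
  note mult = computes_mult_exprs[OF _ _ _ _ digits atD(2,9)]
  have static: "cost parent_expr \<le> 300" "arrays parent_expr = {residueA}" "cost (child_expr a) \<le> 300" "arrays (child_expr a) = {a}" for a
    by (simp_all add: gather_expr_def)
  have fr1: "frame 31 {8..13} sg sg1" using init by (simp add: frame_def)
  have after_init: "frame 31 {8..13} sg sg'" "var sg' offV = l * Z" if "frame 35 {leftA} sg1 sg'" for sg'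
    using fr1 that frame_var[OF that, of offV] init(2) by (auto simp: frame_def)
  have parent: "safe (set_var iV i sg') parent_expr \<and> ev (set_var iV i sg') parent_expr = parents i \<and> parents i \<le> 2 * B"
    if "frame 31 {8..13} sg sg'" "i < 2 * Z" for i sg' using parent_expr_value[OF that] by simp
  obtain sg2 where first: "run (mult_exprs_code parent_expr (child_expr inverseA)) (250000 * mult_time (Suc l) (2 * Z)) sg1 sg2"
    "frame 35 {8..13} sg1 sg2" "block_products B (Suc l) (2 * Q) parents (children inverseA) (arr sg2 resultA)"
    by (rule computesE[OF mult[where sg = sg1 and e = parent_expr and e' = "child_expr inverseA" and f = parents and f' = "children inverseA"]])
       (rule parent child_expr_value | erule after_init | assumption | simp add: regs init(2) static)+
  have after_first: "frame 31 {8..13} sg sg'" "var sg' offV = l * Z" if "frame 35 {leftA} sg2 sg'" for sg'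
    using fr1 first(2) that frame_var[OF that, of offV] frame_var[OF first(2), of offV] init(2) by (auto simp: frame_def)
  have quotient: "safe (set_var iV i sg') (Arr resultA ix) \<and> ev (set_var iV i sg') (Arr resultA ix) = arr sg2 resultA i \<and>
      arr sg2 resultA i \<le> 2 * B" if "i < 2 * Z" "frame 35 {leftA} sg2 sg'" for i sg'
    using block_products_digit[OF first(3), of i] that digits atD(4) by (simp add: frame_arr)
  obtain sg3 where second: "run (mult_exprs_code (Arr resultA ix) (child_expr productA)) (250000 * mult_time (Suc l) (2 * Z)) sg2 sg3"
    "frame 35 {8..13} sg2 sg3" "block_products B (Suc l) (2 * Q) (arr sg2 resultA) (children productA) (arr sg3 resultA)"
    by (rule computesE[OF mult[where sg = sg2 and e = "Arr resultA ix" and e' = "child_expr productA"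
      and f = "arr sg2 resultA" and f' = "children productA"]])
       (rule quotient child_expr_value | erule after_first | assumption | simp add: regs init(2) frame_var[OF first(2)] static)+
  have "mult_time (Suc l) (2 * Z) \<le> tree_time l Z" unfolding tree_time_def by (rule mult_time_mono) auto
  then have "20 + (250000 * mult_time (Suc l) (2 * Z) + 250000 * mult_time (Suc l) (2 * Z)) \<le> 510000 * tree_time l Z"
    using tree_time_ge[of Z l] by linarith
  then show ?thesis unfolding residue_products_code_def
    by (rule computesI[OF run_Seq[OF init(1) run_Seq[OF first(1) second(1)]]])
       (use fr1 init(2) first second in \<open>auto simp: frame_def\<close>)
qed

lemma computes_residue_sum:
  assumes fr: "frame 31 {8..13} sg sg1" and NV: "var sg1 NV = 2 * Z" and digit: "\<And>i. i < 2 * Z \<Longrightarrow> arr sg1 resultA i < B"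
  shows "computes residue_sum_code (2000 * (Z + 1)) 36 {8..13} sg1
    (\<lambda>sg'. \<forall>i<2 * Z. arr sg' resultA i = carried_digit B (2 ^ Suc l) (\<lambda>i. arr sg1 resultA i + parents i) i)"
proof -
  note atD = at_levelD[OF at] and regs = at_level_regs[OF at] and parent = parent_expr_value[OF fr]
  let ?e = "Arr resultA ix [+] parent_expr" and ?sum = "\<lambda>i. arr sg1 resultA i + parents i"
  have SB: "4 * B \<le> S" using atD(7) by linarith
  have sum_expr: "safe (set_var iV i sg1) ?e" "ev (set_var iV i sg1) ?e = ?sum i" "?sum i \<le> 2 * B" if "i < 2 * Z" for i
    using parent[OF that] digit[OF that] that atD(4) SB by (simp_all add: gather_expr_def)
  obtain sg2 where sum: "run (map_loop leftA NV ?e) (500 * (2 * Z + 1)) sg1 sg2" "frame 59 {leftA} sg1 sg2"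
    "\<forall>i. arr sg2 leftA i = (if i < 2 * Z then ev (set_var iV i sg1) ?e else arr sg1 leftA i)"
    by (rule computesE[OF computes_map[of NV sg1 "2 * Z" leftA ?e]]) (use NV atD(4) sum_expr(1) in \<open>auto simp: gather_expr_def\<close>)
  obtain sg3 where length: "run (block [block_lenV ::= len2]) 6 sg2 sg3" "var sg3 = (var sg2)(block_lenV := 2 ^ Suc l)" "arr sg3 = arr sg2"
    by (rule that[OF run_block]) (use frame_var[OF fr] frame_var[OF sum(2)] regs atD(5) in \<open>auto simp: block_cost_def\<close>)
  have sum_value: "arr sg3 leftA i = ?sum i" if "i < 2 * Z" for i using sum(3) sum_expr(2)[OF that] that length(3) by simp
  obtain sg4 where carry: "run (carry_code leftA) (50 * (2 * Z + 1)) sg3 sg4" "frame 37 {resultA} sg3 sg4"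
    "\<forall>i<2 * Z. arr sg4 resultA i = carried_digit B (2 ^ Suc l) (arr sg3 leftA) i"
    by (rule computesE[OF computes_carry[of sg3 "2 * Z" "2 ^ Suc l" B leftA "2 * B"]])
       (use frame_var[OF fr] regs NV frame_var[OF sum(2)] length(2) sum_value sum_expr(3) SB atD(2,4) in auto)
  have "carried_digit B (2 ^ Suc l) (arr sg3 leftA) i = carried_digit B (2 ^ Suc l) ?sum i" if "i < 2 * Z" for i
    by (rule carried_digit_cong) (use sum_value that in simp)
  then show ?thesis unfolding residue_sum_code_def
    by (intro computesI[OF run_Seq[OF sum(1) run_Seq[OF length(1) carry(1)]]])
       (use sum(2) length carry(2,3) in \<open>auto simp: frame_def\<close>)
qed

lemma computes_residue_level:
  assumes B: "B = 4 * b" "1 \<le> b" and x: "\<And>i. i < Z \<Longrightarrow> x i \<le> b \<and> coprime B (x i)"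
  shows "computes residue_level_code (600000 * tree_time l Z) 31 ({8..13} \<union> {residueA}) sg
    (\<lambda>sg'. residue_level B b Z x G l (arr sg' residueA))"
proof -
  note atD = at_levelD[OF at] and regs = at_level_regs[OF at]
  obtain sg1 M where products: "run residue_products_code (510000 * tree_time l Z) sg sg1" "frame 31 {8..13} sg sg1"
    and NV: "var sg1 NV = 2 * Z" and M: "block_products B (Suc l) (2 * Q) parents (children inverseA) M"
    and U: "block_products B (Suc l) (2 * Q) M (children productA) (arr sg1 resultA)"
    by (rule computesE[OF computes_residue_products]) blast
  obtain sg2 where sum: "run residue_sum_code (2000 * (Z + 1)) sg1 sg2" "frame 36 {8..13} sg1 sg2"
    "\<forall>i<2 * Z. arr sg2 resultA i = carried_digit B (2 ^ Suc l) (\<lambda>i. arr sg1 resultA i + parents i) i"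
    by (rule computesE[OF computes_residue_sum[OF products(2) NV]]) (use block_products_digit[OF U] atD(1) in auto)
  let ?e = "gather_expr resultA (Var lenV) (Var lenV) len2 (Var lenV)"
  have len: "var sg2 lenV = 2 ^ l" "var sg2 ZV = Z" using frame_var[OF products(2)] frame_var[OF sum(2)] regs by simp_all
  have expr: "safe (set_var iV i sg2) ?e" "ev (set_var iV i sg2) ?e = gather (arr sg2 resultA) (2 ^ l) (2 ^ l) (2 ^ Suc l) (2 ^ l) i"
    if "i < Z" for i
    using upper_half_position[of i "2 * Q" "2 ^ l"] that atD(1,4) len by (simp_all add: gather_expr_def gather_def)
  obtain sg3 where upper: "run (map_loop residueA ZV ?e) (500 * (Z + 1)) sg2 sg3" "frame 59 {residueA} sg2 sg3"
    "\<forall>i. arr sg3 residueA i = (if i < Z then ev (set_var iV i sg2) ?e else arr sg2 residueA i)"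
    by (rule computesE[OF computes_map[of ZV sg2 Z residueA ?e]]) (use len expr(1) atD(4) in \<open>auto simp: gather_expr_def\<close>)
  have "residue_level B b Z x G l (arr sg3 residueA)"
    by (rule residue_level_pred[OF P N V atD(1) B x M U, of "arr sg2 resultA"]) (simp_all add: sum(3) upper(3) expr(2))
  moreover have "510000 * tree_time l Z + (2000 * (Z + 1) + 500 * (Z + 1)) \<le> 600000 * tree_time l Z"
    using tree_time_ge[of Z l] by simp
  ultimately show ?thesis unfolding residue_level_code_def
    by (intro computesI[OF run_Seq[OF products(1) run_Seq[OF sum(1) upper(1)]]])
       (use products(2) sum(2) upper(2) in \<open>auto simp: frame_def\<close>)
qed

end
end

section \<open>Grouping the inputs\<close>

text \<open>
  Inputs with the same current node are put into common chunks of \<open>L\<close> slots. For each node \<open>v\<close>, \<open>free v\<close> is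
  its next free slot; a multiple of \<open>L\<close> means that a new chunk must be opened.
\<close>

definition slack :: "nat \<Rightarrow> nat \<Rightarrow> nat" where
  "slack L f = (L - f mod L) mod L"

lemma slack_zero: "f mod L = 0 \<Longrightarrow> slack L f = 0"
  by (simp add: slack_def)

lemma slack_pos: "f mod L \<noteq> 0 \<Longrightarrow> slack L f = L - f mod L"
  by (cases "L = 0") (auto simp: slack_def)

lemma slack_new_chunk: "0 < L \<Longrightarrow> slack L (t * L + 1) + 1 = L"
  by (cases "L = 1") (auto simp: slack_def mod_Suc)

lemma slack_Suc:
  assumes f: "f mod L \<noteq> 0" and L: "0 < L"
  shows "slack L (f + 1) + 1 = slack L f"
proof (cases "Suc (f mod L) = L")
  case True
  then show ?thesis using slack_pos[OF f] slack_zero[of "f + 1" L] by (simp add: mod_Suc)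
next
  case False
  then show ?thesis using slack_pos[OF f] slack_pos[of "f + 1" L] mod_less_divisor[OF L, of f] by (simp add: mod_Suc)
qed

context
  fixes L V U :: nat and x node :: "nat \<Rightarrow> nat"
begin

definition grouped :: "nat \<Rightarrow> nat \<Rightarrow> (nat \<Rightarrow> nat) \<Rightarrow> (nat \<Rightarrow> nat) \<Rightarrow> (nat \<Rightarrow> nat) \<Rightarrow> (nat \<Rightarrow> nat) \<Rightarrow> bool" where
  "grouped j t free chunk_node slot slot_value \<longleftrightarrow>
     (\<forall>i<j. slot i < t * L \<and> slot_value (slot i) = x i \<and> chunk_node (slot i div L) = node i) \<and>
     (\<forall>v<V. free v mod L \<noteq> 0 \<longrightarrow> free v < t * L \<and> chunk_node (free v div L) = v \<and>
        (\<forall>i<j. slot i div L = free v div L \<longrightarrow> slot i < free v)) \<and>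
     t * L = j + (\<Sum>v<V. slack L (free v)) \<and>
     (\<forall>i<U. slot_value i = 1 \<or> i < t * L \<and> (\<exists>k<j. slot_value i = x k)) \<and>
     (\<forall>c<t. chunk_node c < V)"

lemma grouped_chunks:
  assumes "grouped j t free chunk_node slot slot_value" "0 < L"
  shows "t * L \<le> j + V * L"
proof -
  have "(\<Sum>v<V. slack L (free v)) \<le> (\<Sum>v<V. L)"
    using assms(2) by (intro sum_mono) (simp add: slack_def less_imp_le_nat)
  then show ?thesis using assms(1) by (simp add: grouped_def)
qed

context
  fixes j t :: nat and free chunk_node slot slot_value :: "nat \<Rightarrow> nat"
  assumes grouped: "grouped j t free chunk_node slot slot_value" and L: "0 < L" and node: "node j < V"
begin

private lemma slot_old: "i < j \<Longrightarrow> slot i < t * L" "i < j \<Longrightarrow> slot_value (slot i) = x i" "i < j \<Longrightarrow> chunk_node (slot i div L) = node i"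
  using grouped by (auto simp: grouped_def)

private lemma free_open:
  assumes "v < V" "free v mod L \<noteq> 0"
  shows "free v < t * L" "chunk_node (free v div L) = v" "i < j \<Longrightarrow> slot i div L = free v div L \<Longrightarrow> slot i < free v"
  using grouped assms by (auto simp: grouped_def)

abbreviation (input) "new_slot \<equiv> if free (node j) mod L = 0 then t * L else free (node j)"
abbreviation (input) "new_chunks \<equiv> if free (node j) mod L = 0 then t + 1 else t"

lemma new_slot_position:
  defines "s \<equiv> new_slot" and "t' \<equiv> new_chunks"
  shows "s < t' * L" "t \<le> t'" "i < j \<Longrightarrow> slot i div L = s div L \<Longrightarrow> slot i < s"
    "c < t \<Longrightarrow> (chunk_node(s div L := node j)) c = chunk_node c" "c < t' \<Longrightarrow> c < t \<or> c = s div L"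
    "u < V \<Longrightarrow> free u mod L \<noteq> 0 \<Longrightarrow> u \<noteq> node j \<Longrightarrow> free u div L \<noteq> s div L"
proof -
  have "free u div L < t" if "u < V" "free u mod L \<noteq> 0" for u
    using free_open(1)[OF that] by (simp add: less_mult_imp_div_less)
  then show "s < t' * L" "t \<le> t'" "i < j \<Longrightarrow> slot i div L = s div L \<Longrightarrow> slot i < s"
    "c < t \<Longrightarrow> (chunk_node(s div L := node j)) c = chunk_node c" "c < t' \<Longrightarrow> c < t \<or> c = s div L"
    "u < V \<Longrightarrow> free u mod L \<noteq> 0 \<Longrightarrow> u \<noteq> node j \<Longrightarrow> free u div L \<noteq> s div L"
    using L slot_old(1)[of i] free_open[OF node] free_open(2)[of u] by (auto simp: s_def t'_def)
qed

lemma new_slot_slack: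
  defines "s \<equiv> new_slot" and "t' \<equiv> new_chunks"
  shows "t' * L = Suc j + (\<Sum>u<V. slack L ((free(node j := s + 1)) u))"
proof -
  let ?rest = "\<Sum>u\<in>{..<V} - {node j}. slack L (free u)"
  have "(\<Sum>u<V. slack L ((free(node j := s + 1)) u)) = slack L (s + 1) + ?rest"
    using node by (subst sum.remove[of _ "node j"]) (auto intro!: sum.cong)
  moreover have "(\<Sum>u<V. slack L (free u)) = slack L (free (node j)) + ?rest"
    using node by (subst sum.remove[of _ "node j"]) auto
  moreover have "t * L = j + (\<Sum>u<V. slack L (free u))" using grouped by (simp add: grouped_def)
  ultimately show ?thesis
    using slack_zero[of "free (node j)" L] slack_new_chunk[OF L, of t] slack_Suc[of "free (node j)" L] L
    by (auto simp: s_def t'_def)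
qed

lemma grouped_Suc:
  defines "s \<equiv> new_slot" and "t' \<equiv> new_chunks"
  shows "grouped (Suc j) t' (free(node j := s + 1)) (chunk_node(s div L := node j)) (slot(j := s)) (slot_value(s := x j))"
  unfolding grouped_def
proof (intro conjI allI impI)
  note pos = new_slot_position[folded s_def t'_def]
  have grow: "i < t' * L" if "i < t * L" for i using that mult_le_mono1[OF pos(2), of L] by (rule less_le_trans)
  have chunk: "i div L < t" if "i < t * L" for i using that by (simp add: less_mult_imp_div_less)
  {
    fix i assume "i < Suc j"
    then consider "i < j" "slot i \<noteq> s" | "i = j" using pos(3)[of i] by (auto simp: less_Suc_eq)
    then have "(slot(j := s)) i < t' * L \<and> (slot_value(s := x j)) ((slot(j := s)) i) = x i \<and>
      (chunk_node(s div L := node j)) ((slot(j := s)) i div L) = node i"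
      by cases (use slot_old[of i] chunk[of "slot i"] pos(1) pos(4)[of "slot i div L"] grow[of "slot i"] in auto)
    then show "(slot(j := s)) i < t' * L" "(slot_value(s := x j)) ((slot(j := s)) i) = x i"
      "(chunk_node(s div L := node j)) ((slot(j := s)) i div L) = node i" by blast+
  next
    fix u assume u: "u < V" and m: "(free(node j := s + 1)) u mod L \<noteq> 0"
    consider "u = node j" "(s + 1) div L = s div L" "s + 1 < t' * L" | "u \<noteq> node j" "free u mod L \<noteq> 0"
    proof (cases "u = node j")
      case True
      then have open_chunk: "(s + 1) mod L \<noteq> 0" using m by simp
      then have "s + 1 \<noteq> t' * L" "(s + 1) div L = s div L" by (metis mod_mult_self2_is_0)
        (use open_chunk in \<open>simp add: div_Suc mod_Suc split: if_splits\<close>)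
      then show thesis using that(1) True pos(1) by simp
    qed (use m that in simp)
    note cases = this
    show "(free(node j := s + 1)) u < t' * L" using cases free_open(1)[OF u] grow by cases auto
    show "(chunk_node(s div L := node j)) ((free(node j := s + 1)) u div L) = u"
      using cases free_open(1,2)[OF u] chunk pos(4) by cases auto
    show "(slot(j := s)) i < (free(node j := s + 1)) u"
      if "i < Suc j" "(slot(j := s)) i div L = (free(node j := s + 1)) u div L" for i
      using cases that pos(3)[of i] pos(6)[OF u] free_open(3)[OF u, of i] by cases (auto simp: less_Suc_eq)
  next
    show "t' * L = Suc j + (\<Sum>u<V. slack L ((free(node j := s + 1)) u))" unfolding s_def t'_def by (rule new_slot_slack)
  next
    fix i assume "i < U"
    then have "slot_value i = 1 \<or> i < t * L \<and> (\<exists>k<j. slot_value i = x k)" using grouped unfolding grouped_def by blast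
    then show "(slot_value(s := x j)) i = 1 \<or> i < t' * L \<and> (\<exists>k<Suc j. (slot_value(s := x j)) i = x k)"
      using pos(1) grow by (auto simp: less_Suc_eq)
  next
    fix c assume "c < t'"
    then show "(chunk_node(s div L := node j)) c < V" using pos(5)[of c] node grouped by (auto simp: grouped_def)
  }
qed

end

end

definition chunked :: "nat \<Rightarrow> nat \<Rightarrow> nat \<Rightarrow> nat \<Rightarrow> (nat \<Rightarrow> nat) \<Rightarrow> (nat \<Rightarrow> nat) \<Rightarrow> (nat \<Rightarrow> nat) \<Rightarrow> (nat \<Rightarrow> nat) \<Rightarrow> (nat \<Rightarrow> nat) \<Rightarrow> bool" where
  "chunked n L V t x node chunk_node slot slot_value \<longleftrightarrow>
     (\<forall>i<n. slot i < t * L \<and> slot_value (slot i) = x i \<and> chunk_node (slot i div L) = node i) \<and>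
     (\<forall>i<t * L. slot_value i = 1 \<or> (\<exists>k<n. slot_value i = x k)) \<and> (\<forall>c<t. chunk_node c < V)"

abbreviation (input) "nV \<equiv> 0 :: nat"
abbreviation (input) "DV \<equiv> 4 :: nat"
abbreviation (input) "LV \<equiv> 18 :: nat"
abbreviation (input) "slotsV \<equiv> 19 :: nat"
abbreviation (input) "inputV \<equiv> 20 :: nat"
abbreviation (input) "chunksV \<equiv> 21 :: nat"
abbreviation (input) "input_nodeV \<equiv> 22 :: nat"
abbreviation (input) "freeV \<equiv> 23 :: nat"
abbreviation (input) "slotV \<equiv> 24 :: nat"

abbreviation (input) "inputA \<equiv> 0 :: nat"
abbreviation (input) "freeA \<equiv> 14 :: nat"
abbreviation (input) "chunk_nodeA \<equiv> 15 :: nat"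
abbreviation (input) "slotA \<equiv> 16 :: nat"
abbreviation (input) "nodeA \<equiv> 17 :: nat"

definition group_step :: "stmt list" where
  "group_step = [input_nodeV ::= Arr nodeA (Var inputV), freeV ::= Arr freeA (Var input_nodeV),
     slotV ::= Ite (Var freeV [mod] Var LV) (Cst 1) (Var chunksV [*] Var LV) (Var freeV),
     chunksV ::= Ite (Var freeV [mod] Var LV) (Cst 1) (Var chunksV [+] Cst 1) (Var chunksV),
     chunk_nodeA\<lbrakk>Var slotV [div] Var LV\<rbrakk> ::= Var input_nodeV, slotA\<lbrakk>Var inputV\<rbrakk> ::= Var slotV,
     productA\<lbrakk>Var slotV\<rbrakk> ::= Arr inputA (Var inputV), freeA\<lbrakk>Var input_nodeV\<rbrakk> ::= Var slotV [+] Cst 1]"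

definition group_init_code :: com where
  "group_init_code = block [slotsV ::= Var nV [+] Var DV, chunksV ::= Cst 0] ;; map_loop freeA DV (Cst 0) ;;
     map_loop productA slotsV (Cst 1)"

definition group_code :: com where
  "group_code = group_init_code ;; for_loop inputV nV (block group_step) ;; block [ZV ::= Var chunksV [*] Var LV]"

context ram
begin

context
  fixes sg :: astate and n m L V :: nat
  assumes regs: "var sg nV = n" "var sg DV = m" "var sg LV = L" and L: "0 < L" and V: "V * L \<le> m" and S: "2 * (n + m) < S"
    and node: "\<And>j. j < n \<Longrightarrow> arr sg nodeA j < V"
begin

definition group_inv :: "nat \<Rightarrow> astate \<Rightarrow> bool" where
  "group_inv j sg' \<longleftrightarrow> (\<forall>u<V. arr sg' freeA u \<le> n + m) \<and>
     grouped L V (n + m) (arr sg inputA) (arr sg nodeA) j (var sg' chunksV) (arr sg' freeA) (arr sg' chunk_nodeA) (arr sg' slotA) (arr sg' productA)"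

lemma nodes_le: "V \<le> m"
  using mult_le_mono2[of 1 L V] L V by linarith

lemma computes_group_step:
  assumes j: "j < n" and fr: "frame 19 {productA, freeA, chunk_nodeA, slotA} sg sg'" and I: "group_inv j sg'" and input: "var sg' inputV = j"
  shows "computes (block group_step) 100 21 {productA, freeA, chunk_nodeA, slotA} sg'
    (\<lambda>sg''. group_inv (Suc j) (set_var inputV (Suc j) sg''))"
proof -
  define u f t where "u = arr sg nodeA j" and "f = arr sg' freeA u" and "t = var sg' chunksV"
  define s t' where "s = (if f mod L = 0 then t * L else f)" and "t' = (if f mod L = 0 then t + 1 else t)"
  have same: "var sg' LV = L" "arr sg' nodeA = arr sg nodeA" "arr sg' inputA = arr sg inputA"
    using fr regs by (simp_all add: frame_var frame_arr)
  have u: "u < V" "u < S" using node[OF j] nodes_le S by (simp_all add: u_def)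
  have old: "grouped L V (n + m) (arr sg inputA) (arr sg nodeA) j t (arr sg' freeA) (arr sg' chunk_nodeA) (arr sg' slotA) (arr sg' productA)"
    using I by (simp add: group_inv_def t_def)
  have new: "grouped L V (n + m) (arr sg inputA) (arr sg nodeA) (Suc j) t' ((arr sg' freeA)(u := s + 1)) ((arr sg' chunk_nodeA)(s div L := u))
      ((arr sg' slotA)(j := s)) ((arr sg' productA)(s := arr sg inputA j))"
    using grouped_Suc[OF old L] u(1) unfolding u_def f_def s_def t'_def by simp
  have "s < t' * L" using new_slot_position(1)[OF old L] u(1) unfolding u_def f_def s_def t'_def by simp
  moreover have t'L: "t' * L \<le> n + m" using grouped_chunks[OF new L] j V by linarith
  ultimately have s: "s < n + m" by linarith
  have "f \<le> n + m" using I u(1) by (simp add: group_inv_def f_def)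
  moreover have "t' \<le> n + m" using L by (intro order_trans[OF _ t'L]) simp
  ultimately have bounds: "t' \<le> S" "s \<le> S" "s < S" "f \<le> S" "j < S" using s S j by simp_all
  then have chunk: "s div L < S" by (intro le_less_trans[OF div_le_dividend])
  show ?thesis
    by (cases "f mod L = 0"; rule computes_block)
       (use bounds chunk u(2) same input new I L s in
         \<open>auto simp: u_def f_def t_def s_def t'_def group_inv_def group_step_def block_cost_def\<close>)
qed

lemma computes_group_init:
  "computes group_init_code (1200 * (n + m + 1)) 19 {productA, freeA, chunk_nodeA, slotA} sg
    (\<lambda>sg'. group_inv 0 (set_var inputV 0 sg'))"
proof -
  obtain sg1 where init: "run (block [slotsV ::= Var nV [+] Var DV, chunksV ::= Cst 0]) 7 sg sg1"
    "var sg1 = (var sg)(slotsV := n + m, chunksV := 0)" "arr sg1 = arr sg"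
    by (rule that[OF run_block]) (use regs S in \<open>simp_all add: block_cost_def\<close>)
  obtain sg2 where clear: "run (map_loop freeA DV (Cst 0)) (500 * (m + 1)) sg1 sg2" "frame 59 {freeA} sg1 sg2"
    "\<forall>i. arr sg2 freeA i = (if i < m then 0 else arr sg1 freeA i)"
    by (rule computesE[OF computes_map[of DV sg1 m freeA "Cst 0"]]) (use regs S init(2) in auto)
  obtain sg3 where ones: "run (map_loop productA slotsV (Cst 1)) (500 * (n + m + 1)) sg2 sg3" "frame 59 {productA} sg2 sg3"
    "\<forall>i. arr sg3 productA i = (if i < n + m then 1 else arr sg2 productA i)"
    by (rule computesE[OF computes_map[of slotsV sg2 "n + m" productA "Cst 1"]]) (use S init(2) frame_var[OF clear(2)] in auto)
  have "group_inv 0 (set_var inputV 0 sg3)"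
    using clear(3) ones(3) frame_arr[OF ones(2)] frame_var[OF clear(2)] frame_var[OF ones(2)] init(2) nodes_le
    by (auto simp: group_inv_def grouped_def slack_def)
  then show ?thesis unfolding group_init_code_def
    by (intro computesI[OF run_Seq[OF init(1) run_Seq[OF clear(1) ones(1)]]])
       (use init clear(2) ones(2) in \<open>auto simp: frame_def\<close>)
qed

lemma computes_group:
  "computes group_code (2000 * (n + m + 1)) 19 {productA, freeA, chunk_nodeA, slotA} sg
    (\<lambda>sg'. \<exists>t. var sg' ZV = t * L \<and> t * L \<le> n + m \<and>
       chunked n L V t (arr sg inputA) (arr sg nodeA) (arr sg' chunk_nodeA) (arr sg' slotA) (arr sg' productA))"
proof -
  let ?Y = "{productA, freeA, chunk_nodeA, slotA}"
  obtain sg1 where init: "run group_init_code (1200 * (n + m + 1)) sg sg1" "frame 19 ?Y sg sg1" "group_inv 0 (set_var inputV 0 sg1)"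
    by (rule computesE[OF computes_group_init]) blast
  have "computes (for_loop inputV nV (block group_step)) (n * (100 + 6) + 4) 19 ?Y sg1
      (\<lambda>sg'. group_inv n sg' \<and> var sg' inputV = n \<and> var sg' nV = n)"
  proof (rule computes_for[where b' = 21 and Y' = ?Y and I = group_inv])
    show "computes (block group_step) 100 21 ?Y sg' (\<lambda>sg''. group_inv (Suc j) (set_var inputV (Suc j) sg''))"
      if "j < n" "frame 19 ?Y sg1 sg'" "group_inv j sg'" "var sg' inputV = j" for j sg'
      using computes_group_step[OF that(1) frame_trans[OF init(2) that(2)] that(3,4)] .
  qed (use init(3) regs S frame_var[OF init(2)] in auto)
  then obtain sg2 where loop: "run (for_loop inputV nV (block group_step)) (n * (100 + 6) + 4) sg1 sg2" "frame 19 ?Y sg1 sg2" "group_inv n sg2"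
    by (rule computesE) blast
  define t where "t = var sg2 chunksV"
  have final: "grouped L V (n + m) (arr sg inputA) (arr sg nodeA) n t (arr sg2 freeA) (arr sg2 chunk_nodeA) (arr sg2 slotA) (arr sg2 productA)"
    using loop(3) by (simp add: group_inv_def t_def)
  have tL: "t * L \<le> n + m" using grouped_chunks[OF final L] V by linarith
  obtain sg3 where count: "run (block [ZV ::= Var chunksV [*] Var LV]) 5 sg2 sg3" "var sg3 = (var sg2)(ZV := t * L)" "arr sg3 = arr sg2"
    by (rule that[OF run_block]) (use frame_var[OF loop(2)] frame_var[OF init(2)] regs tL S in \<open>auto simp: block_cost_def t_def\<close>)
  have "chunked n L V t (arr sg inputA) (arr sg nodeA) (arr sg2 chunk_nodeA) (arr sg2 slotA) (arr sg2 productA)"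
    using final tL unfolding grouped_def chunked_def by (meson less_le_trans)
  moreover have "1200 * (n + m + 1) + ((n * (100 + 6) + 4) + 5) \<le> 2000 * (n + m + 1)" by simp
  ultimately show ?thesis unfolding group_code_def
    by (intro computesI[OF run_Seq[OF init(1) run_Seq[OF loop(1) count(1)]]] exI[of _ t])
       (use init(2) loop(2) count tL in \<open>auto simp: frame_def\<close>)
qed

end
end

section \<open>Computing all levels\<close>

abbreviation (input) "RV \<equiv> 2 :: nat"
abbreviation (input) "KV \<equiv> 3 :: nat"
abbreviation (input) "hV \<equiv> 17 :: nat"
abbreviation (input) "itersV \<equiv> 26 :: nat"
abbreviation (input) "iterV \<equiv> 27 :: nat"
abbreviation (input) "downV \<equiv> 28 :: nat"

definition levels_loop :: "nat \<Rightarrow> com \<Rightarrow> com" where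
  "levels_loop v c = block [lenV ::= Cst 1] ;; for_loop lV v (c ;; block [lenV ::= len2])"

definition up_code :: com where
  "up_code = levels_loop hV (product_level_code productA ;; inverse_level_code)"

definition down_code :: com where
  "down_code = for_loop downV hV (block [lV ::= Var hV [-] (Var downV [+] Cst 1), lenV ::= Pow2 (Var lV)] ;; residue_level_code)"

definition leaf_inverse_expr :: expr where
  "leaf_inverse_expr = (Arr inverseA ix [*] (Cst 2 [+] Arr productA ix [*] Arr inverseA ix)) [mod] Var BV"

definition leaf_inverse_code :: com where
  "leaf_inverse_code = block [itersV ::= Var RV [+] Cst 1] ;; map_loop inverseA ZV (Var BV [-] Cst 1) ;;
     for_loop iterV itersV (update_loop inverseA ZV leaf_inverse_expr)"

lemma nodes_levels_Suc:
  assumes old: "\<And>k. k \<le> l \<Longrightarrow> nodes B Z k (k * Z) (P k) X" and new: "nodes B Z (Suc l) (Suc l * Z) (P (Suc l)) X'"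
    and same: "\<And>i. i < Suc l * Z \<Longrightarrow> X' i = X i" and k: "k \<le> Suc l"
  shows "nodes B Z k (k * Z) (P k) X'"
proof (cases "k = Suc l")
  case False
  then have "k \<le> l" using k by simp
  then have "k * Z + i < Suc l * Z" if "i < Z" for i using mult_le_mono1[of k l Z] that unfolding mult_Suc by linarith
  then show ?thesis using nodes_cong[OF same old[OF \<open>k \<le> l\<close>]] by simp
qed (use new in simp)

lemma product_levels_Suc:
  "\<lbrakk>\<And>k. k \<le> l \<Longrightarrow> product_level B Z x k X; product_level B Z x (Suc l) X'; \<And>i. i < Suc l * Z \<Longrightarrow> X' i = X i; k \<le> Suc l\<rbrakk>
    \<Longrightarrow> product_level B Z x k X'"
  unfolding product_level_def by (rule nodes_levels_Suc)

lemma inverse_levels_Suc: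
  "\<lbrakk>\<And>k. k \<le> l \<Longrightarrow> inverse_level B Z x k X; inverse_level B Z x (Suc l) X'; \<And>i. i < Suc l * Z \<Longrightarrow> X' i = X i; k \<le> Suc l\<rbrakk>
    \<Longrightarrow> inverse_level B Z x k X'"
  unfolding inverse_level_def by (rule nodes_levels_Suc)

lemma loop_time_le:
  fixes g T c d e C :: nat
  assumes "1 \<le> T" "c + d + e \<le> C"
  shows "g * (c * T + d) + e \<le> C * (g + 1) * T"
proof -
  have "d \<le> d * T" "e \<le> e * T" using assms(1) by simp_all
  then have "g * (c * T + d) + e \<le> g * (c * T + d * T) + e * T" by (intro add_mono mult_le_mono2) auto
  also have "\<dots> \<le> (c + d + e) * (g + 1) * T" by (simp add: algebra_simps)
  also have "\<dots> \<le> C * (g + 1) * T" using assms(2) by (intro mult_le_mono1)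
  finally show ?thesis .
qed

lemma tree_time_mono: "l \<le> g \<Longrightarrow> tree_time l Z \<le> tree_time g Z"
  unfolding tree_time_def by (rule mult_time_mono) auto

context ram
begin

context
  fixes sg :: astate and g Z Q B :: nat
  assumes regs: "var sg ZV = Z" "var sg BV = B" and Z: "Z = Q * 2 ^ g" and B: "2 \<le> B" and fits: "fits (g + 2) (2 * Z) B"
begin

lemma fits_level: "l < g \<Longrightarrow> fits (l + 2) (2 * Z) B"
  by (rule fits_mono[OF fits]) auto

lemma height_less: "g + 2 \<le> S" "8 * 2 ^ (g + 2) \<le> S" "2 * Z < S"
  using fitsD[OF fits _ B] by (auto simp: algebra_simps)

lemma at_levelI:
  assumes "l < g" "frame 28 Y sg sg'" "var sg' lV = l" "var sg' lenV = 2 ^ l"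
  shows "at_level l Z (Q * 2 ^ (g - Suc l)) B sg'"
proof -
  have "(2::nat) ^ g = 2 ^ (g - Suc l) * 2 ^ Suc l" using assms(1) by (simp flip: power_add power_Suc)
  then show ?thesis using assms fits_level[OF assms(1)] regs Z B
    by (simp only: at_level_def frame_var) (simp add: mult_ac)
qed

lemma computes_levels:
  assumes limit: "v < 29" "var sg v = g" and init: "I 0 (arr sg)"
    and step: "\<And>l sg'. l < g \<Longrightarrow> at_level l Z (Q * 2 ^ (g - Suc l)) B sg' \<Longrightarrow> I l (arr sg') \<Longrightarrow>
       computes c T 31 Y sg' (\<lambda>sg''. I (Suc l) (arr sg''))"
  shows "computes (levels_loop v c) (g * (T + 12) + 7) 29 Y sg (\<lambda>sg'. I g (arr sg'))"
proof -
  let ?J = "\<lambda>l sg'. I l (arr sg') \<and> var sg' lenV = 2 ^ l"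
  obtain sg1 where one: "run (block [lenV ::= Cst 1]) 3 sg sg1" "var sg1 = (var sg)(lenV := 1)" "arr sg1 = arr sg"
    by (rule that[OF run_block]) (use S_ge in \<open>auto simp: block_cost_def\<close>)
  have "computes (for_loop lV v (c ;; block [lenV ::= len2])) (g * ((T + 6) + 6) + 4) 29 Y sg1
      (\<lambda>sg'. ?J g sg' \<and> var sg' lV = g \<and> var sg' v = g)"
  proof (rule computes_for[where b' = 30 and Y' = Y and I = ?J])
    fix l sg' assume l: "l < g" and fr: "frame 29 Y sg1 sg'" and J: "?J l sg'" and lV: "var sg' lV = l"
    have "frame 28 Y sg sg'" using fr one by (simp add: frame_def)
    from at_levelI[OF l this lV] J have at: "at_level l Z (Q * 2 ^ (g - Suc l)) B sg'" by simp
    obtain sg2 where body: "run c T sg' sg2" "frame 31 Y sg' sg2" "I (Suc l) (arr sg2)"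
      using J by (auto intro: computesE[OF step[OF l at]])
    have "(2::nat) ^ Suc l \<le> 2 ^ (g + 2)" using l by (intro power_increasing) auto
    then have "2 ^ Suc l \<le> S" using height_less(2) by linarith
    then obtain sg3 where double: "run (block [lenV ::= len2]) 6 sg2 sg3" "var sg3 = (var sg2)(lenV := 2 ^ Suc l)" "arr sg3 = arr sg2"
      using frame_var[OF body(2)] J by (intro that[OF run_block]) (auto simp: block_cost_def)
    show "computes (c ;; block [lenV ::= len2]) (T + 6) 30 Y sg' (\<lambda>sg''. ?J (Suc l) (set_var lV (Suc l) sg''))"
      by (rule computesI[OF run_Seq[OF body(1) double(1)]]) (use body double in \<open>auto simp: frame_def\<close>)
  qed (use limit one init height_less(1) in auto)
  then obtain sg2 where loop: "run (for_loop lV v (c ;; block [lenV ::= len2])) (g * (T + 12) + 4) sg1 sg2" "frame 29 Y sg1 sg2" "I g (arr sg2)"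
    by (rule computesE) (simp add: eval_nat_numeral)
  show ?thesis unfolding levels_loop_def
    by (rule computesI[OF run_Seq[OF one(1) loop(1)]]) (use one loop in \<open>auto simp: frame_def\<close>)
qed

lemma computes_product_levels:
  assumes limit: "v < 29" "var sg v = g" and a: "a < 8" and b: "B = 4 * b" "1 \<le> b" and x: "\<And>i. i < Z \<Longrightarrow> x i \<le> b"
    and leaves: "product_level B Z x 0 (arr sg a)"
  shows "computes (levels_loop v (product_level_code a)) (400000 * (g + 1) * tree_time g Z) 29 ({8..13} \<union> {a}) sg
    (\<lambda>sg'. \<forall>l\<le>g. product_level B Z x l (arr sg' a))"
proof -
  let ?I = "\<lambda>l A. \<forall>k\<le>l. product_level B Z x k (A a)"
  have "computes (levels_loop v (product_level_code a)) (g * (300000 * tree_time g Z + 12) + 7) 29 ({8..13} \<union> {a}) sg (\<lambda>sg'. ?I g (arr sg'))"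
  proof (rule computes_levels[OF limit, where I = ?I])
    fix l sg' assume l: "l < g" and at: "at_level l Z (Q * 2 ^ (g - Suc l)) B sg'" and I: "?I l (arr sg')"
    have levels: "product_level B Z x l (arr sg' a)" using I by simp
    have "?I (Suc l) (arr sg'')" if "product_level B Z x (Suc l) (arr sg'' a)" "\<forall>i<Suc l * Z. arr sg'' a i = arr sg' a i" for sg''
      using product_levels_Suc[of l B Z x "arr sg' a" "arr sg'' a"] I that by blast
    then show "computes (product_level_code a) (300000 * tree_time g Z) 31 ({8..13} \<union> {a}) sg' (\<lambda>sg''. ?I (Suc l) (arr sg''))"
      by (intro computes_mono[OF computes_product_level[where x = x, OF at b x a levels]])
         (use l tree_time_mono[of l g Z] in auto)
  qed (use leaves in simp)
  moreover have "g * (300000 * tree_time g Z + 12) + 7 \<le> 400000 * (g + 1) * tree_time g Z"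
    by (rule loop_time_le) (use tree_time_ge[of Z g] in simp_all)
  ultimately show ?thesis by (rule computes_mono) auto
qed

lemma computes_up:
  assumes h: "var sg hV = g" and b: "B = 4 * b" "1 \<le> b" and x: "\<And>i. i < Z \<Longrightarrow> x i \<le> b"
    and leaves: "product_level B Z x 0 (arr sg productA)" "inverse_level B Z x 0 (arr sg inverseA)"
  shows "computes up_code (1200000 * (g + 1) * tree_time g Z) 29 {4..13} sg
    (\<lambda>sg'. \<forall>l\<le>g. product_level B Z x l (arr sg' productA) \<and> inverse_level B Z x l (arr sg' inverseA))"
proof -
  let ?I = "\<lambda>l A. \<forall>k\<le>l. product_level B Z x k (A productA) \<and> inverse_level B Z x k (A inverseA)"
  have "computes up_code (g * (1100000 * tree_time g Z + 12) + 7) 29 {4..13} sg (\<lambda>sg'. ?I g (arr sg'))"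
    unfolding up_code_def
  proof (rule computes_levels[where I = ?I])
    fix l sg' assume l: "l < g" and at: "at_level l Z (Q * 2 ^ (g - Suc l)) B sg'" and I: "?I l (arr sg')"
    obtain sg1 where product: "run (product_level_code productA) (300000 * tree_time l Z) sg' sg1" "frame 31 ({8..13} \<union> {productA}) sg' sg1"
      "product_level B Z x (Suc l) (arr sg1 productA)" "\<forall>i<Suc l * Z. arr sg1 productA i = arr sg' productA i"
      by (rule computesE[OF computes_product_level[where x = x and a = productA, OF at b x]]) (use I in auto)
    have same: "arr sg1 inverseA = arr sg' inverseA" using frame_arr[OF product(2)] by simp
    obtain sg2 where inverse: "run inverse_level_code (800000 * tree_time l Z) sg1 sg2" "frame 31 ({8..13} \<union> {inverseA, newtonA}) sg1 sg2"
      "inverse_level B Z x (Suc l) (arr sg2 inverseA)" "\<forall>i<Suc l * Z. arr sg2 inverseA i = arr sg' inverseA i"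
      by (rule computesE[OF computes_inverse_level[OF at_level_frame[OF at product(2) order_refl] product(3)]]) (use I same in auto)
    have "?I (Suc l) (arr sg2)"
      using product_levels_Suc[of l B Z x "arr sg' productA"] inverse_levels_Suc[of l B Z x "arr sg' inverseA"] I
        product(3,4) inverse(3,4) frame_arr[OF inverse(2), of productA] by simp
    then show "computes (product_level_code productA ;; inverse_level_code) (1100000 * tree_time g Z) 31 {4..13} sg' (\<lambda>sg''. ?I (Suc l) (arr sg''))"
      by (intro computesI[OF run_Seq[OF product(1) inverse(1)]])
         (use tree_time_mono[of l g Z] l product(2) inverse(2) in \<open>auto simp: frame_def\<close>)
  qed (use h leaves in auto)
  moreover have "g * (1100000 * tree_time g Z + 12) + 7 \<le> 1200000 * (g + 1) * tree_time g Z"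
    by (rule loop_time_le) (use tree_time_ge[of Z g] in simp_all)
  ultimately show ?thesis by (rule computes_mono) auto
qed

lemma computes_down:
  assumes h: "var sg hV = g" and b: "B = 4 * b" "1 \<le> b" and x: "\<And>i. i < Z \<Longrightarrow> x i \<le> b \<and> coprime B (x i)"
    and levels: "\<And>l. l < g \<Longrightarrow> product_level B Z x l (arr sg productA) \<and> inverse_level B Z x l (arr sg inverseA)"
    and root: "residue_level B b Z x G g (arr sg residueA)"
  shows "computes down_code (700000 * (g + 1) * tree_time g Z) 28 ({8..13} \<union> {residueA}) sg
    (\<lambda>sg'. residue_level B b Z x G 0 (arr sg' residueA))"
proof -
  let ?set = "[lV ::= Var hV [-] (Var downV [+] Cst 1), lenV ::= Pow2 (Var lV)]"
  let ?I = "\<lambda>j sg'. residue_level B b Z x G (g - j) (arr sg' residueA)"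
  have "computes down_code (g * ((600000 * tree_time g Z + 20) + 6) + 4) 28 ({8..13} \<union> {residueA}) sg
      (\<lambda>sg'. ?I g sg' \<and> var sg' downV = g \<and> var sg' hV = g)"
    unfolding down_code_def
  proof (rule computes_for[where b' = 29 and Y' = "{8..13} \<union> {residueA}" and I = ?I])
    fix j sg' assume j: "j < g" and fr: "frame 28 ({8..13} \<union> {residueA}) sg sg'" and I: "?I j sg'"
      and regs': "var sg' downV = j" "var sg' hV = g"
    define l where "l = g - Suc j"
    have l: "l < g" "g - j = Suc l" using j by (auto simp: l_def)
    have "(2::nat) ^ l \<le> 2 ^ (g + 2)" using l(1) by (intro power_increasing) auto
    then have "2 ^ l \<le> S" "l \<le> S" using height_less l(1) by linarith+
    then obtain sg1 where set: "run (block ?set) 20 sg' sg1" "var sg1 = (var sg')(lV := l, lenV := 2 ^ l)" "arr sg1 = arr sg'"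
      by (intro that[OF run_block]) (use regs' j in \<open>auto simp: block_cost_def l_def\<close>)
    have fr1: "frame 28 ({8..13} \<union> {residueA}) sg sg1" using fr set by (auto simp: frame_def)
    have same: "arr sg1 productA = arr sg productA" "arr sg1 inverseA = arr sg inverseA" using frame_arr[OF fr1] by simp_all
    have at: "at_level l Z (Q * 2 ^ (g - Suc l)) B sg1" by (rule at_levelI[OF l(1) fr1]) (simp_all add: set(2))
    obtain sg2 where residue: "run residue_level_code (600000 * tree_time l Z) sg1 sg2" "frame 31 ({8..13} \<union> {residueA}) sg1 sg2"
      "residue_level B b Z x G l (arr sg2 residueA)"
      by (rule computesE[OF computes_residue_level[where x = x and G = G, OF at _ _ _ b x]]) (use levels[OF l(1)] I set l(2) same in auto)
    show "computes (block ?set ;; residue_level_code) (600000 * tree_time g Z + 20) 29 ({8..13} \<union> {residueA}) sg'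
        (\<lambda>sg''. ?I (Suc j) (set_var downV (Suc j) sg''))"
      by (rule computesI[OF run_Seq[OF set(1) residue(1)]])
         (use tree_time_mono[of l g Z] l(1) set residue in \<open>auto simp: frame_def l_def\<close>)
  qed (use h root height_less in auto)
  moreover have "g * ((600000 * tree_time g Z + 20) + 6) + 4 \<le> 700000 * (g + 1) * tree_time g Z"
    unfolding add.assoc[of _ 20] by (rule loop_time_le) (use tree_time_ge[of Z g] in simp_all)
  ultimately show ?thesis by (rule computes_mono) auto
qed

end

end

lemma hensel_step:
  fixes x y :: nat
  assumes "2 ^ i dvd x * y + 1" "1 \<le> i" "i + 1 \<le> r"
  shows "2 ^ (i + 1) dvd x * (y * (2 + x * y) mod 2 ^ r) + 1"
proof -
  have "[x * (y * (2 + x * y) mod 2 ^ r) + 1 = x * (y * (2 + x * y)) + 1] (mod 2 ^ r)"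
    by (intro cong_add cong_mult cong_refl) (simp add: cong_def)
  then have "[x * (y * (2 + x * y) mod 2 ^ r) + 1 = x * (y * (2 + x * y)) + 1] (mod 2 ^ (i + 1))"
    by (rule cong_dvd_modulus_nat) (rule le_imp_power_dvd, rule assms(3))
  moreover have "2 ^ (i + 1) dvd (x * y + 1) * (x * y + 1)"
  proof -
    have "(2::nat) ^ (i + 1) dvd 2 ^ (i + i)" using assms(2) by (intro le_imp_power_dvd) auto
    also have "\<dots> dvd (x * y + 1) * (x * y + 1)" unfolding power_add by (intro mult_dvd_mono assms(1))
    finally show ?thesis .
  qed
  moreover have "(x * y + 1) * (x * y + 1) = x * (y * (2 + x * y)) + 1" by (simp add: algebra_simps)
  ultimately show ?thesis by (simp add: cong_dvd_iff)
qed

context ram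
begin

lemma computes_leaf_inverse:
  assumes regs: "var sg RV = R" "var sg ZV = Z" "var sg BV = 2 ^ (R + 2)" and bounds: "Z < S" "2 ^ (R + 2) \<le> S" "R + 1 \<le> S"
    and x: "\<And>i. i < Z \<Longrightarrow> odd (arr sg productA i) \<and> arr sg productA i \<le> S"
  shows "computes leaf_inverse_code (2000 * (R + 2) * (Z + 1)) 26 {inverseA, scratchA} sg
    (\<lambda>sg'. inverse_level (2 ^ (R + 2)) Z (arr sg productA) 0 (arr sg' inverseA))"
proof -
  define B where "B = (2::nat) ^ (R + 2)"
  have B: "1 \<le> B" "odd (B - 1)" by (simp_all add: B_def)
  let ?x = "arr sg productA" and ?Y = "{inverseA, scratchA}"
  let ?I = "\<lambda>k sg'. \<forall>i<Z. arr sg' inverseA i < B \<and> 2 ^ (k + 1) dvd ?x i * arr sg' inverseA i + 1"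
  obtain sg1 where init: "run (block [itersV ::= Var RV [+] Cst 1]) 5 sg sg1" "var sg1 = (var sg)(itersV := R + 1)" "arr sg1 = arr sg"
    by (rule that[OF run_block]) (use regs bounds in \<open>auto simp: block_cost_def\<close>)
  obtain sg2 where start: "run (map_loop inverseA ZV (Var BV [-] Cst 1)) (500 * (Z + 1)) sg1 sg2" "frame 59 {inverseA} sg1 sg2"
    "\<forall>i. arr sg2 inverseA i = (if i < Z then B - 1 else arr sg1 inverseA i)"
    by (rule computesE[OF computes_map[of ZV sg1 Z inverseA "Var BV [-] Cst 1"]]) (use init regs bounds B in \<open>auto simp: B_def\<close>)
  have fr2: "frame 26 ?Y sg sg2" using init start(2) by (auto simp: frame_def)
  have "computes (for_loop iterV itersV (update_loop inverseA ZV leaf_inverse_expr)) ((R + 1) * (1000 * (Z + 1) + 6) + 4) 26 ?Y sg2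
      (\<lambda>sg'. ?I (R + 1) sg' \<and> var sg' iterV = R + 1 \<and> var sg' itersV = R + 1)"
  proof (rule computes_for[where b' = 59 and Y' = ?Y and I = ?I])
    have "2 ^ (0 + 1) dvd ?x i * (B - 1) + 1" if "i < Z" for i using x[OF that] B(2) by simp
    then show "?I 0 (set_var iterV 0 sg2)" using start(3) B(1) by simp
    fix k sg' assume k: "k < R + 1" and fr: "frame 26 ?Y sg2 sg'" and I: "?I k sg'"
    have same: "var sg' ZV = Z" "var sg' BV = B" "arr sg' productA = ?x"
      using frame_trans[OF fr2 fr] regs by (simp_all add: frame_var frame_arr B_def)
    have safe: "safe (set_var iV i sg') leaf_inverse_expr" if "i < Z" for i
    proof -
      have "arr sg' inverseA i \<le> S" using I that bounds(2) unfolding B_def by (meson le_trans less_imp_le)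
      then show ?thesis using x[OF that] same bounds(1) that by (simp add: leaf_inverse_expr_def)
    qed
    have step: "2 ^ (k + 2) dvd ?x i * (arr sg' inverseA i * (2 + ?x i * arr sg' inverseA i) mod B) + 1" if "i < Z" for i
      using hensel_step[of "k + 1" "?x i" "arr sg' inverseA i" "R + 2"] I k that by (simp add: B_def)
    show "computes (update_loop inverseA ZV leaf_inverse_expr) (1000 * (Z + 1)) 59 ?Y sg' (\<lambda>sg''. ?I (Suc k) (set_var iterV (Suc k) sg''))"
      by (rule computes_mono[OF computes_update[of ZV sg' Z inverseA leaf_inverse_expr]])
         (use same safe step bounds(1) B(1) in \<open>auto simp: leaf_inverse_expr_def\<close>)
  qed (use init frame_var[OF start(2)] bounds in auto)
  then obtain sg3 where loop: "run (for_loop iterV itersV (update_loop inverseA ZV leaf_inverse_expr)) ((R + 1) * (1000 * (Z + 1) + 6) + 4) sg2 sg3"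
    "frame 26 ?Y sg2 sg3" "?I (R + 1) sg3" by (rule computesE) blast
  have "inverse_level B Z ?x 0 (arr sg3 inverseA)"
    using loop(3) by (simp add: inverse_level_def nodes_def subproduct_0 digit_value_def B_def)
  moreover have "5 + (500 * (Z + 1) + ((R + 1) * (1000 * (Z + 1) + 6) + 4)) \<le> 2000 * (R + 2) * (Z + 1)" by (simp add: algebra_simps)
  ultimately show ?thesis unfolding leaf_inverse_code_def B_def[symmetric]
    by (intro computesI[OF run_Seq[OF init(1) run_Seq[OF start(1) loop(1)]]]) (use frame_trans[OF fr2 loop(2)] in auto)
qed

end

section \<open>One step of the simultaneous binary search\<close>

fun euclid :: "nat \<Rightarrow> nat \<Rightarrow> nat \<Rightarrow> nat \<times> nat" where
  "euclid u v 0 = (u, v)"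
| "euclid u v (Suc i) = (case euclid u v i of (a, b) \<Rightarrow> if b = 0 then (a, b) else (b, a mod b))"

lemma gcd_euclid: "euclid u v i = (a, b) \<Longrightarrow> gcd a b = gcd u v"
proof (induction i arbitrary: a b)
  case (Suc i)
  obtain c d where cd: "euclid u v i = (c, d)" by fastforce
  then show ?case using Suc.IH[OF cd] Suc.prems by (auto split: if_splits simp flip: gcd_red_nat simp: gcd.commute)
qed simp

lemma euclid_le: "euclid u v i = (a, b) \<Longrightarrow> a \<le> max u v \<and> b \<le> v"
proof (induction i arbitrary: a b)
  case (Suc i)
  obtain c d where cd: "euclid u v i = (c, d)" by fastforce
  have "c mod d \<le> v" if "d \<noteq> 0" using that Suc.IH[OF cd] mod_less_divisor[of d c] by linarith
  then show ?case using Suc.IH[OF cd] Suc.prems cd by (auto split: if_splits)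
qed simp

lemma euclid_product:
  assumes "euclid u v (Suc i) = (a, b)"
  shows "(b < a \<or> b = 0) \<and> a * b * 2 ^ i \<le> v * v"
  using assms
proof (induction i arbitrary: a b)
  case 0
  have "v * (u mod v) \<le> v * v" if "v \<noteq> 0" using that by (intro mult_le_mono2) (simp add: less_imp_le)
  then show ?case using 0 by (auto split: if_splits)
next
  case (Suc i)
  obtain c d where cd: "euclid u v (Suc i) = (c, d)" by fastforce
  have IH: "d < c \<or> d = 0" "c * d * 2 ^ i \<le> v * v" using Suc.IH[OF cd] by auto
  show ?case
  proof (cases "d = 0")
    case False
    then have ab: "a = d" "b = c mod d" and "d < c" using Suc.prems cd IH(1) by auto
    have "1 * d \<le> c div d * d" using \<open>d < c\<close> False by (intro mult_right_mono) (auto simp: Suc_le_eq div_greater_zero_iff)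
    then have "2 * (c mod d) \<le> c" using div_mult_mod_eq[of c d] mod_less_divisor[of d c] False by linarith
    then have "d * (2 * (c mod d)) * 2 ^ i \<le> d * c * 2 ^ i" by (intro mult_right_mono mult_left_mono) auto
    also have "\<dots> \<le> v * v" using IH(2) by (simp only: mult.commute[of d])
    finally show ?thesis using False ab by (simp add: mult_ac)
  qed (use Suc.prems cd in auto)
qed

lemma euclid_finished:
  assumes "v \<le> 2 ^ R"
  shows "fst (euclid u v (2 * R + 2)) = gcd u v"
proof -
  obtain a b where ab: "euclid u v (Suc (2 * R + 1)) = (a, b)" by fastforce
  have "a * b * 2 ^ (2 * R + 1) \<le> v * v" using euclid_product[OF ab] by blast
  also have "\<dots> \<le> 2 ^ R * 2 ^ R" using assms by (intro mult_le_mono)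
  also have "\<dots> < 2 ^ (2 * R + 1)" by (simp flip: power_add add: mult_2)
  finally have "a * b = 0" by (metis less_one mult.commute nat_mult_less_cancel1 mult_1_right not_gr_zero mult_less_cancel2)
  then have "b = 0" using euclid_product[OF ab] by auto
  then show ?thesis using gcd_euclid[OF ab] ab by simp
qed

abbreviation (input) "elemV \<equiv> 27 :: nat"
abbreviation (input) "stepV \<equiv> 28 :: nat"
abbreviation (input) "uV \<equiv> 29 :: nat"
abbreviation (input) "vV \<equiv> 30 :: nat"
abbreviation (input) "remV \<equiv> 31 :: nat"

abbreviation (input) "intervalA \<equiv> 3 :: nat"

definition euclid_step :: "stmt list" where
  "euclid_step = [remV ::= Ite (Var vV) (Cst 1) (Cst 0) (Var uV [mod] Var vV), uV ::= Ite (Var vV) (Cst 1) (Var uV) (Var vV), vV ::= Var remV]"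

definition euclid_code :: com where
  "euclid_code = block [uV ::= Arr residueA (Arr slotA (Var elemV)), vV ::= Arr inputA (Var elemV)] ;;
     for_loop stepV itersV (block euclid_step)"

definition branch_stmt :: stmt where
  "branch_stmt = (nodeA\<lbrakk>Var elemV\<rbrakk> ::= Cst 2 [*] Arr nodeA (Var elemV) [+] Ite (Cst 1) (Var uV) (Cst 0) (Cst 1))"

definition branch_code :: com where
  "branch_code = block [itersV ::= Cst 2 [*] Var RV [+] Cst 2] ;; for_loop elemV nV (euclid_code ;; block [branch_stmt])"

definition interval_expr :: expr where
  "interval_expr = Arr intervalA (Var hV [*] Var DV [+] Cst 2 [*] Arr chunk_nodeA (ix [div] Var LV) [*] Var LV [+] ix [mod] Var LV)"

definition group_trees_code :: com where
  "group_trees_code = block [LV ::= Pow2 (Var hV)] ;; group_code ;; leaf_inverse_code ;; up_code"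

definition residues_code :: com where
  "residues_code = map_loop residueA ZV interval_expr ;; down_code"

definition search_step_code :: com where
  "search_step_code = group_trees_code ;; residues_code ;; branch_code"

context ram
begin

lemma computes_euclid:
  assumes j: "var sg elemV = j" "j < S" and iters: "var sg itersV = 2 * R + 2" "2 * R + 2 \<le> S"
    and u: "arr sg slotA j < S" "arr sg residueA (arr sg slotA j) = u" "u \<le> S" and v: "arr sg inputA j = v" "v \<le> S" "v \<le> 2 ^ R"
  shows "computes euclid_code (100 * (R + 2)) 28 {} sg (\<lambda>sg'. var sg' uV = gcd u v)"
proof -
  let ?I = "\<lambda>i sg'. (var sg' uV, var sg' vV) = euclid u v i"
  obtain sg1 where init: "run (block [uV ::= Arr residueA (Arr slotA (Var elemV)), vV ::= Arr inputA (Var elemV)]) 20 sg sg1"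
    "var sg1 = (var sg)(uV := u, vV := v)" "arr sg1 = arr sg"
    by (rule that[OF run_block]) (use assms in \<open>auto simp: block_cost_def\<close>)
  have "computes (for_loop stepV itersV (block euclid_step)) ((2 * R + 2) * (30 + 6) + 4) 28 {} sg1
      (\<lambda>sg'. ?I (2 * R + 2) sg' \<and> var sg' stepV = 2 * R + 2 \<and> var sg' itersV = 2 * R + 2)"
  proof (rule computes_for[where b' = 29 and Y' = "{}" and I = ?I])
    fix i sg' assume I: "?I i sg'"
    then have "var sg' uV \<le> S" "var sg' vV \<le> S" using euclid_le[of u v i] u(3) v(2) by (metis max.boundedI le_trans)+
    then show "computes (block euclid_step) 30 29 {} sg' (\<lambda>sg''. ?I (Suc i) (set_var stepV (Suc i) sg''))"
      by (intro computes_block) (use I[symmetric] in \<open>auto simp: euclid_step_def block_cost_def intro: le_trans[OF mod_less_eq_dividend]\<close>)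
  qed (use init iters in auto)
  then obtain sg2 where loop: "run (for_loop stepV itersV (block euclid_step)) ((2 * R + 2) * (30 + 6) + 4) sg1 sg2" "frame 28 {} sg1 sg2"
    "?I (2 * R + 2) sg2" by (rule computesE) blast
  have "var sg2 uV = gcd u v" using loop(3) euclid_finished[OF v(3), of u] by (metis fst_conv)
  then show ?thesis unfolding euclid_code_def
    by (intro computesI[OF run_Seq[OF init(1) loop(1)]]) (use init loop(2) in \<open>auto simp: frame_def\<close>)
qed

lemma computes_branch:
  assumes regs: "var sg nV = n" "var sg RV = R" and n: "n \<le> S" and R: "2 * R + 2 \<le> S"
    and elem: "\<And>j. j < n \<Longrightarrow> arr sg slotA j < S \<and> arr sg residueA (arr sg slotA j) \<le> S \<and> arr sg inputA j \<le> S \<and> arr sg inputA j \<le> 2 ^ R \<and>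
      arr sg nodeA j \<le> S"
  shows "computes branch_code (200 * (R + 2) * (n + 1)) 26 {nodeA} sg (\<lambda>sg'. \<forall>j<n. arr sg' nodeA j =
    2 * arr sg nodeA j + (if 1 < gcd (arr sg residueA (arr sg slotA j)) (arr sg inputA j) then 0 else 1))"
proof -
  let ?node = "\<lambda>j. 2 * arr sg nodeA j + (if 1 < gcd (arr sg residueA (arr sg slotA j)) (arr sg inputA j) then 0 else 1)"
  let ?I = "\<lambda>i sg'. \<forall>j<n. arr sg' nodeA j = (if j < i then ?node j else arr sg nodeA j)"
  let ?T = "100 * (R + 2) + 30"
  obtain sg1 where init: "run (block [itersV ::= Cst 2 [*] Var RV [+] Cst 2]) 10 sg sg1" "var sg1 = (var sg)(itersV := 2 * R + 2)" "arr sg1 = arr sg"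
    by (rule that[OF run_block]) (use regs R in \<open>auto simp: block_cost_def\<close>)
  have "computes (for_loop elemV nV (euclid_code ;; block [branch_stmt])) (n * (?T + 6) + 4) 27 {nodeA} sg1
      (\<lambda>sg'. ?I n sg' \<and> var sg' elemV = n \<and> var sg' nV = n)"
  proof (rule computes_for[where b' = 28 and Y' = "{nodeA}" and I = ?I])
    fix j sg' assume j: "j < n" and fr: "frame 27 {nodeA} sg1 sg'" and I: "?I j sg'" and elemV: "var sg' elemV = j"
    have same: "arr sg' a = arr sg a" if "a \<noteq> nodeA" for a using that frame_arr[OF fr, of a] init(3) by simp
    obtain sg2 where euclid: "run euclid_code (100 * (R + 2)) sg' sg2" "frame 28 {} sg' sg2"
      "var sg2 uV = gcd (arr sg residueA (arr sg slotA j)) (arr sg inputA j)"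
      by (rule computesE[OF computes_euclid[of sg' j R "arr sg residueA (arr sg slotA j)" "arr sg inputA j"]])
         (use elem[OF j] j n R elemV frame_var[OF fr] init(2) same in auto)
    obtain sg3 where store: "run (block [branch_stmt]) 30 sg2 sg3" "var sg3 = var sg2" "arr sg3 = (arr sg2)(nodeA := (arr sg2 nodeA)(j := ?node j))"
      by (rule that[OF run_block])
         (use euclid elemV j n I frame_var[OF euclid(2)] frame_arr[OF euclid(2)] elem[OF j] in \<open>auto simp: branch_stmt_def block_cost_def\<close>)
    show "computes (euclid_code ;; block [branch_stmt]) ?T 28 {nodeA} sg' (\<lambda>sg''. ?I (Suc j) (set_var elemV (Suc j) sg''))"
      by (rule computesI[OF run_Seq[OF euclid(1) store(1)]])
         (use euclid(2) store I in \<open>auto simp: frame_def less_Suc_eq\<close>)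
  qed (use init regs n in auto)
  then obtain sg2 where loop: "run (for_loop elemV nV (euclid_code ;; block [branch_stmt])) (n * (?T + 6) + 4) sg1 sg2" "frame 27 {nodeA} sg1 sg2"
    "?I n sg2" by (rule computesE) blast
  have "10 + (n * (?T + 6) + 4) \<le> 200 * (R + 2) * (n + 1)" by (simp add: algebra_simps)
  then show ?thesis unfolding branch_code_def
    by (rule computesI[OF run_Seq[OF init(1) loop(1)]]) (use init loop(2,3) in \<open>auto simp: frame_def\<close>)
qed

end

lemma root_residues:
  fixes chunk_node x X D :: "nat \<Rightarrow> nat"
  assumes D: "product_level B (V * 2 ^ Suc g) Suc g D" and B: "V * 2 ^ Suc g \<le> b"
    and chunk: "\<And>c. c < t \<Longrightarrow> chunk_node c < V"
    and X: "\<And>i. i < t * 2 ^ g \<Longrightarrow> X i = D (g * (V * 2 ^ Suc g) + 2 * chunk_node (i div 2 ^ g) * 2 ^ g + i mod 2 ^ g)"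
  shows "residue_level B b (t * 2 ^ g) x (\<lambda>i. gcd (subproduct Suc g (2 * chunk_node (i div 2 ^ g))) (x i)) g X"
  unfolding residue_level_def nodes_def
proof (intro conjI allI impI)
  have child_end: "2 * chunk_node c * 2 ^ g + 2 ^ g \<le> V * 2 ^ Suc g" if "c < t" for c
    using mult_le_mono1[of "chunk_node c + 1" V "2 ^ Suc g"] chunk[OF that] by (simp add: distrib_right)
  {
    fix i assume i: "i < t * 2 ^ g"
    then have "i div 2 ^ g < t" by (simp add: less_mult_imp_div_less)
    from child_end[OF this] have "2 * chunk_node (i div 2 ^ g) * 2 ^ g + i mod 2 ^ g < V * 2 ^ Suc g"
      by (rule less_le_trans[rotated]) simp
    from nodes_digit[OF D[unfolded product_level_def] this] show "X (0 + i) < B" using X[OF i] by (simp add: add.assoc)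
  next
    fix c assume "c < t * 2 ^ g div 2 ^ g"
    then have c: "c < t" by simp
    have inner: "(c * 2 ^ g + i) div 2 ^ g = c" "(c * 2 ^ g + i) mod 2 ^ g = i" if "i < (2::nat) ^ g" for i
      using that by (rule block_div_mod)+
    have "digit_value B X (c * 2 ^ g) (2 ^ g) = digit_value B D (g * (V * 2 ^ Suc g) + 2 * chunk_node c * 2 ^ g) (2 ^ g)"
      using X inner block_index_less[OF c] by (intro digit_value_cong) (simp add: add.assoc)
    also have "\<dots> = subproduct Suc g (2 * chunk_node c)"
      using nodes_value[OF D[unfolded product_level_def], of "2 * chunk_node c"] chunk[OF c] by simp
    finally have root: "digit_value B X (0 + c * 2 ^ g) (2 ^ g) = subproduct Suc g (2 * chunk_node c)" by simp
    have "subproduct Suc g (2 * chunk_node c) \<le> b ^ 2 ^ g"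
      using child_end[OF c] B by (intro subproduct_le) simp
    then show "digit_value B X (0 + c * 2 ^ g) (2 ^ g) \<le> 2 * b ^ 2 ^ g" unfolding root by linarith
    show "gcd (digit_value B X (0 + c * 2 ^ g) (2 ^ g)) (x (c * 2 ^ g + j)) =
        gcd (subproduct Suc g (2 * chunk_node ((c * 2 ^ g + j) div 2 ^ g))) (x (c * 2 ^ g + j))" if "j < 2 ^ g" for j
      unfolding root inner(1)[OF that] ..
  }
qed

definition branch :: "nat \<Rightarrow> nat \<Rightarrow> nat \<Rightarrow> nat" where
  "branch g x v = 2 * v + (if 1 < gcd (subproduct Suc g (2 * v)) x then 0 else 1)"

context ram
begin

context
  fixes sg :: astate and n R K g :: nat
  assumes regs: "var sg nV = n" "var sg RV = R" "var sg DV = 2 ^ K" "var sg BV = 2 ^ (R + 2)" "var sg hV = g"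
    and g: "g < K" and K: "K \<le> R" and fits: "fits (K + 2) (2 * (n + 2 ^ K)) (2 ^ (R + 2))"
    and interval: "product_level (2 ^ (R + 2)) (2 ^ K) Suc g (arr sg intervalA)"
    and x: "\<And>j. j < n \<Longrightarrow> odd (arr sg inputA j) \<and> arr sg inputA j \<le> 2 ^ R" and node: "\<And>j. j < n \<Longrightarrow> arr sg nodeA j < 2 ^ (K - Suc g)"
begin

lemma search_bounds:
  "2 ^ (K - Suc g) * 2 ^ Suc g = (2::nat) ^ K" "8 * 2 ^ (R + 2) \<le> S" "4 * (n + 2 ^ K) < S" "2 * R + 2 \<le> S" "2 ^ g < S" "g * 2 ^ K + 2 ^ K < S"
  "Z \<le> n + 2 ^ K \<Longrightarrow> fits (g + 2) (2 * Z) (2 ^ (R + 2))"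
proof -
  show "2 ^ (K - Suc g) * 2 ^ Suc g = (2::nat) ^ K" using g by (simp flip: power_add power_Suc)
  have B: "2 \<le> (2::nat) ^ (R + 2)" by (rule self_le_power) auto
  note fD = fitsD[OF fits _ B]
  show B8: "8 * 2 ^ (R + 2) \<le> S" using fD(6) by simp
  show "4 * (n + 2 ^ K) < S" using fD(3) by (auto simp: algebra_simps)
  then have "2 ^ K < S" by simp
  then show "2 ^ g < S" using g by (intro le_less_trans[OF power_increasing[of g K 2]]) auto
  define p where "p = (2::nat) ^ R"
  have "R < p" "32 * p \<le> S" using B8 by (simp_all add: p_def)
  then show "2 * R + 2 \<le> S" by linarith
  have "(g + 1) * 2 ^ K \<le> (K + 2) * (n + 2 ^ K)" using g by (intro mult_le_mono) auto
  also have "\<dots> < S" using fD(3) by (auto simp: algebra_simps)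
  finally show "g * 2 ^ K + 2 ^ K < S" by simp
  show "fits (g + 2) (2 * Z) (2 ^ (R + 2))" if "Z \<le> n + 2 ^ K" using fits_mono[OF fits] g that by simp
qed

lemma tree_time_le:
  assumes "Z \<le> n + 2 ^ K"
  shows "(g + 1) * tree_time g Z \<le> 5 * ((R + 4) ^ 4 * (n + 2 ^ K + 1))"
proof -
  have "(2::nat) ^ (g + 2) \<le> 2 ^ (K + 1)" using g by (intro power_increasing) auto
  then have "2 * Z + 2 ^ (g + 2) + 1 \<le> 5 * (n + 2 ^ K + 1)" using assms by simp
  moreover have "g + 1 \<le> R + 4" "(g + 2 + 2) ^ 3 \<le> (R + 4) ^ 3" using g K by (auto intro!: power_mono)
  ultimately have "(g + 1) * tree_time g Z \<le> (R + 4) * ((R + 4) ^ 3 * (5 * (n + 2 ^ K + 1)))"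
    unfolding tree_time_def mult_time_def by (intro mult_le_mono)
  also have "\<dots> = 5 * ((R + 4) ^ Suc 3 * (n + 2 ^ K + 1))" by (simp only: power_Suc mult_ac)
  finally show ?thesis by simp
qed

lemma linear_time_le:
  "n + 2 ^ K + 1 \<le> (R + 4) ^ 4 * (n + 2 ^ K + 1)" "(R + 2) * (n + 2 ^ K + 1) \<le> (R + 4) ^ 4 * (n + 2 ^ K + 1)"
proof -
  have "R + 4 \<le> (R + 4) ^ 4" by (rule self_le_power) auto
  then show "(R + 2) * (n + 2 ^ K + 1) \<le> (R + 4) ^ 4 * (n + 2 ^ K + 1)" by (intro mult_le_mono1) linarith
  have "1 * (n + 2 ^ K + 1) \<le> (R + 4) ^ 4 * (n + 2 ^ K + 1)" by (intro mult_le_mono1 one_le_power) simp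
  then show "n + 2 ^ K + 1 \<le> (R + 4) ^ 4 * (n + 2 ^ K + 1)" by simp
qed

lemma group_trees_time:
  assumes Z: "Z \<le> n + 2 ^ K"
  shows "5 + (2000 * (n + 2 ^ K + 1) + (2000 * (R + 2) * (Z + 1) + 1200000 * (g + 1) * tree_time g Z))
    \<le> 6100000 * ((R + 4) ^ 4 * (n + 2 ^ K + 1))"
proof -
  have "5 + (2000 * (N + 1) + (2000 * p + 1200000 * q)) \<le> 6100000 * X" if "p \<le> X" "q \<le> 5 * X" "N + 1 \<le> X" for p q N X :: nat
    using that by simp
  moreover have "(R + 2) * (Z + 1) \<le> (R + 2) * (n + 2 ^ K + 1)" using Z by (intro mult_le_mono) auto
  ultimately show ?thesis using linear_time_le(1,2) tree_time_le[OF Z] unfolding mult.assoc by (meson le_trans)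
qed

definition group_trees :: "nat \<Rightarrow> (nat \<Rightarrow> nat) \<Rightarrow> astate \<Rightarrow> bool" where
  "group_trees t y sg' \<longleftrightarrow> var sg' ZV = t * 2 ^ g \<and> var sg' LV = 2 ^ g \<and> t * 2 ^ g \<le> n + 2 ^ K \<and>
     chunked n (2 ^ g) (2 ^ (K - Suc g)) t (arr sg inputA) (arr sg nodeA) (arr sg' chunk_nodeA) (arr sg' slotA) y \<and>
     (\<forall>i<t * 2 ^ g. odd (y i) \<and> y i \<le> 2 ^ R) \<and>
     (\<forall>l\<le>g. product_level (2 ^ (R + 2)) (t * 2 ^ g) y l (arr sg' productA) \<and> inverse_level (2 ^ (R + 2)) (t * 2 ^ g) y l (arr sg' inverseA))"

lemma computes_group_trees:
  "computes group_trees_code (6100000 * ((R + 4) ^ 4 * (n + 2 ^ K + 1))) 18 {4..16} sg (\<lambda>sg'. \<exists>t y. group_trees t y sg')"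
proof -
  note bounds = search_bounds
  obtain sg1 where init: "run (block [LV ::= Pow2 (Var hV)]) 5 sg sg1" "var sg1 = (var sg)(LV := 2 ^ g)" "arr sg1 = arr sg"
    by (rule that[OF run_block]) (use regs bounds(5) in \<open>auto simp: block_cost_def\<close>)
  have nodes: "2 ^ (K - Suc g) * 2 ^ g \<le> (2::nat) ^ K" using bounds(1) by simp
  obtain sg2 t where grouping: "run group_code (2000 * (n + 2 ^ K + 1)) sg1 sg2" "frame 19 {productA, freeA, chunk_nodeA, slotA} sg1 sg2"
    and t: "var sg2 ZV = t * 2 ^ g" "t * 2 ^ g \<le> n + 2 ^ K"
    and chunked: "chunked n (2 ^ g) (2 ^ (K - Suc g)) t (arr sg inputA) (arr sg nodeA) (arr sg2 chunk_nodeA) (arr sg2 slotA) (arr sg2 productA)"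
    by (rule computesE[OF computes_group[of sg1 n "2 ^ K" "2 ^ g" "2 ^ (K - Suc g)"]]) (use init regs nodes bounds(3) node in auto)
  define y Z where "y = arr sg2 productA" and "Z = t * 2 ^ g"
  have y: "odd (y i) \<and> y i \<le> 2 ^ R" if "i < Z" for i
    using chunked x that unfolding chunked_def y_def Z_def by (metis odd_one one_le_numeral one_le_power)
  have y_S: "y i \<le> S" if "i < Z" for i using y[OF that] bounds(2) by simp
  have fr2: "frame 18 {4..16} sg sg2" using init grouping(2) by (auto simp: frame_def)
  obtain sg3 where inverse: "run leaf_inverse_code (2000 * (R + 2) * (Z + 1)) sg2 sg3" "frame 26 {inverseA, scratchA} sg2 sg3"
    "inverse_level (2 ^ (R + 2)) Z y 0 (arr sg3 inverseA)"
    by (rule computesE[OF computes_leaf_inverse[of sg2 R Z]])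
       (use frame_var[OF fr2] regs t bounds(2-4) y y_S in \<open>auto simp: Z_def y_def\<close>)
  have leaves: "product_level (2 ^ (R + 2)) Z y 0 (arr sg3 productA)"
    using y frame_arr[OF inverse(2), of productA]
    by (simp add: product_level_def nodes_def subproduct_0 digit_value_def y_def le_less_trans[of _ "2 ^ R"])
  have B: "2 ^ (R + 2) = 4 * (2::nat) ^ R" "1 \<le> (2::nat) ^ R" "2 \<le> (2::nat) ^ (R + 2)" by (simp_all add: self_le_power)
  have regs3: "var sg3 v = var sg2 v" if "v < 26" for v using frame_var[OF inverse(2) that] .
  obtain sg4 where up: "run up_code (1200000 * (g + 1) * tree_time g Z) sg3 sg4" "frame 29 {4..13} sg3 sg4"
    "\<forall>l\<le>g. product_level (2 ^ (R + 2)) Z y l (arr sg4 productA) \<and> inverse_level (2 ^ (R + 2)) Z y l (arr sg4 inverseA)"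
    by (rule computesE[OF computes_up[where g = g and B = "2 ^ (R + 2)" and Z = Z and sg = sg3 and Q = t and b = "2 ^ R" and x = y]])
       (use regs3 frame_var[OF fr2] regs t bounds(7) B y leaves inverse(3) in \<open>auto simp: Z_def\<close>)
  have "var sg4 ZV = t * 2 ^ g" "var sg4 LV = 2 ^ g" "arr sg4 chunk_nodeA = arr sg2 chunk_nodeA" "arr sg4 slotA = arr sg2 slotA"
    using t(1) regs3 frame_var[OF up(2)] frame_var[OF grouping(2), of LV] init(2) frame_arr[OF up(2)] frame_arr[OF inverse(2)] by simp_all
  then have "group_trees t y sg4"
    using up(3) y t(2) chunked unfolding group_trees_def Z_def y_def[symmetric] by simp
  moreover have "Z \<le> n + 2 ^ K" using t(2) by (simp add: Z_def)
  ultimately show ?thesis unfolding group_trees_code_def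
    by (intro computesI[OF run_Seq[OF init(1) run_Seq[OF grouping(1) run_Seq[OF inverse(1) up(1)]]] group_trees_time] exI[of _ t] exI[of _ y])
       (use fr2 inverse(2) up(2) in \<open>auto simp: frame_def\<close>)
qed

lemma computes_root_residues:
  assumes trees: "group_trees t y sg1" and fr: "frame 18 {4..16} sg sg1"
  shows "computes (map_loop residueA ZV interval_expr) (500 * (t * 2 ^ g + 1)) 59 {residueA} sg1 (\<lambda>sg'.
    residue_level (2 ^ (R + 2)) (2 ^ R) (t * 2 ^ g) y
      (\<lambda>i. gcd (subproduct Suc g (2 * arr sg1 chunk_nodeA (i div 2 ^ g))) (y i)) g (arr sg' residueA))"
proof -
  note bounds = search_bounds
  let ?D = "arr sg intervalA" and ?c = "arr sg1 chunk_nodeA"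
  have regs1: "var sg1 ZV = t * 2 ^ g" "var sg1 LV = 2 ^ g" "var sg1 hV = g" "var sg1 DV = 2 ^ K" "arr sg1 intervalA = ?D"
    using trees regs frame_var[OF fr] frame_arr[OF fr] by (simp_all add: group_trees_def)
  have Z: "t * 2 ^ g < S" "t * 2 ^ g \<le> n + 2 ^ K" using trees bounds(3) by (auto simp: group_trees_def)
  have chunk: "?c c < 2 ^ (K - Suc g)" if "c < t" for c using trees that by (auto simp: group_trees_def chunked_def)
  have expr: "safe (set_var iV i sg1) interval_expr"
    "ev (set_var iV i sg1) interval_expr = ?D (g * 2 ^ K + 2 * ?c (i div 2 ^ g) * 2 ^ g + i mod 2 ^ g)" if "i < t * 2 ^ g" for i
  proof -
    have t: "i div 2 ^ g < t" using that by (simp add: less_mult_imp_div_less)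
    have "(?c (i div 2 ^ g) + 1) * 2 ^ Suc g \<le> 2 ^ K"
      unfolding bounds(1)[symmetric] using chunk[OF t] by (intro mult_le_mono1) simp
    then have "2 * ?c (i div 2 ^ g) * 2 ^ g + 2 ^ g \<le> 2 ^ K" by (simp add: distrib_right)
    then have pos: "2 * ?c (i div 2 ^ g) * 2 ^ g + i mod 2 ^ g < 2 ^ K" by (rule less_le_trans[rotated]) simp
    have "?c (i div 2 ^ g) \<le> 2 * ?c (i div 2 ^ g) * 2 ^ g" by simp
    then have "?c (i div 2 ^ g) \<le> S" using pos bounds(6) by linarith
    moreover have "i div 2 ^ g < S" using that Z(1) by (meson div_le_dividend le_less_trans less_trans)
    ultimately show "safe (set_var iV i sg1) interval_expr"
      "ev (set_var iV i sg1) interval_expr = ?D (g * 2 ^ K + 2 * ?c (i div 2 ^ g) * 2 ^ g + i mod 2 ^ g)"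
      using regs1 pos bounds(6) by (simp_all add: interval_expr_def)
  qed
  have "(2::nat) ^ K \<le> 2 ^ R" using K by (intro power_increasing) auto
  then have root: "residue_level (2 ^ (R + 2)) (2 ^ R) (t * 2 ^ g) y (\<lambda>i. gcd (subproduct Suc g (2 * ?c (i div 2 ^ g))) (y i)) g X"
    if "\<And>i. i < t * 2 ^ g \<Longrightarrow> X i = ?D (g * 2 ^ K + 2 * ?c (i div 2 ^ g) * 2 ^ g + i mod 2 ^ g)" for X
    using root_residues[of _ "2 ^ (K - Suc g)" g ?D "2 ^ R" t ?c X] interval chunk that unfolding bounds(1) by blast
  have static: "residueA \<notin> arrays interval_expr" "cost interval_expr \<le> 400" by (simp_all add: interval_expr_def)
  obtain sg2 where gather: "run (map_loop residueA ZV interval_expr) (500 * (t * 2 ^ g + 1)) sg1 sg2" "frame 59 {residueA} sg1 sg2"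
    "\<forall>i. arr sg2 residueA i = (if i < t * 2 ^ g then ev (set_var iV i sg1) interval_expr else arr sg1 residueA i)"
    by (rule computesE[OF computes_map[of ZV sg1 "t * 2 ^ g" residueA interval_expr]]) (use regs1 Z static expr(1) in auto)
  then show ?thesis by (intro computesI[OF gather(1)] root) (simp_all add: expr(2))
qed

lemma computes_residues:
  assumes trees: "group_trees t y sg1" and fr: "frame 18 {4..16} sg sg1"
  shows "computes residues_code (3600000 * ((R + 4) ^ 4 * (n + 2 ^ K + 1))) 28 ({8..13} \<union> {residueA}) sg1 (\<lambda>sg'. \<forall>i<t * 2 ^ g.
    arr sg' residueA i < 2 ^ (R + 2) \<and>
    gcd (arr sg' residueA i) (y i) = gcd (subproduct Suc g (2 * arr sg1 chunk_nodeA (i div 2 ^ g))) (y i))"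
proof -
  define Z G where "Z = t * 2 ^ g" and "G i = gcd (subproduct Suc g (2 * arr sg1 chunk_nodeA (i div 2 ^ g))) (y i)" for i
  have Z: "Z \<le> n + 2 ^ K" "var sg1 ZV = Z" and y: "\<And>i. i < Z \<Longrightarrow> odd (y i) \<and> y i \<le> 2 ^ R"
    and levels: "\<And>l. l \<le> g \<Longrightarrow> product_level (2 ^ (R + 2)) Z y l (arr sg1 productA) \<and> inverse_level (2 ^ (R + 2)) Z y l (arr sg1 inverseA)"
    using trees by (auto simp: group_trees_def Z_def)
  have y_coprime: "y i \<le> 2 ^ R \<and> coprime (2 ^ (R + 2)) (y i)" if "i < Z" for i
    using y[OF that] by (simp only: coprime_power_left_iff coprime_left_2_iff_odd simp_thms)
  obtain sg2 where root: "run (map_loop residueA ZV interval_expr) (500 * (Z + 1)) sg1 sg2" "frame 59 {residueA} sg1 sg2"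
    "residue_level (2 ^ (R + 2)) (2 ^ R) Z y G g (arr sg2 residueA)"
    using computesE[OF computes_root_residues[OF trees fr]] unfolding Z_def G_def[abs_def] by blast
  have B: "2 ^ (R + 2) = 4 * (2::nat) ^ R" "1 \<le> (2::nat) ^ R" "2 \<le> (2::nat) ^ (R + 2)" by (simp_all add: self_le_power)
  obtain sg3 where down: "run down_code (700000 * (g + 1) * tree_time g Z) sg2 sg3" "frame 28 ({8..13} \<union> {residueA}) sg2 sg3"
    "residue_level (2 ^ (R + 2)) (2 ^ R) Z y G 0 (arr sg3 residueA)"
    by (rule computesE[OF computes_down[where g = g and B = "2 ^ (R + 2)" and Z = Z and sg = sg2 and Q = t and b = "2 ^ R" and x = y and G = G]])
       (use frame_var[OF fr] regs Z frame_var[OF root(2)] frame_arr[OF root(2)] search_bounds(7) B y_coprime levels root(3) in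
         \<open>auto simp: Z_def\<close>)
  have "\<forall>i<Z. arr sg3 residueA i < 2 ^ (R + 2) \<and> gcd (arr sg3 residueA i) (y i) = G i"
    using down(3) by (simp add: residue_level_def nodes_def digit_value_def)
  moreover have "500 * (Z + 1) + 700000 * (g + 1) * tree_time g Z \<le> 3600000 * ((R + 4) ^ 4 * (n + 2 ^ K + 1))"
  proof -
    have "500 * (Z + 1) + 700000 * q \<le> 3600000 * X" if "q \<le> 5 * X" "n + 2 ^ K + 1 \<le> X" for q X :: nat
      using that Z(1) by simp
    from this[OF tree_time_le[OF Z(1)] linear_time_le(1)] show ?thesis by (simp only: mult.assoc)
  qed
  ultimately show ?thesis unfolding residues_code_def Z_def G_def
    by (intro computesI[OF run_Seq[OF root(1) down(1)]]) (use root(2) down(2) in \<open>auto simp: frame_def Z_def\<close>)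
qed

lemma computes_search_step:
  "computes search_step_code (12000000 * ((R + 4) ^ 4 * (n + 2 ^ K + 1))) 18 {4..17} sg
    (\<lambda>sg'. \<forall>j<n. arr sg' nodeA j = branch g (arr sg inputA j) (arr sg nodeA j))"
proof -
  note bounds = search_bounds
  let ?W = "(R + 4) ^ 4 * (n + 2 ^ K + 1)"
  obtain sg1 t y where trees: "run group_trees_code (6100000 * ?W) sg sg1" "frame 18 {4..16} sg sg1" "group_trees t y sg1"
    by (rule computesE[OF computes_group_trees]) blast
  obtain sg2 where residues: "run residues_code (3600000 * ?W) sg1 sg2" "frame 28 ({8..13} \<union> {residueA}) sg1 sg2"
    and residue: "\<And>i. i < t * 2 ^ g \<Longrightarrow> arr sg2 residueA i < 2 ^ (R + 2)"
      "\<And>i. i < t * 2 ^ g \<Longrightarrow> gcd (arr sg2 residueA i) (y i) = gcd (subproduct Suc g (2 * arr sg1 chunk_nodeA (i div 2 ^ g))) (y i)"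
    by (rule computesE[OF computes_residues[OF trees(3,2)]]) blast
  have fr2: "frame 18 {4..16} sg sg2" using trees(2) residues(2) by (auto simp: frame_def)
  have slot: "arr sg2 slotA j < t * 2 ^ g" "y (arr sg2 slotA j) = arr sg inputA j"
    "arr sg1 chunk_nodeA (arr sg2 slotA j div 2 ^ g) = arr sg nodeA j" if "j < n" for j
    using trees(3) frame_arr[OF residues(2), of slotA] that by (auto simp: group_trees_def chunked_def)
  have elem: "arr sg2 slotA j < S \<and> arr sg2 residueA (arr sg2 slotA j) \<le> S \<and> arr sg2 inputA j \<le> S \<and> arr sg2 inputA j \<le> 2 ^ R \<and> arr sg2 nodeA j \<le> S"
    if "j < n" for j
  proof -
    have "arr sg nodeA j < 2 ^ K" using node[OF that] by (rule less_le_trans) (intro power_increasing, auto)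
    moreover have "arr sg2 slotA j < n + 2 ^ K" using slot(1)[OF that] trees(3) by (simp add: group_trees_def)
    ultimately show ?thesis using residue(1)[OF slot(1)[OF that]] bounds(2,3) x[OF that] frame_arr[OF fr2] by simp
  qed
  obtain sg3 where branch: "run branch_code (200 * (R + 2) * (n + 1)) sg2 sg3" "frame 26 {nodeA} sg2 sg3"
    "\<forall>j<n. arr sg3 nodeA j = 2 * arr sg2 nodeA j + (if 1 < gcd (arr sg2 residueA (arr sg2 slotA j)) (arr sg2 inputA j) then 0 else 1)"
    by (rule computesE[OF computes_branch[of sg2 n R]]) (use frame_var[OF fr2] regs bounds(3,4) elem in auto)
  have "\<forall>j<n. arr sg3 nodeA j = branch g (arr sg inputA j) (arr sg nodeA j)"
    using branch(3) residue(2)[OF slot(1)] slot(2,3) frame_arr[OF fr2] by (simp add: branch_def)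
  moreover have "(R + 2) * (n + 1) \<le> (R + 2) * (n + 2 ^ K + 1)" by (intro mult_le_mono) auto
  then have "6100000 * ?W + (3600000 * ?W + 200 * (R + 2) * (n + 1)) \<le> 12000000 * ?W" using linear_time_le(2) by linarith
  ultimately show ?thesis unfolding search_step_code_def
    by (intro computesI[OF run_Seq[OF trees(1) run_Seq[OF residues(1) branch(1)]]])
       (use fr2 branch(2) in \<open>auto simp: frame_def\<close>)
qed

end

end

section \<open>Splitting off prime factors in rounds\<close>

text \<open>
  After all blocks of size above \<open>2 ^ h\<close> have been searched, \<open>v\<close> is the block of size \<open>2 ^ h\<close> that
  contains the smallest \<open>d\<close> with a common factor with \<open>x\<close>, if \<open>{1..2 ^ K}\<close> contains such a \<open>d\<close>.
\<close>

definition located :: "nat \<Rightarrow> nat \<Rightarrow> nat \<Rightarrow> nat \<Rightarrow> bool" where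
  "located K x h v \<longleftrightarrow> v < 2 ^ (K - h) \<and> (\<forall>d. 1 \<le> d \<longrightarrow> d \<le> v * 2 ^ h \<longrightarrow> coprime d x) \<and>
     ((\<exists>d. 1 \<le> d \<and> d \<le> 2 ^ K \<and> \<not> coprime d x) \<longrightarrow> (\<exists>d. v * 2 ^ h < d \<and> d \<le> (v + 1) * 2 ^ h \<and> \<not> coprime d x))"

lemma located_start: "located K x K 0"
  unfolding located_def by (auto intro: Suc_le_lessD)

lemma coprime_subproduct_iff: "coprime (subproduct Suc g v) x \<longleftrightarrow> (\<forall>d. v * 2 ^ g < d \<and> d \<le> (v + 1) * 2 ^ g \<longrightarrow> coprime d x)"
proof
  assume coprime: "coprime (subproduct Suc g v) x"
  show "\<forall>d. v * 2 ^ g < d \<and> d \<le> (v + 1) * 2 ^ g \<longrightarrow> coprime d x"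
  proof (intro allI impI)
    fix d assume d: "v * 2 ^ g < d \<and> d \<le> (v + 1) * 2 ^ g"
    define j where "j = d - Suc (v * 2 ^ g)"
    have "Suc (v * 2 ^ g + j) = d" "j < 2 ^ g" using d unfolding j_def distrib_right by linarith+
    then show "coprime d x" using dvd_subproduct[of j g Suc v] coprime coprime_divisors[OF _ dvd_refl] by metis
  qed
next
  assume "\<forall>d. v * 2 ^ g < d \<and> d \<le> (v + 1) * 2 ^ g \<longrightarrow> coprime d x"
  then show "coprime (subproduct Suc g v) x" unfolding subproduct_def by (intro prod_coprime_left) auto
qed

lemma located_branch:
  assumes located: "located K x (Suc g) v" and g: "g < K" and x: "0 < x"
  shows "located K x g (branch g x v)"
proof -
  have v: "v < 2 ^ (K - Suc g)" and below: "\<And>d. 1 \<le> d \<Longrightarrow> d \<le> 2 * v * 2 ^ g \<Longrightarrow> coprime d x"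
    and witness: "\<exists>d. 1 \<le> d \<and> d \<le> 2 ^ K \<and> \<not> coprime d x \<Longrightarrow> \<exists>d. 2 * v * 2 ^ g < d \<and> d \<le> (2 * v + 2) * 2 ^ g \<and> \<not> coprime d x"
    using located unfolding located_def by (simp_all add: algebra_simps)
  have blocks: "2 ^ (K - g) = 2 * (2 ^ (K - Suc g) :: nat)" using g by (metis Suc_diff_Suc power_Suc)
  show ?thesis
  proof (cases "coprime (subproduct Suc g (2 * v)) x")
    case True
    then have "branch g x v = 2 * v + 1" by (simp add: branch_def)
    moreover have left: "coprime d x" if "1 \<le> d" "d \<le> (2 * v + 1) * 2 ^ g" for d
      using True[unfolded coprime_subproduct_iff] below[of d] that by (meson not_le)
    have "located K x g (2 * v + 1)" unfolding located_def
    proof (intro conjI impI)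
      show "2 * v + 1 < 2 ^ (K - g)" unfolding blocks using v by simp
      show "\<forall>d. 1 \<le> d \<longrightarrow> d \<le> (2 * v + 1) * 2 ^ g \<longrightarrow> coprime d x" using left by blast
      assume "\<exists>d. 1 \<le> d \<and> d \<le> 2 ^ K \<and> \<not> coprime d x"
      from witness[OF this] obtain d where d: "2 * v * 2 ^ g < d" "d \<le> (2 * v + 2) * 2 ^ g" "\<not> coprime d x" by blast
      then have "\<not> d \<le> (2 * v + 1) * 2 ^ g" using left[of d] by auto
      then show "\<exists>d. (2 * v + 1) * 2 ^ g < d \<and> d \<le> (2 * v + 1 + 1) * 2 ^ g \<and> \<not> coprime d x"
        using d by (intro exI[of _ d]) simp
    qed
    ultimately show ?thesis by simp
  next
    case False
    then have "gcd (subproduct Suc g (2 * v)) x \<noteq> 1" "gcd (subproduct Suc g (2 * v)) x \<noteq> 0" using x by (simp_all add: coprime_iff_gcd_eq_1)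
    then have "1 < gcd (subproduct Suc g (2 * v)) x" by linarith
    then have "branch g x v = 2 * v" by (simp add: branch_def)
    moreover have "located K x g (2 * v)"
      unfolding located_def blocks using v below False[unfolded coprime_subproduct_iff] by auto
    ultimately show ?thesis by simp
  qed
qed

lemma composite_prime_factor:
  fixes x :: nat
  assumes "1 < x" "\<not> prime x"
  obtains p where "prime p" "p dvd x" "p * p \<le> x"
proof -
  define p where "p = (LEAST p. prime p \<and> p dvd x)"
  have "\<exists>p. prime p \<and> p dvd x" using assms(1) by (intro prime_factor_nat) simp
  then have p: "prime p" "p dvd x" unfolding p_def by (metis (mono_tags, lifting) LeastI_ex)+
  obtain y where y: "x = p * y" using p(2) by blast
  have "y \<noteq> 1" using assms(2) y p(1) by auto
  then obtain q where q: "prime q" "q dvd y" using prime_factor_nat by blast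
  have "p \<le> q" unfolding p_def using q y by (intro Least_le) auto
  also have "q \<le> y" using q(2) y assms(1) by (intro dvd_imp_le) (auto intro: gr0I)
  finally show thesis using p y by (intro that) auto
qed

definition found_factor :: "nat \<Rightarrow> nat \<Rightarrow> nat" where
  "found_factor x v = (if 0 < v \<and> v + 1 dvd x then v + 1 else x)"

context
  fixes K x v :: nat
  assumes located: "located K x 0 v" and x: "0 < x" "x < 2 ^ (2 * K)"
begin

lemma located_prime:
  assumes p: "prime p" "p dvd v + 1" "p dvd x"
  shows "p = v + 1"
proof -
  have "\<not> coprime p x" using p by (metis coprime_common_divisor_nat dvd_refl not_prime_1)
  then have "\<not> p \<le> v" using located prime_ge_1_nat[OF p(1)] by (auto simp: located_def)
  then show ?thesis using dvd_imp_le[OF p(2)] by simp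
qed

lemma located_composite:
  assumes "1 < x" "\<not> prime x"
  shows "v + 1 dvd x" "prime (v + 1)"
proof -
  obtain p where p: "prime p" "p dvd x" "p * p \<le> x" using composite_prime_factor[OF assms] .
  have "p * p < 2 ^ K * 2 ^ K" using p(3) x(2) by (simp add: mult_2 power_add)
  then have "p \<le> 2 ^ K" using mult_le_mono[of "2 ^ K" p "2 ^ K" p] by linarith
  moreover have "\<not> coprime p x" using p by (metis coprime_common_divisor_nat dvd_refl not_prime_1)
  ultimately obtain d where "v < d" "d \<le> v + 1" "\<not> coprime d x"
    using located prime_ge_1_nat[OF p(1)] unfolding located_def by auto
  then have "gcd (v + 1) x \<noteq> 1" by (metis Suc_eq_plus1 Suc_leI coprime_iff_gcd_eq_1 le_antisym)
  then obtain r where r: "prime r" "r dvd gcd (v + 1) x" using prime_factor_nat by blast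
  then have "r = v + 1" using located_prime by simp
  then show "v + 1 dvd x" "prime (v + 1)" using r by auto
qed

lemma found_factor:
  shows "found_factor x v dvd x" "found_factor x v = 1 \<or> prime (found_factor x v)" "found_factor x v = 1 \<longleftrightarrow> x = 1"
proof -
  show dvd: "found_factor x v dvd x" by (simp add: found_factor_def)
  show "found_factor x v = 1 \<or> prime (found_factor x v)"
  proof (cases "x = 1 \<or> prime x")
    case True
    then show ?thesis using dvd by (metis nat_dvd_1_iff_1 prime_nat_iff)
  next
    case False
    then show ?thesis using located_composite x(1) by (auto simp: found_factor_def)
  qed
  show "found_factor x v = 1 \<longleftrightarrow> x = 1" using dvd by (auto simp: found_factor_def split: if_splits)
qed

end

lemma halved_quotient:
  fixes z f r y :: nat
  assumes z: "odd z" "z = 1 \<or> z * 2 ^ r \<le> y" and f: "f dvd z" "f = 1 \<longleftrightarrow> z = 1"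
  shows "odd (z div f)" "z div f \<le> z" "z div f = 1 \<or> z div f * 2 ^ Suc r \<le> y"
proof -
  obtain u where u: "z = f * u" using f(1) by blast
  have "0 < f" using z(1) u by (auto intro: gr0I)
  then have quotient: "z div f = u" using u by simp
  then show "odd (z div f)" "z div f \<le> z" using z(1) u by (simp, intro div_le_dividend)
  show "z div f = 1 \<or> z div f * 2 ^ Suc r \<le> y"
  proof (cases "z = 1")
    case False
    then have "2 \<le> f" using f(2) \<open>0 < f\<close> by linarith
    then have "2 * u \<le> z" unfolding u by (rule mult_le_mono1)
    then have "2 * u * 2 ^ r \<le> z * 2 ^ r" by (rule mult_le_mono1)
    also have "\<dots> \<le> y" using z(2) False by simp
    finally show ?thesis by (simp add: quotient mult_ac)
  qed (use f(2) in simp)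
qed

lemma halve_even:
  fixes x z r :: nat
  assumes z: "z \<le> x" "0 < z" "odd z \<or> z * 2 ^ r \<le> x"
  defines "z' \<equiv> z div (if even z then 2 else 1)"
  shows "z' \<le> x \<and> 0 < z' \<and> (odd z' \<or> z' * 2 ^ Suc r \<le> x)"
  using z unfolding z'_def by (cases "even z") (auto elim!: evenE)

definition factored :: "nat \<Rightarrow> nat \<Rightarrow> (nat \<Rightarrow> nat) \<Rightarrow> (nat \<Rightarrow> nat) \<Rightarrow> (nat \<Rightarrow> nat) \<Rightarrow> bool" where
  "factored n r C X x \<longleftrightarrow> (\<forall>j<n. (\<forall>i<r. C (i * n + j) = 1 \<or> prime (C (i * n + j))) \<and> (\<Prod>i<r. C (i * n + j)) * X j = x j)"

lemma factored_Suc: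
  assumes r: "factored n r C X x" and F: "\<And>j. j < n \<Longrightarrow> (F j = 1 \<or> prime (F j)) \<and> F j dvd X j"
    and X': "\<And>j. j < n \<Longrightarrow> X' j = X j div F j"
  shows "factored n (Suc r) (overwrite (r * n) n F C) X' x"
  unfolding factored_def
proof (intro allI impI)
  let ?C = "overwrite (r * n) n F C"
  fix j assume j: "j < n"
  have new: "?C (r * n + j) = F j" using j by simp
  have old: "?C (i * n + j) = C (i * n + j)" if "i < r" for i
    using block_index_less[OF that j] by (intro overwrite_outside) simp
  have "(\<Prod>i<Suc r. ?C (i * n + j)) * X' j = (\<Prod>i<r. C (i * n + j)) * (F j * (X j div F j))"
    using new old X'[OF j] by (simp add: mult.assoc)
  also have "\<dots> = x j" using r F[OF j] j by (simp add: factored_def)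
  finally show "(\<forall>i<Suc r. ?C (i * n + j) = 1 \<or> prime (?C (i * n + j))) \<and> (\<Prod>i<Suc r. ?C (i * n + j)) * X' j = x j"
    using new old F[OF j] r j by (auto simp: less_Suc_eq factored_def)
qed

abbreviation (input) "roundV \<equiv> 14 :: nat"
abbreviation (input) "offsetV \<equiv> 15 :: nat"
abbreviation (input) "searchV \<equiv> 16 :: nat"

abbreviation (input) "factorsA \<equiv> 2 :: nat"
abbreviation (input) "factorA \<equiv> 18 :: nat"

definition interval_tree_code :: com where
  "interval_tree_code = block [ZV ::= Var DV] ;; map_loop intervalA DV (ix [+] Cst 1) ;; levels_loop KV (product_level_code intervalA)"

definition search_code :: com where
  "search_code = map_loop nodeA nV (Cst 0) ;;
     for_loop searchV KV (block [hV ::= Var KV [-] (Var searchV [+] Cst 1)] ;; search_step_code)"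

text \<open>The factors found in round \<open>r\<close> form row \<open>r\<close> of the table, with entry \<open>1\<close> for no factor.\<close>

definition record_code :: com where
  "record_code = map_loop_at factorsA offsetV nV (Arr factorA ix) ;; update_loop inputA nV (Arr inputA ix [div] Arr factorA ix) ;;
     block [offsetV ::= Var offsetV [+] Var nV]"

definition rounds_loop :: "com \<Rightarrow> com" where
  "rounds_loop c = for_loop roundV RV (c ;; record_code)"

definition two_expr :: expr where
  "two_expr = Ite (Arr inputA ix [mod] Cst 2) (Cst 1) (Cst 2) (Cst 1)"

definition found_expr :: expr where
  "found_expr = Ite (Cst 0) (Arr nodeA ix)
     (Ite (Arr inputA ix [mod] (Arr nodeA ix [+] Cst 1)) (Cst 1) (Arr nodeA ix [+] Cst 1) (Arr inputA ix)) (Arr inputA ix)"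

definition strip_code :: com where
  "strip_code = rounds_loop (map_loop factorA nV two_expr)"

definition rounds_code :: com where
  "rounds_code = rounds_loop (search_code ;; map_loop factorA nV found_expr)"

lemma (in ram) computes_interval_tree:
  assumes regs: "var sg KV = K" "var sg DV = 2 ^ K" "var sg BV = 2 ^ (R + 2)" and K: "K \<le> R" and fits: "fits (K + 2) (2 * 2 ^ K) (2 ^ (R + 2))"
  shows "computes interval_tree_code (500000 * (K + 1) * tree_time K (2 ^ K)) 25 ({8..13} \<union> {intervalA}) sg
    (\<lambda>sg'. \<forall>l\<le>K. product_level (2 ^ (R + 2)) (2 ^ K) Suc l (arr sg' intervalA))"
proof -
  have B: "2 ^ (R + 2) = 4 * (2::nat) ^ R" "1 \<le> (2::nat) ^ R" "2 \<le> (2::nat) ^ (R + 2)" by (simp_all add: self_le_power)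
  have Suc_le: "Suc i \<le> 2 ^ R" if "i < 2 ^ K" for i using that power_increasing[OF K, of "2::nat"] by (simp add: Suc_le_eq less_le_trans)
  have S: "2 * 2 ^ K < S" using fitsD(3)[OF fits _ B(3)] by (simp add: algebra_simps)
  obtain sg1 where init: "run (block [ZV ::= Var DV]) 3 sg sg1" "var sg1 = (var sg)(ZV := 2 ^ K)" "arr sg1 = arr sg"
    by (rule that[OF run_block]) (use regs S in \<open>auto simp: block_cost_def\<close>)
  obtain sg2 where leaves: "run (map_loop intervalA DV (ix [+] Cst 1)) (500 * (2 ^ K + 1)) sg1 sg2" "frame 59 {intervalA} sg1 sg2"
    "\<forall>i. arr sg2 intervalA i = (if i < 2 ^ K then Suc i else arr sg1 intervalA i)"
    by (rule computesE[OF computes_map[of DV sg1 "2 ^ K" intervalA "ix [+] Cst 1"]]) (use init regs S in auto)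
  have level0: "product_level (2 ^ (R + 2)) (2 ^ K) Suc 0 (arr sg2 intervalA)"
    using leaves(3) le_less_trans[OF Suc_le, of _ "4 * 2 ^ R"] by (simp add: product_level_def nodes_def subproduct_0 digit_value_def)
  obtain sg3 where levels: "run (levels_loop KV (product_level_code intervalA)) (400000 * (K + 1) * tree_time K (2 ^ K)) sg2 sg3"
    "frame 29 ({8..13} \<union> {intervalA}) sg2 sg3" "\<forall>l\<le>K. product_level (2 ^ (R + 2)) (2 ^ K) Suc l (arr sg3 intervalA)"
    by (rule computesE[OF computes_product_levels[where sg = sg2 and v = KV and g = K and Q = 1 and x = Suc and a = intervalA,
        OF _ _ _ B(3) fits _ _ _ B(1,2)]])
       (use init(2) frame_var[OF leaves(2)] regs Suc_le level0 in auto)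
  have "3 + (500 * (2 ^ K + 1) + 400000 * (K + 1) * tree_time K (2 ^ K)) \<le> 500000 * (K + 1) * tree_time K (2 ^ K)"
  proof -
    have "2 ^ K + 1 \<le> (K + 1) * tree_time K (2 ^ K)" using tree_time_ge[of "2 ^ K" K] mult_le_mono1[of 1 "K + 1" "tree_time K (2 ^ K)"] by simp
    moreover have "3 + (500 * (z + 1) + 400000 * q) \<le> 500000 * q" if "z + 1 \<le> q" for z q :: nat using that by simp
    ultimately show ?thesis unfolding mult.assoc by blast
  qed
  then show ?thesis unfolding interval_tree_code_def
    by (rule computesI[OF run_Seq[OF init(1) run_Seq[OF leaves(1) levels(1)]]]) (use init leaves(2) levels(2,3) in \<open>auto simp: frame_def\<close>)
qed

lemma search_time:
  fixes n K R :: nat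
  assumes "K \<le> R"
  defines "W \<equiv> (R + 4) ^ 4 * (n + 2 ^ K + 1)"
  shows "500 * (n + 1) + (K * ((12000000 * W + 10) + 6) + 4) \<le> 13000000 * ((R + 4) ^ 5 * (n + 2 ^ K + 1))"
proof -
  have "1 * (n + 2 ^ K + 1) \<le> W" unfolding W_def by (intro mult_le_mono1 one_le_power) simp
  then have W: "1 \<le> W" "n + 1 \<le> W" by simp_all
  have "K * (12000000 * W + (10 + 6)) + 4 \<le> 12000020 * (K + 1) * W" by (rule loop_time_le) (use W in simp_all)
  moreover have "1 * W \<le> (K + 1) * W" by (rule mult_le_mono1) simp
  moreover have "(K + 1) * W \<le> (R + 4) * W" by (rule mult_le_mono1) (use assms(1) in simp)
  moreover have "(R + 4) * W = (R + 4) ^ Suc 4 * (n + 2 ^ K + 1)" unfolding W_def by (simp only: power_Suc mult.assoc)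
  ultimately show ?thesis using W(2) unfolding mult.assoc add.assoc by simp
qed

lemma rounds_time:
  fixes n K R :: nat
  defines "W \<equiv> (R + 4) ^ 5 * (n + 2 ^ K + 1)"
  shows "R * (13001000 * W + 1600 * (n + 1) + 6) + 4 \<le> 13004000 * ((R + 4) ^ 6 * (n + 2 ^ K + 1))"
proof -
  have W: "1 * (n + 1) \<le> W" unfolding W_def by (intro mult_le_mono one_le_power) auto
  then have "13001000 * W + 1600 * (n + 1) + 6 \<le> 13003000 * W + 6" by linarith
  then have "R * (13001000 * W + 1600 * (n + 1) + 6) + 4 \<le> R * (13003000 * W + 6) + 4" by (intro add_mono mult_le_mono2) auto
  also have "\<dots> \<le> 13004000 * (R + 1) * W" by (rule loop_time_le) (use W in simp_all)
  also have "\<dots> \<le> 13004000 * (R + 4) * W" by (intro mult_le_mono1 mult_le_mono2) simp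
  also have "\<dots> = 13004000 * ((R + 4) ^ Suc 5 * (n + 2 ^ K + 1))" unfolding W_def by (simp only: power_Suc mult.assoc)
  finally show ?thesis by simp
qed

context ram
begin

lemma computes_search:
  assumes regs: "var sg nV = n" "var sg RV = R" "var sg KV = K" "var sg DV = 2 ^ K" "var sg BV = 2 ^ (R + 2)"
    and K: "K \<le> R" and fits: "fits (K + 2) (2 * (n + 2 ^ K)) (2 ^ (R + 2))"
    and interval: "\<And>l. l \<le> K \<Longrightarrow> product_level (2 ^ (R + 2)) (2 ^ K) Suc l (arr sg intervalA)"
    and x: "\<And>j. j < n \<Longrightarrow> odd (arr sg inputA j) \<and> arr sg inputA j \<le> 2 ^ R" and S: "n < S" "K < S"
  shows "computes search_code (13000000 * ((R + 4) ^ 5 * (n + 2 ^ K + 1))) 16 {4..17} sg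
    (\<lambda>sg'. \<forall>j<n. located K (arr sg inputA j) 0 (arr sg' nodeA j))"
proof -
  let ?W = "(R + 4) ^ 4 * (n + 2 ^ K + 1)" and ?set = "[hV ::= Var KV [-] (Var searchV [+] Cst 1)]"
  obtain sg1 where clear: "run (map_loop nodeA nV (Cst 0)) (500 * (n + 1)) sg sg1" "frame 59 {nodeA} sg sg1"
    "\<forall>i. arr sg1 nodeA i = (if i < n then 0 else arr sg nodeA i)"
    by (rule computesE[OF computes_map[of nV sg n nodeA "Cst 0"]]) (use regs S in auto)
  let ?I = "\<lambda>i sg'. \<forall>j<n. located K (arr sg inputA j) (K - i) (arr sg' nodeA j)"
  have fr1: "frame 16 {4..17} sg sg1" by (rule frame_mono[OF clear(2)]) auto
  have "computes (for_loop searchV KV (block ?set ;; search_step_code)) (K * ((12000000 * ?W + 10) + 6) + 4) 16 {4..17} sg1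
      (\<lambda>sg'. ?I K sg' \<and> var sg' searchV = K \<and> var sg' KV = K)"
  proof (rule computes_for[where b' = 17 and Y' = "{4..17}" and I = ?I])
    fix i sg' assume i: "i < K" and fr: "frame 16 {4..17} sg1 sg'" and I: "?I i sg'" and searchV: "var sg' searchV = i"
    define g where "g = K - Suc i"
    have g: "g < K" "K - i = Suc g" using i by (auto simp: g_def)
    note fr' = frame_trans[OF fr1 fr]
    obtain sg2 where set: "run (block ?set) 10 sg' sg2" "var sg2 = (var sg')(hV := g)" "arr sg2 = arr sg'"
      by (rule that[OF run_block]) (use frame_var[OF fr'] regs searchV i S(2) in \<open>auto simp: block_cost_def g_def\<close>)
    have same: "arr sg2 inputA = arr sg inputA" "arr sg2 intervalA = arr sg intervalA" using frame_arr[OF fr'] set(3) by simp_all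
    have located: "located K (arr sg inputA j) (Suc g) (arr sg2 nodeA j)" if "j < n" for j using I that set(3) g(2) by simp
    obtain sg3 where step: "run search_step_code (12000000 * ?W) sg2 sg3" "frame 18 {4..17} sg2 sg3"
      "\<forall>j<n. arr sg3 nodeA j = branch g (arr sg inputA j) (arr sg2 nodeA j)"
      by (rule computesE[OF computes_search_step[of sg2 n R K g, OF _ _ _ _ _ g(1) K fits]])
         (use frame_var[OF fr'] regs set(2) interval[of g] g(1) x same located in \<open>auto simp: located_def\<close>)
    have "located K (arr sg inputA j) g (arr sg3 nodeA j)" if "j < n" for j
      using located_branch[OF located[OF that] g(1) odd_pos] x[OF that] step(3) that by simp
    then show "computes (block ?set ;; search_step_code) (12000000 * ?W + 10) 17 {4..17} sg' (\<lambda>sg''. ?I (Suc i) (set_var searchV (Suc i) sg''))"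
      by (intro computesI[OF run_Seq[OF set(1) step(1)]]) (use set step(2) in \<open>auto simp: frame_def g_def\<close>)
  qed (use regs frame_var[OF clear(2)] S clear(3) in \<open>auto simp: located_start\<close>)
  then obtain sg2 where loop: "run (for_loop searchV KV (block ?set ;; search_step_code)) (K * ((12000000 * ?W + 10) + 6) + 4) sg1 sg2"
    "frame 16 {4..17} sg1 sg2" "?I K sg2" by (rule computesE) blast
  show ?thesis unfolding search_code_def
    by (rule computesI[OF run_Seq[OF clear(1) loop(1)] search_time[OF K]]) (use frame_trans[OF fr1 loop(2)] loop(3) in auto)
qed

lemma computes_record:
  assumes regs: "var sg nV = n" "var sg offsetV = r * n" and S: "Suc r * n \<le> S" "n < S"
    and X: "\<And>j. j < n \<Longrightarrow> 0 < arr sg inputA j \<and> arr sg inputA j \<le> S"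
    and F: "\<And>j. j < n \<Longrightarrow> (arr sg factorA j = 1 \<or> prime (arr sg factorA j)) \<and> arr sg factorA j dvd arr sg inputA j"
    and old: "factored n r (arr sg factorsA) (arr sg inputA) x"
  shows "computes record_code (1600 * (n + 1)) 15 {inputA, factorsA, scratchA} sg (\<lambda>sg'. factored n (Suc r) (arr sg' factorsA) (arr sg' inputA) x \<and>
    var sg' offsetV = Suc r * n \<and> (\<forall>j<n. arr sg' inputA j = arr sg inputA j div arr sg factorA j))"
proof -
  let ?e = "Arr inputA ix [div] Arr factorA ix"
  have F_le: "arr sg factorA j \<le> S" if "j < n" for j
    using X[OF that] F[OF that] dvd_imp_le[of "arr sg factorA j" "arr sg inputA j"] by linarith
  obtain sg1 where row: "run (map_loop_at factorsA offsetV nV (Arr factorA ix)) (500 * (n + 1)) sg sg1" "frame 59 {factorsA} sg sg1"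
    "arr sg1 factorsA = overwrite (r * n) n (arr sg factorA) (arr sg factorsA)"
    by (rule computesE[OF computes_map_at[of offsetV nV sg n "r * n" factorsA "Arr factorA ix"]]) (use regs S in auto)
  obtain sg2 where quotient: "run (update_loop inputA nV ?e) (1000 * (n + 1)) sg1 sg2" "frame 59 {inputA, scratchA} sg1 sg2"
    "\<forall>j. arr sg2 inputA j = (if j < n then arr sg inputA j div arr sg factorA j else arr sg inputA j)"
    by (rule computesE[OF computes_update[of nV sg1 n inputA ?e]])
       (use regs S X F_le frame_var[OF row(2)] frame_arr[OF row(2)] in auto)
  obtain sg3 where shift: "run (block [offsetV ::= Var offsetV [+] Var nV]) 5 sg2 sg3" "var sg3 = (var sg2)(offsetV := Suc r * n)" "arr sg3 = arr sg2"
    by (rule that[OF run_block]) (use regs S frame_var[OF row(2)] frame_var[OF quotient(2)] in \<open>auto simp: block_cost_def\<close>)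
  have "factored n (Suc r) (arr sg3 factorsA) (arr sg3 inputA) x"
    using factored_Suc[OF old F, of "arr sg3 inputA"] quotient(3) row(3) frame_arr[OF quotient(2)] shift(3) by simp
  then show ?thesis unfolding record_code_def
    by (intro computesI[OF run_Seq[OF row(1) run_Seq[OF quotient(1) shift(1)]]])
       (use row(2) quotient shift in \<open>auto simp: frame_def\<close>)
qed

lemma computes_rounds_loop:
  assumes regs: "var sg nV = n" "var sg RV = R" "var sg offsetV = q * n" and S: "(q + R) * n \<le> S" "n < S" "R \<le> S"
    and start: "factored n q (arr sg factorsA) (arr sg inputA) x" "I 0 (arr sg inputA)"
    and I: "\<And>r X j. I r X \<Longrightarrow> j < n \<Longrightarrow> 0 < X j \<and> X j \<le> S"
    and I_cong: "\<And>r X X'. I r X \<Longrightarrow> (\<And>j. j < n \<Longrightarrow> X' j = X j) \<Longrightarrow> I r X'"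
    and step: "\<And>r sg'. r < R \<Longrightarrow> frame 14 ({0, 2} \<union> {4..18}) sg sg' \<Longrightarrow> I r (arr sg' inputA) \<Longrightarrow>
      computes c T 16 {4..18} sg' (\<lambda>sg''. (\<forall>j<n. (arr sg'' factorA j = 1 \<or> prime (arr sg'' factorA j)) \<and> arr sg'' factorA j dvd arr sg' inputA j) \<and>
         I (Suc r) (\<lambda>j. arr sg' inputA j div arr sg'' factorA j))"
  shows "computes (rounds_loop c) (R * (T + 1600 * (n + 1) + 6) + 4) 14 ({0, 2} \<union> {4..18}) sg (\<lambda>sg'.
    factored n (q + R) (arr sg' factorsA) (arr sg' inputA) x \<and> var sg' offsetV = (q + R) * n \<and> I R (arr sg' inputA))"
proof -
  let ?Y = "{0, 2} \<union> {4..18} :: nat set"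
  let ?J = "\<lambda>r sg'. factored n (q + r) (arr sg' factorsA) (arr sg' inputA) x \<and> var sg' offsetV = (q + r) * n \<and> I r (arr sg' inputA)"
  have "computes (rounds_loop c) (R * (T + 1600 * (n + 1) + 6) + 4) 14 ?Y sg (\<lambda>sg'. ?J R sg' \<and> var sg' roundV = R \<and> var sg' RV = R)"
    unfolding rounds_loop_def
  proof (rule computes_for[where b' = 15 and Y' = ?Y and I = ?J])
    fix r sg' assume r: "r < R" and fr: "frame 14 ?Y sg sg'" and J: "?J r sg'"
    obtain sg1 where factor: "run c T sg' sg1" "frame 16 {4..18} sg' sg1"
      "\<forall>j<n. (arr sg1 factorA j = 1 \<or> prime (arr sg1 factorA j)) \<and> arr sg1 factorA j dvd arr sg' inputA j"
      "I (Suc r) (\<lambda>j. arr sg' inputA j div arr sg1 factorA j)"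
      by (rule computesE[OF step[OF r fr]]) (use J in auto)
    have "Suc (q + r) * n \<le> (q + R) * n" using r by (intro mult_le_mono1) simp
    then have bound: "Suc (q + r) * n \<le> S" using S(1) by linarith
    have same: "arr sg1 inputA = arr sg' inputA" "arr sg1 factorsA = arr sg' factorsA" using frame_arr[OF factor(2)] by simp_all
    obtain sg2 where recorded: "run record_code (1600 * (n + 1)) sg1 sg2" "frame 15 {inputA, factorsA, scratchA} sg1 sg2"
      "factored n (Suc (q + r)) (arr sg2 factorsA) (arr sg2 inputA) x" "var sg2 offsetV = Suc (q + r) * n"
      "\<forall>j<n. arr sg2 inputA j = arr sg' inputA j div arr sg1 factorA j"
      by (rule computesE[OF computes_record[of sg1 n "q + r" x, OF _ _ bound]])
         (use J I[of r "arr sg' inputA"] factor(3) frame_var[OF factor(2)] frame_var[OF fr] regs S same in auto)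
    have "I (Suc r) (arr sg2 inputA)" by (rule I_cong[OF factor(4)]) (use recorded(5) in auto)
    then show "computes (c ;; record_code) (T + 1600 * (n + 1)) 15 ?Y sg' (\<lambda>sg''. ?J (Suc r) (set_var roundV (Suc r) sg''))"
      by (intro computesI[OF run_Seq[OF factor(1) recorded(1)]]) (use factor(2) recorded in \<open>auto simp: frame_def\<close>)
  qed (use regs S start in auto)
  then show ?thesis by (rule computes_mono) auto
qed

lemma computes_strip:
  assumes regs: "var sg nV = n" "var sg RV = R" "var sg offsetV = 0" and S: "R * n \<le> S" "n < S" "R \<le> S" "2 ^ R \<le> S"
    and x: "\<And>j. j < n \<Longrightarrow> 0 < arr sg inputA j \<and> arr sg inputA j < 2 ^ R"
  shows "computes strip_code (2200 * (R + 1) * (n + 1)) 14 ({0, 2} \<union> {4..18}) sg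
    (\<lambda>sg'. factored n R (arr sg' factorsA) (arr sg' inputA) (arr sg inputA) \<and>
    var sg' offsetV = R * n \<and> (\<forall>j<n. odd (arr sg' inputA j) \<and> arr sg' inputA j < 2 ^ R))"
proof -
  let ?x = "arr sg inputA"
  let ?I = "\<lambda>r X. \<forall>j<n. X j \<le> ?x j \<and> 0 < X j \<and> (odd (X j) \<or> X j * 2 ^ r \<le> ?x j)"
  have x_S: "?x j \<le> S" if "j < n" for j using x[OF that] S(4) by linarith
  have strip: "computes strip_code (R * (500 * (n + 1) + 1600 * (n + 1) + 6) + 4) 14 ({0, 2} \<union> {4..18}) sg (\<lambda>sg'.
      factored n (0 + R) (arr sg' factorsA) (arr sg' inputA) ?x \<and> var sg' offsetV = (0 + R) * n \<and> ?I R (arr sg' inputA))"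
    unfolding strip_code_def
  proof (rule computes_rounds_loop[where I = ?I])
    show "factored n 0 (arr sg factorsA) ?x ?x" by (simp add: factored_def)
    show "0 < X j \<and> X j \<le> S" if "?I r X" "j < n" for r X j using that x_S[OF that(2)] by (meson le_trans)
    fix r sg' assume fr: "frame 14 ({0, 2} \<union> {4..18}) sg sg'" and I: "?I r (arr sg' inputA)"
    have X_S: "arr sg' inputA j \<le> S" if "j < n" for j using I x_S[OF that] that by (meson le_trans)
    obtain sg1 where two: "run (map_loop factorA nV two_expr) (500 * (n + 1)) sg' sg1" "frame 59 {factorA} sg' sg1"
      "\<forall>j. arr sg1 factorA j = (if j < n then if even (arr sg' inputA j) then 2 else 1 else arr sg' factorA j)"
      by (rule computesE[OF computes_map[of nV sg' n factorA two_expr]])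
         (use frame_var[OF fr] regs S X_S in \<open>auto simp: two_expr_def even_iff_mod_2_eq_zero\<close>)
    have "?I (Suc r) (\<lambda>j. arr sg' inputA j div arr sg1 factorA j)"
    proof (intro allI impI)
      fix j assume j: "j < n"
      then have "arr sg1 factorA j = (if even (arr sg' inputA j) then 2 else 1)" using two(3) by simp
      then show "arr sg' inputA j div arr sg1 factorA j \<le> ?x j \<and> 0 < arr sg' inputA j div arr sg1 factorA j \<and>
          (odd (arr sg' inputA j div arr sg1 factorA j) \<or> arr sg' inputA j div arr sg1 factorA j * 2 ^ Suc r \<le> ?x j)"
        using halve_even[of "arr sg' inputA j" "?x j" r] I j by (simp only:)
    qed
    then show "computes (map_loop factorA nV two_expr) (500 * (n + 1)) 16 {4..18} sg' (\<lambda>sg''.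
        (\<forall>j<n. (arr sg'' factorA j = 1 \<or> prime (arr sg'' factorA j)) \<and> arr sg'' factorA j dvd arr sg' inputA j) \<and>
        ?I (Suc r) (\<lambda>j. arr sg' inputA j div arr sg'' factorA j))"
      by (intro computesI[OF two(1)] frame_mono[OF two(2)]) (use two(3) in auto)
  qed (use regs S x in auto)
  have time: "R * (500 * (n + 1) + 1600 * (n + 1) + 6) + 4 \<le> 2200 * (R + 1) * (n + 1)"
    using loop_time_le[of "n + 1" 2100 6 4 2200 R] by (simp add: distrib_right)
  have stripped: "\<forall>j<n. odd (X j) \<and> X j < 2 ^ R" if "?I R X" for X
  proof (intro allI impI)
    fix j assume j: "j < n"
    then have "X j \<le> ?x j" "1 * 2 ^ R \<le> X j * 2 ^ R" "odd (X j) \<or> X j * 2 ^ R \<le> ?x j"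
      using that by (auto simp: Suc_le_eq)
    then show "odd (X j) \<and> X j < 2 ^ R" using x[OF j] by linarith
  qed
  show ?thesis by (rule computes_mono[OF strip time order_refl subset_refl]) (simp only: add_0, use stripped in blast)
qed

lemma computes_found_factor:
  assumes regs: "var sg nV = n" "var sg RV = R" "var sg KV = K" "var sg DV = 2 ^ K" "var sg BV = 2 ^ (R + 2)"
    and K: "K \<le> R" "R \<le> 2 * K" and fits: "fits (K + 2) (2 * (n + 2 ^ K)) (2 ^ (R + 2))"
    and interval: "\<And>l. l \<le> K \<Longrightarrow> product_level (2 ^ (R + 2)) (2 ^ K) Suc l (arr sg intervalA)"
    and x: "\<And>j. j < n \<Longrightarrow> odd (arr sg inputA j) \<and> arr sg inputA j < 2 ^ R" and S: "n < S" "K < S" "2 ^ R \<le> S" "2 ^ K \<le> S"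
  shows "computes (search_code ;; map_loop factorA nV found_expr) (13001000 * ((R + 4) ^ 5 * (n + 2 ^ K + 1))) 16 {4..18} sg (\<lambda>sg'. \<forall>j<n.
    arr sg' factorA j dvd arr sg inputA j \<and> (arr sg' factorA j = 1 \<or> prime (arr sg' factorA j)) \<and> (arr sg' factorA j = 1 \<longleftrightarrow> arr sg inputA j = 1))"
proof -
  have x_le: "odd (arr sg inputA j) \<and> arr sg inputA j \<le> 2 ^ R" if "j < n" for j using x[OF that] by simp
  obtain sg1 where search: "run search_code (13000000 * ((R + 4) ^ 5 * (n + 2 ^ K + 1))) sg sg1" "frame 16 {4..17} sg sg1"
    and located: "\<And>j. j < n \<Longrightarrow> located K (arr sg inputA j) 0 (arr sg1 nodeA j)"
    by (rule computesE[OF computes_search[OF regs K(1) fits interval x_le S(1,2)]]) auto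
  have safe: "safe (set_var iV j sg1) found_expr" if "j < n" for j
  proof -
    have "arr sg1 nodeA j < 2 ^ K" using located[OF that] by (simp add: located_def)
    then have "arr sg1 nodeA j < S" using S(4) by linarith
    moreover have "arr sg inputA j \<le> S" using x[OF that] S(3) by linarith
    ultimately show ?thesis using frame_arr[OF search(2), of inputA] that S(1) by (simp add: found_expr_def)
  qed
  have static: "factorA \<notin> arrays found_expr" "cost found_expr \<le> 400" by (simp_all add: found_expr_def)
  obtain sg2 where factor: "run (map_loop factorA nV found_expr) (500 * (n + 1)) sg1 sg2" "frame 59 {factorA} sg1 sg2"
    "\<forall>j. arr sg2 factorA j = (if j < n then ev (set_var iV j sg1) found_expr else arr sg1 factorA j)"
    by (rule computesE[OF computes_map[of nV sg1 n factorA found_expr]])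
       (use frame_var[OF search(2)] regs S static safe in auto)
  have "arr sg2 factorA j = found_factor (arr sg inputA j) (arr sg1 nodeA j)" if "j < n" for j
    using factor(3) that frame_arr[OF search(2), of inputA] by (simp add: found_expr_def found_factor_def mod_eq_0_iff_dvd)
  moreover have "0 < arr sg inputA j" "arr sg inputA j < 2 ^ (2 * K)" if "j < n" for j
    using x[OF that] power_increasing[OF K(2), of "2::nat"] by (auto intro: odd_pos less_le_trans)
  moreover have "1 * (n + 1) \<le> (R + 4) ^ 5 * (n + 2 ^ K + 1)" by (intro mult_le_mono one_le_power) auto
  then have "13000000 * ((R + 4) ^ 5 * (n + 2 ^ K + 1)) + 500 * (n + 1) \<le> 13001000 * ((R + 4) ^ 5 * (n + 2 ^ K + 1))" by linarith
  ultimately show ?thesis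
    by (intro computesI[OF run_Seq[OF search(1) factor(1)]])
       (use search(2) factor(2) found_factor[OF located] in \<open>auto simp: frame_def\<close>)
qed

lemma computes_rounds:
  assumes regs: "var sg nV = n" "var sg RV = R" "var sg KV = K" "var sg DV = 2 ^ K" "var sg BV = 2 ^ (R + 2)" "var sg offsetV = R * n"
    and K: "K \<le> R" "R \<le> 2 * K" and fits: "fits (K + 2) (2 * (n + 2 ^ K)) (2 ^ (R + 2))"
    and interval: "\<And>l. l \<le> K \<Longrightarrow> product_level (2 ^ (R + 2)) (2 ^ K) Suc l (arr sg intervalA)"
    and x: "\<And>j. j < n \<Longrightarrow> odd (arr sg inputA j) \<and> arr sg inputA j < 2 ^ R"
    and S: "n < S" "K < S" "2 ^ R \<le> S" "2 ^ K \<le> S" "(R + R) * n \<le> S" "R \<le> S"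
    and start: "factored n R (arr sg factorsA) (arr sg inputA) y"
  shows "computes rounds_code (13004000 * ((R + 4) ^ 6 * (n + 2 ^ K + 1))) 14 ({0, 2} \<union> {4..18}) sg
    (\<lambda>sg'. factored n (2 * R) (arr sg' factorsA) (\<lambda>_. 1) y)"
proof -
  let ?W = "(R + 4) ^ 5 * (n + 2 ^ K + 1)" and ?x = "arr sg inputA" and ?Y = "{0, 2} \<union> {4..18} :: nat set"
  let ?I = "\<lambda>r X. \<forall>j<n. odd (X j) \<and> X j < 2 ^ R \<and> (X j = 1 \<or> X j * 2 ^ r \<le> ?x j)"
  have rounds: "computes rounds_code (R * (13001000 * ?W + 1600 * (n + 1) + 6) + 4) 14 ?Y sg (\<lambda>sg'.
      factored n (R + R) (arr sg' factorsA) (arr sg' inputA) y \<and> var sg' offsetV = (R + R) * n \<and> ?I R (arr sg' inputA))"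
    unfolding rounds_code_def
  proof (rule computes_rounds_loop[where I = ?I])
    show "0 < X j \<and> X j \<le> S" if "?I r X" "j < n" for r X j using that S(3) by (meson le_trans less_imp_le odd_pos)
    fix r sg' assume fr: "frame 14 ?Y sg sg'" and I: "?I r (arr sg' inputA)"
    obtain sg1 where factor: "run (search_code ;; map_loop factorA nV found_expr) (13001000 * ?W) sg' sg1" "frame 16 {4..18} sg' sg1"
      "\<forall>j<n. arr sg1 factorA j dvd arr sg' inputA j \<and> (arr sg1 factorA j = 1 \<or> prime (arr sg1 factorA j)) \<and>
        (arr sg1 factorA j = 1 \<longleftrightarrow> arr sg' inputA j = 1)"
      by (rule computesE[OF computes_found_factor[of sg' n R K, OF _ _ _ _ _ K fits]])
         (use frame_var[OF fr] frame_arr[OF fr] regs interval I S in auto)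
    have "?I (Suc r) (\<lambda>j. arr sg' inputA j div arr sg1 factorA j)"
    proof (intro allI impI)
      fix j assume j: "j < n"
      then show "odd (arr sg' inputA j div arr sg1 factorA j) \<and> arr sg' inputA j div arr sg1 factorA j < 2 ^ R \<and>
          (arr sg' inputA j div arr sg1 factorA j = 1 \<or> arr sg' inputA j div arr sg1 factorA j * 2 ^ Suc r \<le> ?x j)"
        using halved_quotient[of "arr sg' inputA j" r "?x j" "arr sg1 factorA j"] I factor(3) by (meson le_less_trans)
    qed
    then show "computes (search_code ;; map_loop factorA nV found_expr) (13001000 * ?W) 16 {4..18} sg' (\<lambda>sg''.
        (\<forall>j<n. (arr sg'' factorA j = 1 \<or> prime (arr sg'' factorA j)) \<and> arr sg'' factorA j dvd arr sg' inputA j) \<and>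
        ?I (Suc r) (\<lambda>j. arr sg' inputA j div arr sg'' factorA j))"
      by (intro computesI[OF factor(1) order_refl factor(2)]) (use factor(3) in blast)
  qed (use regs S x start in auto)
  have finished: "X j = 1" if I: "?I R X" and j: "j < n" for X j
  proof (rule ccontr)
    assume "X j \<noteq> 1"
    then have "odd (X j)" "X j * 2 ^ R \<le> ?x j" using I j by auto
    moreover have "1 * 2 ^ R \<le> X j * 2 ^ R" using odd_pos[OF \<open>odd (X j)\<close>] by (intro mult_le_mono1) simp
    ultimately show False using x[OF j] by linarith
  qed
  have "factored n (2 * R) C (\<lambda>_. 1) y" if "factored n (R + R) C X y" "?I R X" for C X
    using that(1) finished[OF that(2)] by (simp add: factored_def mult_2)
  then show ?thesis by (intro computes_mono[OF rounds rounds_time order_refl subset_refl]) blast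
qed

end

section \<open>The output\<close>

definition stores :: "(nat \<Rightarrow> nat) \<Rightarrow> nat \<Rightarrow> nat list \<Rightarrow> bool" where
  "stores A a ys \<longleftrightarrow> map A [a..<a + length ys] = ys"

lemma stores_Nil [simp]: "stores A a []"
  by (simp add: stores_def)

lemma stores_append: "stores A a (xs @ ys) \<longleftrightarrow> stores A a xs \<and> stores A (a + length xs) ys"
proof -
  have "[a..<a + length (xs @ ys)] = [a..<a + length xs] @ [a + length xs..<a + length xs + length ys]"
    using upt_add_eq_append[of a "a + length xs" "length ys"] by (simp add: add.assoc)
  then show ?thesis unfolding stores_def by simp
qed

lemma stores_Cons: "stores A a (y # ys) \<longleftrightarrow> A a = y \<and> stores A (Suc a) ys"
  by (simp add: stores_def upt_conv_Cons del: upt_Suc)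

lemma stores_nth: "stores A a ys \<Longrightarrow> j < length ys \<Longrightarrow> A (a + j) = ys ! j"
  unfolding stores_def by (metis add_diff_cancel_left' length_map length_upt nth_map nth_upt nat_add_left_cancel_less)

lemma stores_cong: "stores A a ys \<Longrightarrow> (\<And>i. a \<le> i \<Longrightarrow> i < a + length ys \<Longrightarrow> A' i = A i) \<Longrightarrow> stores A' a ys"
  unfolding stores_def by (elim trans[rotated], intro map_cong) auto

definition listing :: "nat list list \<Rightarrow> nat list" where
  "listing pss = concat (map (\<lambda>ps. length ps # ps) pss)"

definition column :: "nat \<Rightarrow> (nat \<Rightarrow> nat) \<Rightarrow> nat \<Rightarrow> nat \<Rightarrow> nat list" where
  "column n C r j = filter (\<lambda>f. 1 < f) (map (\<lambda>i. C (i * n + j)) [0..<r])"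

lemma column_0 [simp]: "column n C 0 j = []"
  by (simp add: column_def)

lemma column_Suc: "column n C (Suc r) j = column n C r j @ (if 1 < C (r * n + j) then [C (r * n + j)] else [])"
  by (simp add: column_def)

lemma length_column: "length (column n C r j) \<le> r"
  unfolding column_def using length_filter_le[of _ "map (\<lambda>i. C (i * n + j)) [0..<r]"] by simp

definition columns :: "nat \<Rightarrow> (nat \<Rightarrow> nat) \<Rightarrow> nat \<Rightarrow> nat \<Rightarrow> nat list list" where
  "columns n C r k = map (column n C r) [0..<k]"

lemma listing_columns_0 [simp]: "listing (columns n C r 0) = []"
  by (simp add: listing_def columns_def)

lemma listing_columns_Suc:
  "listing (columns n C r (Suc k)) = listing (columns n C r k) @ length (column n C r k) # column n C r k"
  by (simp add: listing_def columns_def)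

lemma length_listing_columns: "length (listing (columns n C r k)) \<le> k * (r + 1)"
proof (induction k)
  case (Suc k) then show ?case using length_column[of n C r k] by (simp add: listing_columns_Suc)
qed simp

lemma mset_column:
  assumes "factored n r C (\<lambda>_. 1) x" "j < n"
  shows "mset (column n C r j) = prime_factorization (x j)"
proof -
  have "prod_list (column n C k j) = (\<Prod>i<k. C (i * n + j))" if "k \<le> r" for k
    using that
  proof (induction k)
    case (Suc k)
    have "C (k * n + j) = 1 \<or> prime (C (k * n + j))" using assms Suc.prems by (auto simp: factored_def)
    then show ?case using Suc by (auto simp: column_Suc dest: prime_gt_1_nat)
  qed simp
  then have "x j = prod_mset (mset (column n C r j))"
    using assms by (simp add: factored_def prod_mset_prod_list)
  moreover have "prime q" if q: "q \<in># mset (column n C r j)" for q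
  proof -
    obtain i where "i < r" "q = C (i * n + j)" "1 < q" using q by (auto simp: column_def)
    then show ?thesis using assms unfolding factored_def by (metis less_irrefl)
  qed
  ultimately show ?thesis using prime_factorization_prod_mset_primes[of "mset (column n C r j)"] by simp
qed

lemma factored_le:
  assumes "factored n r C (\<lambda>_. 1) x" "j < n" "i < r" "0 < x j"
  shows "C (i * n + j) \<le> x j"
proof -
  have "C (i * n + j) dvd (\<Prod>k<r. C (k * n + j))" using assms(3) by (intro dvd_prodI) auto
  also have "\<dots> = x j" using assms(1,2) by (simp add: factored_def)
  finally show ?thesis using assms(4) by (rule dvd_imp_le)
qed

abbreviation (input) "limitV \<equiv> 14 :: nat"
abbreviation (input) "columnV \<equiv> 15 :: nat"
abbreviation (input) "startV \<equiv> 16 :: nat"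
abbreviation (input) "rowV \<equiv> 17 :: nat"
abbreviation (input) "cursorV \<equiv> 18 :: nat"
abbreviation (input) "outputV \<equiv> 19 :: nat"

abbreviation (input) "outputA \<equiv> 1 :: nat"

definition append_entry :: "stmt list" where
  "append_entry = [outputV ::= Arr factorsA (Var rowV [*] Var nV [+] Var columnV), outputA\<lbrakk>Var cursorV\<rbrakk> ::= Var outputV,
     cursorV ::= Var cursorV [+] Ite (Cst 1) (Var outputV) (Cst 1) (Cst 0)]"

definition append_column_code :: com where
  "append_column_code = block [startV ::= Var cursorV, cursorV ::= Var cursorV [+] Cst 1] ;;
     for_loop rowV limitV (block append_entry) ;; block [outputA\<lbrakk>Var startV\<rbrakk> ::= Var cursorV [-] (Var startV [+] Cst 1)]"

definition output_code :: com where
  "output_code = block [limitV ::= Var RV [+] Var RV, cursorV ::= Cst 0] ;; for_loop columnV nV append_column_code"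

context ram
begin

lemma computes_append_entries:
  assumes regs: "var sg nV = n" "var sg columnV = j" "var sg limitV = m" "var sg cursorV = h" and S: "h + m < S" "m * n < S"
    and j: "j < n" and C: "\<And>i. i < m \<Longrightarrow> arr sg factorsA (i * n + j) \<le> S"
  shows "computes (for_loop rowV limitV (block append_entry)) (29 * m + 4) 17 {outputA} sg (\<lambda>sg'.
    var sg' cursorV = h + length (column n (arr sg factorsA) m j) \<and> stores (arr sg' outputA) h (column n (arr sg factorsA) m j) \<and>
    (\<forall>i<h. arr sg' outputA i = arr sg outputA i))"
proof -
  let ?C = "arr sg factorsA"
  let ?I = "\<lambda>r sg'. var sg' cursorV = h + length (column n ?C r j) \<and> stores (arr sg' outputA) h (column n ?C r j) \<and>
    (\<forall>i<h. arr sg' outputA i = arr sg outputA i)"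
  have "computes (for_loop rowV limitV (block append_entry)) (m * (23 + 6) + 4) 17 {outputA} sg
      (\<lambda>sg'. ?I m sg' \<and> var sg' rowV = m \<and> var sg' limitV = m)"
  proof (rule computes_for[where b' = 18 and Y' = "{outputA}" and I = ?I])
    fix r sg' assume r: "r < m" and fr: "frame 17 {outputA} sg sg'" and I: "?I r sg'" and rowV: "var sg' rowV = r"
    define f where "f = ?C (r * n + j)"
    define p where "p = h + length (column n ?C r j)"
    have "r * n + j < m * n" by (rule block_index_less[OF r j])
    then have bounds: "r * n + j < S" "p + 1 \<le> S" "p < S" "f \<le> S"
      using S length_column[of n ?C r j] r C[OF r] by (auto simp: p_def f_def)
    have vars: "var sg' nV = n" "var sg' columnV = j" "arr sg' factorsA = ?C" "var sg' cursorV = p"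
      using frame_var[OF fr] frame_arr[OF fr] regs I by (auto simp: p_def)
    obtain sg1 where entry: "run (block append_entry) 23 sg' sg1" "arr sg1 = (arr sg')(outputA := (arr sg' outputA)(p := f))"
      "var sg1 = (var sg')(outputV := f, cursorV := p + (if 1 < f then 1 else 0))"
      by (rule that[OF run_block]) (use vars bounds rowV in \<open>auto simp: append_entry_def block_cost_def f_def\<close>)
    have "stores (arr sg1 outputA) h (column n ?C r j)"
      by (rule stores_cong[of "arr sg' outputA"]) (use I entry(2) in \<open>auto simp: p_def\<close>)
    then have "stores (arr sg1 outputA) h (column n ?C (Suc r) j)"
      using entry(2) by (simp add: column_Suc stores_append stores_Cons p_def f_def)
    then show "computes (block append_entry) 23 18 {outputA} sg' (\<lambda>sg''. ?I (Suc r) (set_var rowV (Suc r) sg''))"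
      by (intro computesI[OF entry(1)]) (use entry(2,3) I in \<open>auto simp: frame_def column_Suc p_def f_def\<close>)
  qed (use regs S in auto)
  then show ?thesis by (rule computes_mono) auto
qed

lemma computes_append_column:
  assumes regs: "var sg nV = n" "var sg columnV = j" "var sg limitV = m" "var sg cursorV = h" and S: "h + (m + 1) < S" "m * n < S"
    and j: "j < n" and C: "\<And>i. i < m \<Longrightarrow> arr sg factorsA (i * n + j) \<le> S"
  shows "computes append_column_code (29 * m + 21) 16 {outputA} sg (\<lambda>sg'. var sg' cursorV = h + (1 + length (column n (arr sg factorsA) m j)) \<and>
    stores (arr sg' outputA) h (length (column n (arr sg factorsA) m j) # column n (arr sg factorsA) m j) \<and>
    (\<forall>i<h. arr sg' outputA i = arr sg outputA i))"
proof -
  let ?col = "column n (arr sg factorsA) m j"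
  obtain sg1 where start: "run (block [startV ::= Var cursorV, cursorV ::= Var cursorV [+] Cst 1]) 7 sg sg1"
    "var sg1 = (var sg)(startV := h, cursorV := h + 1)" "arr sg1 = arr sg"
    by (rule that[OF run_block]) (use regs S in \<open>auto simp: block_cost_def\<close>)
  obtain sg2 where entries: "run (for_loop rowV limitV (block append_entry)) (29 * m + 4) sg1 sg2" "frame 17 {outputA} sg1 sg2"
    "var sg2 cursorV = h + 1 + length ?col" "stores (arr sg2 outputA) (h + 1) ?col" "\<forall>i<h + 1. arr sg2 outputA i = arr sg outputA i"
    by (rule computesE[OF computes_append_entries[of sg1 n j m "h + 1"]]) (use start regs S j C in auto)
  obtain sg3 where head: "run (block [outputA\<lbrakk>Var startV\<rbrakk> ::= Var cursorV [-] (Var startV [+] Cst 1)]) 10 sg2 sg3"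
    "var sg3 = var sg2" "arr sg3 = (arr sg2)(outputA := (arr sg2 outputA)(h := length ?col))"
    by (rule that[OF run_block]) (use start(2) frame_var[OF entries(2)] entries(3) S in \<open>auto simp: block_cost_def\<close>)
  have "stores (arr sg3 outputA) (Suc h) ?col"
    by (rule stores_cong[of "arr sg2 outputA"]) (use entries(4) head(3) in auto)
  then show ?thesis unfolding append_column_code_def
    by (intro computesI[OF run_Seq[OF start(1) run_Seq[OF entries(1) head(1)]]])
       (use start entries head in \<open>auto simp: frame_def stores_Cons\<close>)
qed

lemma computes_output:
  assumes regs: "var sg nV = n" "var sg RV = R" and S: "n * (2 * R + 1) < S" "2 * R < S" "n < S"
    and C: "\<And>i j. i < 2 * R \<Longrightarrow> j < n \<Longrightarrow> arr sg factorsA (i * n + j) \<le> S"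
  shows "computes output_code (100 * (R + 1) * (n + 1)) 14 {outputA} sg
    (\<lambda>sg'. stores (arr sg' outputA) 0 (listing (columns n (arr sg factorsA) (2 * R) n)))"
proof -
  let ?C = "arr sg factorsA"
  let ?L = "\<lambda>k. listing (columns n ?C (2 * R) k)"
  let ?I = "\<lambda>k sg'. var sg' limitV = 2 * R \<and> var sg' cursorV = length (?L k) \<and> stores (arr sg' outputA) 0 (?L k)"
  obtain sg1 where init: "run (block [limitV ::= Var RV [+] Var RV, cursorV ::= Cst 0]) 7 sg sg1"
    "var sg1 = (var sg)(limitV := 2 * R, cursorV := 0)" "arr sg1 = arr sg"
    by (rule that[OF run_block]) (use regs S in \<open>auto simp: block_cost_def\<close>)
  have "computes (for_loop columnV nV append_column_code) (n * (29 * (2 * R) + 21 + 6) + 4) 15 {outputA} sg1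
      (\<lambda>sg'. ?I n sg' \<and> var sg' columnV = n \<and> var sg' nV = n)"
  proof (rule computes_for[where b' = 16 and Y' = "{outputA}" and I = ?I])
    fix k sg' assume k: "k < n" and fr: "frame 15 {outputA} sg1 sg'" and I: "?I k sg'" and columnV: "var sg' columnV = k"
    have "Suc k * (2 * R + 1) \<le> n * (2 * R + 1)" using k by (intro mult_le_mono1) simp
    then have "length (?L k) + (2 * R + 1) < S" using length_listing_columns[of n ?C "2 * R" k] S(1) by simp
    moreover have "2 * R * n < S" using S(1) by (simp add: algebra_simps)
    moreover have "arr sg' factorsA = ?C" using frame_arr[OF fr] init(3) by simp
    ultimately obtain sg2 where col: "run append_column_code (29 * (2 * R) + 21) sg' sg2" "frame 16 {outputA} sg' sg2"
      "var sg2 cursorV = length (?L k) + (1 + length (column n ?C (2 * R) k))"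
      "stores (arr sg2 outputA) (length (?L k)) (length (column n ?C (2 * R) k) # column n ?C (2 * R) k)"
      "\<forall>i<length (?L k). arr sg2 outputA i = arr sg' outputA i"
      by (rule_tac computesE[OF computes_append_column[of sg' n k "2 * R" "length (?L k)"]])
         (use I columnV k C frame_var[OF fr] init(2) regs in auto)
    have "stores (arr sg2 outputA) 0 (?L k)"
      by (rule stores_cong[of "arr sg' outputA"]) (use I col(5) in auto)
    then show "computes append_column_code (29 * (2 * R) + 21) 16 {outputA} sg' (\<lambda>sg''. ?I (Suc k) (set_var columnV (Suc k) sg''))"
      by (intro computesI[OF col(1)]) (use I frame_var[OF col(2)] col in \<open>auto simp: listing_columns_Suc stores_append\<close>)
  qed (use init regs S in auto)
  then obtain sg2 where loop: "run (for_loop columnV nV append_column_code) (n * (29 * (2 * R) + 21 + 6) + 4) sg1 sg2"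
    "frame 15 {outputA} sg1 sg2" "stores (arr sg2 outputA) 0 (?L n)"
    by (rule computesE) auto
  have time: "7 + (n * (29 * (2 * R) + 21 + 6) + 4) \<le> 100 * (R + 1) * (n + 1)"
    by (simp add: algebra_simps)
  show ?thesis unfolding output_code_def
    by (intro computesI[OF run_Seq[OF init(1) loop(1)] time]) (use init loop in \<open>auto simp: frame_def\<close>)
qed

end

section \<open>The complete program\<close>

definition bitlen :: "nat \<Rightarrow> nat" where
  "bitlen s = (LEAST r. s < 2 ^ r)"

lemma less_bitlen: "s < 2 ^ bitlen s"
  unfolding bitlen_def by (rule LeastI[of _ s]) (rule less_exp)

lemma bitlen_less: "i < bitlen s \<Longrightarrow> 2 ^ i \<le> s"
  unfolding bitlen_def using not_less_Least not_less by blast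

lemma power_bitlen_le: "2 ^ bitlen s \<le> 2 * s + 1"
proof (cases "bitlen s")
  case (Suc i)
  then show ?thesis using bitlen_less[of i s] by simp
qed simp

definition halflen :: "nat \<Rightarrow> nat" where
  "halflen s = (bitlen s + 1) div 2"

lemma halflen_bounds: "halflen s \<le> bitlen s" "bitlen s \<le> 2 * halflen s" "2 * halflen s \<le> bitlen s + 1"
  unfolding halflen_def by (cases "bitlen s", auto)

lemma power_halflen_le: "2 ^ halflen s * 2 ^ halflen s \<le> 4 * s + 2"
proof -
  have "(2::nat) ^ halflen s * 2 ^ halflen s = 2 ^ (2 * halflen s)" by (simp add: power_add mult_2)
  also have "\<dots> \<le> 2 ^ (bitlen s + 1)" using halflen_bounds by (intro power_increasing) auto
  finally show ?thesis using power_bitlen_le[of s] by simp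
qed

definition setup_code :: com where
  "setup_code = block [RV ::= Cst 0, 6 ::= Cst 1, 7 ::= Var 1 [+] Cst 1] ;;
     Loop (Lt (Reg 6) (Reg 7)) (block [6 ::= Cst 2 [*] Var 6, RV ::= Var RV [+] Cst 1]) ;;
     block [KV ::= (Var RV [+] Cst 1) [div] Cst 2, DV ::= Pow2 (Var KV), BV ::= Pow2 (Var RV [+] Cst 2), offsetV ::= Cst 0]"

definition factor_table_code :: com where
  "factor_table_code = setup_code ;; interval_tree_code ;; strip_code ;; rounds_code"

definition stride_code :: com where
  "stride_code = Op 60 Add (Reg 0) (Reg 1) ;; Op 60 Add (Reg 60) (Const 2) ;; Op 60 Mul (Reg 60) (Reg 60) ;;
     Op 60 Mul (Reg 60) (Reg 60) ;; Op 60 Mul (Reg 60) (Reg 60) ;; Op 60 Mul (Reg 60) (Reg 60)"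

definition factor_program :: com where
  "factor_program = stride_code ;; (factor_table_code ;; output_code) ;; Op 0 BitOr (Reg 60) (Const 0)"

definition steps :: "nat \<Rightarrow> nat \<Rightarrow> nat" where
  "steps n s = (bitlen s + 4) ^ 6 * (n + 2 ^ halflen s + 1)"

lemma le_steps: "(bitlen s + 1) * (n + 1) \<le> steps n s" "bitlen s + 4 \<le> steps n s"
proof -
  have power: "bitlen s + 4 \<le> (bitlen s + 4) ^ 6" using power_increasing[of 1 6 "bitlen s + 4"] by simp
  then show "(bitlen s + 1) * (n + 1) \<le> steps n s" unfolding steps_def by (intro mult_le_mono) auto
  have "(bitlen s + 4) * 1 \<le> steps n s" unfolding steps_def using power by (intro mult_le_mono) auto
  then show "bitlen s + 4 \<le> steps n s" by simp
qed

lemma interval_tree_time_le: "(halflen s + 1) * tree_time (halflen s) (2 ^ halflen s) \<le> 6 * steps n s"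
proof -
  let ?K = "halflen s" and ?R = "bitlen s"
  have "(?K + 1) * tree_time ?K (2 ^ ?K) = (?K + 1) * (?K + 4) ^ 3 * (6 * 2 ^ ?K + 1)"
    by (simp add: tree_time_def mult_time_def power_add algebra_simps del: add_2_eq_Suc')
  also have "\<dots> \<le> (?R + 4) ^ Suc 3 * (6 * (n + 2 ^ ?K + 1))"
    unfolding power_Suc using halflen_bounds(1)[of s] by (intro mult_le_mono power_mono) auto
  also have "\<dots> \<le> (?R + 4) ^ 6 * (6 * (n + 2 ^ ?K + 1))"
    by (intro mult_le_mono1 power_increasing) auto
  also have "\<dots> = 6 * steps n s" unfolding steps_def by (rule mult.left_commute)
  finally show ?thesis .
qed

context ram
begin

lemma computes_setup:
  assumes s: "var sg 1 = s" and S: "8 * (s + 2) \<le> S"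
  shows "computes setup_code (10 * (bitlen s + 4)) 2 {} sg (\<lambda>sg'. var sg' RV = bitlen s \<and> var sg' KV = halflen s \<and>
    var sg' DV = 2 ^ halflen s \<and> var sg' BV = 2 ^ (bitlen s + 2) \<and> var sg' offsetV = 0)"
proof -
  let ?R = "bitlen s" and ?K = "halflen s"
  have "(2::nat) ^ ?K \<le> 2 * s + 1" using order_trans[OF power_increasing[OF halflen_bounds(1)] power_bitlen_le] by simp
  moreover have "?R < 2 * s + 1" using less_exp power_bitlen_le by (rule less_le_trans)
  ultimately have bounds: "?R + 2 \<le> S" "2 ^ (?R + 2) \<le> S" "?K \<le> S" "2 ^ ?K \<le> S"
    using power_bitlen_le[of s] halflen_bounds(1)[of s] S by simp_all
  obtain sg1 where init: "run (block [RV ::= Cst 0, 6 ::= Cst 1, 7 ::= Var 1 [+] Cst 1]) 9 sg sg1"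
    "var sg1 = (var sg)(RV := 0, 6 := 1, 7 := s + 1)" "arr sg1 = arr sg"
    by (rule that[OF run_block]) (use s S in \<open>auto simp: block_cost_def\<close>)
  let ?double = "[6 ::= Cst 2 [*] Var 6, RV ::= Var RV [+] Cst 1]"
  have "computes (Loop (Lt (Reg 6) (Reg 7)) (block ?double)) (?R * (9 + 1) + 1) 2 {} sg1
      (\<lambda>sg'. var sg' 6 = 2 ^ ?R \<and> var sg' RV = ?R \<and> var sg' 7 = s + 1)"
  proof (rule computes_while[where I = "\<lambda>i sg'. var sg' 6 = 2 ^ i \<and> var sg' RV = i \<and> var sg' 7 = s + 1"])
    fix i sg' assume i: "i \<le> ?R" and I: "var sg' 6 = 2 ^ i \<and> var sg' RV = i \<and> var sg' 7 = s + 1"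
    have "2 ^ i \<le> s \<longleftrightarrow> i < ?R" using less_bitlen[of s] bitlen_less[of i s] i by (cases "i = ?R") auto
    then show "var sg' 6 < var sg' 7 \<longleftrightarrow> i < ?R" using I by (simp add: less_Suc_eq_le)
  next
    fix i sg' assume i: "i < ?R" and I: "var sg' 6 = 2 ^ i \<and> var sg' RV = i \<and> var sg' 7 = s + 1"
    show "computes (block ?double) 9 2 {} sg' (\<lambda>sg''. var sg'' 6 = 2 ^ Suc i \<and> var sg'' RV = Suc i \<and> var sg'' 7 = s + 1)"
      by (rule computes_block) (use I bitlen_less[OF i] i bounds S in \<open>auto simp: block_cost_def frame_def\<close>)
  qed (use init in auto)
  then obtain sg2 where loop: "run (Loop (Lt (Reg 6) (Reg 7)) (block ?double)) (?R * 10 + 1) sg1 sg2" "frame 2 {} sg1 sg2" "var sg2 RV = ?R"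
    by (rule computesE) (use that in simp)
  obtain sg3 where sizes: "run (block [KV ::= (Var RV [+] Cst 1) [div] Cst 2, DV ::= Pow2 (Var KV),
    BV ::= Pow2 (Var RV [+] Cst 2), offsetV ::= Cst 0]) 17 sg2 sg3"
    "var sg3 = (var sg2)(KV := ?K, DV := 2 ^ ?K, BV := 2 ^ (?R + 2), offsetV := 0)" "arr sg3 = arr sg2"
    by (rule that[OF run_block]) (use loop(3) bounds in \<open>auto simp: block_cost_def halflen_def\<close>)
  show ?thesis unfolding setup_code_def
    by (intro computesI[OF run_Seq[OF init(1) run_Seq[OF loop(1) sizes(1)]]]) (use init loop sizes in \<open>auto simp: frame_def\<close>)
qed

context
  fixes n s :: nat
  assumes stride: "(n + s + 2) ^ 16 \<le> S"
begin

lemma stride_ge: "a + b \<le> 16 \<Longrightarrow> 2 ^ a * (n + s + 2) ^ b \<le> S"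
proof -
  assume "a + b \<le> 16"
  have "2 ^ a * (n + s + 2) ^ b \<le> (n + s + 2) ^ a * (n + s + 2) ^ b" by (intro mult_le_mono power_mono) auto
  also have "\<dots> = (n + s + 2) ^ (a + b)" by (simp add: power_add)
  also have "\<dots> \<le> (n + s + 2) ^ 16" using \<open>a + b \<le> 16\<close> by (intro power_increasing) auto
  finally show ?thesis using stride by linarith
qed

lemma size_bounds: "2 ^ bitlen s \<le> 2 * (n + s + 2)" "2 ^ halflen s \<le> 2 * (n + s + 2)" "bitlen s < 2 * (n + s + 2)"
proof -
  show R: "2 ^ bitlen s \<le> 2 * (n + s + 2)" using power_bitlen_le[of s] by simp
  have "(2::nat) ^ halflen s \<le> 2 ^ bitlen s" using halflen_bounds(1) by (rule power_increasing) simp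
  then show "2 ^ halflen s \<le> 2 * (n + s + 2)" using R by linarith
  show "bitlen s < 2 * (n + s + 2)" using less_exp R by (rule less_le_trans)
qed

lemma size_less: "n < S" "2 * bitlen s < S" "halflen s < S" "2 ^ bitlen s \<le> S" "2 ^ halflen s \<le> S" "8 * (s + 2) \<le> S"
  using stride_ge[of 8 1] size_bounds halflen_bounds(1)[of s] by auto

lemma fits_sizes: "fits (halflen s + 2) (2 * (n + 2 ^ halflen s)) (2 ^ (bitlen s + 2))"
  unfolding fits_def
proof (intro conjI)
  let ?K = "halflen s" and ?R = "bitlen s"
  define Z where "Z = n + s + 2"
  note stride_ge = stride_ge[folded Z_def] and size_bounds = size_bounds[folded Z_def]
  have "8 * 2 ^ (?K + 2) * (2 ^ (?R + 2) * 2 ^ (?R + 2)) = 512 * (2 ^ ?K * (2 ^ ?R * (2 ^ ?R :: nat)))" by (simp add: power_add)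
  also have "\<dots> \<le> 512 * (2 * Z * (2 * Z * (2 * Z)))" using size_bounds by (intro mult_le_mono) auto
  also have "\<dots> = 2 ^ 12 * Z ^ 3" by (simp add: power3_eq_cube)
  also have "\<dots> \<le> S" by (rule stride_ge) simp
  finally show "8 * 2 ^ (?K + 2) * (2 ^ (?R + 2) * 2 ^ (?R + 2)) \<le> S" .
  have KZ: "?K + 2 \<le> 4 * Z" using halflen_bounds(1)[of s] size_bounds(3) by (simp add: Z_def)
  then show "4 * (?K + 2) \<le> S" using stride_ge[of 8 1] by simp
  have "2 * (?K + 2) * (2 * (n + 2 ^ ?K)) \<le> 2 * (4 * Z) * (2 * (4 * Z))"
    using KZ size_bounds(2) by (intro mult_le_mono) (auto simp: Z_def)
  also have "\<dots> = 2 ^ 6 * Z ^ 2" by (simp add: power2_eq_square)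
  also have "\<dots> < 2 ^ 14 * Z ^ 2" by (simp add: Z_def)
  also have "\<dots> \<le> S" by (rule stride_ge) simp
  finally show "2 * (?K + 2) * (2 * (n + 2 ^ ?K)) < S" .
qed

lemma table_size_less: "n * (2 * bitlen s + 1) < S"
proof -
  have "n * (2 * bitlen s + 1) \<le> (n + 2 ^ halflen s) * (4 * (halflen s + 2))"
    using halflen_bounds(2)[of s] by (intro mult_le_mono) auto
  also have "\<dots> < S" using fits_sizes by (simp add: fits_def algebra_simps)
  finally show ?thesis .
qed

lemma computes_factor_table:
  assumes regs: "var sg nV = n" "var sg 1 = s" and x: "\<And>j. j < n \<Longrightarrow> 1 \<le> arr sg inputA j \<and> arr sg inputA j \<le> s"
  shows "computes factor_table_code (20000000 * steps n s) 2 (- {outputA}) sg (\<lambda>sg'. var sg' RV = bitlen s \<and>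
    factored n (2 * bitlen s) (arr sg' factorsA) (\<lambda>_. 1) (arr sg inputA))"
proof -
  let ?R = "bitlen s" and ?K = "halflen s"
  have sizes: "?R * n \<le> S" "(?R + ?R) * n \<le> S" "?R \<le> S" using table_size_less size_less(2) by (simp_all add: algebra_simps)
  have x_less: "0 < arr sg inputA j \<and> arr sg inputA j < 2 ^ ?R" if "j < n" for j using x[OF that] less_bitlen[of s] by linarith
  obtain sg1 where sizes_set: "run setup_code (10 * (?R + 4)) sg sg1" "frame 2 {} sg sg1" "var sg1 RV = ?R" "var sg1 KV = ?K"
    "var sg1 DV = 2 ^ ?K" "var sg1 BV = 2 ^ (?R + 2)" "var sg1 offsetV = 0"
    by (rule computesE[OF computes_setup[OF regs(2) size_less(6)]]) auto
  have fits_tree: "fits (?K + 2) (2 * 2 ^ ?K) (2 ^ (?R + 2))" by (rule fits_mono[OF fits_sizes]) auto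
  obtain sg2 where tree: "run interval_tree_code (500000 * (?K + 1) * tree_time ?K (2 ^ ?K)) sg1 sg2" "frame 25 ({8..13} \<union> {intervalA}) sg1 sg2"
    "\<forall>l\<le>?K. product_level (2 ^ (?R + 2)) (2 ^ ?K) Suc l (arr sg2 intervalA)"
    by (rule computesE[OF computes_interval_tree[OF sizes_set(4-6) halflen_bounds(1) fits_tree]]) auto
  have same: "arr sg2 inputA = arr sg inputA" using frame_arr[OF sizes_set(2)] frame_arr[OF tree(2)] by simp
  obtain sg3 where strip: "run strip_code (2200 * (?R + 1) * (n + 1)) sg2 sg3" "frame 14 ({0, 2} \<union> {4..18}) sg2 sg3"
    "factored n ?R (arr sg3 factorsA) (arr sg3 inputA) (arr sg inputA)" "var sg3 offsetV = ?R * n"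
    "\<forall>j<n. odd (arr sg3 inputA j) \<and> arr sg3 inputA j < 2 ^ ?R"
    by (rule computesE[OF computes_strip[of sg2 n ?R]])
       (use sizes_set frame_var[OF sizes_set(2)] frame_var[OF tree(2)] regs x_less sizes size_less same in auto)
  obtain sg4 where rounds: "run rounds_code (13004000 * steps n s) sg3 sg4" "frame 14 ({0, 2} \<union> {4..18}) sg3 sg4"
    "factored n (2 * ?R) (arr sg4 factorsA) (\<lambda>_. 1) (arr sg inputA)" unfolding steps_def
    by (rule computesE[OF computes_rounds[of sg3 n ?R ?K "arr sg inputA", OF _ _ _ _ _ _ halflen_bounds(1,2) fits_sizes]])
       (use sizes_set frame_var[OF sizes_set(2)] frame_var[OF tree(2)] frame_var[OF strip(2)] frame_arr[OF strip(2)]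
          tree(3) strip(3-5) regs sizes size_less in auto)
  have "10 * q + (500000 * u + (2200 * v + 13004000 * t)) \<le> 20000000 * t" if "q \<le> t" "u \<le> 6 * t" "v \<le> t" for q u v t :: nat
    using that by linarith
  from this[OF le_steps(2) interval_tree_time_le le_steps(1)]
  have time: "10 * (?R + 4) + (500000 * (?K + 1) * tree_time ?K (2 ^ ?K) + (2200 * (?R + 1) * (n + 1) + 13004000 * steps n s)) \<le> 20000000 * steps n s"
    by (simp only: mult.assoc)
  show ?thesis unfolding factor_table_code_def
    by (intro computesI[OF run_Seq[OF sizes_set(1) run_Seq[OF tree(1) run_Seq[OF strip(1) rounds(1)]]] time])
       (use sizes_set tree strip rounds in \<open>auto simp: frame_def\<close>)
qed

lemma computes_factorizations:
  assumes regs: "var sg nV = n" "var sg 1 = s" and x: "\<And>j. j < n \<Longrightarrow> 1 \<le> arr sg inputA j \<and> arr sg inputA j \<le> s"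
  shows "computes (factor_table_code ;; output_code) (21000000 * steps n s) 2 UNIV sg (\<lambda>sg'.
    \<exists>pss. map mset pss = map (\<lambda>j. prime_factorization (arr sg inputA j)) [0..<n] \<and>
      length (listing pss) < S \<and> stores (arr sg' outputA) 0 (listing pss))"
proof -
  let ?R = "bitlen s"
  obtain sg1 where table: "run factor_table_code (20000000 * steps n s) sg sg1" "frame 2 (- {outputA}) sg sg1" "var sg1 RV = ?R"
    "factored n (2 * ?R) (arr sg1 factorsA) (\<lambda>_. 1) (arr sg inputA)"
    by (rule computesE[OF computes_factor_table[OF regs x]]) auto
  have "arr sg1 factorsA (i * n + j) \<le> S" if "i < 2 * ?R" "j < n" for i j
  proof -
    have "arr sg1 factorsA (i * n + j) \<le> arr sg inputA j" using factored_le[OF table(4) that(2,1)] x[OF that(2)] by simp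
    also have "\<dots> \<le> S" using x[OF that(2)] size_less(6) by simp
    finally show ?thesis .
  qed
  then obtain sg2 where listed: "run output_code (100 * (?R + 1) * (n + 1)) sg1 sg2" "frame 14 {outputA} sg1 sg2"
    "stores (arr sg2 outputA) 0 (listing (columns n (arr sg1 factorsA) (2 * ?R) n))"
    by (rule_tac computesE[OF computes_output[of sg1 n ?R]])
       (use frame_var[OF table(2)] table(3) regs table_size_less size_less in auto)
  let ?pss = "columns n (arr sg1 factorsA) (2 * ?R) n"
  have "map mset ?pss = map (\<lambda>j. prime_factorization (arr sg inputA j)) [0..<n]"
    using mset_column[OF table(4)] by (simp add: columns_def)
  moreover have "length (listing ?pss) < S" using length_listing_columns table_size_less by (rule le_less_trans)
  moreover have "20000000 * steps n s + 100 * (?R + 1) * (n + 1) \<le> 21000000 * steps n s"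
    using le_steps(1)[of s n] unfolding mult.assoc by linarith
  ultimately show ?thesis
    by (intro computesI[OF run_Seq[OF table(1) listed(1)]]) (use table(2) listed in \<open>auto simp: frame_def\<close>)
qed

end

end

lemma (in ram) mem_holds_stores:
  assumes sim: "sim sg \<rho>" and ys: "length ys < S" "stores (arr sg outputA) 0 ys"
  shows "mem_holds w (\<rho>\<lparr>regs := r\<rparr>) S ys"
  unfolding mem_holds_def
proof (intro conjI allI impI)
  have "S + length ys \<le> 2 * S" using ys(1) by simp
  also have "\<dots> \<le> S * S" using S_ge by simp
  finally show "S + length ys \<le> 2 ^ w" using S_less(2) by simp
  fix j assume j: "j < length ys"
  have "outputA < 30" by simp
  moreover have "j < S" using j ys(1) by (rule less_trans)
  ultimately have "mem \<rho> (outputA * S + j) = arr sg outputA j" using sim unfolding sim_def by blast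
  then show "mem (\<rho>\<lparr>regs := r\<rparr>) (S + j) = ys ! j" using stores_nth[OF ys(2) j] by simp
qed

lemma exec_stride_code:
  assumes w: "(length xs + s + 2) ^ 16 < 2 ^ w"
  shows "exec w stride_code (input_state s xs) 6
    (input_state s xs\<lparr>regs := (regs (input_state s xs))(60 := (length xs + s + 2) ^ 16)\<rparr>)"
proof -
  define Z where "Z = length xs + s + 2"
  define \<rho> where "\<rho> z = input_state s xs\<lparr>regs := (regs (input_state s xs))(60 := z)\<rparr>" for z
  have Z_power: "Z ^ k < 2 ^ w" if "k \<le> 16" for k
    using power_increasing[OF that, of Z] w unfolding Z_def by linarith
  have sum: "exec w (Op 60 Add (Reg 0) (Reg 1)) (input_state s xs) 1 (\<rho> (length xs + s))"
    using exec_Op[of w 60 Add "Reg 0" "Reg 1" "input_state s xs"] Z_power[of 1] by (simp add: \<rho>_def Z_def input_state_def)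
  have "2 < (2::nat) ^ w" using Z_power[of 2] power_mono[of 2 Z 2] by (simp add: Z_def)
  then have base: "exec w (Op 60 Add (Reg 60) (Const 2)) (\<rho> (length xs + s)) 1 (\<rho> Z)"
    using exec_Op[of w 60 Add "Reg 60" "Const 2" "\<rho> (length xs + s)"] Z_power[of 1] by (simp add: \<rho>_def Z_def)
  have square: "exec w (Op 60 Mul (Reg 60) (Reg 60)) (\<rho> (Z ^ k)) 1 (\<rho> (Z ^ (k + k)))" if "k + k \<le> 16" for k
    using exec_Op[of w 60 Mul "Reg 60" "Reg 60" "\<rho> (Z ^ k)"] Z_power[OF that] by (simp add: \<rho>_def power_add)
  have squares: "exec w (Op 60 Mul (Reg 60) (Reg 60)) (\<rho> Z) 1 (\<rho> (Z ^ 2))" "exec w (Op 60 Mul (Reg 60) (Reg 60)) (\<rho> (Z ^ 2)) 1 (\<rho> (Z ^ 4))"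
    "exec w (Op 60 Mul (Reg 60) (Reg 60)) (\<rho> (Z ^ 4)) 1 (\<rho> (Z ^ 8))" "exec w (Op 60 Mul (Reg 60) (Reg 60)) (\<rho> (Z ^ 8)) 1 (\<rho> (Z ^ 16))"
    using square[of 1] square[of 2] square[of 4] square[of 8] by (simp_all flip: numeral_2_eq_2)
  have six: "6 = 1 + (1 + (1 + (1 + (1 + (1::nat)))))" by simp
  have "exec w stride_code (input_state s xs) 6 (\<rho> (Z ^ 16))" unfolding stride_code_def six
    by (rule exec_Seq[OF sum exec_Seq[OF base exec_Seq[OF squares(1) exec_Seq[OF squares(2) exec_Seq[OF squares(3,4)]]]]])
  then show ?thesis unfolding \<rho>_def Z_def .
qed

lemma factor_program_correct:
  assumes xs: "set xs \<subseteq> {1..s}" and w: "(length xs + s + 2) ^ 128 \<le> 2 ^ w"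
  shows "\<exists>\<tau> \<sigma>. exec w factor_program (input_state s xs) \<tau> \<sigma> \<and> \<tau> \<le> 22000000 * steps (length xs) s \<and>
    outputs_factorizations w \<sigma> xs"
proof -
  define S where "S = (length xs + s + 2) ^ 16"
  interpret ram w S
  proof
    have "2 ^ 16 \<le> S" unfolding S_def by (rule power_mono) simp_all
    then show "256 \<le> S" by simp
    show "S ^ 8 \<le> 2 ^ w" using w unfolding S_def by (simp flip: power_mult)
  qed
  define \<rho> where "\<rho> = input_state s xs\<lparr>regs := (regs (input_state s xs))(60 := S)\<rparr>"
  have stride: "exec w stride_code (input_state s xs) 6 \<rho>" unfolding \<rho>_def S_def
    using S_less(1) by (intro exec_stride_code) (simp add: S_def)
  define sg where "sg = AState ((\<lambda>_. 0)(nV := length xs, 1 := s)) (\<lambda>a i. mem \<rho> (a * S + i))"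
  have "length xs + s + 2 \<le> S" unfolding S_def by (rule self_le_power) simp_all
  then have sim: "sim sg \<rho>" unfolding sim_def bounded_def by (auto simp: sg_def \<rho>_def input_state_def)
  have input: "arr sg inputA j = xs ! j" if "j < length xs" for j using that by (simp add: sg_def \<rho>_def input_state_def)
  have "1 \<le> arr sg inputA j \<and> arr sg inputA j \<le> s" if "j < length xs" for j
    using input[OF that] subsetD[OF xs nth_mem[OF that]] by simp
  then obtain sg' pss where factor: "run (factor_table_code ;; output_code) (21000000 * steps (length xs) s) sg sg'"
    "map mset pss = map (\<lambda>j. prime_factorization (arr sg inputA j)) [0..<length xs]" "length (listing pss) < S"
    "stores (arr sg' outputA) 0 (listing pss)"
    by (rule_tac computesE[OF computes_factorizations[of "length xs" s sg]]) (auto simp: S_def sg_def)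
  obtain \<tau> \<sigma> where exec: "exec w (factor_table_code ;; output_code) \<rho> \<tau> \<sigma>" "\<tau> \<le> 21000000 * steps (length xs) s" "sim sg' \<sigma>"
    using factor(1) sim unfolding run_def by blast
  let ?\<sigma> = "\<sigma>\<lparr>regs := (regs \<sigma>)(0 := S)\<rparr>"
  have "exec w (Op 0 BitOr (Reg 60) (Const 0)) \<sigma> 1 ?\<sigma>"
    using exec_Op[of w 0 BitOr "Reg 60" "Const 0" \<sigma>] exec(3) by (simp add: sim_def)
  then have "exec w factor_program (input_state s xs) (6 + (\<tau> + 1)) ?\<sigma>"
    unfolding factor_program_def by (rule exec_Seq[OF stride exec_Seq[OF exec(1)]])
  moreover have "6 + (\<tau> + 1) \<le> 22000000 * steps (length xs) s" using exec(2) le_steps(2)[of s "length xs"] by linarith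
  moreover have "map mset pss = map prime_factorization xs"
    unfolding factor(2) by (rule nth_equalityI) (simp_all add: input)
  moreover have "mem_holds w ?\<sigma> (regs ?\<sigma> 0) (listing pss)" using mem_holds_stores[OF exec(3) factor(3,4)] by simp
  ultimately show ?thesis unfolding outputs_factorizations_def listing_def by blast
qed

section \<open>The running time\<close>

lemma soft_bigo_cmult: "f \<in> soft_bigo T \<Longrightarrow> (\<lambda>x. c * f x) \<in> soft_bigo T"
  unfolding soft_bigo_def by (auto intro: landau_o.big.cmult_in_iff')

lemma bitlen_le_ln:
  fixes t :: real
  assumes t: "3 \<le> t" "real s \<le> t ^ 2"
  shows "real (bitlen s) \<le> 6 * ln t"
proof -
  have "9 \<le> t ^ 2" using power_mono[OF t(1), of 2] by simp
  have "2 ^ bitlen s \<le> 2 * real s + 1"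
    using of_nat_mono[OF power_bitlen_le[of s], where 'a = real] by simp
  also have "\<dots> \<le> 3 * t ^ 2" using t(2) \<open>9 \<le> t ^ 2\<close> by linarith
  also have "\<dots> \<le> t * t ^ 2" using t(1) by (intro mult_right_mono) auto
  finally have power: "2 ^ bitlen s \<le> t ^ 3" by (simp add: power3_eq_cube power2_eq_square)
  have "exp (real (bitlen s)) = exp 1 ^ bitlen s" by (simp flip: exp_of_nat_mult)
  also have "\<dots> \<le> (2 * 2) ^ bitlen s" using exp_le by (intro power_mono) auto
  also have "\<dots> = 2 ^ bitlen s * 2 ^ bitlen s" by (rule power_mult_distrib)
  also have "\<dots> \<le> t ^ 3 * t ^ 3" using power t(1) by (intro mult_mono) auto
  also have "\<dots> = t ^ 6" by (simp flip: power_add)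
  finally have "real (bitlen s) \<le> ln (t ^ 6)" using t(1) by (subst ln_ge_iff) auto
  then show ?thesis using t(1) by (simp add: ln_realpow)
qed

lemma power_halflen_le_sqrt: "2 ^ halflen s \<le> 2 * sqrt (real s) + 2"
proof -
  have "(2 ^ halflen s) ^ 2 \<le> 4 * real s + 2"
    using of_nat_mono[OF power_halflen_le[of s], where 'a = real] by (simp add: power2_eq_square)
  also have "\<dots> \<le> (2 * sqrt (real s) + 2) ^ 2" by (simp add: power2_sum)
  finally show ?thesis by (rule power2_le_imp_le) simp
qed

lemma steps_le:
  fixes t :: real
  assumes t: "t = real n + sqrt (real s)" "3 \<le> t"
  shows "real (steps n s) \<le> 3000000 * (t * ln t ^ 6)"
proof -
  have "exp (1::real) \<le> t" using exp_le t(2) by linarith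
  then have ln: "1 \<le> ln t" using t(2) by (subst ln_ge_iff) auto
  have "sqrt (real s) ^ 2 \<le> t ^ 2" using t by (intro power_mono) auto
  then have "real (bitlen s + 4) \<le> 10 * ln t" using bitlen_le_ln[of t s] ln t(2) by simp
  then have "real (bitlen s + 4) ^ 6 \<le> (10 * ln t) ^ 6" by (intro power_mono) auto
  then have log_part: "real ((bitlen s + 4) ^ 6) \<le> 1000000 * ln t ^ 6" by (simp add: power_mult_distrib)
  have linear_part: "real (n + 2 ^ halflen s + 1) \<le> 3 * t"
    using power_halflen_le_sqrt[of s] real_sqrt_ge_zero[of "real s"] t by simp
  have "real (steps n s) \<le> (1000000 * ln t ^ 6) * (3 * t)"
    unfolding steps_def of_nat_mult using log_part linear_part by (intro mult_mono) auto
  then show ?thesis by (simp add: mult.commute)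
qed

lemma steps_soft_bigo: "(\<lambda>(n, s). real (steps n s)) \<in> soft_bigo (\<lambda>(n, s). real n + sqrt (real s))"
proof -
  define T :: "nat \<times> nat \<Rightarrow> real" where "T = (\<lambda>(n, s). real n + sqrt (real s))"
  have "\<forall>\<^sub>F p in filtercomap T at_top. 3 \<le> T p"
    using eventually_ge_at_top[of "3::real"] unfolding eventually_filtercomap by blast
  then have "\<forall>\<^sub>F p in filtercomap T at_top. norm ((\<lambda>(n, s). real (steps n s)) p) \<le> 3000000 * norm (T p * ln (T p) ^ 6)"
  proof (rule eventually_mono)
    fix p assume large: "3 \<le> T p"
    obtain n s where p: "p = (n, s)" by (cases p)
    have "0 \<le> T p * ln (T p) ^ 6" using large by simp
    then show "norm ((\<lambda>(n, s). real (steps n s)) p) \<le> 3000000 * norm (T p * ln (T p) ^ 6)"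
      using steps_le[of "T p" n s] large by (simp add: p T_def)
  qed
  then show ?thesis unfolding soft_bigo_def T_def[symmetric] by (blast intro: bigoI)
qed

theorem theorem3p8:
  "\<exists>(P :: com) (k :: nat) (t :: nat \<times> nat \<Rightarrow> real).
     t \<in> soft_bigo (\<lambda>(n, s). real n + sqrt (real s)) \<and>
     (\<forall>(w :: nat) (n :: nat) (s :: nat) (xs :: nat list).
        length xs = n \<longrightarrow> set xs \<subseteq> {1..s} \<longrightarrow> (n + s + 2) ^ k \<le> 2 ^ w \<longrightarrow>
        (\<exists>\<tau> \<sigma>. exec w P (input_state s xs) \<tau> \<sigma> \<and> real \<tau> \<le> t (n, s) \<and>
               outputs_factorizations w \<sigma> xs))"
proof (rule exI[of _ factor_program], rule exI[of _ 128], rule exI[of _ "\<lambda>p. 22000000 * (\<lambda>(n, s). real (steps n s)) p"],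
    intro conjI allI impI)
  let ?t = "\<lambda>p. 22000000 * (\<lambda>(n, s). real (steps n s)) p"
  show "?t \<in> soft_bigo (\<lambda>(n, s). real n + sqrt (real s))"
    using steps_soft_bigo by (rule soft_bigo_cmult)
  fix w n s :: nat and xs :: "nat list"
  assume "length xs = n" "set xs \<subseteq> {1..s}" "(n + s + 2) ^ 128 \<le> 2 ^ w"
  then obtain \<tau> \<sigma> where exec: "exec w factor_program (input_state s xs) \<tau> \<sigma>" "outputs_factorizations w \<sigma> xs"
    and "\<tau> \<le> 22000000 * steps n s" using factor_program_correct by blast
  then have "real \<tau> \<le> ?t (n, s)" using of_nat_mono[of \<tau> "22000000 * steps n s", where 'a = real] by simp
  with exec show "\<exists>\<tau> \<sigma>. exec w factor_program (input_state s xs) \<tau> \<sigma> \<and> real \<tau> \<le> ?t (n, s) \<and> outputs_factorizations w \<sigma> xs"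
    by blast
qed

end
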